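(* Let $n\ge1$, $R_n=\mathrm H_{\mathbb E}(\mathbb{CP}^n)=\bigoplus_{d=0}^{2n}R_n^d$, and let $0\le d\le2n$. (1) The classes $\gamma_n^j\beta_n^{d-2j}$, for $0\le j\le\min\big\{\lfloor\frac d2\rfloor,\lfloor\frac{2n-d}2\rfloor\big\}$, form a basis of the real vector space $R_n^d$. (2) If $d\le n$, the symmetric bilinear pairing $R_n^d\times R_n^d\to\mathbb R$, $(x,y)\mapsto\ell(\beta_n^{2(n-d)}xy)$, is positive definite. (3) If $d\le n$, the multiplication map $R_n^d\to R_n^{2n-d}$, $x\mapsto\beta_n^{2(n-d)}x$, is a linear isomorphism.
   Context: Zonoids. For a finite-dimensional Euclidean space $W$, $\widehat{\mathcal Z}_o(W)$ is the real vector space of formal differences (Minkowski addition) of centered zonoids (zonoids = Hausdorff limits of finite Minkowski sums of segments; centered = symmetric about $0$). For an integrable random vector $\xi\in W$, $K(\xi)$ is the centered zonoid with support function $\frac12\mathbb E|\langle u,\xi\rangle|$; every centered zonoid is of this form. $\ell$ is the linear functional with $\ell(K(\xi))=\mathbb E\|\xi\|$. Algebra. For a Euclidean space $V$, $\Lambda^dV$ (over $\mathbb R$) has the induced inner product; $\bigoplus_d\widehat{\mathcal Z}_o(\Lambda^dV)$ is a graded commutative algebra with bilinear product determined by $K(\xi_1)\wedge K(\xi_2)=K(\xi_1\wedge\xi_2)$ for independent integrable $\xi_i$. $\widehat{\mathcal G}_o^d(V)$ is the span of the $K(\xi)$ with $\xi\in\Lambda^dV$ integrable and a.s. simple ($=v_1\wedge\dots\wedge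 v_d$). With the pairing $\langle K(\xi),K(\zeta)\rangle=\mathbb E|\langle\xi,\zeta\rangle|$ ($\xi,\zeta$ independent), $\mathcal I^d(V)=\{K\in\widehat{\mathcal G}_o^d(V):\langle K,L\rangle=0\ \forall L\in\widehat{\mathcal G}_o^d(V)\}$; $\bigoplus_d\mathcal I^d(V)$ is an ideal on which $\ell$ vanishes, and $\mathcal Q_o(V)=\bigoplus_d\widehat{\mathcal G}_o^d(V)/\mathcal I^d(V)$ carries the induced $\ell$. Products in $\mathcal Q_o(V)$ are written without $\wedge$. Space. $\mathbb{CP}^n=\mathrm U(n+1)/(\mathrm U(1)\times\mathrm U(n))$, with the Fubini–Study metric ($\mathrm{vol}(\mathbb{CP}^n)=\pi^n/n!$); its cotangent space at the base point is $\mathbb C^n=\mathbb R^{2n}$ with the standard $\mathrm U(n)$-action. The centered probabilistic intersection ring is $R_n=\mathrm H_{\mathbb E}(\mathbb{CP}^n)=\mathcal Q_o(\mathbb C^n)^{\mathrm U(n)}$, a graded commutative real algebra. $\beta_n=[B_{2n}]\in R_n^1$ is the class of the unit ball $B_{2n}\subseteq\mathbb C^n$, and $\gamma_n=[\mathbb{CP}^{n-1}]_{\mathbb E}\in R_n^2$ is the Grassmann class of a complex hyperplane; explicitly $\gamma_n=\frac n\pi[P_n]$ with $P_n=K(g(e_1\wedge\sqrt{-1}\,e_1))$, $g\in\mathrm U(n)$ uniformly random. *)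

theory Defs
  imports "HOL-Probability.Probability"
begin

section \<open>Zonoids and virtual zonoids\<close>

definition zonotope :: "'w::euclidean_space set \<Rightarrow> bool" where
  "zonotope Z \<longleftrightarrow> (\<exists>segs. Z = (\<Sum>(a, b)\<leftarrow>segs. closed_segment a b))"

text \<open>Convergence in the Hausdorff metric, written with closed neighbourhoods.\<close>

definition hausdorff_limit :: "(nat \<Rightarrow> 'w::euclidean_space set) \<Rightarrow> 'w set \<Rightarrow> bool" where
  "hausdorff_limit Z K \<longleftrightarrow>
     (\<forall>e>0. \<forall>\<^sub>F k in sequentially. K \<subseteq> Z k + cball 0 e \<and> Z k \<subseteq> K + cball 0 e)"

definition zonoid :: "'w::euclidean_space set \<Rightarrow> bool" where
  "zonoid K \<longleftrightarrow> compact K \<and> K \<noteq> {} \<and> (\<exists>Z. (\<forall>k. zonotope (Z k)) \<and> hausdorff_limit Z K)"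

definition centered_zonoid :: "'w::euclidean_space set \<Rightarrow> bool" where
  "centered_zonoid K \<longleftrightarrow> zonoid K \<and> uminus ` K = K"

definition support_fun :: "'w::euclidean_space set \<Rightarrow> 'w \<Rightarrow> real" where
  "support_fun K u = (SUP x\<in>K. u \<bullet> x)"

lemma zonotope_convex: "zonotope Z \<Longrightarrow> convex Z"
proof -
  have "convex (\<Sum>(a, b)\<leftarrow>segs. closed_segment a b)" for segs :: "('a \<times> 'a) list"
    by (induction segs) (auto intro!: convex_set_plus)
  then show "zonotope Z \<Longrightarrow> convex Z" by (auto simp: zonotope_def)
qed

lemma compact_set_plus: "compact A \<Longrightarrow> compact B \<Longrightarrow> compact (A + B :: 'a::euclidean_space set)"
proof -
  assume "compact A" "compact B"
  then have "compact {x + y | x y. x \<in> A \<and> y \<in> B}" by (rule compact_sums)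
  also have "{x + y | x y. x \<in> A \<and> y \<in> B} = A + B" by (auto simp: set_plus_def)
  finally show ?thesis .
qed

lemma zonotope_compact: "zonotope Z \<Longrightarrow> compact Z"
proof -
  have "compact (\<Sum>(a, b)\<leftarrow>segs. closed_segment a b)" for segs :: "('a \<times> 'a) list"
    by (induction segs) (auto intro!: compact_set_plus)
  then show "zonotope Z \<Longrightarrow> compact Z" by (auto simp: zonotope_def)
qed

lemma zonotope_singleton_0: "zonotope {0}"
  unfolding zonotope_def by (rule exI[of _ "[]"]) simp

lemma zonotope_add: "zonotope Z \<Longrightarrow> zonotope Z' \<Longrightarrow> zonotope (Z + Z')"
  unfolding zonotope_def by (metis map_append sum_list_append)

lemma linear_image_set_plus:
  assumes "linear f" shows "f ` (A + B) = f ` A + f ` B"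
  using linear_add[OF assms] by (auto simp: set_plus_def image_iff) metis+

lemma zonotope_linear_image:
  assumes "linear f" "zonotope Z" shows "zonotope (f ` Z)"
proof -
  have *: "f ` (\<Sum>(a, b)\<leftarrow>segs. closed_segment a b)
      = (\<Sum>(a, b)\<leftarrow>map (map_prod f f) segs. closed_segment a b)" for segs
    by (induction segs)
       (auto simp: linear_0[OF assms(1)] linear_image_set_plus[OF assms(1)]
          closed_segment_linear_image[OF assms(1)])
  then show ?thesis using assms(2) unfolding zonotope_def by blast
qed

lemma hausdorff_limit_const: "hausdorff_limit (\<lambda>_. K) K"
proof -
  have "K \<subseteq> K + cball 0 e" if "e > 0" for e :: real
  proof
    fix x assume "x \<in> K"
    then have "x + 0 \<in> K + cball 0 e" using that by (intro set_plus_intro) auto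
    then show "x \<in> K + cball 0 e" by simp
  qed
  then show ?thesis by (auto simp: hausdorff_limit_def)
qed

lemma cball_plus_half: "cball (0::'a::euclidean_space) (e/2) + cball 0 (e/2) \<subseteq> cball 0 e"
proof
  fix x :: 'a assume "x \<in> cball 0 (e/2) + cball 0 (e/2)"
  then obtain a b where "x = a + b" "norm a \<le> e/2" "norm b \<le> e/2" by (auto simp: set_plus_def)
  then show "x \<in> cball 0 e" using norm_triangle_ineq[of a b] by simp
qed

lemma hausdorff_limit_add:
  assumes "hausdorff_limit Z K" "hausdorff_limit Z' K'"
  shows "hausdorff_limit (\<lambda>k. Z k + Z' k) (K + K')"
  unfolding hausdorff_limit_def
proof (intro allI impI)
  fix e :: real assume "e > 0"
  then have "e/2 > 0" by simp
  have *: "A + B \<subseteq> (C + D) + cball 0 e"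
    if "A \<subseteq> C + cball 0 (e/2)" "B \<subseteq> D + cball 0 (e/2)" for A B C D :: "'a set"
  proof -
    have "A + B \<subseteq> (C + cball 0 (e/2)) + (D + cball 0 (e/2))"
      using that by (rule set_plus_mono2)
    also have "\<dots> = (C + D) + (cball 0 (e/2) + cball 0 (e/2))"
      by (simp add: ac_simps)
    also have "\<dots> \<subseteq> (C + D) + cball 0 e"
      using cball_plus_half by (rule set_plus_mono2[OF order_refl])
    finally show ?thesis .
  qed
  show "\<forall>\<^sub>F k in sequentially. K + K' \<subseteq> Z k + Z' k + cball 0 e \<and> Z k + Z' k \<subseteq> K + K' + cball 0 e"
    using assms(1)[unfolded hausdorff_limit_def, rule_format, OF \<open>e/2 > 0\<close>]
      assms(2)[unfolded hausdorff_limit_def, rule_format, OF \<open>e/2 > 0\<close>]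
    by eventually_elim (auto intro!: * del: subsetI)
qed

lemma hausdorff_limit_linear_image:
  fixes f :: "'v::euclidean_space \<Rightarrow> 'w::euclidean_space"
  assumes f: "linear f" and "hausdorff_limit Z K"
  shows "hausdorff_limit (\<lambda>k. f ` Z k) (f ` K)"
  unfolding hausdorff_limit_def
proof (intro allI impI)
  fix e :: real assume "e > 0"
  obtain B where B: "B > 0" "\<And>x. norm (f x) \<le> B * norm x"
    using linear_bounded_pos[OF f] by blast
  have "e / B > 0" using \<open>e > 0\<close> B by simp
  have im: "f ` cball 0 (e/B) \<subseteq> cball 0 e"
  proof -
    have "norm (f x) \<le> e" if "norm x \<le> e / B" for x
      using B(2)[of x] that B(1) by (simp add: pos_le_divide_eq mult.commute)
    then show ?thesis by auto
  qed
  have *: "f ` A \<subseteq> f ` C + cball 0 e" if "A \<subseteq> C + cball 0 (e/B)" for A C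
  proof -
    have "f ` A \<subseteq> f ` C + f ` cball 0 (e/B)"
      using that by (auto simp flip: linear_image_set_plus[OF f])
    also have "\<dots> \<subseteq> f ` C + cball 0 e" using im by (rule set_plus_mono2[OF order_refl])
    finally show ?thesis .
  qed
  show "\<forall>\<^sub>F k in sequentially. f ` K \<subseteq> f ` Z k + cball 0 e \<and> f ` Z k \<subseteq> f ` K + cball 0 e"
    using assms(2)[unfolded hausdorff_limit_def, rule_format, OF \<open>e/B > 0\<close>]
    by eventually_elim (auto intro!: * del: subsetI)
qed

lemma zonoid_convex: assumes "zonoid K" shows "convex K"
proof (rule convexI)
  fix x y and s t :: real
  assume xy: "x \<in> K" "y \<in> K" and st: "s \<ge> 0" "t \<ge> 0" "s + t = 1"
  from assms obtain Z where K: "compact K" and Z: "\<And>k. zonotope (Z k)" "hausdorff_limit Z K"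
    by (auto simp: zonoid_def)
  have "\<exists>z\<in>K. dist z (s *\<^sub>R x + t *\<^sub>R y) < e" if "e > 0" for e
  proof -
    have "e/3 > 0" using that by simp
    from Z(2)[unfolded hausdorff_limit_def, rule_format, OF this]
    obtain k where k: "K \<subseteq> Z k + cball 0 (e/3)" "Z k \<subseteq> K + cball 0 (e/3)"
      by (metis (no_types, lifting) eventually_happens sequentially_bot)
    have "convex (Z k + cball 0 (e/3))" using zonotope_convex[OF Z(1)] by (intro convex_set_plus) auto
    then have "s *\<^sub>R x + t *\<^sub>R y \<in> Z k + cball 0 (e/3)"
      using xy k(1) st by (auto simp: convex_def)
    then obtain p q where "p \<in> Z k" "norm q \<le> e/3" and pq: "s *\<^sub>R x + t *\<^sub>R y = p + q"
      by (auto simp: set_plus_def)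
    then obtain p' q' where "p' \<in> K" "norm q' \<le> e/3" "p = p' + q'"
      using k(2) by (fastforce simp: set_plus_def)
    then have "dist p' (s *\<^sub>R x + t *\<^sub>R y) = norm (q' + q)"
      using pq \<open>p = p' + q'\<close> norm_minus_cancel[of "q' + q"] by (simp add: dist_norm add.assoc)
    also have "\<dots> < e"
      using \<open>norm q \<le> e/3\<close> \<open>norm q' \<le> e/3\<close> that norm_triangle_ineq[of q' q] by linarith
    finally show ?thesis using \<open>p' \<in> K\<close> by blast
  qed
  then show "s *\<^sub>R x + t *\<^sub>R y \<in> K"
    using compact_imp_closed[OF K] by (metis closure_approachable closure_closed)
qed

lemma zonoid_add: assumes "zonoid K" "zonoid L" shows "zonoid (K + L)"
proof -
  from assms obtain Z Z' where "\<And>k. zonotope (Z k)" "hausdorff_limit Z K"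
    "\<And>k. zonotope (Z' k)" "hausdorff_limit Z' L" by (auto simp: zonoid_def)
  then have "\<exists>Z. (\<forall>k. zonotope (Z k)) \<and> hausdorff_limit Z (K + L)"
    by (intro exI[of _ "\<lambda>k. Z k + Z' k"]) (auto intro: zonotope_add hausdorff_limit_add)
  moreover have "compact (K + L)" "K + L \<noteq> {}"
    using assms by (simp_all add: zonoid_def compact_set_plus) (fastforce simp: set_plus_def)
  ultimately show ?thesis by (simp add: zonoid_def)
qed

lemma zonoid_linear_image:
  fixes f :: "'v::euclidean_space \<Rightarrow> 'w::euclidean_space"
  assumes f: "linear f" and "zonoid K" shows "zonoid (f ` K)"
proof -
  from assms obtain Z where "\<And>k. zonotope (Z k)" "hausdorff_limit Z K"
    by (auto simp: zonoid_def)
  then have "\<exists>Z. (\<forall>k. zonotope (Z k)) \<and> hausdorff_limit Z (f ` K)"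
    using f by (intro exI[of _ "\<lambda>k. f ` Z k"])
      (auto intro: zonotope_linear_image hausdorff_limit_linear_image)
  moreover have "compact (f ` K)"
    using assms by (auto simp: zonoid_def intro!: compact_continuous_image linear_continuous_on
        linear_conv_bounded_linear[THEN iffD1])
  ultimately show ?thesis using assms by (auto simp: zonoid_def)
qed

lemma centered_zonoid_0: "centered_zonoid {0}"
  by (auto simp: centered_zonoid_def zonoid_def
      intro!: exI[of _ "\<lambda>_. {0}"] hausdorff_limit_const zonotope_singleton_0)

lemma centered_zonoid_add:
  "centered_zonoid K \<Longrightarrow> centered_zonoid L \<Longrightarrow> centered_zonoid (K + L)"
  by (simp add: centered_zonoid_def zonoid_add linear_image_set_plus linear_uminus)

lemma centered_zonoid_linear_image:
  fixes f :: "'v::euclidean_space \<Rightarrow> 'w::euclidean_space"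
  assumes f: "linear f" and "centered_zonoid K" shows "centered_zonoid (f ` K)"
proof -
  have "uminus ` f ` K = f ` uminus ` K" by (simp add: image_image linear_neg[OF f])
  then show ?thesis using assms by (simp add: centered_zonoid_def zonoid_linear_image)
qed

lemma centered_zonoidD:
  assumes "centered_zonoid K"
  shows "compact K" "convex K" "K \<noteq> {}"
  using assms zonoid_convex by (auto simp: centered_zonoid_def zonoid_def)

lemma bdd_above_inner: "compact K \<Longrightarrow> bdd_above ((\<lambda>x. u \<bullet> x) ` K)"
  by (intro bounded_imp_bdd_above compact_imp_bounded compact_continuous_image continuous_intros)

lemma support_fun_upper: "compact K \<Longrightarrow> x \<in> K \<Longrightarrow> u \<bullet> x \<le> support_fun K u"
  unfolding support_fun_def by (rule cSUP_upper) (auto intro: bdd_above_inner)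

lemma support_fun_eqI:
  assumes "x \<in> K" "u \<bullet> x = c" "\<And>y. y \<in> K \<Longrightarrow> u \<bullet> y \<le> c"
  shows "support_fun K u = c"
  unfolding support_fun_def using assms by (intro cSup_eq_maximum) auto

lemma support_fun_attained:
  assumes "compact K" "K \<noteq> {}"
  obtains x where "x \<in> K" "support_fun K u = u \<bullet> x"
proof -
  obtain x where "x \<in> K" "\<And>y. y \<in> K \<Longrightarrow> u \<bullet> y \<le> u \<bullet> x"
    using continuous_attains_sup[OF assms continuous_on_inner[OF continuous_on_const continuous_on_id], of u]
    by blast
  then show ?thesis by (intro that[of x]) (auto intro: support_fun_eqI)
qed

lemma support_fun_add:
  assumes "compact K" "K \<noteq> {}" "compact L" "L \<noteq> {}"
  shows "support_fun (K + L) u = support_fun K u + support_fun L u"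
proof -
  obtain x where x: "x \<in> K" "support_fun K u = u \<bullet> x" using assms support_fun_attained by blast
  obtain y where y: "y \<in> L" "support_fun L u = u \<bullet> y" using assms support_fun_attained by blast
  show ?thesis
    by (rule support_fun_eqI[of "x + y"])
       (use x y in \<open>auto simp: inner_add_right set_plus_def intro!: add_mono
          support_fun_upper[OF assms(1), of _ u, unfolded x(2)]
          support_fun_upper[OF assms(3), of _ u, unfolded y(2)]\<close>)
qed

lemma support_fun_linear_image:
  assumes "compact K" "K \<noteq> {}" "\<And>x. x \<in> K \<Longrightarrow> u \<bullet> f x = v \<bullet> x"
  shows "support_fun (f ` K) u = support_fun K v"
  unfolding support_fun_def image_image using assms by simp

lemma support_fun_scale:
  assumes "compact K" "K \<noteq> {}" "c \<ge> 0"
  shows "support_fun ((*\<^sub>R) c ` K) u = c * support_fun K u"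
proof -
  obtain x where x: "x \<in> K" "support_fun K u = u \<bullet> x" using assms support_fun_attained by blast
  show ?thesis
    by (rule support_fun_eqI[of "c *\<^sub>R x"])
      (use x assms(3) in \<open>auto intro!: mult_left_mono support_fun_upper[OF assms(1), of _ u, unfolded x(2)]\<close>)
qed

lemma support_fun_le_imp_subset:
  assumes K: "compact K" and L: "compact L" "convex L"
    and le: "\<And>u. support_fun K u \<le> support_fun L u" "L \<noteq> {}"
  shows "K \<subseteq> L"
proof
  fix x assume x: "x \<in> K"
  show "x \<in> L"
  proof (rule ccontr)
    assume "x \<notin> L"
    then obtain a b where ab: "a \<bullet> x < b" "\<forall>y\<in>L. a \<bullet> y > b"
      using separating_hyperplane_closed_point[OF L(2) compact_imp_closed[OF L(1)]] by blast
    obtain y where y: "y \<in> L" "support_fun L (- a) = - a \<bullet> y"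
      using support_fun_attained[OF L(1) le(2)] by blast
    have "- a \<bullet> x \<le> support_fun K (- a)" using support_fun_upper[OF K x] .
    also have "\<dots> \<le> - a \<bullet> y" using le y by metis
    finally show False using ab y by fastforce
  qed
qed

lemma support_fun_inject:
  assumes "compact K" "convex K" "K \<noteq> {}" "compact L" "convex L" "L \<noteq> {}"
    and "\<And>u. support_fun K u = support_fun L u"
  shows "K = L"
  using assms support_fun_le_imp_subset[of K L] support_fun_le_imp_subset[of L K] by auto

text \<open>
  Formal differences \<open>K - L\<close> of centered zonoids: pairs \<open>(K, L)\<close> modulo
  \<open>K + L' = K' + L\<close>. The relation is partial because it is restricted to pairs of centered
  zonoids. The scalar action is the one of the Grothendieck group, so negative scalars
  exchange the two components (scaling a centered zonoid by \<open>-1\<close> as a set does nothing).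
\<close>

definition vzonoid_rel :: "('w::euclidean_space set \<times> 'w set) \<Rightarrow> ('w set \<times> 'w set) \<Rightarrow> bool" where
  "vzonoid_rel = (\<lambda>(K, L) (K', L').
     centered_zonoid K \<and> centered_zonoid L \<and> centered_zonoid K' \<and> centered_zonoid L' \<and>
     K + L' = K' + L)"

lemma vzonoid_rel_iff:
  "vzonoid_rel (K, L) (K', L') \<longleftrightarrow>
     centered_zonoid K \<and> centered_zonoid L \<and> centered_zonoid K' \<and> centered_zonoid L' \<and>
     (\<forall>u. support_fun K u - support_fun L u = support_fun K' u - support_fun L' u)"
proof -
  have "K + L' = K' + L \<longleftrightarrow> (\<forall>u. support_fun K u - support_fun L u = support_fun K' u - support_fun L' u)"
    if c: "centered_zonoid K" "centered_zonoid L" "centered_zonoid K'" "centered_zonoid L'"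
  proof -
    note d = c[THEN centered_zonoidD(1)] c[THEN centered_zonoidD(2)] c[THEN centered_zonoidD(3)]
    note s = centered_zonoidD[OF centered_zonoid_add[OF c(1) c(4)]]
             centered_zonoidD[OF centered_zonoid_add[OF c(3) c(2)]]
    have "K + L' = K' + L \<longleftrightarrow> (\<forall>u. support_fun (K + L') u = support_fun (K' + L) u)"
      using support_fun_inject[OF s] by metis
    then show ?thesis by (simp add: support_fun_add d algebra_simps)
  qed
  then show ?thesis by (auto simp: vzonoid_rel_def)
qed

lemma vzonoid_rel_part_equivp: "part_equivp vzonoid_rel"
proof (rule part_equivpI)
  show "\<exists>x::'a set \<times> 'a set. vzonoid_rel x x"
    by (rule exI[of _ "({0}, {0})"]) (simp add: vzonoid_rel_iff centered_zonoid_0)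
  show "symp (vzonoid_rel :: ('a set \<times> 'a set) \<Rightarrow> _)"
    by (auto intro!: sympI simp: vzonoid_rel_iff)
  show "transp (vzonoid_rel :: ('a set \<times> 'a set) \<Rightarrow> _)"
    by (auto intro!: transpI simp: vzonoid_rel_iff)
qed

quotient_type (overloaded) 'w vzonoid = "'w::euclidean_space set \<times> 'w set" / partial: vzonoid_rel
  by (rule vzonoid_rel_part_equivp)

instantiation vzonoid :: (euclidean_space) real_vector
begin

lift_definition zero_vzonoid :: "'a vzonoid" is "({0}, {0})"
  by (simp add: vzonoid_rel_iff centered_zonoid_0)

lift_definition plus_vzonoid :: "'a vzonoid \<Rightarrow> 'a vzonoid \<Rightarrow> 'a vzonoid"
  is "\<lambda>(K, L) (K', L'). (K + K', L + L')"
proof -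
  fix p q p' q' :: "'a set \<times> 'a set"
  obtain K L K' L' M N M' N' where pq: "p = (K, L)" "q = (K', L')" "p' = (M, N)" "q' = (M', N')"
    by (metis surj_pair)
  assume "vzonoid_rel p q" "vzonoid_rel p' q'"
  then have z: "centered_zonoid K" "centered_zonoid L" "centered_zonoid K'" "centered_zonoid L'"
     "centered_zonoid M" "centered_zonoid N" "centered_zonoid M'" "centered_zonoid N'"
    and h: "\<And>u. support_fun K u - support_fun L u = support_fun K' u - support_fun L' u"
     "\<And>u. support_fun M u - support_fun N u = support_fun M' u - support_fun N' u"
    by (auto simp: vzonoid_rel_iff pq)
  have s: "support_fun (X + Y) u = support_fun X u + support_fun Y u"
    if "centered_zonoid X" "centered_zonoid Y" for X Y :: "'a set" and u
    using that by (intro support_fun_add centered_zonoidD)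
  show "vzonoid_rel ((case p of (K, L) \<Rightarrow> \<lambda>(K', L'). (K + K', L + L')) p')
      ((case q of (K, L) \<Rightarrow> \<lambda>(K', L'). (K + K', L + L')) q')"
    unfolding pq prod.case vzonoid_rel_iff
    by (intro conjI allI centered_zonoid_add z) (use h in \<open>simp add: s z add_diff_add\<close>)
qed

lift_definition uminus_vzonoid :: "'a vzonoid \<Rightarrow> 'a vzonoid"
  is "\<lambda>(K, L). (L, K)"
proof -
  fix p q :: "'a set \<times> 'a set"
  obtain K L K' L' where pq: "p = (K, L)" "q = (K', L')" by (metis surj_pair)
  assume *: "vzonoid_rel p q"
  then have "support_fun L u - support_fun K u = support_fun L' u - support_fun K' u" for u
    unfolding pq vzonoid_rel_iff by (metis minus_diff_eq)
  then show "vzonoid_rel (case p of (K, L) \<Rightarrow> (L, K)) (case q of (K, L) \<Rightarrow> (L, K))"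
    using * by (simp only: pq vzonoid_rel_iff prod.case simp_thms)
qed

definition minus_vzonoid :: "'a vzonoid \<Rightarrow> 'a vzonoid \<Rightarrow> 'a vzonoid" where
  "x - y = x + (- y)" for x y :: "'a vzonoid"

lift_definition scaleR_vzonoid :: "real \<Rightarrow> 'a vzonoid \<Rightarrow> 'a vzonoid"
  is "\<lambda>c (K, L). if 0 \<le> c then ((*\<^sub>R) c ` K, (*\<^sub>R) c ` L)
        else ((*\<^sub>R) (- c) ` L, (*\<^sub>R) (- c) ` K)"
proof -
  fix c :: real and p q :: "'a set \<times> 'a set"
  obtain K L K' L' where pq: "p = (K, L)" "q = (K', L')" by (metis surj_pair)
  assume "vzonoid_rel p q"
  then have z: "centered_zonoid K" "centered_zonoid L" "centered_zonoid K'" "centered_zonoid L'"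
    and h: "\<And>u. support_fun K u - support_fun L u = support_fun K' u - support_fun L' u"
    by (auto simp: vzonoid_rel_iff pq)
  have s: "support_fun ((*\<^sub>R) a ` X) u = a * support_fun X u"
    if "0 \<le> a" "X \<in> {K, L, K', L'}" for a u X
    using that z by (auto intro!: support_fun_scale centered_zonoidD)
  have c: "centered_zonoid ((*\<^sub>R) a ` X)" if "X \<in> {K, L, K', L'}" for a X
    using that z by (auto intro!: centered_zonoid_linear_image linear_scaleR)
  have h': "a * support_fun K u - a * support_fun L u = a * support_fun K' u - a * support_fun L' u"
    "a * support_fun L u - a * support_fun K u = a * support_fun L' u - a * support_fun K' u" for a u
  proof -
    show 1: "a * support_fun K u - a * support_fun L u = a * support_fun K' u - a * support_fun L' u"
      using h[of u] by (simp flip: right_diff_distrib)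
    show "a * support_fun L u - a * support_fun K u = a * support_fun L' u - a * support_fun K' u"
      using 1 by linarith
  qed
  show "vzonoid_rel
     (case p of (K, L) \<Rightarrow> if 0 \<le> c then ((*\<^sub>R) c ` K, (*\<^sub>R) c ` L)
        else ((*\<^sub>R) (- c) ` L, (*\<^sub>R) (- c) ` K))
     (case q of (K, L) \<Rightarrow> if 0 \<le> c then ((*\<^sub>R) c ` K, (*\<^sub>R) c ` L)
        else ((*\<^sub>R) (- c) ` L, (*\<^sub>R) (- c) ` K))"
  proof (cases "0 \<le> c")
    case True
    then show ?thesis using s[OF True] c h' by (simp add: pq vzonoid_rel_iff)
  next
    case False
    then have "0 \<le> - c" by simp
    from False show ?thesis using s[OF \<open>0 \<le> - c\<close>] c h'[of "- c"]
      by (simp only: pq vzonoid_rel_iff prod.case if_False insert_iff simp_thms)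
  qed
qed

lift_definition vz_support :: "'a vzonoid \<Rightarrow> 'a \<Rightarrow> real"
  is "\<lambda>(K, L) u. support_fun K u - support_fun L u"
  by (auto simp: vzonoid_rel_iff)

lemma vz_support_inject: "x = y \<longleftrightarrow> (\<forall>u. vz_support x u = vz_support y u)"
  by transfer (auto simp: vzonoid_rel_iff)

lemma vz_support_0: "vz_support 0 u = 0"
  by transfer simp

lemma vz_support_add: "vz_support (x + y) u = vz_support x u + vz_support y u"
  by transfer (auto simp: vzonoid_rel_iff support_fun_add centered_zonoidD)

lemma vz_support_minus: "vz_support (- x) u = - vz_support x u"
  by transfer (auto simp: vzonoid_rel_iff)

lemma vz_support_scale: "vz_support (scaleR c x) u = c * vz_support x u"
proof (transfer fixing: c u)
  fix p :: "'a set \<times> 'a set"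
  obtain K L where p: "p = (K, L)" by (metis surj_pair)
  assume "vzonoid_rel p p"
  then have z: "compact K" "compact L" "K \<noteq> {}" "L \<noteq> {}"
    by (auto simp: vzonoid_rel_iff p dest: centered_zonoidD)
  show "(case case p of (K, L) \<Rightarrow> if 0 \<le> c then ((*\<^sub>R) c ` K, (*\<^sub>R) c ` L)
        else ((*\<^sub>R) (- c) ` L, (*\<^sub>R) (- c) ` K) of
        (K, L) \<Rightarrow> \<lambda>u. support_fun K u - support_fun L u) u =
      c * (case p of (K, L) \<Rightarrow> \<lambda>u. support_fun K u - support_fun L u) u"
  proof (cases "0 \<le> c")
    case True
    then show ?thesis using z by (simp add: p support_fun_scale right_diff_distrib)
  next
    case False
    then have "0 \<le> - c" by simp
    from False show ?thesis
      by (simp only: p prod.case if_False support_fun_scale[OF z(1,3) \<open>0 \<le> - c\<close>]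
          support_fun_scale[OF z(2,4) \<open>0 \<le> - c\<close>]) (simp add: algebra_simps)
  qed
qed

instance
proof
  fix x y z :: "'a vzonoid" and a b :: real
  note vz = vz_support_inject vz_support_0 vz_support_add vz_support_minus vz_support_scale
  show "x + y + z = x + (y + z)" by (simp add: vz add.assoc)
  show "x + y = y + x" by (simp add: vz add.commute)
  show "0 + x = x" by (simp add: vz)
  show "- x + x = 0" by (simp add: vz)
  show "x - y = x + - y" by (rule minus_vzonoid_def)
  show "a *\<^sub>R (x + y) = a *\<^sub>R x + a *\<^sub>R y" by (simp add: vz distrib_left)
  show "(a + b) *\<^sub>R x = a *\<^sub>R x + b *\<^sub>R x" by (simp add: vz distrib_right)
  show "a *\<^sub>R b *\<^sub>R x = (a * b) *\<^sub>R x" by (simp add: vz mult.assoc)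
  show "1 *\<^sub>R x = x" by (simp add: vz)
qed

end

text \<open>
  The centered zonoid of a random vector \<open>X\<close> on the probability space \<open>M\<close>; existence and
  uniqueness for integrable \<open>X\<close> are shown at the end.
\<close>

definition zonoid_of :: "'a measure \<Rightarrow> ('a \<Rightarrow> 'w::euclidean_space) \<Rightarrow> 'w set" where
  "zonoid_of M X = (THE K. centered_zonoid K \<and>
     (\<forall>u. support_fun K u = (\<integral>\<omega>. \<bar>u \<bullet> X \<omega>\<bar> \<partial>M) / 2))"


definition vzonoid_of :: "'w::euclidean_space set \<Rightarrow> 'w vzonoid" where
  "vzonoid_of K = abs_vzonoid (K, {0})"

definition K_class :: "'a measure \<Rightarrow> ('a \<Rightarrow> 'w::euclidean_space) \<Rightarrow> 'w vzonoid" where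
  "K_class M X = vzonoid_of (zonoid_of M X)"

text \<open>
  The zonoid of \<open>\<xi>\<close> depends only on the distribution of \<open>\<xi>\<close>, so quantification over all integrable
  random vectors is rendered by quantification over Borel probability measures \<open>M\<close> on the
  vector space, with \<open>\<lambda>x. x\<close> as the random vector. Independent pairs live on \<open>M \<Otimes>\<^sub>M N\<close>.
\<close>

definition integrable_law :: "'w::euclidean_space measure \<Rightarrow> bool" where
  "integrable_law M \<longleftrightarrow> prob_space M \<and> sets M = sets borel \<and> integrable M (\<lambda>x. x)"

text \<open>
  The length, the pairing and the product are specified by their values on the classes
  of the \<open>K(\<xi>)\<close>, which span all virtual zonoids. That such (bi)linear maps exist is shown at
  the end.
\<close>

definition vz_length :: "'w::euclidean_space vzonoid \<Rightarrow> real" where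
  "vz_length = (SOME f. linear f \<and>
     (\<forall>M. integrable_law M \<longrightarrow> f (K_class M (\<lambda>x. x)) = (\<integral>x. norm x \<partial>M)))"

definition vz_pairing :: "'w::euclidean_space vzonoid \<Rightarrow> 'w vzonoid \<Rightarrow> real" where
  "vz_pairing = (SOME B. bilinear B \<and>
     (\<forall>M N. integrable_law M \<longrightarrow> integrable_law N \<longrightarrow>
        B (K_class M (\<lambda>x. x)) (K_class N (\<lambda>x. x)) = (\<integral>(x, y). \<bar>x \<bullet> y\<bar> \<partial>(M \<Otimes>\<^sub>M N))))"

definition vz_map :: "('v::euclidean_space \<Rightarrow> 'w::euclidean_space) \<Rightarrow> 'v vzonoid \<Rightarrow> 'w vzonoid" where
  "vz_map f x = (case rep_vzonoid x of (K, L) \<Rightarrow> abs_vzonoid (f ` K, f ` L))"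

section \<open>The exterior algebra\<close>

text \<open>
  The whole exterior algebra of \<open>V = real ^ 'm\<close>, with the coordinate at \<open>I\<close> belonging to the
  basis vector \<open>e\<^sub>I\<close>, the wedge product of the \<open>e\<^sub>i\<close>, \<open>i \<in> I\<close>, in the order given by \<open>to_nat\<close>.
  The \<open>e\<^sub>I\<close> are orthonormal for the induced inner product, so that this is the standard
  inner product of the type. Virtual zonoids of the degree \<open>d\<close> part are virtual zonoids of the
  whole space; virtual zonoids of different degree parts are linearly independent there,
  because the support function of a zonoid in degree \<open>d\<close> factors through the projection to
  degree \<open>d\<close>. So the direct sum over the degrees is an internal one.
\<close>

type_synonym 'm ext = "real ^ ('m set)"

definition shuffle_sign :: "'m::finite set \<Rightarrow> 'm set \<Rightarrow> real" where
  "shuffle_sign I J = (- 1) ^ card {(i, j). i \<in> I \<and> j \<in> J \<and> to_nat j < to_nat i}"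

definition wedge :: "'m::finite ext \<Rightarrow> 'm ext \<Rightarrow> 'm ext" where
  "wedge x y = (\<chi> K. \<Sum>I\<in>Pow K. shuffle_sign I (K - I) * x $ I * y $ (K - I))"

definition ext_vec :: "real ^ 'm::finite \<Rightarrow> 'm ext" where
  "ext_vec v = (\<Sum>i\<in>UNIV. v $ i *\<^sub>R axis {i} 1)"

definition ext_product :: "(real ^ 'm::finite) list \<Rightarrow> 'm ext" where
  "ext_product vs = foldr (\<lambda>v. wedge (ext_vec v)) vs (axis {} 1)"

definition simple_ext :: "nat \<Rightarrow> 'm::finite ext set" where
  "simple_ext d = {ext_product vs | vs. length vs = d}"

text \<open>The algebra endomorphism induced by a linear \<open>f\<close>, given on the basis vectors \<open>e\<^sub>I\<close>.\<close>

definition ext_map :: "(real ^ 'm::finite \<Rightarrow> real ^ 'm) \<Rightarrow> 'm ext \<Rightarrow> 'm ext" where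
  "ext_map f x = (\<Sum>I\<in>UNIV. x $ I *\<^sub>R
     ext_product (map (\<lambda>k. f (axis (from_nat k) 1)) (sorted_list_of_set (to_nat ` I))))"

section \<open>Grassmann zonoids and the quotient algebra\<close>

definition vz_wedge :: "'m::finite ext vzonoid \<Rightarrow> 'm ext vzonoid \<Rightarrow> 'm ext vzonoid" where
  "vz_wedge = (SOME B. bilinear B \<and>
     (\<forall>M N. integrable_law M \<longrightarrow> integrable_law N \<longrightarrow>
        B (K_class M (\<lambda>x. x)) (K_class N (\<lambda>x. x)) = K_class (M \<Otimes>\<^sub>M N) (\<lambda>(x, y). wedge x y)))"

text \<open>For \<open>d\<close> above the dimension, \<open>grass d\<close> is zero.\<close>

definition grass :: "nat \<Rightarrow> 'm::finite ext vzonoid set" where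
  "grass d = span {K_class M (\<lambda>x. x) | M. integrable_law M \<and> (AE x in M. x \<in> simple_ext d)}"

definition grass_null :: "nat \<Rightarrow> 'm::finite ext vzonoid set" where
  "grass_null d = {x \<in> grass d. \<forall>y\<in>grass d. vz_pairing x y = 0}"

definition grass_total :: "'m::finite ext vzonoid set" where
  "grass_total = span (\<Union>d. grass d)"

definition grass_null_total :: "'m::finite ext vzonoid set" where
  "grass_null_total = span (\<Union>d. grass_null d)"

definition q_rel :: "'m::finite ext vzonoid \<Rightarrow> 'm ext vzonoid \<Rightarrow> bool" where
  "q_rel x y \<longleftrightarrow> x \<in> grass_total \<and> y \<in> grass_total \<and> x - y \<in> grass_null_total"

lemma q_rel_iff_refl: "q_rel x x \<longleftrightarrow> x \<in> grass_total"
  by (simp add: q_rel_def grass_null_total_def span_zero)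

lemma q_rel_part_equivp: "part_equivp q_rel"
proof (rule part_equivpI)
  show "\<exists>x :: 'm::finite ext vzonoid. q_rel x x"
    by (rule exI[of _ 0]) (simp add: q_rel_iff_refl grass_total_def span_zero)
  show "symp (q_rel :: 'm::finite ext vzonoid \<Rightarrow> _)"
    by (rule sympI) (metis minus_diff_eq grass_null_total_def q_rel_def span_neg)
  show "transp (q_rel :: 'm::finite ext vzonoid \<Rightarrow> _)"
  proof (rule transpI)
    fix x y z :: "'m ext vzonoid" assume "q_rel x y" "q_rel y z"
    then show "q_rel x z"
      using span_add[of "x - y" "\<Union>d. grass_null d" "y - z"] by (simp add: q_rel_def grass_null_total_def)
  qed
qed

text \<open>The algebra \<open>Q\<^sub>o(V)\<close>; its degree \<open>d\<close> part is \<open>q_deg d\<close> below.\<close>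

quotient_type (overloaded) 'm qring = "('m::finite) ext vzonoid" / partial: q_rel
  by (rule q_rel_part_equivp)

instantiation qring :: (finite) real_vector
begin

lift_definition zero_qring :: "'a qring" is 0
  by (simp add: q_rel_iff_refl grass_total_def span_zero)

lift_definition plus_qring :: "'a qring \<Rightarrow> 'a qring \<Rightarrow> 'a qring" is "(+)"
  unfolding q_rel_def grass_total_def grass_null_total_def add_diff_add by (simp add: span_add)

lift_definition scaleR_qring :: "real \<Rightarrow> 'a qring \<Rightarrow> 'a qring" is scaleR
  unfolding q_rel_def grass_total_def grass_null_total_def scaleR_diff_right[symmetric]
  by (simp add: span_scale)

definition uminus_qring :: "'a qring \<Rightarrow> 'a qring" where
  "- x = (- 1) *\<^sub>R x" for x :: "'a qring"

definition minus_qring :: "'a qring \<Rightarrow> 'a qring \<Rightarrow> 'a qring" where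
  "x - y = x + - y" for x y :: "'a qring"

instance
proof
  fix x y z :: "'a qring" and a b :: real
  note g = q_rel_iff_refl grass_total_def span_add span_scale span_zero
  show "x + y + z = x + (y + z)" by transfer (simp add: g add.assoc)
  show "x + y = y + x" by transfer (simp add: g add.commute)
  show "0 + x = x" by transfer (simp add: g)
  show "- x + x = 0" unfolding uminus_qring_def by transfer (simp add: g)
  show "x - y = x + - y" by (rule minus_qring_def)
  show "a *\<^sub>R (x + y) = a *\<^sub>R x + a *\<^sub>R y" by transfer (simp add: g scaleR_add_right)
  show "(a + b) *\<^sub>R x = a *\<^sub>R x + b *\<^sub>R x" by transfer (simp add: g scaleR_add_left)
  show "a *\<^sub>R b *\<^sub>R x = (a * b) *\<^sub>R x" by transfer (simp add: g)
  show "1 *\<^sub>R x = x" by transfer (simp add: g)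
qed

end

text \<open>
  Product, length and group action are induced from representatives. They do not depend on
  the choice: \<open>grass_null_total\<close> is an ideal of \<open>grass_total\<close> on which the length vanishes, and
  it is stable under orthogonal maps.
\<close>

instantiation qring :: (finite) "{one, times}"
begin

definition one_qring :: "'a qring" where
  "one_qring = abs_qring (K_class (return borel (axis {} 1)) (\<lambda>x. x))"

definition times_qring :: "'a qring \<Rightarrow> 'a qring \<Rightarrow> 'a qring" where
  "x * y = abs_qring (vz_wedge (rep_qring x) (rep_qring y))" for x y :: "'a qring"

instance ..

end

instance qring :: (finite) power ..

definition q_deg :: "nat \<Rightarrow> 'm::finite qring set" where
  "q_deg d = abs_qring ` grass d"

definition q_length :: "'m::finite qring \<Rightarrow> real" where
  "q_length x = vz_length (rep_qring x)"

definition q_map :: "(real ^ 'm::finite \<Rightarrow> real ^ 'm) \<Rightarrow> 'm qring \<Rightarrow> 'm qring" where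
  "q_map f x = abs_qring (vz_map (ext_map f) (rep_qring x))"

section \<open>The centered probabilistic intersection ring of complex projective space\<close>

text \<open>
  \<open>\<complex>\<^sup>n\<close> with \<open>n = CARD('n)\<close> is identified with \<open>real ^ ('n \<times> bool)\<close>; the coordinates \<open>(i, False)\<close>
  and \<open>(i, True)\<close> are the real and imaginary part of the coordinate \<open>i\<close>.
\<close>

definition realify :: "complex ^ 'n::finite \<Rightarrow> real ^ ('n \<times> bool)" where
  "realify v = (\<chi> p. if snd p then Im (v $ fst p) else Re (v $ fst p))"

definition complexify :: "real ^ ('n::finite \<times> bool) \<Rightarrow> complex ^ 'n" where
  "complexify x = (\<chi> i. Complex (x $ (i, False)) (x $ (i, True)))"

definition unitary_group :: "(complex ^ 'n::finite ^ 'n) set" where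
  "unitary_group = {A. (\<chi> i j. cnj (A $ j $ i)) ** A = mat 1}"

definition real_action :: "complex ^ 'n::finite ^ 'n \<Rightarrow> real ^ ('n \<times> bool) \<Rightarrow> real ^ ('n \<times> bool)" where
  "real_action A x = realify (A *v complexify x)"

text \<open>The law of a uniformly random element of \<open>U(n)\<close>: the unique left-invariant probability measure.\<close>

definition haar_unitary :: "(complex ^ 'n::finite ^ 'n) measure" where
  "haar_unitary = (SOME M. prob_space M \<and> sets M = sets borel \<and> (AE A in M. A \<in> unitary_group) \<and>
     (\<forall>B\<in>unitary_group. distr M borel (\<lambda>A. B ** A) = M))"

definition cp_ring :: "('n::finite \<times> bool) qring set" where
  "cp_ring = {x. \<forall>A\<in>unitary_group. q_map (real_action A) x = x}"

definition cp_deg :: "nat \<Rightarrow> ('n::finite \<times> bool) qring set" where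
  "cp_deg d = cp_ring \<inter> q_deg d"

definition cp_beta :: "('n::finite \<times> bool) qring" where
  "cp_beta = abs_qring (vzonoid_of (ext_vec ` cball 0 1))"

text \<open>Any fixed index would do as the index of \<open>e\<^sub>1\<close>, since \<open>g\<close> is uniformly distributed.\<close>

definition first_index :: "'n::finite" where
  "first_index = (ARG_MIN to_nat i. True)"

definition cp_gamma :: "('n::finite \<times> bool) qring" where
  "cp_gamma = (real CARD('n) / pi) *\<^sub>R abs_qring (K_class (haar_unitary :: (complex ^ 'n ^ 'n) measure)
     (\<lambda>A. ext_map (real_action A)
        (wedge (ext_vec (realify (axis first_index 1))) (ext_vec (realify (axis first_index \<i>))))))"

section \<open>Bases, forms and isomorphisms on subspaces\<close>

definition is_basis_of :: "'i set \<Rightarrow> ('i \<Rightarrow> 'a::real_vector) \<Rightarrow> 'a set \<Rightarrow> bool" where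
  "is_basis_of J b S \<longleftrightarrow> inj_on b J \<and> independent (b ` J) \<and> span (b ` J) = S"

definition linear_iso_on :: "'a::real_vector set \<Rightarrow> 'b::real_vector set \<Rightarrow> ('a \<Rightarrow> 'b) \<Rightarrow> bool" where
  "linear_iso_on S T f \<longleftrightarrow> subspace S \<and> subspace T \<and>
     (\<forall>x\<in>S. \<forall>y\<in>S. f (x + y) = f x + f y) \<and> (\<forall>c. \<forall>x\<in>S. f (c *\<^sub>R x) = c *\<^sub>R f x) \<and>
     bij_betw f S T"

definition pos_def_form_on :: "'a::real_vector set \<Rightarrow> ('a \<Rightarrow> 'a \<Rightarrow> real) \<Rightarrow> bool" where
  "pos_def_form_on S B \<longleftrightarrow> subspace S \<and>
     (\<forall>x\<in>S. \<forall>y\<in>S. B x y = B y x) \<and>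
     (\<forall>x\<in>S. \<forall>y\<in>S. \<forall>z\<in>S. B (x + y) z = B x z + B y z) \<and>
     (\<forall>c. \<forall>x\<in>S. \<forall>y\<in>S. B (c *\<^sub>R x) y = c * B x y) \<and>
     (\<forall>x\<in>S. x \<noteq> 0 \<longrightarrow> B x x > 0)"

section \<open>Well-definedness\<close>

text \<open>
  The closure of the set of means \<open>E(\<phi> X)/2\<close>, \<open>\<bar>\<phi>\<bar> \<le> 1\<close>, is the zonoid of \<open>X\<close>: its support function is
  right, and approximating \<open>X\<close> by simple functions approximates it by zonotopes.
\<close>

definition selection_means :: "'a measure \<Rightarrow> ('a \<Rightarrow> 'w::euclidean_space) \<Rightarrow> 'w set" where
  "selection_means M X =
     {(1/2) *\<^sub>R (\<integral>\<omega>. \<phi> \<omega> *\<^sub>R X \<omega> \<partial>M) | \<phi>. \<phi> \<in> borel_measurable M \<and> (\<forall>\<omega>. \<bar>\<phi> \<omega>\<bar> \<le> 1)}"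

lemma integrable_bounded_scaleR:
  fixes X :: "'a \<Rightarrow> 'w::euclidean_space"
  assumes "integrable M X" "\<phi> \<in> borel_measurable M" "\<And>\<omega>. \<bar>\<phi> \<omega>\<bar> \<le> (1::real)"
  shows "integrable M (\<lambda>\<omega>. \<phi> \<omega> *\<^sub>R X \<omega>)"
proof (rule Bochner_Integration.integrable_bound[OF assms(1)])
  show "(\<lambda>\<omega>. \<phi> \<omega> *\<^sub>R X \<omega>) \<in> borel_measurable M" using assms by measurable
  show "AE x in M. norm (\<phi> x *\<^sub>R X x) \<le> norm (X x)"
    using mult_right_mono[OF assms(3) norm_ge_zero] by auto
qed

lemma norm_integral_le:
  fixes f :: "'a \<Rightarrow> 'w::euclidean_space" and g :: "'a \<Rightarrow> real"
  assumes "integrable M f" "integrable M g" "\<And>x. x \<in> space M \<Longrightarrow> norm (f x) \<le> g x"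
  shows "norm (\<integral>x. f x \<partial>M) \<le> (\<integral>x. g x \<partial>M)"
proof -
  have "norm (\<integral>x. f x \<partial>M) \<le> (\<integral>x. norm (f x) \<partial>M)" by (rule integral_norm_bound)
  also have "\<dots> \<le> (\<integral>x. g x \<partial>M)" using assms by (intro integral_mono) auto
  finally show ?thesis .
qed

lemma selection_means_zonotope:
  fixes X :: "'a \<Rightarrow> 'w::euclidean_space"
  assumes "prob_space M" and X: "simple_function M X"
  shows "zonotope (selection_means M X)"
proof -
  interpret prob_space M by fact
  define F where "F = X ` space M"
  define p where "p y = prob (X -` {y} \<inter> space M)" for y
  have F: "finite F" using X unfolding F_def by (rule simple_functionD)
  have ev [measurable]: "X -` {y} \<inter> space M \<in> events" for y
    using X by (rule simple_functionD)
  have Xsum: "X \<omega> = (\<Sum>y\<in>F. indicator (X -` {y} \<inter> space M) \<omega> *\<^sub>R y)" if "\<omega> \<in> space M" for \<omega>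
  proof -
    have "(\<Sum>y\<in>F. indicator (X -` {y} \<inter> space M) \<omega> *\<^sub>R y) = (\<Sum>y\<in>F. if y = X \<omega> then y else 0)"
      using that by (intro sum.cong) (auto simp: indicator_def)
    also have "\<dots> = X \<omega>" using F that by (auto simp: F_def)
    finally show ?thesis by simp
  qed
  have int_phi: "(\<integral>\<omega>. \<phi> \<omega> *\<^sub>R X \<omega> \<partial>M)
      = (\<Sum>y\<in>F. (\<integral>\<omega>. \<phi> \<omega> * indicator (X -` {y} \<inter> space M) \<omega> \<partial>M) *\<^sub>R y)"
    if [measurable]: "\<phi> \<in> borel_measurable M" and b: "\<And>\<omega>. \<bar>\<phi> \<omega>\<bar> \<le> (1::real)" for \<phi>
  proof -
    have i: "integrable M (\<lambda>\<omega>. \<phi> \<omega> * indicator (X -` {y} \<inter> space M) \<omega>)" for y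
    proof (rule integrable_const_bound[where B = 1])
      show "AE x in M. norm (\<phi> x * indicator (X -` {y} \<inter> space M) x) \<le> 1"
        using b by (auto simp: indicator_def)
    qed measurable
    have "(\<integral>\<omega>. \<phi> \<omega> *\<^sub>R X \<omega> \<partial>M)
        = (\<integral>\<omega>. (\<Sum>y\<in>F. (\<phi> \<omega> * indicator (X -` {y} \<inter> space M) \<omega>) *\<^sub>R y) \<partial>M)"
      by (intro Bochner_Integration.integral_cong refl, subst Xsum)
         (auto simp: scaleR_sum_right)
    also have "\<dots> = (\<Sum>y\<in>F. (\<integral>\<omega>. (\<phi> \<omega> * indicator (X -` {y} \<inter> space M) \<omega>) *\<^sub>R y \<partial>M))"
      by (intro Bochner_Integration.integral_sum integrable_scaleR_left) (auto intro: i)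
    also have "\<dots> = (\<Sum>y\<in>F. (\<integral>\<omega>. \<phi> \<omega> * indicator (X -` {y} \<inter> space M) \<omega> \<partial>M) *\<^sub>R y)"
      by (intro sum.cong refl integral_scaleR_left) (auto intro: i)
    finally show ?thesis .
  qed
  define seg where "seg y = (- (p y / 2) *\<^sub>R y, (p y / 2) *\<^sub>R y)" for y
  have seg: "closed_segment (fst (seg y)) (snd (seg y)) = {(c / 2) *\<^sub>R y | c. \<bar>c\<bar> \<le> p y}" for y
  proof (intro equalityI subsetI)
    fix z assume "z \<in> closed_segment (fst (seg y)) (snd (seg y))"
    then obtain t where t: "0 \<le> t" "t \<le> 1"
      "z = (1 - t) *\<^sub>R (- (p y / 2) *\<^sub>R y) + t *\<^sub>R ((p y / 2) *\<^sub>R y)"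
      by (auto simp: seg_def in_segment)
    have "z = (((2 * t - 1) * p y) / 2) *\<^sub>R y"
    proof -
      have "(1 - t) * (- (p y / 2)) + t * (p y / 2) = ((2 * t - 1) * p y) / 2"
        by (simp add: field_simps)
      then show ?thesis unfolding t(3) scaleR_scaleR scaleR_add_left[symmetric] by simp
    qed
    moreover have "\<bar>(2 * t - 1) * p y\<bar> \<le> 1 * p y"
      unfolding abs_mult using t by (intro mult_mono) (auto simp: p_def)
    ultimately show "z \<in> {(c / 2) *\<^sub>R y | c. \<bar>c\<bar> \<le> p y}" by auto
  next
    fix z assume "z \<in> {(c / 2) *\<^sub>R y | c. \<bar>c\<bar> \<le> p y}"
    then obtain c where c: "\<bar>c\<bar> \<le> p y" "z = (c / 2) *\<^sub>R y" by auto
    show "z \<in> closed_segment (fst (seg y)) (snd (seg y))"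
    proof (cases "p y = 0")
      case True
      then show ?thesis using c by (simp add: seg_def)
    next
      case False
      then have pos: "p y > 0" by (simp add: p_def zero_less_measure_iff)
      define t where "t = (c / p y + 1) / 2"
      have "0 \<le> t" "t \<le> 1" using c pos by (auto simp: t_def field_simps abs_le_iff)
      moreover have "z = (1 - t) *\<^sub>R (- (p y / 2) *\<^sub>R y) + t *\<^sub>R ((p y / 2) *\<^sub>R y)"
      proof -
        have "(1 - t) * (- (p y / 2)) + t * (p y / 2) = c / 2"
          using pos by (simp add: t_def field_simps)
        then show ?thesis unfolding c(2) scaleR_scaleR scaleR_add_left[symmetric] by simp
      qed
      ultimately show ?thesis by (auto simp: seg_def in_segment)
    qed
  qed
  have "selection_means M X = (\<Sum>y\<in>F. {(c / 2) *\<^sub>R y | c. \<bar>c\<bar> \<le> p y})" (is "_ = ?S")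
  proof (intro equalityI subsetI)
    fix z assume "z \<in> selection_means M X"
    then obtain \<phi> where z: "z = (1/2) *\<^sub>R (\<integral>\<omega>. \<phi> \<omega> *\<^sub>R X \<omega> \<partial>M)"
      and [measurable]: "\<phi> \<in> borel_measurable M" and b: "\<And>\<omega>. \<bar>\<phi> \<omega>\<bar> \<le> 1"
      by (auto simp: selection_means_def)
    define c where "c y = (\<integral>\<omega>. \<phi> \<omega> * indicator (X -` {y} \<inter> space M) \<omega> \<partial>M)" for y
    have "z = (\<Sum>y\<in>F. (c y / 2) *\<^sub>R y)"
      unfolding z int_phi[OF \<open>\<phi> \<in> borel_measurable M\<close> b] scaleR_sum_right by (simp add: c_def)
    moreover have "\<bar>c y\<bar> \<le> p y" for y
    proof -
      have "norm (c y) \<le> (\<integral>\<omega>. indicator (X -` {y} \<inter> space M) \<omega> \<partial>M)"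
        unfolding c_def
      proof (rule norm_integral_le)
        show "integrable M (\<lambda>\<omega>. \<phi> \<omega> * indicator (X -` {y} \<inter> space M) \<omega>)"
        proof (rule integrable_const_bound[where B = 1])
          show "AE x in M. norm (\<phi> x * indicator (X -` {y} \<inter> space M) x) \<le> 1"
            using b by (auto simp: indicator_def)
        qed measurable
        show "integrable M (\<lambda>\<omega>. indicator (X -` {y} \<inter> space M) \<omega> :: real)"
          by (intro integrable_real_indicator ev) (simp add: emeasure_eq_measure)
      qed (use b in \<open>auto simp: indicator_def\<close>)
      then show ?thesis by (simp add: p_def Int_commute)
    qed
    ultimately show "z \<in> ?S" unfolding set_sum_alt[OF F] by blast
  next
    fix z assume "z \<in> ?S"
    then obtain s where s: "z = sum s F" "\<forall>y\<in>F. s y \<in> {(c / 2) *\<^sub>R y | c. \<bar>c\<bar> \<le> p y}"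
      unfolding set_sum_alt[OF F] by blast
    then have "\<forall>y\<in>F. \<exists>c. s y = (c / 2) *\<^sub>R y \<and> \<bar>c\<bar> \<le> p y" by auto
    then obtain c where c: "\<And>y. y \<in> F \<Longrightarrow> s y = (c y / 2) *\<^sub>R y" "\<And>y. y \<in> F \<Longrightarrow> \<bar>c y\<bar> \<le> p y"
      by metis
    define d where "d y = (if p y = 0 then 0 else c y / p y)" for y
    define \<phi> where "\<phi> \<omega> = (\<Sum>y\<in>F. d y * indicator (X -` {y} \<inter> space M) \<omega>)" for \<omega>
    have d: "\<bar>d y\<bar> \<le> 1" "d y * p y = c y" if "y \<in> F" for y
      using c(2)[OF that] by (auto simp: d_def divide_le_eq_1 p_def zero_less_measure_iff)
    have phi: "\<phi> \<omega> = (if \<omega> \<in> space M then d (X \<omega>) else 0)" for \<omega>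
    proof (cases "\<omega> \<in> space M")
      case True
      have "\<phi> \<omega> = (\<Sum>y\<in>F. if y = X \<omega> then d y else 0)"
        unfolding \<phi>_def using True by (intro sum.cong) (auto simp: indicator_def)
      then show ?thesis using True F by (auto simp: F_def)
    qed (simp add: \<phi>_def)
    have b: "\<bar>\<phi> \<omega>\<bar> \<le> 1" for \<omega> using d(1) by (auto simp: phi F_def)
    have m: "\<phi> \<in> borel_measurable M" unfolding \<phi>_def by measurable
    have "(\<integral>\<omega>. \<phi> \<omega> * indicator (X -` {y} \<inter> space M) \<omega> \<partial>M) = c y" if "y \<in> F" for y
    proof -
      have "(\<integral>\<omega>. \<phi> \<omega> * indicator (X -` {y} \<inter> space M) \<omega> \<partial>M)
          = (\<integral>\<omega>. d y * indicator (X -` {y} \<inter> space M) \<omega> \<partial>M)"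
        by (intro Bochner_Integration.integral_cong) (auto simp: phi indicator_def)
      then show ?thesis using d(2)[OF that] by (simp add: p_def Int_commute)
    qed
    then have "z = (1/2) *\<^sub>R (\<integral>\<omega>. \<phi> \<omega> *\<^sub>R X \<omega> \<partial>M)"
      unfolding int_phi[OF m b] s(1) scaleR_sum_right by (intro sum.cong) (auto simp: c(1))
    then show "z \<in> selection_means M X" unfolding selection_means_def
      by (intro CollectI exI[of _ \<phi>]) (use m b in auto)
  qed
  also have "\<dots> = (\<Sum>y\<in>F. closed_segment (fst (seg y)) (snd (seg y)))" by (simp add: seg)
  finally have eq: "selection_means M X = (\<Sum>y\<in>F. closed_segment (fst (seg y)) (snd (seg y)))" .
  obtain ys where "F = set ys" "distinct ys" using finite_distinct_list[OF F] by metis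
  then have "selection_means M X = (\<Sum>(a, b)\<leftarrow>map seg ys. closed_segment a b)"
    unfolding eq by (simp add: sum.distinct_set_conv_list o_def split_def)
  then show ?thesis unfolding zonotope_def by blast
qed

lemma selection_means_close:
  fixes X Y :: "'a \<Rightarrow> 'w::euclidean_space"
  assumes "integrable M X" "integrable M Y" "(\<integral>\<omega>. norm (X \<omega> - Y \<omega>) \<partial>M) \<le> e"
  shows "selection_means M X \<subseteq> selection_means M Y + cball 0 e"
proof
  fix z assume "z \<in> selection_means M X"
  then obtain \<phi> where z: "z = (1/2) *\<^sub>R (\<integral>\<omega>. \<phi> \<omega> *\<^sub>R X \<omega> \<partial>M)"
    and m: "\<phi> \<in> borel_measurable M" and b: "\<And>\<omega>. \<bar>\<phi> \<omega>\<bar> \<le> 1"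
    by (auto simp: selection_means_def)
  note i = integrable_bounded_scaleR[OF assms(1) m b] integrable_bounded_scaleR[OF assms(2) m b]
  define z' where "z' = (1/2) *\<^sub>R (\<integral>\<omega>. \<phi> \<omega> *\<^sub>R Y \<omega> \<partial>M)"
  have "z - z' = (1/2) *\<^sub>R (\<integral>\<omega>. \<phi> \<omega> *\<^sub>R (X \<omega> - Y \<omega>) \<partial>M)"
    using i by (simp add: z z'_def scaleR_diff_right)
  also have "norm \<dots> \<le> 1 * (\<integral>\<omega>. norm (X \<omega> - Y \<omega>) \<partial>M)"
    unfolding norm_scaleR
  proof (rule mult_mono[OF _ norm_integral_le])
    show "integrable M (\<lambda>\<omega>. \<phi> \<omega> *\<^sub>R (X \<omega> - Y \<omega>))"
      using i by (simp add: scaleR_diff_right)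
    show "norm (\<phi> \<omega> *\<^sub>R (X \<omega> - Y \<omega>)) \<le> norm (X \<omega> - Y \<omega>)" for \<omega>
      using mult_right_mono[OF b norm_ge_zero] by simp
  qed (use assms in auto)
  finally have "norm (z - z') \<le> e" using assms(3) by simp
  moreover have "z' \<in> selection_means M Y" unfolding selection_means_def z'_def
    by (intro CollectI exI[of _ \<phi>]) (use m b in auto)
  ultimately have "z' + (z - z') \<in> selection_means M Y + cball 0 e" by (intro set_plus_intro) auto
  then show "z \<in> selection_means M Y + cball 0 e" by simp
qed

lemma zonoid_of_exists:
  fixes X :: "'a \<Rightarrow> 'w::euclidean_space"
  assumes "prob_space M" and X: "integrable M X"
  shows "\<exists>K. centered_zonoid K \<and> (\<forall>u. support_fun K u = (\<integral>\<omega>. \<bar>u \<bullet> X \<omega>\<bar> \<partial>M) / 2)"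
proof -
  interpret prob_space M by fact
  define A where "A = selection_means M X"
  define K where "K = closure A"
  have neg: "uminus ` A \<subseteq> A"
  proof
    fix z assume "z \<in> uminus ` A"
    then obtain \<phi> where z: "z = - ((1/2) *\<^sub>R (\<integral>\<omega>. \<phi> \<omega> *\<^sub>R X \<omega> \<partial>M))"
      and m: "\<phi> \<in> borel_measurable M" and b: "\<And>\<omega>. \<bar>\<phi> \<omega>\<bar> \<le> 1"
      by (auto simp: selection_means_def A_def)
    then have "z = (1/2) *\<^sub>R (\<integral>\<omega>. (- \<phi> \<omega>) *\<^sub>R X \<omega> \<partial>M)" by simp
    moreover have "(\<lambda>\<omega>. - \<phi> \<omega>) \<in> borel_measurable M" "\<And>\<omega>. \<bar>- \<phi> \<omega>\<bar> \<le> 1" using m b by auto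
    ultimately show "z \<in> A" unfolding A_def selection_means_def
      by (intro CollectI exI[of _ "\<lambda>\<omega>. - \<phi> \<omega>"]) auto
  qed
  have "uminus ` A = A"
  proof
    show "A \<subseteq> uminus ` A" using image_mono[OF neg, of uminus] by (simp add: image_image)
  qed (rule neg)
  then have symm: "uminus ` K = K"
    unfolding K_def using closure_injective_linear_image[OF linear_uminus, of A] by simp
  have "\<exists>s. (\<forall>i. simple_function M (s i)) \<and> (\<lambda>i. \<integral>\<omega>. norm (X \<omega> - s i \<omega>) \<partial>M) \<longlonglongrightarrow> 0
      \<and> (\<forall>i. integrable M (s i))"
  proof -
    from X obtain x where "has_bochner_integral M X x" by (auto simp: integrable.simps)
    then obtain s where s: "\<And>i. Bochner_Integration.simple_bochner_integrable M (s i)"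
       "(\<lambda>i. \<integral>\<^sup>+\<omega>. norm (X \<omega> - s i \<omega>) \<partial>M) \<longlonglongrightarrow> 0"
      by (auto elim!: has_bochner_integral.cases)
    have i: "integrable M (s i)" for i using s(1) by (rule integrableI_simple_bochner_integrable)
    have "(\<lambda>i. ennreal (\<integral>\<omega>. norm (X \<omega> - s i \<omega>) \<partial>M)) \<longlonglongrightarrow> ennreal 0"
      using s(2) X i by (simp add: nn_integral_eq_integral)
    then have "(\<lambda>i. \<integral>\<omega>. norm (X \<omega> - s i \<omega>) \<partial>M) \<longlonglongrightarrow> 0"
      by (subst (asm) tendsto_ennreal_iff) auto
    then show ?thesis using s(1) i by (intro exI[of _ s]) (auto elim: Bochner_Integration.simple_bochner_integrable.cases)
  qed
  then obtain s where s: "\<And>i. simple_function M (s i)" "\<And>i. integrable M (s i)"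
    "(\<lambda>i. \<integral>\<omega>. norm (X \<omega> - s i \<omega>) \<partial>M) \<longlonglongrightarrow> 0" by blast
  have bd: "norm z \<le> (\<integral>\<omega>. norm (X \<omega>) \<partial>M)" if "z \<in> A" for z
  proof -
    have "selection_means M X \<subseteq> selection_means M (\<lambda>_. 0) + cball 0 (\<integral>\<omega>. norm (X \<omega>) \<partial>M)"
      using X by (intro selection_means_close) auto
    moreover have "selection_means M (\<lambda>_. 0 :: 'w) \<subseteq> {0}" by (auto simp: selection_means_def)
    ultimately have "z \<in> {0} + cball 0 (\<integral>\<omega>. norm (X \<omega>) \<partial>M)"
      using that set_plus_mono2[OF _ order_refl] unfolding A_def by blast
    then show ?thesis by simp
  qed
  then have "bounded A" by (auto simp: bounded_iff)
  then have cK: "compact K" by (simp add: K_def compact_closure)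
  have "0 \<in> A" unfolding A_def selection_means_def
    by (intro CollectI exI[of _ "\<lambda>_. 0"]) auto
  then have "K \<noteq> {}" unfolding K_def using closure_subset by blast
  have "hausdorff_limit (\<lambda>i. selection_means M (s i)) K"
    unfolding hausdorff_limit_def
  proof (intro allI impI)
    fix e :: real assume "e > 0"
    with s(3) have "\<forall>\<^sub>F i in sequentially. (\<integral>\<omega>. norm (X \<omega> - s i \<omega>) \<partial>M) < e"
      by (rule order_tendstoD(2))
    then show "\<forall>\<^sub>F i in sequentially. K \<subseteq> selection_means M (s i) + cball 0 e
        \<and> selection_means M (s i) \<subseteq> K + cball 0 e"
    proof eventually_elim
      case (elim i)
      have 1: "A \<subseteq> selection_means M (s i) + cball 0 e"
        unfolding A_def using elim by (intro selection_means_close X s) auto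
      have "selection_means M (s i) \<subseteq> A + cball 0 e"
        unfolding A_def using elim by (intro selection_means_close X s) (auto simp: norm_minus_commute)
      also have "\<dots> \<subseteq> K + cball 0 e"
        unfolding K_def by (intro set_plus_mono2 closure_subset order_refl)
      finally have 2: "selection_means M (s i) \<subseteq> K + cball 0 e" .
      have "compact (selection_means M (s i) + cball 0 e)"
        by (intro compact_set_plus compact_cball zonotope_compact selection_means_zonotope s) fact
      then have "K \<subseteq> selection_means M (s i) + cball 0 e"
        unfolding K_def using 1 by (intro closure_minimal compact_imp_closed)
      with 2 show ?case by blast
    qed
  qed
  then have "zonoid K"
    unfolding zonoid_def using cK \<open>K \<noteq> {}\<close> selection_means_zonotope[OF assms(1) s(1)]
    by (intro conjI exI[of _ "\<lambda>i. selection_means M (s i)"] allI)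
  moreover have "support_fun K u = (\<integral>\<omega>. \<bar>u \<bullet> X \<omega>\<bar> \<partial>M) / 2" for u
  proof -
    have iu: "integrable M (\<lambda>\<omega>. u \<bullet> X \<omega>)" using X by simp
    have le: "u \<bullet> z \<le> (\<integral>\<omega>. \<bar>u \<bullet> X \<omega>\<bar> \<partial>M) / 2" if zA: "z \<in> A" for z
    proof -
      obtain \<phi> where z: "z = (1/2) *\<^sub>R (\<integral>\<omega>. \<phi> \<omega> *\<^sub>R X \<omega> \<partial>M)"
        and m: "\<phi> \<in> borel_measurable M" and b: "\<And>\<omega>. \<bar>\<phi> \<omega>\<bar> \<le> 1"
        using zA unfolding selection_means_def A_def mem_Collect_eq by blast
      note i = integrable_bounded_scaleR[OF X m b]
      have "u \<bullet> z = (\<integral>\<omega>. \<phi> \<omega> * (u \<bullet> X \<omega>) \<partial>M) / 2"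
        unfolding z using integral_inner_right[OF i, of u] by simp
      also have "(\<integral>\<omega>. \<phi> \<omega> * (u \<bullet> X \<omega>) \<partial>M) \<le> (\<integral>\<omega>. \<bar>u \<bullet> X \<omega>\<bar> \<partial>M)"
      proof (rule integral_mono)
        show "integrable M (\<lambda>\<omega>. \<phi> \<omega> * (u \<bullet> X \<omega>))"
          using integrable_inner_right[OF i, of u] by simp
        show "\<phi> \<omega> * (u \<bullet> X \<omega>) \<le> \<bar>u \<bullet> X \<omega>\<bar>" for \<omega>
          using mult_right_mono[OF b[of \<omega>] abs_ge_zero[of "u \<bullet> X \<omega>"]]
            abs_ge_self[of "\<phi> \<omega> * (u \<bullet> X \<omega>)"] by (simp add: abs_mult)
      qed (use iu in auto)
      finally show ?thesis by simp
    qed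
    have "A \<subseteq> {z. u \<bullet> z \<le> (\<integral>\<omega>. \<bar>u \<bullet> X \<omega>\<bar> \<partial>M) / 2}" using le by auto
    then have up: "K \<subseteq> {z. u \<bullet> z \<le> (\<integral>\<omega>. \<bar>u \<bullet> X \<omega>\<bar> \<partial>M) / 2}"
      unfolding K_def by (rule closure_minimal) (rule closed_halfspace_le)
    define \<phi> where "\<phi> \<omega> = (if u \<bullet> X \<omega> \<ge> 0 then 1 else - 1 :: real)" for \<omega>
    have m: "\<phi> \<in> borel_measurable M" unfolding \<phi>_def using X by measurable
    have b: "\<bar>\<phi> \<omega>\<bar> \<le> 1" for \<omega> by (simp add: \<phi>_def)
    define z where "z = (1/2) *\<^sub>R (\<integral>\<omega>. \<phi> \<omega> *\<^sub>R X \<omega> \<partial>M)"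
    have "z \<in> A" unfolding z_def A_def selection_means_def
      by (intro CollectI exI[of _ \<phi>]) (use m b in auto)
    then have "z \<in> K" using closure_subset K_def by auto
    moreover have "u \<bullet> z = (\<integral>\<omega>. \<bar>u \<bullet> X \<omega>\<bar> \<partial>M) / 2"
    proof -
      have "u \<bullet> z = (\<integral>\<omega>. \<phi> \<omega> * (u \<bullet> X \<omega>) \<partial>M) / 2"
        unfolding z_def using integral_inner_right[OF integrable_bounded_scaleR[OF X m b], of u] by simp
      also have "(\<integral>\<omega>. \<phi> \<omega> * (u \<bullet> X \<omega>) \<partial>M) = (\<integral>\<omega>. \<bar>u \<bullet> X \<omega>\<bar> \<partial>M)"
        by (intro Bochner_Integration.integral_cong) (auto simp: \<phi>_def)
      finally show ?thesis .
    qed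
    ultimately show ?thesis using up by (intro support_fun_eqI) auto
  qed
  ultimately show ?thesis using symm by (auto simp: centered_zonoid_def)
qed

lemma
  fixes X :: "'a \<Rightarrow> 'w::euclidean_space"
  assumes "prob_space M" "integrable M X"
  shows centered_zonoid_zonoid_of: "centered_zonoid (zonoid_of M X)"
    and support_fun_zonoid_of: "support_fun (zonoid_of M X) u = (\<integral>\<omega>. \<bar>u \<bullet> X \<omega>\<bar> \<partial>M) / 2"
proof -
  have "\<exists>!K. centered_zonoid K \<and> (\<forall>u. support_fun K u = (\<integral>\<omega>. \<bar>u \<bullet> X \<omega>\<bar> \<partial>M) / 2)"
  proof (rule ex_ex1I[OF zonoid_of_exists[OF assms]])
    fix K L
    assume K: "centered_zonoid K \<and> (\<forall>u. support_fun K u = (\<integral>\<omega>. \<bar>u \<bullet> X \<omega>\<bar> \<partial>M) / 2)"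
      and L: "centered_zonoid L \<and> (\<forall>u. support_fun L u = (\<integral>\<omega>. \<bar>u \<bullet> X \<omega>\<bar> \<partial>M) / 2)"
    have "support_fun K u = support_fun L u" for u
      by (rule trans[OF spec[OF conjunct2[OF K]] sym[OF spec[OF conjunct2[OF L]]]])
    with K L have "centered_zonoid K" "centered_zonoid L" "\<And>u. support_fun K u = support_fun L u"
      by blast+
    then show "K = L" by (intro support_fun_inject) (auto dest: centered_zonoidD)
  qed
  from theI'[OF this] show "centered_zonoid (zonoid_of M X)"
    "support_fun (zonoid_of M X) u = (\<integral>\<omega>. \<bar>u \<bullet> X \<omega>\<bar> \<partial>M) / 2"
    by (simp_all add: zonoid_of_def)
qed

lemma vz_support_abs:
  "centered_zonoid K \<Longrightarrow> centered_zonoid L \<Longrightarrow>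
     vz_support (abs_vzonoid (K, L)) u = support_fun K u - support_fun L u"
  by (subst vz_support.abs_eq) (auto simp: vzonoid_rel_iff)

lemma rep_vzonoid_centered:
  assumes "rep_vzonoid x = (K, L)"
  shows "centered_zonoid K" "centered_zonoid L" "x = abs_vzonoid (K, L)"
proof -
  have "vzonoid_rel (rep_vzonoid x) (rep_vzonoid x)"
    using Quotient3_vzonoid by (rule Quotient3_rep_reflp)
  then show "centered_zonoid K" "centered_zonoid L" by (auto simp: assms vzonoid_rel_iff)
  show "x = abs_vzonoid (K, L)"
    using Quotient3_abs_rep[OF Quotient3_vzonoid, of x] by (simp add: assms)
qed

lemma vz_support_map:
  assumes f: "linear f"
  shows "vz_support (vz_map f x) u = vz_support x (adjoint f u)"
proof -
  obtain K L where r: "rep_vzonoid x = (K, L)" by (metis surj_pair)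
  note z = rep_vzonoid_centered[OF r]
  have "support_fun (f ` X) u = support_fun X (adjoint f u)" if "centered_zonoid X" for X
    using centered_zonoidD[OF that] adjoint_works[OF f] by (intro support_fun_linear_image) (auto simp: inner_commute)
  then show ?thesis
    using z(1,2) vz_support_abs[OF z(1,2)]
    by (simp add: vz_map_def r vz_support_abs centered_zonoid_linear_image[OF f] flip: z(3))
qed

lemma vz_support_K_class:
  assumes "prob_space M" "integrable M X"
  shows "vz_support (K_class M X) u = (\<integral>\<omega>. \<bar>u \<bullet> X \<omega>\<bar> \<partial>M) / 2"
  using centered_zonoid_zonoid_of[OF assms] support_fun_zonoid_of[OF assms, of u]
  by (simp add: K_class_def vzonoid_of_def vz_support_abs centered_zonoid_0 support_fun_def[of "{0}"])

lemma support_fun_lipschitz: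
  assumes "compact K" "K \<noteq> {}" "\<And>x. x \<in> K \<Longrightarrow> norm x \<le> R"
  shows "\<bar>support_fun K u - support_fun K v\<bar> \<le> R * norm (u - v)"
proof -
  have *: "support_fun K u - support_fun K v \<le> R * norm (u - v)" for u v
  proof -
    obtain x where x: "x \<in> K" "support_fun K u = u \<bullet> x" using assms support_fun_attained by blast
    have "support_fun K u - support_fun K v \<le> u \<bullet> x - v \<bullet> x"
      using x support_fun_upper[OF assms(1) x(1), of v] by simp
    also have "\<dots> = (u - v) \<bullet> x" by (simp add: inner_diff_left)
    also have "\<dots> \<le> norm (u - v) * norm x" by (rule norm_cauchy_schwarz)
    also have "\<dots> \<le> norm (u - v) * R" using assms(3)[OF x(1)] by (rule mult_left_mono) simp
    finally show ?thesis by (simp add: mult.commute)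
  qed
  show ?thesis using *[of u v] *[of v u] by (simp add: norm_minus_commute abs_le_iff)
qed

lemma vz_support_lipschitz:
  obtains R where "R \<ge> 0" "\<And>u v. \<bar>vz_support x u - vz_support x v\<bar> \<le> R * norm (u - v)"
proof -
  obtain K L where r: "rep_vzonoid x = (K, L)" by (metis surj_pair)
  note z = rep_vzonoid_centered[OF r]
  note c = centered_zonoidD[OF z(1)] centered_zonoidD[OF z(2)]
  obtain R where R: "R > 0" "\<And>x. x \<in> K \<Longrightarrow> norm x \<le> R"
    using compact_imp_bounded[OF c(1)] by (auto simp: bounded_pos)
  obtain R' where R': "R' > 0" "\<And>x. x \<in> L \<Longrightarrow> norm x \<le> R'"
    using compact_imp_bounded[OF c(4)] by (auto simp: bounded_pos)
  show ?thesis
  proof (rule that[of "R + R'"])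
    fix u v
    have "\<bar>support_fun K u - support_fun K v\<bar> \<le> R * norm (u - v)"
      "\<bar>support_fun L u - support_fun L v\<bar> \<le> R' * norm (u - v)"
      using c R R' by (auto intro!: support_fun_lipschitz)
    then show "\<bar>vz_support x u - vz_support x v\<bar> \<le> (R + R') * norm (u - v)"
      unfolding z(3) vz_support_abs[OF z(1,2)] distrib_right by linarith
  qed (use R R' in simp)
qed

lemma vz_support_at_0: "vz_support x 0 = 0"
proof -
  obtain K L where r: "rep_vzonoid x = (K, L)" by (metis surj_pair)
  note z = rep_vzonoid_centered[OF r]
  have "support_fun X 0 = 0" if "centered_zonoid X" for X :: "'a set"
    using centered_zonoidD(3)[OF that] by (simp add: support_fun_def)
  then show ?thesis using z by (simp add: vz_support_abs)
qed

lemma vz_support_measurable [measurable]: "vz_support x \<in> borel_measurable borel"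
proof -
  obtain R where R: "R \<ge> 0" "\<And>u v. \<bar>vz_support x u - vz_support x v\<bar> \<le> R * norm (u - v)"
    using vz_support_lipschitz by blast
  have "R-lipschitz_on UNIV (vz_support x)"
    using R by (auto intro!: lipschitz_onI simp: dist_norm)
  then show ?thesis by (intro borel_measurable_continuous_onI lipschitz_on_continuous_on)
qed

lemma integrable_vz_support:
  assumes "integrable M X"
  shows "integrable M (\<lambda>\<omega>. vz_support x (X \<omega>))"
proof -
  obtain R where R: "R \<ge> 0" "\<And>u v. \<bar>vz_support x u - vz_support x v\<bar> \<le> R * norm (u - v)"
    using vz_support_lipschitz by blast
  show ?thesis
  proof (rule Bochner_Integration.integrable_bound)
    show "integrable M (\<lambda>\<omega>. R * norm (X \<omega>))" using assms by simp
    show "(\<lambda>\<omega>. vz_support x (X \<omega>)) \<in> borel_measurable M"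
      using borel_measurable_integrable[OF assms] by measurable
    show "AE \<omega> in M. norm (vz_support x (X \<omega>)) \<le> norm (R * norm (X \<omega>))"
      using R(1) R(2)[of _ 0] by (auto simp: vz_support_at_0)
  qed
qed

lemma linear_integral_vz_support:
  assumes "integrable M X"
  shows "linear (\<lambda>x. \<integral>\<omega>. vz_support x (X \<omega>) \<partial>M)"
  by (rule linearI)
     (simp_all add: vz_support_add vz_support_scale integrable_vz_support[OF assms])

lemma integrable_lawD:
  assumes "integrable_law M"
  shows "prob_space M" "sets M = sets borel" "integrable M (\<lambda>x. x)"
  using assms by (auto simp: integrable_law_def)

lemma integrable_pair_bilinear:
  fixes b :: "'v::euclidean_space \<Rightarrow> 'w::euclidean_space \<Rightarrow> 'r::euclidean_space"
  assumes M: "integrable_law M" and N: "integrable_law N" and b: "bilinear b"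
  shows "integrable (M \<Otimes>\<^sub>M N) (\<lambda>(x, y). b x y)"
proof -
  interpret M: prob_space M using M by (rule integrable_lawD)
  interpret N: prob_space N using N by (rule integrable_lawD)
  interpret pair_sigma_finite M N ..
  obtain B where B: "B > 0" "\<And>x y. norm (b x y) \<le> B * norm x * norm y"
    using bilinear_bounded_pos[OF b] by blast
  have [measurable_cong]: "sets M = sets borel" "sets N = sets borel"
    using M N by (simp_all add: integrable_lawD)
  have "(\<lambda>p. b (fst p) (snd p)) \<in> borel_measurable (borel \<Otimes>\<^sub>M borel)"
    unfolding borel_prod
    by (intro borel_measurable_continuous_onI bounded_bilinear.continuous_on[OF b[unfolded bilinear_conv_bounded_bilinear]]
        continuous_intros)
  then have m [measurable]: "(\<lambda>(x, y). b x y) \<in> borel_measurable (M \<Otimes>\<^sub>M N)"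
    by (simp add: split_def cong: measurable_cong_sets sets_pair_measure_cong)
  have i: "integrable N (\<lambda>y. norm y)" "integrable M (\<lambda>x. norm x)"
    using M N by (auto simp: integrable_law_def)
  have "integrable (M \<Otimes>\<^sub>M N) (\<lambda>(x, y). norm x * norm y)"
  proof (rule Fubini_integrable)
    show "(\<lambda>(x, y). norm x * norm y) \<in> borel_measurable (M \<Otimes>\<^sub>M N)" by measurable
  qed (use i in auto)
  then have "integrable (M \<Otimes>\<^sub>M N) (\<lambda>p. B * (case p of (x, y) \<Rightarrow> norm x * norm y))" by simp
  then show ?thesis
    by (rule Bochner_Integration.integrable_bound)
       (use B m in \<open>auto simp: mult.assoc abs_mult intro!: AE_I2\<close>)
qed

text \<open>A map on pairs of laws that is linear in each argument separately extends to virtual zonoids.\<close>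

lemma bilinear_extension_exists:
  fixes G :: "'v::euclidean_space measure \<Rightarrow> 'w::euclidean_space measure \<Rightarrow> 'r::real_vector"
  assumes l: "\<And>N. integrable_law N \<Longrightarrow>
      \<exists>f. linear f \<and> (\<forall>M. integrable_law M \<longrightarrow> f (K_class M (\<lambda>x. x)) = G M N)"
    and r: "\<And>M. integrable_law M \<Longrightarrow>
      \<exists>f. linear f \<and> (\<forall>N. integrable_law N \<longrightarrow> f (K_class N (\<lambda>x. x)) = G M N)"
  shows "\<exists>B. bilinear B \<and> (\<forall>M N. integrable_law M \<longrightarrow> integrable_law N \<longrightarrow>
      B (K_class M (\<lambda>x. x)) (K_class N (\<lambda>x. x)) = G M N)"
proof -
  define S :: "'w vzonoid set" where "S = {K_class N (\<lambda>x. x) | N. integrable_law N}"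
  obtain C where C: "C \<subseteq> S" "independent C" "S \<subseteq> span C"
    using maximal_independent_subset by blast
  have "\<forall>c\<in>C. \<exists>N. integrable_law N \<and> c = K_class N (\<lambda>x. x)" using C(1) by (auto simp: S_def)
  then obtain m where m: "\<And>c. c \<in> C \<Longrightarrow> integrable_law (m c)" "\<And>c. c \<in> C \<Longrightarrow> c = K_class (m c) (\<lambda>x. x)"
    by metis
  have "\<forall>N. \<exists>f. integrable_law N \<longrightarrow>
      linear f \<and> (\<forall>M. integrable_law M \<longrightarrow> f (K_class M (\<lambda>x. x)) = G M N)"
    using l by blast
  then obtain F where F: "\<And>N. integrable_law N \<Longrightarrow> linear (F N)"
      "\<And>M N. integrable_law N \<Longrightarrow> integrable_law M \<Longrightarrow> F N (K_class M (\<lambda>x. x)) = G M N"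
    by metis
  define B where "B x = real_vector.construct C (\<lambda>c. F (m c) x)" for x
  have lin2: "linear (B x)" for x
    unfolding B_def using C(2) by (rule linear_construct)
  have lin1: "linear (\<lambda>x. B x y)" for y
  proof (rule linearI)
    fix x x' :: "'v vzonoid" and a :: real
    have "B (x + x') = real_vector.construct C (\<lambda>c. F (m c) x + F (m c) x')"
      unfolding B_def using F(1)[OF m(1)] by (intro real_vector.construct_cong) (simp add: linear_add)
    then show "B (x + x') y = B x y + B x' y"
      using C(2) by (simp add: B_def real_vector.construct_add)
    have "B (a *\<^sub>R x) = real_vector.construct C (\<lambda>c. a *\<^sub>R F (m c) x)"
      unfolding B_def using F(1)[OF m(1)] by (intro real_vector.construct_cong) (simp add: linear_scale)
    then show "B (a *\<^sub>R x) y = a *\<^sub>R B x y"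
      using C(2) by (simp add: B_def real_vector.construct_scale)
  qed
  have "B (K_class M (\<lambda>x. x)) (K_class N (\<lambda>x. x)) = G M N" if MN: "integrable_law M" "integrable_law N" for M N
  proof -
    obtain f where f: "linear f" "\<And>N. integrable_law N \<Longrightarrow> f (K_class N (\<lambda>x. x)) = G M N"
      using r[OF MN(1)] by blast
    have "B (K_class M (\<lambda>x. x)) y = f y" if "y \<in> span C" for y
    proof (rule linear_eq_on_span[OF lin2 f(1) _ that])
      fix c assume c: "c \<in> C"
      have "B (K_class M (\<lambda>x. x)) c = F (m c) (K_class M (\<lambda>x. x))"
        unfolding B_def using C(2) c by (rule real_vector.construct_basis)
      also have "\<dots> = f c" using F(2)[OF m(1)[OF c] MN(1)] f(2)[OF m(1)[OF c]] m(2)[OF c] by simp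
      finally show "B (K_class M (\<lambda>x. x)) c = f c" .
    qed
    moreover have "K_class N (\<lambda>x. x) \<in> span C" using C(3) MN(2) by (auto simp: S_def)
    ultimately show ?thesis using f(2)[OF MN(2)] by simp
  qed
  then show ?thesis using lin1 lin2 by (auto simp: bilinear_def intro!: exI[of _ B])
qed

lemma linear_extension_exists:
  fixes G :: "'v::euclidean_space measure \<Rightarrow> 'w::euclidean_space vzonoid"
  assumes "\<And>u. \<exists>f. linear f \<and> (\<forall>M. integrable_law M \<longrightarrow> f (K_class M (\<lambda>x. x)) = vz_support (G M) u)"
  shows "\<exists>f. linear f \<and> (\<forall>M. integrable_law M \<longrightarrow> f (K_class M (\<lambda>x. x)) = G M)"
proof -
  define S :: "'v vzonoid set" where "S = {K_class N (\<lambda>x. x) | N. integrable_law N}"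
  obtain C where C: "C \<subseteq> S" "independent C" "S \<subseteq> span C"
    using maximal_independent_subset by blast
  have "\<forall>c\<in>C. \<exists>N. integrable_law N \<and> c = K_class N (\<lambda>x. x)" using C(1) by (auto simp: S_def)
  then obtain m where m: "\<And>c. c \<in> C \<Longrightarrow> integrable_law (m c)" "\<And>c. c \<in> C \<Longrightarrow> c = K_class (m c) (\<lambda>x. x)"
    by metis
  define f where "f = real_vector.construct C (\<lambda>c. G (m c))"
  have lin: "linear f" unfolding f_def using C(2) by (rule linear_construct)
  have "f (K_class M (\<lambda>x. x)) = G M" if M: "integrable_law M" for M
  proof -
    have "vz_support (f (K_class M (\<lambda>x. x))) u = vz_support (G M) u" for u
    proof -
      obtain g where g: "linear g" "\<And>M. integrable_law M \<Longrightarrow> g (K_class M (\<lambda>x. x)) = vz_support (G M) u"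
        using assms by blast
      have lin': "linear (\<lambda>x. vz_support (f x) u)"
        by (rule linearI) (simp_all add: linear_add[OF lin] linear_scale[OF lin] vz_support_add vz_support_scale)
      have "vz_support (f x) u = g x" if "x \<in> span C" for x
      proof (rule linear_eq_on_span[OF lin' g(1) _ that])
        fix c assume c: "c \<in> C"
        have "f c = G (m c)" unfolding f_def using C(2) c by (rule real_vector.construct_basis)
        then show "vz_support (f c) u = g c" using g(2)[OF m(1)[OF c]] m(2)[OF c] by simp
      qed
      moreover have "K_class M (\<lambda>x. x) \<in> span C" using C(3) M by (auto simp: S_def)
      ultimately show ?thesis using g(2)[OF M] by simp
    qed
    then show ?thesis by (simp add: vz_support_inject)
  qed
  with lin show ?thesis by blast
qed

text \<open>Slices of a bilinear map of two independent random vectors.\<close>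

lemma slice_functionals:
  fixes b :: "'v::euclidean_space \<Rightarrow> 'w::euclidean_space \<Rightarrow> 'r::euclidean_space"
  assumes b: "bilinear b" and MN: "integrable_law M" "integrable_law N"
  shows "(\<integral>(x, y). \<bar>u \<bullet> b x y\<bar> \<partial>(M \<Otimes>\<^sub>M N))
      = 2 * (\<integral>y. vz_support (K_class M (\<lambda>x. x)) (adjoint (\<lambda>x. b x y) u) \<partial>N)"
    and "(\<integral>(x, y). \<bar>u \<bullet> b x y\<bar> \<partial>(M \<Otimes>\<^sub>M N)) = 2 * (\<integral>x. vz_support (K_class N (\<lambda>x. x)) (adjoint (b x) u) \<partial>M)"
proof -
  interpret M: prob_space M using MN(1) by (rule integrable_lawD)
  interpret N: prob_space N using MN(2) by (rule integrable_lawD)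
  interpret pair_sigma_finite M N ..
  have i: "integrable (M \<Otimes>\<^sub>M N) (\<lambda>(x, y). \<bar>u \<bullet> b x y\<bar>)"
    using integrable_abs[OF integrable_inner_right[OF integrable_pair_bilinear[OF MN b], of u]]
    by (simp add: split_def)
  have a: "adjoint (\<lambda>x. b x y) u \<bullet> x = u \<bullet> b x y" "adjoint (b x) u \<bullet> y = u \<bullet> b x y" for x y
    using b adjoint_works[of "\<lambda>x. b x y" x u] adjoint_works[of "b x" y u]
    by (auto simp: bilinear_def inner_commute)
  have k: "vz_support (K_class M (\<lambda>x. x)) u = (\<integral>x. \<bar>u \<bullet> x\<bar> \<partial>M) / 2"
      "vz_support (K_class N (\<lambda>x. x)) v = (\<integral>x. \<bar>v \<bullet> x\<bar> \<partial>N) / 2" for u v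
    by (rule vz_support_K_class[OF integrable_lawD(1,3)[OF MN(1)]],
        rule vz_support_K_class[OF integrable_lawD(1,3)[OF MN(2)]])
  show "(\<integral>(x, y). \<bar>u \<bullet> b x y\<bar> \<partial>(M \<Otimes>\<^sub>M N))
      = 2 * (\<integral>y. vz_support (K_class M (\<lambda>x. x)) (adjoint (\<lambda>x. b x y) u) \<partial>N)"
    using integral_snd[OF i] by (simp add: k a)
  show "(\<integral>(x, y). \<bar>u \<bullet> b x y\<bar> \<partial>(M \<Otimes>\<^sub>M N))
      = 2 * (\<integral>x. vz_support (K_class N (\<lambda>x. x)) (adjoint (b x) u) \<partial>M)"
    using integral_fst[OF i] by (simp add: k a)
qed

lemma integrable_adjoint_slice:
  fixes b :: "'v::euclidean_space \<Rightarrow> 'w::euclidean_space \<Rightarrow> 'r::euclidean_space"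
  assumes b: "bilinear b"
  shows "integrable_law N \<Longrightarrow> integrable N (\<lambda>y. adjoint (\<lambda>x. b x y) u)"
    and "integrable_law M \<Longrightarrow> integrable M (\<lambda>x. adjoint (b x) u)"
proof -
  have a: "x \<bullet> adjoint (\<lambda>x. b x y) u = u \<bullet> b x y" "y \<bullet> adjoint (b x) u = u \<bullet> b x y" for x y
    using b adjoint_works[of "\<lambda>x. b x y" x u] adjoint_works[of "b x" y u]
    by (auto simp: bilinear_def inner_commute)
  have lin_y: "linear (\<lambda>y. adjoint (\<lambda>x. b x y) u)"
  proof (rule linearI)
    show "adjoint (\<lambda>x. b x (y + y')) u = adjoint (\<lambda>x. b x y) u + adjoint (\<lambda>x. b x y') u" for y y'
      by (rule vector_eq_ldot[THEN iffD1]) (simp only: inner_add_right a, simp only: bilinear_radd[OF b] inner_add_right simp_thms)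
    show "adjoint (\<lambda>x. b x (c *\<^sub>R y)) u = c *\<^sub>R adjoint (\<lambda>x. b x y) u" for c y
      by (rule vector_eq_ldot[THEN iffD1]) (simp only: inner_scaleR_right a, simp only: bilinear_rmul[OF b] inner_scaleR_right simp_thms)
  qed
  show "integrable_law N \<Longrightarrow> integrable N (\<lambda>y. adjoint (\<lambda>x. b x y) u)"
    by (rule integrable_bounded_linear[OF linear_conv_bounded_linear[THEN iffD1, OF lin_y] integrable_lawD(3)])
  have lin_x: "linear (\<lambda>x. adjoint (b x) u)"
  proof (rule linearI)
    show "adjoint (b (x + x')) u = adjoint (b x) u + adjoint (b x') u" for x x'
      by (rule vector_eq_ldot[THEN iffD1]) (simp only: inner_add_right a, simp only: bilinear_ladd[OF b] inner_add_right simp_thms)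
    show "adjoint (b (c *\<^sub>R x)) u = c *\<^sub>R adjoint (b x) u" for c x
      by (rule vector_eq_ldot[THEN iffD1]) (simp only: inner_scaleR_right a, simp only: bilinear_lmul[OF b] inner_scaleR_right simp_thms)
  qed
  show "integrable_law M \<Longrightarrow> integrable M (\<lambda>x. adjoint (b x) u)"
    by (rule integrable_bounded_linear[OF linear_conv_bounded_linear[THEN iffD1, OF lin_x] integrable_lawD(3)])
qed

lemma bilinear_product_exists:
  fixes b :: "'v::euclidean_space \<Rightarrow> 'w::euclidean_space \<Rightarrow> 'r::euclidean_space"
  assumes b: "bilinear b"
  shows "\<exists>B. bilinear B \<and> (\<forall>M N. integrable_law M \<longrightarrow> integrable_law N \<longrightarrow>
      B (K_class M (\<lambda>x. x)) (K_class N (\<lambda>x. x)) = K_class (M \<Otimes>\<^sub>M N) (\<lambda>(x, y). b x y))"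
proof (rule bilinear_extension_exists; rule linear_extension_exists)
  have s: "vz_support (K_class (M \<Otimes>\<^sub>M N) (\<lambda>(x, y). b x y)) u = (\<integral>(x, y). \<bar>u \<bullet> b x y\<bar> \<partial>(M \<Otimes>\<^sub>M N)) / 2"
    if "integrable_law M" "integrable_law N" for M N u
  proof -
    interpret M: prob_space M using that(1) by (rule integrable_lawD)
    interpret N: prob_space N using that(2) by (rule integrable_lawD)
    interpret pair_prob_space M N ..
    show ?thesis
      using vz_support_K_class[OF prob_space_axioms integrable_pair_bilinear[OF that b]]
      by (simp add: split_def)
  qed
  fix u :: 'r
  show "\<exists>f. linear f \<and> (\<forall>M. integrable_law M \<longrightarrow> f (K_class M (\<lambda>x. x))
      = vz_support (K_class (M \<Otimes>\<^sub>M N) (\<lambda>(x, y). b x y)) u)" if N: "integrable_law N" for N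
  proof (intro exI conjI allI impI)
    show "linear (\<lambda>x. \<integral>y. vz_support x (adjoint (\<lambda>x. b x y) u) \<partial>N)"
      by (rule linear_integral_vz_support[OF integrable_adjoint_slice(1)[OF b N]])
    show "(\<integral>y. vz_support (K_class M (\<lambda>x. x)) (adjoint (\<lambda>x. b x y) u) \<partial>N)
      = vz_support (K_class (M \<Otimes>\<^sub>M N) (\<lambda>(x, y). b x y)) u" if M: "integrable_law M" for M
      unfolding s[OF M N] slice_functionals(1)[OF b M N] by simp
  qed
  show "\<exists>f. linear f \<and> (\<forall>N. integrable_law N \<longrightarrow> f (K_class N (\<lambda>x. x))
      = vz_support (K_class (M \<Otimes>\<^sub>M N) (\<lambda>(x, y). b x y)) u)" if M: "integrable_law M" for M
  proof (intro exI conjI allI impI)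
    show "linear (\<lambda>y. \<integral>x. vz_support y (adjoint (b x) u) \<partial>M)"
      by (rule linear_integral_vz_support[OF integrable_adjoint_slice(2)[OF b M]])
    show "(\<integral>x. vz_support (K_class N (\<lambda>x. x)) (adjoint (b x) u) \<partial>M)
      = vz_support (K_class (M \<Otimes>\<^sub>M N) (\<lambda>(x, y). b x y)) u" if N: "integrable_law N" for N
      unfolding s[OF M N] slice_functionals(2)[OF b M N] by simp
  qed
qed

lemma vz_pairing_exists:
  "\<exists>B :: 'w::euclidean_space vzonoid \<Rightarrow> 'w vzonoid \<Rightarrow> real. bilinear B \<and>
     (\<forall>M N. integrable_law M \<longrightarrow> integrable_law N \<longrightarrow>
        B (K_class M (\<lambda>x. x)) (K_class N (\<lambda>x. x)) = (\<integral>(x, y). \<bar>x \<bullet> y\<bar> \<partial>(M \<Otimes>\<^sub>M N)))"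
proof -
  have b: "bilinear ((\<bullet>) :: 'w \<Rightarrow> 'w \<Rightarrow> real)"
    by (simp add: bilinear_conv_bounded_bilinear bounded_bilinear_inner)
  have double: "linear (\<lambda>x. 2 * F x)" if "linear F" for F :: "'w vzonoid \<Rightarrow> real"
    by (rule linearI) (simp_all add: linear_add[OF that] linear_scale[OF that] distrib_left)
  have one: "(\<integral>(x, y). \<bar>(1::real) \<bullet> (x \<bullet> y)\<bar> \<partial>P) = (\<integral>(x, y). \<bar>x \<bullet> y\<bar> \<partial>P)" for P :: "('w \<times> 'w) measure"
    by (simp add: inner_real_def)
  show ?thesis
  proof (rule bilinear_extension_exists)
    fix N :: "'w measure" assume N: "integrable_law N"
    show "\<exists>f. linear f \<and> (\<forall>M. integrable_law M \<longrightarrow> f (K_class M (\<lambda>x. x)) = (\<integral>(x, y). \<bar>x \<bullet> y\<bar> \<partial>(M \<Otimes>\<^sub>M N)))"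
    proof (intro exI conjI allI impI)
      show "linear (\<lambda>x. 2 * (\<integral>y. vz_support x (adjoint (\<lambda>x. x \<bullet> y) 1) \<partial>N))"
        by (rule double[OF linear_integral_vz_support[OF integrable_adjoint_slice(1)[OF b N]]])
      show "2 * (\<integral>y. vz_support (K_class M (\<lambda>x. x)) (adjoint (\<lambda>x. x \<bullet> y) 1) \<partial>N)
          = (\<integral>(x, y). \<bar>x \<bullet> y\<bar> \<partial>(M \<Otimes>\<^sub>M N))" if M: "integrable_law M" for M
        by (rule trans[OF slice_functionals(1)[OF b M N, symmetric] one])
    qed
  next
    fix M :: "'w measure" assume M: "integrable_law M"
    show "\<exists>f. linear f \<and> (\<forall>N. integrable_law N \<longrightarrow> f (K_class N (\<lambda>x. x)) = (\<integral>(x, y). \<bar>x \<bullet> y\<bar> \<partial>(M \<Otimes>\<^sub>M N)))"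
    proof (intro exI conjI allI impI)
      show "linear (\<lambda>y. 2 * (\<integral>x. vz_support y (adjoint ((\<bullet>) x) 1) \<partial>M))"
        by (rule double[OF linear_integral_vz_support[OF integrable_adjoint_slice(2)[OF b M]]])
      show "2 * (\<integral>x. vz_support (K_class N (\<lambda>x. x)) (adjoint ((\<bullet>) x) 1) \<partial>M)
          = (\<integral>(x, y). \<bar>x \<bullet> y\<bar> \<partial>(M \<Otimes>\<^sub>M N))" if N: "integrable_law N" for N
        by (rule trans[OF slice_functionals(2)[OF b M N, symmetric] one])
    qed
  qed
qed

lemma bilinear_wedge: "bilinear (wedge :: 'm::finite ext \<Rightarrow> 'm ext \<Rightarrow> 'm ext)"
  unfolding bilinear_def
  by (intro conjI allI linearI)
     (simp_all add: wedge_def vec_eq_iff distrib_left distrib_right sum.distrib sum_distrib_left mult_ac)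

lemma
  shows bilinear_vz_pairing: "bilinear (vz_pairing :: 'w::euclidean_space vzonoid \<Rightarrow> _)"
    and vz_pairing_K_class: "integrable_law M \<Longrightarrow> integrable_law N \<Longrightarrow>
      vz_pairing (K_class M (\<lambda>x. x)) (K_class N (\<lambda>x. x :: 'w)) = (\<integral>(x, y). \<bar>x \<bullet> y\<bar> \<partial>(M \<Otimes>\<^sub>M N))"
  using someI_ex[OF vz_pairing_exists] by (auto simp: vz_pairing_def)

lemma
  shows bilinear_vz_wedge: "bilinear (vz_wedge :: 'm::finite ext vzonoid \<Rightarrow> _)"
    and vz_wedge_K_class: "integrable_law M \<Longrightarrow> integrable_law N \<Longrightarrow>
      vz_wedge (K_class M (\<lambda>x. x)) (K_class N (\<lambda>x. x :: 'm ext)) = K_class (M \<Otimes>\<^sub>M N) (\<lambda>(x, y). wedge x y)"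
  using someI_ex[OF bilinear_product_exists[OF bilinear_wedge]] by (auto simp: vz_wedge_def)

text \<open>Existence of the length, by pairing with a Gaussian vector.\<close>

definition gauss_space :: "('w::euclidean_space \<Rightarrow> real) measure" where
  "gauss_space = PiM Basis (\<lambda>_. density lborel std_normal_density)"

definition gauss_vec :: "('w::euclidean_space \<Rightarrow> real) \<Rightarrow> 'w" where
  "gauss_vec \<omega> = (\<Sum>b\<in>Basis. \<omega> b *\<^sub>R b)"

lemma prob_space_gauss_space: "prob_space gauss_space"
  unfolding gauss_space_def by (intro prob_space_PiM prob_space_normal_density) simp

lemma gauss_component:
  assumes "b \<in> Basis"
  shows "distributed (gauss_space :: ('w::euclidean_space \<Rightarrow> real) measure) lborel (\<lambda>\<omega>. \<omega> b) std_normal_density"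
proof -
  interpret prob_space "density lborel std_normal_density" by (rule prob_space_normal_density) simp
  have "distr (gauss_space :: ('w \<Rightarrow> real) measure) (density lborel std_normal_density) (\<lambda>\<omega>. \<omega> b) = density lborel std_normal_density"
    unfolding gauss_space_def using assms by (intro distr_PiM_component prob_space_normal_density) auto
  moreover have "distr (gauss_space :: ('w \<Rightarrow> real) measure) (density lborel std_normal_density) (\<lambda>\<omega>. \<omega> b)
      = distr gauss_space lborel (\<lambda>\<omega>. \<omega> b)"
    by (intro distr_cong) auto
  moreover have "(\<lambda>\<omega>. \<omega> b) \<in> measurable gauss_space lborel"
    unfolding gauss_space_def using assms measurable_component_singleton[of b Basis "\<lambda>_. density lborel std_normal_density"]
    by (simp cong: measurable_cong_sets)
  ultimately show ?thesis by (simp add: distributed_def)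
qed

lemma integrable_gauss_component:
  assumes "b \<in> Basis"
  shows "integrable (gauss_space :: ('w::euclidean_space \<Rightarrow> real) measure) (\<lambda>\<omega>. \<omega> b)"
  using distributed_integrable_var[OF gauss_component[OF assms]] integrable_std_normal_moment[of 1] by simp

lemma integrable_gauss_vec: "integrable gauss_space (gauss_vec :: _ \<Rightarrow> 'w::euclidean_space)"
  unfolding gauss_vec_def
  by (intro Bochner_Integration.integrable_sum integrable_scaleR_left integrable_gauss_component)

lemma integral_abs_inner_gauss:
  "(\<integral>\<omega>. \<bar>x \<bullet> gauss_vec \<omega>\<bar> \<partial>gauss_space) = sqrt (2 / pi) * norm (x :: 'w::euclidean_space)"
proof (cases "x = 0")
  case False
  interpret P: prob_space "gauss_space :: ('w \<Rightarrow> real) measure" by (rule prob_space_gauss_space)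
  let ?P = "gauss_space :: ('w \<Rightarrow> real) measure"
  define I where "I = {b \<in> Basis. x \<bullet> b \<noteq> 0}"
  have I: "finite I" "I \<noteq> {}" "I \<subseteq> Basis"
    using False euclidean_all_zero_iff[of x] by (auto simp: I_def)
  have "P.indep_vars (\<lambda>_. density lborel std_normal_density) (\<lambda>b \<omega>. \<omega> b) Basis"
  proof (subst P.indep_vars_iff_distr_eq_PiM')
    let ?N = "density lborel std_normal_density :: real measure"
    show "(\<lambda>\<omega>. \<omega> b) \<in> measurable ?P ?N" if "b \<in> Basis" for b
      unfolding gauss_space_def using that by (rule measurable_component_singleton)
    have "distr ?P (PiM Basis (\<lambda>_. ?N)) (\<lambda>\<omega>. \<lambda>b\<in>Basis. \<omega> b) = distr ?P ?P (\<lambda>\<omega>. \<omega>)"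
      by (intro distr_cong) (auto simp: gauss_space_def space_PiM PiE_restrict)
    also have "\<dots> = PiM Basis (\<lambda>_. ?N)" by (simp add: gauss_space_def)
    also have "\<dots> = PiM Basis (\<lambda>b. distr ?P ?N (\<lambda>\<omega>. \<omega> b))"
      unfolding gauss_space_def
      by (intro PiM_cong refl distr_PiM_component[symmetric] prob_space_normal_density) simp_all
    finally show "distr ?P (PiM Basis (\<lambda>_. ?N)) (\<lambda>\<omega>. \<lambda>b\<in>Basis. \<omega> b) = PiM Basis (\<lambda>b. distr ?P ?N (\<lambda>\<omega>. \<omega> b))" .
  qed simp
  then have "P.indep_vars (\<lambda>_. borel) (\<lambda>b \<omega>. \<omega> b) Basis"
    by (simp add: P.indep_vars_def cong: measurable_cong_sets)
  then have "P.indep_vars (\<lambda>_. borel) (\<lambda>b \<omega>. \<omega> b) I"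
    using I(3) by (rule P.indep_vars_subset)
  then have "P.indep_vars (\<lambda>_. borel) (\<lambda>b \<omega>. (x \<bullet> b) * \<omega> b) I"
    by (rule P.indep_vars_compose2) auto
  moreover have "distributed gauss_space lborel (\<lambda>\<omega>. (x \<bullet> b) * \<omega> b) (normal_density 0 \<bar>x \<bullet> b\<bar>)" if "b \<in> I" for b
    using P.normal_density_affine[OF gauss_component[of b], of "x \<bullet> b" 0] that by (auto simp: I_def)
  ultimately have "distributed gauss_space lborel (\<lambda>\<omega>. \<Sum>b\<in>I. (x \<bullet> b) * \<omega> b)
      (normal_density (\<Sum>b\<in>I. 0) (sqrt (\<Sum>b\<in>I. \<bar>x \<bullet> b\<bar>\<^sup>2)))"
    using I by (intro P.sum_indep_normal) (auto simp: I_def)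
  moreover have "(\<Sum>b\<in>I. (x \<bullet> b) * \<omega> b) = x \<bullet> gauss_vec \<omega>" for \<omega>
    unfolding gauss_vec_def inner_sum_right using I(3)
    by (intro sum.mono_neutral_cong_left) (auto simp: I_def)
  moreover have "sqrt (\<Sum>b\<in>I. \<bar>x \<bullet> b\<bar>\<^sup>2) = norm x"
  proof -
    have "(\<Sum>b\<in>I. \<bar>x \<bullet> b\<bar>\<^sup>2) = (\<Sum>b\<in>Basis. (x \<bullet> b)\<^sup>2)"
      using I(3) by (intro sum.mono_neutral_cong_left) (auto simp: I_def)
    also have "\<dots> = x \<bullet> x" by (subst euclidean_inner) (simp add: power2_eq_square)
    finally show ?thesis by (simp add: norm_eq_sqrt_inner)
  qed
  ultimately have "distributed gauss_space lborel (\<lambda>\<omega>. x \<bullet> gauss_vec \<omega>) (normal_density 0 (norm x))"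
    by simp
  from distributed_integral[OF this, of abs]
  have "(\<integral>\<omega>. \<bar>x \<bullet> gauss_vec \<omega>\<bar> \<partial>gauss_space) = (\<integral>t. normal_density 0 (norm x) t * \<bar>t\<bar> \<partial>lborel)"
    by (simp add: normal_density_nonneg)
  also have "\<dots> = sqrt (2 / pi) * norm x"
    using integral_normal_moment_abs_odd[of "norm x" 0 0] False by simp
  finally show ?thesis .
qed simp

lemma vz_length_exists:
  "\<exists>f :: 'w::euclidean_space vzonoid \<Rightarrow> real. linear f \<and>
     (\<forall>M. integrable_law M \<longrightarrow> f (K_class M (\<lambda>x. x)) = (\<integral>x. norm x \<partial>M))"
proof -
  let ?P = "gauss_space :: ('w \<Rightarrow> real) measure"
  interpret P: prob_space ?P by (rule prob_space_gauss_space)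
  have [measurable]: "gauss_vec \<in> borel_measurable ?P"
    using integrable_gauss_vec by (rule borel_measurable_integrable)
  define N where "N = distr ?P borel gauss_vec"
  have N: "integrable_law N"
    unfolding integrable_law_def N_def
    by (auto intro!: P.prob_space_distr simp: integrable_distr_eq integrable_gauss_vec)
  have b: "bilinear ((\<bullet>) :: 'w \<Rightarrow> 'w \<Rightarrow> real)"
    by (simp add: bilinear_conv_bounded_bilinear bounded_bilinear_inner)
  obtain B :: "'w vzonoid \<Rightarrow> 'w vzonoid \<Rightarrow> real" where B: "bilinear B"
    "\<And>M N. integrable_law M \<Longrightarrow> integrable_law N \<Longrightarrow>
        B (K_class M (\<lambda>x. x)) (K_class N (\<lambda>x. x)) = (\<integral>(x, y). \<bar>x \<bullet> y\<bar> \<partial>(M \<Otimes>\<^sub>M N))"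
    using vz_pairing_exists by blast
  define f where "f x = sqrt (pi / 2) * B x (K_class N (\<lambda>x. x))" for x
  have "linear f"
    unfolding f_def by (rule linearI) (simp_all add: bilinear_ladd[OF B(1)] bilinear_lmul[OF B(1)] distrib_left)
  moreover have "f (K_class M (\<lambda>x. x)) = (\<integral>x. norm x \<partial>M)" if M: "integrable_law M" for M
  proof -
    interpret M: prob_space M using M by (rule integrable_lawD)
    interpret N: prob_space N using N by (rule integrable_lawD)
    interpret pair_sigma_finite M N ..
    have "(\<integral>(x, y). \<bar>x \<bullet> y\<bar> \<partial>(M \<Otimes>\<^sub>M N)) = (\<integral>x. (\<integral>y. \<bar>x \<bullet> y\<bar> \<partial>N) \<partial>M)"
      using integral_fst[of "\<lambda>x y. \<bar>x \<bullet> y\<bar>"] integrable_abs[OF integrable_pair_bilinear[OF M N b]]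
      by (simp add: split_def)
    also have "\<dots> = (\<integral>x. sqrt (2 / pi) * norm x \<partial>M)"
      by (intro Bochner_Integration.integral_cong refl)
         (simp add: N_def integral_distr integral_abs_inner_gauss)
    finally have "f (K_class M (\<lambda>x. x)) = (sqrt (pi / 2) * sqrt (2 / pi)) * (\<integral>x. norm x \<partial>M)"
      unfolding f_def B(2)[OF M N] by simp
    moreover have "sqrt (pi / 2) * sqrt (2 / pi) = 1" by (simp flip: real_sqrt_mult)
    ultimately show ?thesis by simp
  qed
  ultimately show ?thesis by blast
qed

lemma
  shows linear_vz_length: "linear (vz_length :: 'w::euclidean_space vzonoid \<Rightarrow> real)"
    and vz_length_K_class: "integrable_law M \<Longrightarrow>
      vz_length (K_class M (\<lambda>x. x :: 'w)) = (\<integral>x. norm x \<partial>M)"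
  using someI_ex[OF vz_length_exists] by (auto simp: vz_length_def)

end

theory Submission
  imports Defs "HOL-Real_Asymp.Real_Asymp"
begin

text \<open>
  A class is determined by its support function on simple vectors. Let the class be unitarily invariant,
  and let a simple vector contain a real plane with Kaehler angle of cosine \<open>\<kappa>\<close> whose complex span is
  orthogonal to the remaining factors. Averaging over the unitary maps of that complex span leads to the mean
  absolute value of a Gaussian quadratic form, which turns out to be affine in \<open>\<kappa>\<^sup>2\<close>. So the value of the
  support function is \<open>\<kappa>\<^sup>2\<close> times its value for a complex line plus \<open>1 - \<kappa>\<^sup>2\<close> times its value for a
  totally real plane. Splitting off pairs of vectors of extremal Kaehler angle, one reduces to products of \<open>k\<close>
  complex lines with \<open>d - 2 k\<close> vectors, all Hermitian orthogonal; this bounds the dimension of degree \<open>d\<close>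
  by the number of monomials in \<open>\<gamma>\<close> and \<open>\<beta>\<close>.

  Conversely, Gaussian and unitary integration show that the length of \<open>\<beta>\<^bsup>2p\<^esup>\<gamma>\<^bsup>n-p\<^esup>\<close> is, up to a factor
  \<open>a b\<^sup>p\<close> with \<open>a, b > 0\<close>, the integral of \<open>cos\<^bsup>2p\<^esup>\<close> over \<open>[0, \<pi>]\<close>. Hence the form of part (2), evaluated on
  a combination of the monomials, is the integral of the square of a cosine polynomial with nonzero coefficients.
  It is positive, so the monomials are independent and, by the dimension bound, a basis. Part (3) follows, since
  positivity makes the multiplication injective and it maps the basis in degree \<open>d\<close> to the one in degree \<open>2n - d\<close>.
\<close>

section \<open>Exterior algebra\<close>

text \<open>The affine dependence on \<kappa>^2 has a quaternionic source. A complex plane carries a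
  sphere of complex structures \<open>twist\<close>, and pairing a Gaussian vector of the plane and
  its twist with two fixed vectors gives a quadratic form with two eigenvalues, each double. Half
  the squared radius of a planar Gaussian is exponentially distributed, so the mean absolute value
  is elementary: a constant plus the square of a linear form in the twist. Mixed terms cancel when
  signs are averaged. Two obstacles shape the rest. A class of the quotient has well-defined values
  only at simple vectors, so every reduction, in particular contraction by a factor of a product,
  must stay within multiples of simple vectors. And the length is not visibly a function of these
  values. It is one in top degree, and wedging with a Gaussian vector raises the degree while
  multiplying the length by a positive constant. The cosine integral enters through the product of
  the odd numbers below 2p, which Gaussian factors taken in pairs produce and which, up to p! 2^p,
  obeys the recursion of the moments of the cosine.\<close>

lemma inversions_finite: "finite {(i, j). i \<in> I \<and> (j :: 'm::finite) \<in> J \<and> to_nat j < to_nat (i :: 'm)}"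
  by (rule finite)

lemma shuffle_sign_square [simp]: "shuffle_sign I J * shuffle_sign I J = 1"
  by (simp add: shuffle_sign_def flip: power_mult_distrib)

lemma shuffle_sign_Un_left:
  assumes "I \<inter> I' = {}"
  shows "shuffle_sign (I \<union> I') J = shuffle_sign I J * shuffle_sign I' J"
proof -
  have "{(i, j). i \<in> I \<union> I' \<and> j \<in> J \<and> to_nat j < to_nat i}
    = {(i, j). i \<in> I \<and> j \<in> J \<and> to_nat j < to_nat i} \<union> {(i, j). i \<in> I' \<and> j \<in> J \<and> to_nat j < to_nat i}"
    by auto
  moreover have "card \<dots> = card {(i, j). i \<in> I \<and> j \<in> J \<and> to_nat j < to_nat i}
      + card {(i, j). i \<in> I' \<and> j \<in> J \<and> to_nat j < to_nat i}"
    using assms by (intro card_Un_disjoint inversions_finite) auto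
  ultimately show ?thesis by (simp add: shuffle_sign_def power_add)
qed

lemma shuffle_sign_Un_right:
  assumes "J \<inter> J' = {}"
  shows "shuffle_sign I (J \<union> J') = shuffle_sign I J * shuffle_sign I J'"
proof -
  have "{(i, j). i \<in> I \<and> j \<in> J \<union> J' \<and> to_nat j < to_nat i}
    = {(i, j). i \<in> I \<and> j \<in> J \<and> to_nat j < to_nat i} \<union> {(i, j). i \<in> I \<and> j \<in> J' \<and> to_nat j < to_nat i}"
    by auto
  moreover have "card \<dots> = card {(i, j). i \<in> I \<and> j \<in> J \<and> to_nat j < to_nat i}
      + card {(i, j). i \<in> I \<and> j \<in> J' \<and> to_nat j < to_nat i}"
    using assms by (intro card_Un_disjoint inversions_finite) auto
  ultimately show ?thesis by (simp add: shuffle_sign_def power_add)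
qed

lemma shuffle_sign_empty [simp]: "shuffle_sign {} J = 1" "shuffle_sign I {} = 1"
  by (simp_all add: shuffle_sign_def)

lemma shuffle_sign_singletons:
  "i \<noteq> j \<Longrightarrow> shuffle_sign {i} {j} = - shuffle_sign {j} {i}"
proof -
  assume "i \<noteq> j"
  then have "to_nat i \<noteq> to_nat j" by simp
  have *: "{(x, y). x \<in> {a} \<and> y \<in> {b} \<and> to_nat y < to_nat x} = (if to_nat b < to_nat a then {(a, b)} else {})"
    for a b :: 'a by auto
  show ?thesis using \<open>to_nat i \<noteq> to_nat j\<close> unfolding shuffle_sign_def * by auto
qed

lemma wedge_axis:
  "wedge (axis I 1) (axis J 1) = (if I \<inter> J = {} then shuffle_sign I J *\<^sub>R axis (I \<union> J) 1 else 0)"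
proof (rule vec_eq_iff[THEN iffD2], rule allI)
  fix K :: "'a set"
  have "wedge (axis I 1) (axis J 1) $ K
    = (\<Sum>L\<in>Pow K. if L = I then (if K - I = J then shuffle_sign I J else 0) else 0)"
    unfolding wedge_def vec_lambda_beta
    by (intro sum.cong) (auto simp: axis_def)
  also have "\<dots> = (if I \<subseteq> K \<and> K - I = J then shuffle_sign I J else 0)"
    by (subst sum.delta) auto
  also have "I \<subseteq> K \<and> K - I = J \<longleftrightarrow> I \<inter> J = {} \<and> K = I \<union> J" by blast
  finally show "wedge (axis I 1) (axis J 1) $ K
    = (if I \<inter> J = {} then shuffle_sign I J *\<^sub>R axis (I \<union> J) 1 else 0) $ K"
    by (auto simp: axis_def)
qed

lemmas wedge_bilinear_simps =
  bilinear_ladd[OF bilinear_wedge] bilinear_radd[OF bilinear_wedge]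
  bilinear_lmul[OF bilinear_wedge] bilinear_rmul[OF bilinear_wedge]
  bilinear_lzero[OF bilinear_wedge] bilinear_rzero[OF bilinear_wedge]
  bilinear_lneg[OF bilinear_wedge] bilinear_rneg[OF bilinear_wedge]
  bilinear_lsub[OF bilinear_wedge] bilinear_rsub[OF bilinear_wedge]

lemma linear_wedge_right: "linear (wedge x)" and linear_wedge_left: "linear (\<lambda>x. wedge x y)"
  using bilinear_wedge by (auto simp: bilinear_def)

lemma ext_linear_eqI:
  fixes f g :: "'m::finite ext \<Rightarrow> 'b::real_vector"
  assumes "linear f" "linear g" "\<And>I. f (axis I 1) = g (axis I 1)"
  shows "f = g"
  by (rule linear_eq_stdbasis[OF assms(1,2)]) (use assms(3) in \<open>auto simp: Basis_vec_def\<close>)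

text \<open>The inversion count is additive in both index sets, so either bracketing gives the
  product of the three pairwise signs for disjoint sets and zero otherwise.\<close>

lemma wedge_assoc_axis:
  "wedge (wedge (axis I 1) (axis J 1)) (axis H 1) = wedge (axis I 1) (wedge (axis J 1) (axis H 1))"
  by (auto simp: wedge_axis wedge_bilinear_simps shuffle_sign_Un_left shuffle_sign_Un_right
      Int_Un_distrib Int_Un_distrib2 Un_assoc)

lemma wedge_assoc: "wedge (wedge x y) z = wedge x (wedge y z)"
proof -
  note l = linear_wedge_right linear_wedge_left linear_compose[OF linear_wedge_right linear_wedge_left, unfolded o_def]
     linear_compose[OF linear_wedge_left linear_wedge_left, unfolded o_def]
     linear_compose[OF linear_wedge_left linear_wedge_right, unfolded o_def]
     linear_compose[OF linear_wedge_right linear_wedge_right, unfolded o_def]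
  have 1: "wedge (wedge (axis I 1) (axis J 1)) z = wedge (axis I 1) (wedge (axis J 1) z)" for I J z
    by (rule fun_cong[of _ _ z], rule ext_linear_eqI) (auto intro: l simp: wedge_assoc_axis)
  have 2: "wedge (wedge (axis I 1) y) z = wedge (axis I 1) (wedge y z)" for I y z
    by (rule fun_cong[of _ _ y], rule ext_linear_eqI) (auto intro: l simp: 1)
  show ?thesis
    by (rule fun_cong[of _ _ x], rule ext_linear_eqI) (auto intro: l simp: 2)
qed

lemma wedge_one_left [simp]: "wedge (axis {} 1) x = x"
  by (rule fun_cong[of _ _ x], rule ext_linear_eqI)
     (auto simp: linear_wedge_right wedge_axis intro: linear_id[unfolded id_def])

lemma wedge_one_right [simp]: "wedge x (axis {} 1) = x"
  by (rule fun_cong[of _ _ x], rule ext_linear_eqI)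
     (auto simp: linear_wedge_left wedge_axis intro: linear_id[unfolded id_def])

lemma linear_ext_vec: "linear ext_vec"
  by (rule linearI) (simp_all add: ext_vec_def scaleR_add_left sum.distrib scaleR_sum_right)

lemmas ext_vec_simps = linear_add[OF linear_ext_vec] linear_scale[OF linear_ext_vec] linear_0[OF linear_ext_vec]
  linear_neg[OF linear_ext_vec] linear_diff[OF linear_ext_vec]

lemma ext_vec_axis: "ext_vec (axis i 1) = axis {i} 1"
proof -
  have "ext_vec (axis i 1) = (\<Sum>j\<in>UNIV. if j = i then axis {i} 1 else 0)"
    unfolding ext_vec_def by (intro sum.cong) (auto simp: axis_def)
  then show ?thesis by simp
qed

lemma vec_linear_eqI:
  fixes f g :: "real ^ 'm::finite \<Rightarrow> 'b::real_vector"
  assumes "linear f" "linear g" "\<And>i. f (axis i 1) = g (axis i 1)"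
  shows "f = g"
  by (rule linear_eq_stdbasis[OF assms(1,2)]) (use assms(3) in \<open>auto simp: Basis_vec_def\<close>)

lemma bilinear_vec_eqI:
  fixes f g :: "real ^ 'm::finite \<Rightarrow> real ^ 'k::finite \<Rightarrow> 'b::real_vector"
  assumes "bilinear f" "bilinear g" "\<And>i j. f (axis i 1) (axis j 1) = g (axis i 1) (axis j 1)"
  shows "f x y = g x y"
proof -
  have "f (axis i 1) = g (axis i 1)" for i
    using assms by (intro vec_linear_eqI) (auto simp: bilinear_def)
  then have "(\<lambda>x. f x y) = (\<lambda>x. g x y)"
    using assms by (intro vec_linear_eqI) (auto simp: bilinear_def)
  then show ?thesis by metis
qed

lemma wedge_vec_anticommute: "wedge (ext_vec v) (ext_vec w) = - wedge (ext_vec w) (ext_vec v)"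
proof (rule bilinear_vec_eqI[of "\<lambda>v w. wedge (ext_vec v) (ext_vec w)" "\<lambda>v w. - wedge (ext_vec w) (ext_vec v)"])
  show "wedge (ext_vec (axis i 1)) (ext_vec (axis j 1)) = - wedge (ext_vec (axis j 1)) (ext_vec (axis i 1 :: real ^ 'a))" for i j
    using shuffle_sign_singletons[of i j]
    by (auto simp: ext_vec_axis wedge_axis insert_commute)
qed (auto simp: bilinear_def ext_vec_simps wedge_bilinear_simps intro!: linearI)

lemma wedge_vec_self [simp]: "wedge (ext_vec v) (ext_vec v) = 0"
  using wedge_vec_anticommute[of v v] by (metis eq_neg_iff_add_eq_0 scaleR_2 scaleR_eq_0_iff zero_neq_numeral)

lemma wedge_vec_vec_left: "wedge (ext_vec v) (wedge (ext_vec v) x) = 0"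
  by (simp add: wedge_bilinear_simps flip: wedge_assoc)

lemma wedge_vec_swap: "wedge (ext_vec v) (wedge (ext_vec w) x) = - wedge (ext_vec w) (wedge (ext_vec v) x)"
  by (simp add: wedge_bilinear_simps wedge_vec_anticommute[of v w] flip: wedge_assoc)

lemma ext_product_Nil [simp]: "ext_product [] = axis {} 1"
  and ext_product_Cons [simp]: "ext_product (v # vs) = wedge (ext_vec v) (ext_product vs)"
  by (simp_all add: ext_product_def)

lemma ext_product_append: "ext_product (vs @ ws) = wedge (ext_product vs) (ext_product ws)"
  by (induction vs) (simp_all add: wedge_assoc)

lemma ext_product_move:
  "\<exists>c\<in>{1, -1}. ext_product (vs @ w # ws) = c *\<^sub>R ext_product (w # vs @ ws)"
proof (induction vs)
  case (Cons v vs)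
  then obtain c where c: "c \<in> {1, -1}" "ext_product (vs @ w # ws) = c *\<^sub>R ext_product (w # vs @ ws)" by blast
  then have "ext_product ((v # vs) @ w # ws) = (- c) *\<^sub>R ext_product (w # (v # vs) @ ws)"
    by (simp add: wedge_bilinear_simps wedge_vec_swap[of v w])
  then show ?case using c(1) by force
qed auto

lemma ext_product_mset_cong:
  "mset vs = mset ws \<Longrightarrow> \<exists>c\<in>{1, -1}. ext_product vs = c *\<^sub>R ext_product ws"
proof (induction vs arbitrary: ws)
  case (Cons v vs)
  have "v \<in> set ws" using mset_eq_setD[OF Cons.prems] by auto
  then obtain xs ys where ws: "ws = xs @ v # ys" by (meson split_list)
  with Cons.prems have "mset vs = mset (xs @ ys)" by simp
  from Cons.IH[OF this] obtain c where c: "c \<in> {1, -1}" "ext_product vs = c *\<^sub>R ext_product (xs @ ys)" by blast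
  obtain c' where c': "c' \<in> {1, -1}" "ext_product (xs @ v # ys) = c' *\<^sub>R ext_product (v # xs @ ys)"
    using ext_product_move by blast
  have "ext_product (v # vs) = (c * c') *\<^sub>R ext_product ws"
    using c c' by (auto simp: ws wedge_bilinear_simps)
  then show ?case using c c' by (intro bexI[of _ "c * c'"]) auto
qed auto

lemma wedge_ext_product_span:
  assumes "v \<in> span (set vs)"
  shows "wedge (ext_vec v) (ext_product vs) = 0"
proof -
  have *: "wedge (ext_vec v) (ext_product vs) = 0" if v: "v \<in> set vs" for v
  proof -
    obtain xs ys where vs: "vs = xs @ v # ys" using v by (meson split_list)
    obtain c where "ext_product (xs @ v # ys) = c *\<^sub>R ext_product (v # xs @ ys)"
      using ext_product_move by blast
    then show ?thesis by (simp add: vs wedge_bilinear_simps wedge_vec_vec_left)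
  qed
  from assms show ?thesis
    by (induction rule: span_induct_alt) (auto simp: * ext_vec_simps wedge_bilinear_simps)
qed

section \<open>The interior product\<close>

definition contract :: "real ^ 'm::finite \<Rightarrow> 'm ext \<Rightarrow> 'm ext" where
  "contract w = adjoint (wedge (ext_vec w))"

lemma contract_inner: "contract w x \<bullet> y = x \<bullet> wedge (ext_vec w) y"
  unfolding contract_def using adjoint_works[OF linear_wedge_right] by (metis inner_commute)

lemma linear_contract: "linear (contract w)"
  unfolding contract_def by (rule adjoint_linear[OF linear_wedge_right])

lemma contract_add_vec: "contract (v + w) x = contract v x + contract w x"
  and contract_scale_vec: "contract (c *\<^sub>R v) x = c *\<^sub>R contract v x"
  by (rule vector_eq_rdot[THEN iffD1]; simp add: inner_add_left contract_inner ext_vec_simps wedge_bilinear_simps inner_add_right)+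

lemmas contract_simps = linear_add[OF linear_contract] linear_scale[OF linear_contract]
  linear_0[OF linear_contract] linear_neg[OF linear_contract] linear_diff[OF linear_contract]

lemma contract_axis:
  "contract (axis i 1) (axis I 1) = (if i \<in> I then shuffle_sign {i} (I - {i}) *\<^sub>R axis (I - {i}) 1 else 0)"
proof (rule vec_eq_iff[THEN iffD2], rule allI)
  fix K
  have "contract (axis i 1) (axis I 1) $ K = contract (axis i 1) (axis I 1) \<bullet> axis K 1"
    by (simp add: inner_axis)
  also have "\<dots> = axis I 1 \<bullet> (if i \<notin> K then shuffle_sign {i} K *\<^sub>R axis (insert i K) 1 else (0 :: 'a ext))"
    by (simp add: contract_inner ext_vec_axis wedge_axis)
  also have "\<dots> = (if i \<in> I then shuffle_sign {i} (I - {i}) *\<^sub>R axis (I - {i}) 1 else 0) $ K"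
    unfolding inner_axis_axis if_distrib[of "inner _"] inner_scaleR_right inner_zero_right inner_real_def
    by (auto simp: axis_def)
  finally show "contract (axis i 1) (axis I 1) $ K
    = (if i \<in> I then shuffle_sign {i} (I - {i}) *\<^sub>R axis (I - {i}) 1 else 0) $ K" .
qed

lemma contract_wedge_axis:
  "contract (axis i 1) (wedge (ext_vec (axis j 1)) (axis I 1))
    = (axis i 1 \<bullet> (axis j 1 :: real ^ 'm::finite)) *\<^sub>R axis I 1 - wedge (ext_vec (axis j 1)) (contract (axis i 1) (axis I 1))"
proof (cases "i = j")
  case True
  then show ?thesis
    by (auto simp: ext_vec_axis wedge_axis contract_axis contract_simps wedge_bilinear_simps inner_axis_axis
      
        Diff_insert_absorb insert_absorb)
next
  case False
  \<comment> \<open>The comparisons with the other indices agree on both sides; on the left each of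
    the two orders of \<open>i\<close> and \<open>j\<close> occurs once, which contributes
    -1.\<close>
  have *: "shuffle_sign {j} I * shuffle_sign {i} (insert j (I - {i}))
      = - shuffle_sign {j} (I - {i}) * shuffle_sign {i} (I - {i})" if "i \<in> I" "j \<notin> I"
  proof -
    have "shuffle_sign {j} I = shuffle_sign {j} ({i} \<union> (I - {i}))" using that by (simp add: insert_absorb)
    also have "\<dots> = shuffle_sign {j} {i} * shuffle_sign {j} (I - {i})"
      by (rule shuffle_sign_Un_right) auto
    finally have 1: "shuffle_sign {j} I = shuffle_sign {j} {i} * shuffle_sign {j} (I - {i})" .
    have 2: "shuffle_sign {i} ({j} \<union> (I - {i})) = shuffle_sign {i} {j} * shuffle_sign {i} (I - {i})"
      using that by (intro shuffle_sign_Un_right) auto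
    show ?thesis using False shuffle_sign_singletons[of i j]
      by (simp add: 1 2[simplified] mult_ac)
  qed
  have "insert j I - {i} = insert j (I - {i})" using False by auto
  then show ?thesis using False *
    by (auto simp: ext_vec_axis wedge_axis contract_axis contract_simps wedge_bilinear_simps inner_axis_axis)
qed

text \<open>The interior product is an antiderivation. As an adjoint it is the operation that
  appears in support functions of products, and this rule makes it computable on products of
  vectors. Multilinearity leaves only basis vectors to check.\<close>

lemma contract_wedge:
  "contract w (wedge (ext_vec v) x) = (w \<bullet> v) *\<^sub>R x - wedge (ext_vec v) (contract w x)"
proof -
  have 1: "contract (axis i 1) (wedge (ext_vec (axis j 1)) x)
    = (axis i 1 \<bullet> (axis j 1 :: real ^ 'a)) *\<^sub>R x - wedge (ext_vec (axis j 1)) (contract (axis i 1) x)" for i j x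
    by (rule fun_cong[of _ _ x], rule ext_linear_eqI)
       (auto intro!: linearI simp: contract_wedge_axis contract_simps wedge_bilinear_simps scaleR_add_right scaleR_diff_right)
  show ?thesis
  proof (rule bilinear_vec_eqI[of "\<lambda>w v. contract w (wedge (ext_vec v) x)"
      "\<lambda>w v. (w \<bullet> v) *\<^sub>R x - wedge (ext_vec v) (contract w x)"])
  qed (auto simp: 1 bilinear_def contract_add_vec contract_scale_vec contract_simps ext_vec_simps
        wedge_bilinear_simps inner_add_left inner_add_right scaleR_add_left scaleR_diff_right intro!: linearI)
qed

text \<open>Support functions and absolute inner products are even, so for them the factors of a
  product may be permuted freely.\<close>

lemma ext_product_perm_eq:
  assumes "mset vs = mset ws" and even: "\<And>x. F (- x) = F x"
  shows "F (ext_product vs) = F (ext_product ws)"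
  using ext_product_mset_cong[OF assms(1)] even by auto

text \<open>Moving \<open>p\<close> to the other side as a contraction, the antiderivation rule
  leaves only the multiple \<open>p \<bullet> p\<close> of \<open>x\<close>.\<close>

lemma norm_wedge_orthogonal:
  assumes "contract p x = 0"
  shows "norm (wedge (ext_vec p) x) = norm p * norm x"
proof -
  have "wedge (ext_vec p) x \<bullet> wedge (ext_vec p) x = contract p (wedge (ext_vec p) x) \<bullet> x"
    by (simp add: contract_inner)
  also have "\<dots> = (p \<bullet> p) * (x \<bullet> x)" using assms by (simp add: contract_wedge wedge_bilinear_simps)
  finally show ?thesis by (simp add: norm_eq_sqrt_inner real_sqrt_mult)
qed

lemma wedge_vec_nth_empty: "wedge (ext_vec v) y $ {} = 0"
  by (simp add: wedge_def ext_vec_def axis_def)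

lemma contract_one [simp]: "contract v (axis {} 1) = 0"
proof -
  have "contract v (axis {} 1) \<bullet> y = 0" for y
    by (subst contract_inner, subst inner_commute) (simp add: inner_axis wedge_vec_nth_empty)
  then show ?thesis by (metis inner_eq_zero_iff)
qed

lemma contract_ext_product_orthogonal:
  "(\<And>v. v \<in> set vs \<Longrightarrow> w \<bullet> v = 0) \<Longrightarrow> contract w (ext_product vs) = 0"
  by (induction vs) (simp_all add: contract_wedge wedge_bilinear_simps)

text \<open>All dependence on \<open>w\<close> can be collected in the first factor, so that
  contraction by \<open>w\<close> produces a single term and keeps simple vectors simple up to a
  scalar.\<close>

lemma ext_product_orthogonal_tail:
  "vs \<noteq> [] \<Longrightarrow> \<exists>u us. length us + 1 = length vs \<and> ext_product vs = ext_product (u # us) \<and> (\<forall>v\<in>set us. w \<bullet> v = 0)"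
proof (induction vs rule: list_nonempty_induct)
  case (single v)
  then show ?case by (intro exI[of _ v] exI[of _ "[]"]) auto
next
  case (cons v vs)
  then obtain u us where u: "length us + 1 = length vs" "ext_product vs = ext_product (u # us)" "\<forall>v\<in>set us. w \<bullet> v = 0"
    by blast
  show ?case
  proof (cases "w \<bullet> u = 0")
    case True
    then show ?thesis using u by (intro exI[of _ v] exI[of _ "u # us"]) auto
  next
    case False
    \<comment> \<open>Subtracting a multiple of \<open>u\<close> leaves the wedge with
      \<open>u\<close> unchanged; this multiple makes the vector orthogonal to \<open>w\<close>.
      Bringing \<open>u\<close> to the front costs the sign in \<open>- u\<close>.\<close>
    define v' where "v' = v - ((w \<bullet> v) / (w \<bullet> u)) *\<^sub>R u"
    have "ext_product (v # vs) = ext_product ((- u) # v' # us)"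
      using u(2) by (simp add: v'_def ext_vec_simps wedge_bilinear_simps wedge_vec_vec_left wedge_vec_swap[of v u])
    moreover have "w \<bullet> v' = 0" using False by (simp add: v'_def inner_diff_right)
    ultimately show ?thesis using u by (intro exI[of _ "- u"] exI[of _ "v' # us"]) auto
  qed
qed

lemma contract_simple:
  assumes "x \<in> simple_ext (Suc d)"
  obtains c y where "y \<in> simple_ext d" "contract w x = c *\<^sub>R y"
proof -
  obtain vs where vs: "length vs = Suc d" "x = ext_product vs" using assms by (auto simp: simple_ext_def)
  then obtain u us where us: "length us = d" "x = ext_product (u # us)" "\<forall>v\<in>set us. w \<bullet> v = 0"
    using ext_product_orthogonal_tail[of vs w] by force
  have "contract w x = (w \<bullet> u) *\<^sub>R ext_product us"
    unfolding us(2) ext_product_Cons contract_wedge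
    by (subst contract_ext_product_orthogonal) (use us(3) in \<open>auto simp: wedge_bilinear_simps\<close>)
  then show ?thesis using that us(1) by (auto simp: simple_ext_def)
qed

definition contract_list :: "(real ^ 'm::finite) list \<Rightarrow> 'm ext \<Rightarrow> 'm ext" where
  "contract_list ws = fold contract ws"

lemma contract_list_inner: "contract_list ws x \<bullet> y = x \<bullet> wedge (ext_product ws) y"
  by (induction ws arbitrary: x) (simp_all add: contract_list_def contract_inner wedge_assoc)

lemma adjoint_wedge_ext_product: "adjoint (wedge (ext_product ws)) = contract_list ws"
proof
  fix x
  have "adjoint (wedge (ext_product ws)) x \<bullet> y = contract_list ws x \<bullet> y" for y
    using adjoint_works[OF linear_wedge_right] by (metis inner_commute contract_list_inner)
  then show "adjoint (wedge (ext_product ws)) x = contract_list ws x" using vector_eq_rdot by blast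
qed

text \<open>Evaluating the support function of a product at a simple vector means contracting that
  vector; such evaluations thus stay within multiples of simple vectors.\<close>

lemma contract_list_simple:
  "x \<in> simple_ext (length ws + d) \<Longrightarrow> \<exists>c. \<exists>y\<in>simple_ext d. contract_list ws x = c *\<^sub>R y"
proof (induction ws arbitrary: x)
  case Nil
  then show ?case by (intro exI[of _ 1] bexI[of _ x]) (auto simp: contract_list_def)
next
  case (Cons w ws)
  then have "x \<in> simple_ext (Suc (length ws + d))" by simp
  from contract_simple[OF this, of w] obtain c y where cy: "y \<in> simple_ext (length ws + d)" "contract w x = c *\<^sub>R y"
    by metis
  obtain c' z where "z \<in> simple_ext d" "contract_list ws y = c' *\<^sub>R z" using Cons.IH[OF cy(1)] by blast
  moreover have "contract_list ws (c *\<^sub>R y) = c *\<^sub>R contract_list ws y" for c y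
  proof (induction ws arbitrary: c y)
    case (Cons w ws)
    then show ?case by (simp add: contract_list_def contract_simps)
  qed (simp add: contract_list_def)
  ultimately show ?case using cy by (intro exI[of _ "c * c'"] bexI[of _ z]) (auto simp: contract_list_def)
qed

section \<open>Rewriting products of vectors\<close>

lemma span_insert_swap:
  "u \<in> span (insert v S) \<Longrightarrow> v \<in> span (insert u S) \<Longrightarrow> span (insert u S) = span (insert v S)"
  by (rule span_eq[THEN iffD2]) (auto intro: span_base)

lemma ext_product_orthogonalize_tail:
  "\<exists>us'. length us' = length us \<and> ext_product (u # us) = ext_product (u # us') \<and>
     (\<forall>v\<in>set us'. u \<bullet> v = 0) \<and> span (insert u (set us')) = span (insert u (set us))"
  if "norm u = 1"
proof (induction us)
  case (Cons v us)
  then obtain us' where us': "length us' = length us" "ext_product (u # us) = ext_product (u # us')"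
     "\<forall>v\<in>set us'. u \<bullet> v = 0" "span (insert u (set us')) = span (insert u (set us))" by blast
  define v' where "v' = v - (u \<bullet> v) *\<^sub>R u"
  have "ext_product (u # v # us) = ext_product (u # v' # us')"
    using us'(2) by (simp add: v'_def wedge_vec_swap[of u] ext_vec_simps wedge_bilinear_simps wedge_vec_vec_left)
  moreover have "u \<bullet> v' = 0" using that by (simp add: v'_def inner_diff_right dot_square_norm)
  moreover have "span (insert u (insert v' (set us'))) = span (insert u (insert v (set us)))"
  proof -
    have "span (insert u (insert v' (set us'))) = span (insert v' (insert u (set us')))"
      by (simp add: insert_commute)
    also have "\<dots> = span (insert v (insert u (set us')))"
    proof (rule span_insert_swap)
      have "u \<in> span (insert v (insert u (set us')))" "v \<in> span (insert v (insert u (set us')))"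
        by (auto intro: span_base)
      then show "v' \<in> span (insert v (insert u (set us')))"
        unfolding v'_def by (intro span_diff span_scale)
      have "u \<in> span (insert v' (insert u (set us')))" "v' \<in> span (insert v' (insert u (set us')))"
        by (auto intro: span_base)
      then have "v' + (u \<bullet> v) *\<^sub>R u \<in> span (insert v' (insert u (set us')))"
        by (intro span_add span_scale)
      then show "v \<in> span (insert v' (insert u (set us')))" by (simp add: v'_def)
    qed
    also have "\<dots> = span (insert v (insert u (set us)))"
      using us'(4) by (simp add: span_insert)
    finally show ?thesis by (simp add: insert_commute)
  qed
  ultimately show ?case using us'(1,3) by (intro exI[of _ "v' # us'"]) auto
qed auto

text \<open>Any unit vector of the span can serve as first factor. The span is tracked along with
  the product because further vectors are then extracted from the remaining factors.\<close>

lemma ext_product_split_unit: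
  assumes "u \<in> span (set vs)" "norm u = 1"
  shows "\<exists>us c. length vs = Suc (length us) \<and> ext_product vs = c *\<^sub>R ext_product (u # us) \<and>
     (\<forall>v\<in>set us. u \<bullet> v = 0) \<and> span (insert u (set us)) = span (set vs)"
proof -
  \<comment> \<open>The induction runs over nonzero rather than unit vectors, as the remainder
    \<open>u'\<close> passed to the tail need not have norm one.\<close>
  have "\<exists>us c. length vs = Suc (length us) \<and> ext_product vs = c *\<^sub>R ext_product (u # us) \<and>
     span (insert u (set us)) = span (set vs)" if "u \<in> span (set vs)" "u \<noteq> 0" for u vs
    using that
  proof (induction vs arbitrary: u)
    case (Cons v vs)
    then obtain a where a: "u - a *\<^sub>R v \<in> span (set vs)" by (auto simp: span_insert)
    define u' where "u' = u - a *\<^sub>R v"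
    have u: "u = u' + a *\<^sub>R v" by (simp add: u'_def)
    show ?case
    proof (cases "u' = 0")
      \<comment> \<open>Here \<open>u\<close> is a multiple of the head itself and simply replaces
        it.\<close>
      case True
      then have "a \<noteq> 0" "v = (1 / a) *\<^sub>R u" using Cons.prems(2) u by auto
      moreover have "span (insert ((1 / a) *\<^sub>R u) (set vs)) = span (insert u (set vs))"
      proof (rule span_insert_swap)
        have "a *\<^sub>R (1 / a) *\<^sub>R u \<in> span (insert ((1 / a) *\<^sub>R u) (set vs))"
          by (rule span_scale, rule span_base) simp
        then show "u \<in> span (insert ((1 / a) *\<^sub>R u) (set vs))" using \<open>a \<noteq> 0\<close> by simp
        show "(1 / a) *\<^sub>R u \<in> span (insert u (set vs))" by (intro span_scale) (auto intro: span_base)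
      qed
      ultimately show ?thesis
        by (intro exI[of _ vs] exI[of _ "1 / a"]) (simp add: ext_vec_simps wedge_bilinear_simps)
    next
      case False
      from Cons.IH[OF a[folded u'_def] False] obtain us c where us:
        "length vs = Suc (length us)" "ext_product vs = c *\<^sub>R ext_product (u' # us)"
        "span (insert u' (set us)) = span (set vs)" by blast
      have "ext_product (v # vs) = (- c) *\<^sub>R ext_product (u # v # us)"
        using us(2) by (simp add: u ext_vec_simps wedge_bilinear_simps wedge_vec_vec_left wedge_vec_swap[of u' v])
      moreover have "span (insert u (insert v (set us))) = span (insert v (set vs))"
      proof -
        have "span (insert u (insert v (set us))) = span (insert u' (insert v (set us)))"
        proof (rule span_insert_swap)
          have "v \<in> span (insert u' (insert v (set us)))" "u' \<in> span (insert u' (insert v (set us)))"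
            by (auto intro: span_base)
          then show "u \<in> span (insert u' (insert v (set us)))" unfolding u by (intro span_add span_scale)
          have "v \<in> span (insert u (insert v (set us)))" "u \<in> span (insert u (insert v (set us)))"
            by (auto intro: span_base)
          then show "u' \<in> span (insert u (insert v (set us)))" unfolding u'_def by (intro span_diff span_scale)
        qed
        also have "\<dots> = span (insert v (insert u' (set us)))" by (simp add: insert_commute)
        also have "\<dots> = span (insert v (set vs))" using us(3) by (simp add: span_insert)
        finally show ?thesis .
      qed
      ultimately show ?thesis using us(1) by (intro exI[of _ "v # us"] exI[of _ "- c"]) auto
    qed
  qed auto
  from this[OF assms(1)] assms(2) obtain us c where us: "length vs = Suc (length us)"
    "ext_product vs = c *\<^sub>R ext_product (u # us)" "span (insert u (set us)) = span (set vs)" by force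
  obtain us' where "length us' = length us" "ext_product (u # us) = ext_product (u # us')"
     "\<forall>v\<in>set us'. u \<bullet> v = 0" "span (insert u (set us')) = span (insert u (set us))"
    using ext_product_orthogonalize_tail[OF assms(2), of us] by blast
  then show ?thesis using us by (intro exI[of _ us'] exI[of _ c]) auto
qed

lemma ext_product_dependent:
  assumes "dim (set vs) < length vs"
  shows "ext_product vs = 0"
  using assms
proof (induction vs)
  case (Cons v vs)
  show ?case
  proof (cases "v \<in> span (set vs)")
    case True
    then show ?thesis by (simp add: wedge_ext_product_span)
  next
    case False
    then have "dim (set (v # vs)) = dim (set vs) + 1" by (simp add: dim_insert)
    then show ?thesis using Cons by (simp add: wedge_bilinear_simps)
  qed
qed simp

subsection \<open>Degree\<close>

definition ext_degree :: "nat \<Rightarrow> 'm::finite ext \<Rightarrow> 'm ext" where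
  "ext_degree d x = (\<chi> I. if card I = d then x $ I else 0)"

lemma linear_ext_degree: "linear (ext_degree d)"
  by (rule linearI) (simp_all add: ext_degree_def vec_eq_iff)

lemma ext_degree_inner: "ext_degree d x \<bullet> y = x \<bullet> ext_degree d y"
  by (auto simp: ext_degree_def inner_vec_def intro!: sum.cong)

lemma ext_degree_axis: "ext_degree d (axis I 1) = (if card I = d then axis I 1 else 0)"
  by (auto simp: ext_degree_def vec_eq_iff axis_def)

lemma ext_degree_ext_degree: "ext_degree d (ext_degree e x) = (if d = e then ext_degree d x else 0)"
  by (auto simp: ext_degree_def vec_eq_iff)

lemma ext_degree_wedge_vec: "ext_degree (Suc d) (wedge (ext_vec v) x) = wedge (ext_vec v) (ext_degree d x)"
proof -
  let ?A = "\<lambda>v x. ext_degree (Suc d) (wedge (ext_vec v) x)" and ?B = "\<lambda>v x. wedge (ext_vec v) (ext_degree d x)"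
  have 1: "?A (axis i 1) x = ?B (axis i 1) x" for i x
  proof (rule fun_cong[of _ _ x], rule ext_linear_eqI)
    show "?A (axis i 1) (axis I 1) = ?B (axis i 1) (axis I 1)" for I
      by (auto simp: ext_vec_axis wedge_axis ext_degree_axis wedge_bilinear_simps
          linear_scale[OF linear_ext_degree] linear_0[OF linear_ext_degree])
  qed (auto intro!: linearI simp: wedge_bilinear_simps linear_add[OF linear_ext_degree] linear_scale[OF linear_ext_degree])
  show ?thesis
    by (rule fun_cong[of _ _ v], rule vec_linear_eqI)
       (auto intro!: linearI simp: 1 ext_vec_simps wedge_bilinear_simps linear_add[OF linear_ext_degree] linear_scale[OF linear_ext_degree])
qed

lemma ext_degree_ext_product: "ext_degree d (ext_product vs) = (if length vs = d then ext_product vs else 0)"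
proof -
  have "ext_degree (length vs) (ext_product vs) = ext_product vs"
    by (induction vs) (simp_all add: ext_degree_axis ext_degree_wedge_vec)
  then show ?thesis using ext_degree_ext_degree[of d "length vs" "ext_product vs"] by auto
qed

lemma ext_degree_simple: "x \<in> simple_ext e \<Longrightarrow> ext_degree d x = (if d = e then x else 0)"
  by (auto simp: simple_ext_def ext_degree_ext_product)

subsection \<open>Induced maps\<close>

lemma linear_ext_map: "linear (ext_map f)"
  by (rule linearI) (simp_all add: ext_map_def scaleR_add_left sum.distrib scaleR_sum_right)

lemma ext_map_axis:
  "ext_map f (axis I 1) = ext_product (map (\<lambda>k. f (axis (from_nat k) 1)) (sorted_list_of_set (to_nat ` I)))"
proof -
  have "ext_map f (axis I 1) = (\<Sum>J\<in>UNIV. if J = I then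
    ext_product (map (\<lambda>k. f (axis (from_nat k) 1)) (sorted_list_of_set (to_nat ` I))) else 0)"
    unfolding ext_map_def by (intro sum.cong) (auto simp: axis_def)
  then show ?thesis by simp
qed

text \<open>Inserting a factor at its sorted position moves it past the smaller indices; the
  resulting sign is the shuffle sign of a singleton, which links the sorted lists in
  \<open>ext_map\<close> to the wedge product.\<close>

lemma ext_product_insort:
  "sorted ks \<Longrightarrow> distinct ks \<Longrightarrow> k \<notin> set ks \<Longrightarrow> ext_product (map h (insort k ks)) =
     (- 1) ^ card {j \<in> set ks. j < k} *\<^sub>R wedge (ext_vec (h k)) (ext_product (map h ks))"
  for k :: nat
proof (induction ks)
  case (Cons a ks)
  show ?case
  proof (cases "k \<le> a")
    case True
    then have "{j \<in> set (a # ks). j < k} = {}" using Cons.prems by auto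
    then show ?thesis using True by (simp only:) simp
  next
    case False
    have "{j \<in> set (a # ks). j < k} = insert a {j \<in> set ks. j < k}" using False by auto
    moreover have "a \<notin> {j \<in> set ks. j < k}" using Cons.prems by auto
    ultimately have "card {j \<in> set (a # ks). j < k} = Suc (card {j \<in> set ks. j < k})" by simp
    then show ?thesis using False Cons
      by (simp only:) (simp add: wedge_bilinear_simps wedge_vec_swap[of "h a"])
  qed
qed simp

lemma shuffle_sign_single: "shuffle_sign {i} I = (- 1) ^ card {j \<in> to_nat ` I. j < to_nat i}"
proof -
  have "{(x, j). x \<in> {i} \<and> j \<in> I \<and> to_nat j < to_nat x} = Pair i ` {j \<in> I. to_nat j < to_nat i}" by auto
  moreover have "{j \<in> to_nat ` I. j < to_nat i} = to_nat ` {j \<in> I. to_nat j < to_nat i}" by auto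
  ultimately show ?thesis by (simp add: shuffle_sign_def card_image inj_on_def)
qed

lemma ext_map_wedge_vec:
  assumes f: "linear f"
  shows "ext_map f (wedge (ext_vec v) x) = wedge (ext_vec (f v)) (ext_map f x)"
proof -
  let ?A = "\<lambda>v x. ext_map f (wedge (ext_vec v) x)" and ?B = "\<lambda>v x. wedge (ext_vec (f v)) (ext_map f x)"
  note s = linear_add[OF linear_ext_map] linear_scale[OF linear_ext_map] linear_0[OF linear_ext_map]
  have ax: "?A (axis i 1) (axis I 1) = ?B (axis i 1) (axis I 1)" for i I
  proof (cases "i \<in> I")
    case True
    \<comment> \<open>A repeated index gives a repeated image factor, so both sides vanish.\<close>
    have "f (axis i 1) \<in> set (map (\<lambda>k. f (axis (from_nat k) 1)) (sorted_list_of_set (to_nat ` I)))"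
      using True by (auto intro!: image_eqI[of _ _ "to_nat i"])
    then have "?B (axis i 1) (axis I 1) = 0"
      unfolding ext_map_axis by (intro wedge_ext_product_span span_base)
    then show ?thesis using True by (simp add: ext_vec_axis wedge_axis s)
  next
    case False
    have "ext_map f (axis (insert i I) 1) = shuffle_sign {i} I *\<^sub>R wedge (ext_vec (f (axis i 1))) (ext_map f (axis I 1))"
    proof -
      have "ext_map f (axis (insert i I) 1)
        = ext_product (map (\<lambda>k. f (axis (from_nat k) 1)) (insort (to_nat i) (sorted_list_of_set (to_nat ` I))))"
        unfolding ext_map_axis image_insert by (subst sorted_list_of_set_insert) (use False in auto)
      also have "\<dots> = (- 1) ^ card {j \<in> to_nat ` I. j < to_nat i} *\<^sub>R
          wedge (ext_vec (f (axis (from_nat (to_nat i)) 1))) (ext_map f (axis I 1))"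
        unfolding ext_map_axis by (subst ext_product_insort) (use False in auto)
      finally show ?thesis by (simp add: shuffle_sign_single)
    qed
    then show ?thesis using False by (simp add: ext_vec_axis wedge_axis s)
  qed
  have 1: "?A (axis i 1) x = ?B (axis i 1) x" for i x
  proof (rule fun_cong[of _ _ x], rule ext_linear_eqI)
    show "?A (axis i 1) (axis I 1) = ?B (axis i 1) (axis I 1)" for I by (rule ax)
  qed (auto intro!: linearI simp: wedge_bilinear_simps s)
  show ?thesis
    by (rule fun_cong[of _ _ v], rule vec_linear_eqI)
       (auto intro!: linearI simp: 1 ext_vec_simps wedge_bilinear_simps s linear_add[OF f] linear_scale[OF f])
qed

lemma ext_map_ext_product: "linear f \<Longrightarrow> ext_map f (ext_product vs) = ext_product (map f vs)"
  by (induction vs) (simp_all add: ext_map_wedge_vec ext_map_axis)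

lemma axis_ext_product: "\<exists>c vs. length vs = card I \<and> axis I 1 = c *\<^sub>R ext_product vs"
  using finite[of I]
proof (induction I rule: finite_induct)
  case empty
  then show ?case by (intro exI[of _ 1] exI[of _ "[]"]) simp
next
  case (insert i I)
  then obtain c vs where c: "length vs = card I" "axis I 1 = c *\<^sub>R ext_product vs" by blast
  have "axis (insert i I) 1 = shuffle_sign {i} I *\<^sub>R wedge (ext_vec (axis i 1)) (axis I 1)"
    using insert(2) by (simp add: ext_vec_axis wedge_axis)
  also have "\<dots> = (shuffle_sign {i} I * c) *\<^sub>R ext_product (axis i 1 # vs)"
    by (simp add: c wedge_bilinear_simps)
  finally show ?case using c insert by (intro exI[of _ "shuffle_sign {i} I * c"] exI[of _ "axis i 1 # vs"]) auto
qed

text \<open>Induced maps act factorwise on products of vectors, so identities between them are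
  tested on products instead of basis vectors.\<close>

lemma ext_linear_eqI':
  fixes f g :: "'m::finite ext \<Rightarrow> 'b::real_vector"
  assumes "linear f" "linear g" "\<And>vs. f (ext_product vs) = g (ext_product vs)"
  shows "f = g"
proof (rule ext_linear_eqI[OF assms(1,2)])
  fix I :: "'m set"
  obtain c vs where "axis I 1 = c *\<^sub>R ext_product vs" using axis_ext_product by metis
  then show "f (axis I 1) = g (axis I 1)" using assms by (simp add: linear_scale)
qed

lemma ext_map_compose: "linear f \<Longrightarrow> linear g \<Longrightarrow> ext_map f (ext_map g x) = ext_map (\<lambda>x. f (g x)) x"
  by (rule fun_cong[of _ _ x], rule ext_linear_eqI')
     (auto simp: ext_map_ext_product o_def linear_compose[unfolded o_def]
       intro!: linear_ext_map linear_compose[OF linear_ext_map linear_ext_map, unfolded o_def])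

lemma ext_map_ident: "ext_map (\<lambda>x. x) x = x"
  by (rule fun_cong[of _ _ x], rule ext_linear_eqI')
     (auto simp: ext_map_ext_product linear_id[unfolded id_def] linear_ext_map)

lemma ext_map_contract:
  assumes f: "orthogonal_transformation f"
  shows "contract (f w) (ext_map f x) = ext_map f (contract w x)"
proof -
  note s = linear_diff[OF linear_ext_map] linear_scale[OF linear_ext_map] linear_0[OF linear_ext_map]
  note f' = orthogonal_transformation_linear[OF f]
  have *: "contract (f w) (ext_product (map f vs)) = ext_map f (contract w (ext_product vs))" for vs
    using f by (induction vs) (simp_all add: s contract_wedge ext_map_wedge_vec[OF f']
        ext_map_ext_product[OF f'] orthogonal_transformation_def)
  show ?thesis
    by (rule fun_cong[of _ _ x], rule ext_linear_eqI') (auto simp: ext_map_ext_product[OF f'] *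
        intro!: linear_ext_map linear_contract linear_compose[OF linear_ext_map linear_contract, unfolded o_def]
          linear_compose[OF linear_contract linear_ext_map, unfolded o_def])
qed

text \<open>Contractions are intertwined by the induced map, so the factors of one argument can be
  removed one by one until only coefficients at the empty index set are compared.\<close>

lemma ext_map_inner:
  assumes f: "orthogonal_transformation f"
  shows "ext_map f x \<bullet> ext_map f y = x \<bullet> y"
proof -
  note f' = orthogonal_transformation_linear[OF f]
  have nil: "ext_map f y \<bullet> axis {} 1 = y \<bullet> axis {} 1" for y
  proof (rule fun_cong[of _ _ y], rule ext_linear_eqI')
    have "ext_product vs \<bullet> axis {} 1 = 0" if "vs \<noteq> []" for vs :: "(real ^ 'a) list"
      using ext_degree_inner[of "length vs" "ext_product vs" "axis {} 1"] that
      by (simp add: ext_degree_ext_product ext_degree_axis)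
    then show "ext_map f (ext_product vs) \<bullet> axis {} 1 = ext_product vs \<bullet> axis {} 1" for vs
      by (cases "vs = []") (simp_all add: ext_map_ext_product[OF f'] ext_map_axis)
  qed (auto intro!: linearI simp: inner_add_left linear_add[OF linear_ext_map] linear_scale[OF linear_ext_map])
  have prod: "ext_map f y \<bullet> ext_product (map f vs) = y \<bullet> ext_product vs" for vs y
  proof (induction vs arbitrary: y)
    case (Cons v vs)
    have "ext_map f y \<bullet> ext_product (map f (v # vs)) = contract (f v) (ext_map f y) \<bullet> ext_product (map f vs)"
      by (simp add: contract_inner)
    then show ?case by (simp add: ext_map_contract[OF f] Cons.IH contract_inner)
  qed (simp add: nil)
  show ?thesis
    by (rule fun_cong[of _ _ y], rule ext_linear_eqI')
       (auto intro!: linearI simp: inner_add_right linear_add[OF linear_ext_map] linear_scale[OF linear_ext_map]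
         ext_map_ext_product[OF f'] prod)
qed

section \<open>Gaussian vectors\<close>

text \<open>Lebesgue measure and its image \<open>\<nu>\<close> satisfy \<open>\<nu>(A) \<lambda>(B) = \<nu>(B) \<lambda>(A)\<close> by Fubini and translation
  invariance; take \<open>B\<close> the unit ball.\<close>

lemma nn_integral_lborel_translate:
  assumes [measurable]: "h \<in> borel_measurable borel"
  shows "(\<integral>\<^sup>+x. h (x - c) \<partial>lborel) = (\<integral>\<^sup>+x. h x \<partial>(lborel :: 'a::euclidean_space measure))"
proof -
  have "(\<integral>\<^sup>+x. h x \<partial>lborel) = (\<integral>\<^sup>+x. h x \<partial>distr lborel borel ((+) (- c)))"
    by (subst lborel_distr_plus) simp
  also have "\<dots> = (\<integral>\<^sup>+x. h (x - c) \<partial>lborel)" by (subst nn_integral_distr) auto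
  finally show ?thesis by simp
qed

lemma nn_integral_lborel_reflect:
  assumes [measurable]: "h \<in> borel_measurable borel"
  shows "(\<integral>\<^sup>+x. h (c - x) \<partial>lborel) = (\<integral>\<^sup>+x. h x \<partial>(lborel :: 'a::euclidean_space measure))"
proof -
  have "lborel = density (distr lborel borel (\<lambda>x::'a. c + (- 1) *\<^sub>R x)) (\<lambda>_. ennreal (\<bar>- 1\<bar> ^ DIM('a)))"
    by (rule lborel_affine) simp
  then have *: "lborel = distr lborel borel (\<lambda>x::'a. c - x)" by (simp add: density_1)
  show ?thesis by (subst (2) *, subst nn_integral_distr) auto
qed

lemma lborel_orthogonal:
  fixes f :: "'a::euclidean_space \<Rightarrow> 'a"
  assumes f: "orthogonal_transformation f"
  shows "distr lborel borel f = lborel"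
proof (rule measure_eqI)
  have [measurable]: "f \<in> borel_measurable borel"
    using orthogonal_transformation_linear[OF f] by (intro borel_measurable_continuous_onI linear_continuous_on)
       (simp add: linear_conv_bounded_linear)
  define g where "g = inv f"
  have fg: "f (g y) = y" for y
    unfolding g_def using orthogonal_transformation_surj[OF f] by (rule surj_f_inv_f)
  fix A :: "'a set" assume "A \<in> sets (distr lborel borel f)"
  then have A [measurable]: "A \<in> sets borel" by simp
  define B :: "'a set" where "B = ball 0 1"
  have B [measurable]: "B \<in> sets borel" by (simp add: B_def)
  have B_f: "indicator B (f x) = (indicator B x :: ennreal)" for x
    using orthogonal_transformation_norm[OF f] by (auto simp: B_def indicator_def)
  define I :: ennreal where "I = (\<integral>\<^sup>+x. \<integral>\<^sup>+y. indicator A (f x) * indicator B (y - f x) \<partial>lborel \<partial>lborel)"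
  have "I = (\<integral>\<^sup>+x. indicator A (f x) * emeasure lborel B \<partial>lborel)"
    unfolding I_def
    by (intro nn_integral_cong) (simp add: nn_integral_cmult nn_integral_lborel_translate[of "indicator B"])
  also have "\<dots> = emeasure (distr lborel borel f) A * emeasure lborel B"
  proof -
    have "(\<integral>\<^sup>+x. indicator A (f x) \<partial>lborel) = (\<integral>\<^sup>+x. indicator A x \<partial>distr lborel borel f)"
      by (subst nn_integral_distr) auto
    then show ?thesis by (simp add: nn_integral_multc)
  qed
  finally have 1: "I = emeasure (distr lborel borel f) A * emeasure lborel B" .
  have "I = (\<integral>\<^sup>+y. \<integral>\<^sup>+x. indicator A (f x) * indicator B (y - f x) \<partial>lborel \<partial>lborel)"
    unfolding I_def by (rule lborel_pair.Fubini') measurable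
  \<comment> \<open>The substitution of \<open>g y - x\<close> for \<open>x\<close> exchanges the
    arguments of the two indicators.\<close>
  also have "\<dots> = (\<integral>\<^sup>+y. \<integral>\<^sup>+x. indicator A (y - f x) * indicator B (f x) \<partial>lborel \<partial>lborel)"
  proof (rule nn_integral_cong)
    fix y
    have "(\<integral>\<^sup>+x. indicator A (f x) * indicator B (y - f x) \<partial>lborel)
      = (\<integral>\<^sup>+x. indicator A (f (g y - x)) * indicator B (y - f (g y - x)) \<partial>lborel)"
      by (rule nn_integral_lborel_reflect[symmetric]) measurable
    then show "(\<integral>\<^sup>+x. indicator A (f x) * indicator B (y - f x) \<partial>lborel)
      = (\<integral>\<^sup>+x. indicator A (y - f x) * (indicator B (f x) :: ennreal) \<partial>lborel)"
      by (simp add: linear_diff[OF orthogonal_transformation_linear[OF f]] fg)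
  qed
  also have "\<dots> = (\<integral>\<^sup>+x. \<integral>\<^sup>+y. indicator A (y - f x) * indicator B (f x) \<partial>lborel \<partial>lborel)"
    by (rule lborel_pair.Fubini') measurable
  also have "\<dots> = (\<integral>\<^sup>+x. emeasure lborel A * indicator B x \<partial>lborel)"
    by (intro nn_integral_cong) (simp add: B_f nn_integral_multc nn_integral_lborel_translate[of "indicator A"])
  also have "\<dots> = emeasure lborel A * emeasure lborel B" by (simp add: nn_integral_cmult)
  finally have "emeasure (distr lborel borel f) A * emeasure lborel B = emeasure lborel A * emeasure lborel B"
    using 1 by simp
  moreover have "emeasure lborel B \<noteq> 0" "emeasure lborel B \<noteq> \<infinity>"
    by (simp_all add: B_def emeasure_ball) (metis less_irrefl of_nat_0_le_iff unit_ball_vol_pos)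
  ultimately show "emeasure (distr lborel borel f) A = emeasure lborel A"
    by (simp add: ennreal_mult_cancel_left infinity_ennreal_def mult.commute[of _ "emeasure lborel B"])
qed simp

section \<open>Standard Gaussian vectors\<close>

abbreviation std_normal :: "real measure" where
  "std_normal \<equiv> density lborel std_normal_density"

text \<open>The exponent is written through the Euclidean norm so that the density is literally a
  function of the radius, as radial integration requires.\<close>

lemma PiM_std_normal:
  assumes "finite A"
  shows "PiM A (\<lambda>_. std_normal) = density (PiM A (\<lambda>_. lborel))
    (\<lambda>x. ennreal ((1 / sqrt (2 * pi)) ^ card A * exp (- (sqrt (\<Sum>i\<in>A. (x i)\<^sup>2))\<^sup>2 / 2)))"
proof -
  interpret L: product_sigma_finite "\<lambda>_::'a. lborel :: real measure" by standard
  interpret S: prob_space std_normal by (rule prob_space_normal_density) simp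
  interpret N: product_sigma_finite "\<lambda>_::'a. std_normal" by standard
  have eq: "ennreal ((1 / sqrt (2 * pi)) ^ card A * exp (- (sqrt (\<Sum>i\<in>A. (x i)\<^sup>2))\<^sup>2 / 2))
     = (\<Prod>i\<in>A. ennreal (std_normal_density (x i)))" for x
  proof -
    have "(sqrt (\<Sum>i\<in>A. (x i)\<^sup>2))\<^sup>2 = (\<Sum>i\<in>A. (x i)\<^sup>2)" by (simp add: sum_nonneg)
    then have "exp (- (sqrt (\<Sum>i\<in>A. (x i)\<^sup>2))\<^sup>2 / 2) = exp (\<Sum>i\<in>A. - (x i)\<^sup>2 / 2)"
      by (simp add: sum_negf sum_divide_distrib)
    also have "\<dots> = (\<Prod>i\<in>A. exp (- (x i)\<^sup>2 / 2))" using assms by (rule exp_sum)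
    finally show ?thesis
      by (simp add: prod_ennreal normal_density_nonneg std_normal_density_def prod.distrib prod_dividef
          real_sqrt_mult power_divide)
  qed
  show ?thesis
    unfolding eq
  proof (rule N.PiM_eqI[symmetric, OF assms])
    fix B :: "'a \<Rightarrow> real set" assume B: "\<And>i. i \<in> A \<Longrightarrow> B i \<in> sets std_normal"
    have [measurable]: "Pi\<^sub>E A B \<in> sets (PiM A (\<lambda>_. lborel))" using B assms by (intro sets_PiM_I_finite) auto
    have "emeasure (density (PiM A (\<lambda>_. lborel)) (\<lambda>x. \<Prod>i\<in>A. ennreal (std_normal_density (x i)))) (Pi\<^sub>E A B)
      = (\<integral>\<^sup>+x. (\<Prod>i\<in>A. ennreal (std_normal_density (x i))) * indicator (Pi\<^sub>E A B) x \<partial>PiM A (\<lambda>_. lborel))"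
      by (rule emeasure_density) measurable
    also have "\<dots> = (\<integral>\<^sup>+x. (\<Prod>i\<in>A. ennreal (std_normal_density (x i)) * indicator (B i) (x i)) \<partial>PiM A (\<lambda>_. lborel))"
    proof (rule nn_integral_cong)
      fix x assume "x \<in> space (PiM A (\<lambda>_. lborel :: real measure))"
      then have "indicator (Pi\<^sub>E A B) x = (\<Prod>i\<in>A. indicator (B i) (x i) :: ennreal)"
        using assms by (auto simp: indicator_def space_PiM PiE_iff extensional_def prod_zero_iff)
      then show "(\<Prod>i\<in>A. ennreal (std_normal_density (x i))) * indicator (Pi\<^sub>E A B) x
        = (\<Prod>i\<in>A. ennreal (std_normal_density (x i)) * indicator (B i) (x i))"
        by (simp add: prod.distrib)
    qed
    also have "\<dots> = (\<Prod>i\<in>A. \<integral>\<^sup>+x. ennreal (std_normal_density x) * indicator (B i) x \<partial>lborel)"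
      using B by (intro L.product_nn_integral_prod assms) auto
    also have "\<dots> = (\<Prod>i\<in>A. emeasure std_normal (B i))"
      using B by (intro prod.cong refl emeasure_density[symmetric]) auto
    finally show "emeasure (density (PiM A (\<lambda>_. lborel)) (\<lambda>x. \<Prod>i\<in>A. ennreal (std_normal_density (x i)))) (Pi\<^sub>E A B)
      = (\<Prod>i\<in>A. emeasure std_normal (B i))" .
  qed (simp, rule sets_PiM_cong, auto)
qed

lemma measurable_gauss_vec [measurable]: "gauss_vec \<in> borel_measurable gauss_space"
  using integrable_gauss_vec by (rule borel_measurable_integrable)

lemma distr_gauss_vec:
  "distr gauss_space borel (gauss_vec :: _ \<Rightarrow> 'w::euclidean_space)
    = density lborel (\<lambda>x. ennreal ((1 / sqrt (2 * pi)) ^ DIM('w) * exp (- (norm x)\<^sup>2 / 2)))"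
proof -
  let ?T = "\<lambda>f. \<Sum>b\<in>Basis. f b *\<^sub>R b :: 'w"
  let ?h = "\<lambda>x. ennreal ((1 / sqrt (2 * pi)) ^ DIM('w) * exp (- (norm x)\<^sup>2 / 2))"
  have n: "norm (?T f) = sqrt (\<Sum>b\<in>Basis. (f b)\<^sup>2)" for f :: "'w \<Rightarrow> real"
    by (subst norm_eq_sqrt_inner, subst euclidean_inner) (simp add: power2_eq_square)
  have "distr gauss_space borel (gauss_vec :: _ \<Rightarrow> 'w) = distr (density (PiM Basis (\<lambda>_. lborel)) (\<lambda>x. ?h (?T x))) borel ?T"
    unfolding gauss_space_def PiM_std_normal[OF finite_Basis] gauss_vec_def n ..
  also have "\<dots> = density (distr (PiM Basis (\<lambda>_. lborel)) borel ?T) ?h"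
    by (rule density_distr[symmetric]) measurable
  finally show ?thesis by (simp flip: lborel_eq)
qed

text \<open>The Gaussian density depends on the norm alone, and Lebesgue measure is
  invariant.\<close>

lemma distr_gauss_vec_orthogonal:
  fixes f :: "'w::euclidean_space \<Rightarrow> 'w"
  assumes f: "orthogonal_transformation f"
  shows "distr gauss_space borel (\<lambda>\<omega>. f (gauss_vec \<omega>)) = distr gauss_space borel gauss_vec"
proof -
  have [measurable]: "f \<in> borel_measurable borel"
    using orthogonal_transformation_linear[OF f] by (intro borel_measurable_continuous_onI linear_continuous_on)
       (simp add: linear_conv_bounded_linear)
  let ?h = "\<lambda>x::'w. ennreal ((1 / sqrt (2 * pi)) ^ DIM('w) * exp (- (norm x)\<^sup>2 / 2))"
  have "distr gauss_space borel (\<lambda>\<omega>. f (gauss_vec \<omega>)) = distr (distr gauss_space borel gauss_vec) borel f"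
    by (subst distr_distr) (auto simp: o_def)
  also have "\<dots> = distr (density lborel (\<lambda>x. ?h (f x))) borel f"
    by (simp add: distr_gauss_vec orthogonal_transformation_norm[OF f])
  also have "\<dots> = density (distr lborel borel f) ?h"
    by (rule density_distr[symmetric]) measurable
  finally show ?thesis by (simp add: lborel_orthogonal[OF f] distr_gauss_vec)
qed

lemma orthonormal_extend:
  fixes B :: "'w::euclidean_space set"
  assumes "pairwise orthogonal B" "\<And>b. b \<in> B \<Longrightarrow> norm b = 1"
  obtains B' where "B \<subseteq> B'" "pairwise orthogonal B'" "\<And>b. b \<in> B' \<Longrightarrow> norm b = 1"
    "finite B'" "card B' = DIM('w)" "span B' = UNIV"
proof -
  obtain U where U: "U \<inter> insert 0 B = {}" "pairwise orthogonal (B \<union> U)" "span (B \<union> U) = span (B \<union> UNIV)"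
    using orthogonal_extension_strong[OF assms(1)] by metis
  define B' where "B' = B \<union> (\<lambda>x. x /\<^sub>R norm x) ` U"
  have n: "norm b = 1" if "b \<in> B'" for b using that assms(2) U(1) by (auto simp: B'_def intro!: left_inverse)
  have "x \<bullet> y = 0" if "x \<in> B \<union> U" "y \<in> B \<union> U" "x \<noteq> y" for x y
    using U(2) that by (auto simp: pairwise_def orthogonal_def)
  moreover have "B' = (\<lambda>x. if x \<in> B then x else x /\<^sub>R norm x) ` (B \<union> U)"
    using U(1) by (auto simp: B'_def image_iff)
  ultimately have o: "pairwise orthogonal B'"
    by (auto simp: pairwise_def orthogonal_def) blast+
  have "span B' = UNIV"
  proof -
    have "x \<in> span B'" if "x \<in> B \<union> U" for x
    proof (cases "x \<in> B")
      case False
      then have "x /\<^sub>R norm x \<in> B'" "norm x \<noteq> 0" using that U(1) by (auto simp: B'_def)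
      then show ?thesis using span_scale[OF span_base, of "x /\<^sub>R norm x" B' "norm x"] by simp
    qed (auto simp: B'_def intro: span_base)
    then have "span (B \<union> U) \<subseteq> span B'" by (intro span_minimal) auto
    then show ?thesis using U(3) by auto
  qed
  moreover have i: "independent B'" using o n by (intro pairwise_orthogonal_independent) force+
  ultimately have "card B' = DIM('w)" by (metis dim_span_eq_card_independent dim_UNIV)
  show ?thesis
  proof (rule that[of B'])
    show "B \<subseteq> B'" unfolding B'_def by (rule Un_upper1)
    show "finite B'" using i by (rule independent_imp_finite)
  qed (fact o n \<open>card B' = DIM('w)\<close> \<open>span B' = UNIV\<close>)+
qed

text \<open>A rotation carries a completion of \<open>B\<close> to the standard basis; there the
  coordinates form a marginal of the product measure, and the Gaussian law is rotation
  invariant.\<close>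

lemma distr_gauss_orthonormal:
  fixes B :: "'w::euclidean_space set"
  assumes "pairwise orthogonal B" "\<And>b. b \<in> B \<Longrightarrow> norm b = 1"
  shows "finite B" "distr gauss_space (PiM B (\<lambda>_. std_normal)) (\<lambda>\<omega>. \<lambda>b\<in>B. gauss_vec \<omega> \<bullet> b) = PiM B (\<lambda>_. std_normal)"
proof -
  obtain B' where B': "B \<subseteq> B'" "pairwise orthogonal B'" "\<And>b. b \<in> B' \<Longrightarrow> norm b = 1"
    "finite B'" "card B' = DIM('w)" "span B' = UNIV" using orthonormal_extend[OF assms] by metis
  show "finite B" using B' finite_subset by metis
  obtain \<pi> where \<pi>: "bij_betw \<pi> B' (Basis :: 'w set)"
    using finite_same_card_bij[OF B'(4) finite_Basis] B'(5) by metis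
  define f where "f x = (\<Sum>b\<in>B'. (x \<bullet> b) *\<^sub>R \<pi> b)" for x
  have inner_\<pi>: "\<pi> b \<bullet> \<pi> c = (if b = c then 1 else 0)" if "b \<in> B'" "c \<in> B'" for b c
  proof -
    have "\<pi> b \<in> Basis" "\<pi> c \<in> Basis" using that \<pi> by (auto simp: bij_betw_def)
    moreover have "\<pi> b = \<pi> c \<longleftrightarrow> b = c" using that \<pi> by (auto simp: bij_betw_def inj_on_def)
    ultimately show ?thesis by (simp add: inner_Basis)
  qed
  have fb: "f x \<bullet> \<pi> b = x \<bullet> b" if "b \<in> B'" for x b
  proof -
    have "f x \<bullet> \<pi> b = (\<Sum>c\<in>B'. if c = b then x \<bullet> b else 0)"
      unfolding f_def inner_sum_left by (intro sum.cong) (use that in \<open>auto simp: inner_\<pi>\<close>)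
    then show ?thesis using that B'(4) by simp
  qed
  have lin: "linear f"
    unfolding f_def by (rule linearI) (simp_all add: inner_add_left scaleR_add_left sum.distrib scaleR_sum_right)
  have fB: "f c = \<pi> c" if "c \<in> B'" for c
  proof -
    have "f c = (\<Sum>b\<in>B'. if b = c then \<pi> c else 0)"
      unfolding f_def using that B'(2,3)
      by (intro sum.cong) (auto simp: pairwise_def orthogonal_def dot_square_norm)
    then show ?thesis using that B'(4) by simp
  qed
  have "f x \<bullet> f y = x \<bullet> y" for x y
  proof -
    have "y \<in> span B'" using B'(6) by simp
    then have "f x \<bullet> f y = x \<bullet> y"
      by (induction rule: span_induct_alt)
         (simp_all add: linear_0[OF lin] linear_add[OF lin] linear_scale[OF lin] inner_add_right fB fb)
    then show ?thesis .
  qed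
  then have f: "orthogonal_transformation f" using lin by (simp add: orthogonal_transformation_def)
  let ?N = "std_normal"
  let ?R = "\<lambda>x. \<lambda>b\<in>B. x \<bullet> \<pi> b"
  have R [measurable]: "?R \<in> measurable borel (PiM B (\<lambda>_. ?N))"
    by (rule measurable_restrict) (simp cong: measurable_cong_sets)
  have [measurable]: "f \<in> borel_measurable borel"
    using lin by (intro borel_measurable_continuous_onI linear_continuous_on) (simp add: linear_conv_bounded_linear)
  have "distr gauss_space (PiM B (\<lambda>_. ?N)) (\<lambda>\<omega>. \<lambda>b\<in>B. gauss_vec \<omega> \<bullet> b)
    = distr (distr gauss_space borel (\<lambda>\<omega>. f (gauss_vec \<omega>))) (PiM B (\<lambda>_. ?N)) ?R"
    by (subst distr_distr, measurable) (intro distr_cong refl, use B'(1) in \<open>auto simp: fb subset_iff intro!: restrict_ext\<close>)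
  also have "\<dots> = distr (distr gauss_space borel gauss_vec) (PiM B (\<lambda>_. ?N)) ?R"
    by (simp add: distr_gauss_vec_orthogonal[OF f])
  also have "\<dots> = distr gauss_space (PiM B (\<lambda>_. ?N)) (\<lambda>\<omega>. \<lambda>b\<in>B. \<omega> (\<pi> b))"
  proof (subst distr_distr, measurable, intro distr_cong refl)
    fix \<omega> :: "'w \<Rightarrow> real"
    show "(?R \<circ> gauss_vec) \<omega> = (\<lambda>b\<in>B. \<omega> (\<pi> b))"
    proof -
      have "\<pi> b \<in> Basis" if "b \<in> B" for b using that B'(1) \<pi> by (auto simp: bij_betw_def)
      then show ?thesis by (auto simp: gauss_vec_def inner_sum_left_Basis intro!: restrict_ext)
    qed
  qed
  also have "\<dots> = PiM B (\<lambda>_. ?N)"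
    unfolding gauss_space_def
    using funcsetI[of B \<pi> Basis] distr_PiM_reindex[of Basis "\<lambda>_. ?N" \<pi> B] B'(1) \<pi> prob_space_normal_density[of 1 0]
    by (auto simp: bij_betw_def o_def subset_iff intro: inj_on_subset)
  finally show "distr gauss_space (PiM B (\<lambda>_. ?N)) (\<lambda>\<omega>. \<lambda>b\<in>B. gauss_vec \<omega> \<bullet> b) = PiM B (\<lambda>_. ?N)" .
qed

lemma nn_integral_gauss_orthonormal:
  fixes B :: "'w::euclidean_space set"
  assumes B: "pairwise orthogonal B" "\<And>b. b \<in> B \<Longrightarrow> norm b = 1"
    and h: "h \<in> borel_measurable (PiM B (\<lambda>_. borel))"
  shows "(\<integral>\<^sup>+\<omega>. h (\<lambda>b\<in>B. gauss_vec \<omega> \<bullet> b) \<partial>gauss_space) = (\<integral>\<^sup>+x. h x \<partial>PiM B (\<lambda>_. std_normal))"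
proof -
  have s: "sets (PiM B (\<lambda>_. std_normal)) = sets (PiM B (\<lambda>_. borel))" by (rule sets_PiM_cong) auto
  have [measurable]: "(\<lambda>\<omega>. \<lambda>b\<in>B. gauss_vec \<omega> \<bullet> b) \<in> measurable gauss_space (PiM B (\<lambda>_. std_normal))"
    by (rule measurable_restrict) (simp cong: measurable_cong_sets)
  have "(\<integral>\<^sup>+x. h x \<partial>PiM B (\<lambda>_. std_normal))
    = (\<integral>\<^sup>+x. h x \<partial>distr gauss_space (PiM B (\<lambda>_. std_normal)) (\<lambda>\<omega>. \<lambda>b\<in>B. gauss_vec \<omega> \<bullet> b))"
    by (simp add: distr_gauss_orthonormal(2)[OF B])
  also have "\<dots> = (\<integral>\<^sup>+\<omega>. h (\<lambda>b\<in>B. gauss_vec \<omega> \<bullet> b) \<partial>gauss_space)"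
    by (rule nn_integral_distr) (use h s in \<open>auto cong: measurable_cong_sets\<close>)
  finally show ?thesis by simp
qed

text \<open>The volume of the ball is the distribution function of both measures, and half-lines
  generate the Borel sets.\<close>

lemma distr_norm_PiM_lborel:
  assumes A: "finite A" "A \<noteq> {}"
  shows "distr (PiM A (\<lambda>_. lborel)) borel (\<lambda>x. sqrt (\<Sum>i\<in>A. (x i)\<^sup>2)) = density lborel
    (\<lambda>\<rho>. ennreal (unit_ball_vol (card A) * card A * \<rho> ^ (card A - 1)) * indicator {0..} \<rho>)" (is "?L = ?R")
proof -
  let ?V = "unit_ball_vol (real (card A))"
  have c: "card A > 0" using A by (simp add: card_gt_0_iff)
  have L: "emeasure ?L {..r} = ennreal (if r > 0 then ?V * r ^ card A else 0)" if "r \<noteq> 0" for r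
  proof (cases "r > 0")
    case True
    have "emeasure ?L {..r} = emeasure (PiM A (\<lambda>_. lborel))
        ({f. sqrt (\<Sum>i\<in>A. (f i)\<^sup>2) \<le> r} \<inter> space (PiM A (\<lambda>_. lborel)))"
      by (subst emeasure_distr) (auto intro!: arg_cong2[where f = emeasure])
    then show ?thesis using True by (simp add: emeasure_cball_aux[OF A(1)])
  next
    case False
    then have "\<not> sqrt (\<Sum>i\<in>A. (x i)\<^sup>2) \<le> r" for x :: "'a \<Rightarrow> real"
      using that real_sqrt_ge_zero[of "\<Sum>i\<in>A. (x i)\<^sup>2"] sum_nonneg[of A "\<lambda>i. (x i)\<^sup>2"]
      by (smt (verit) zero_le_power2)
    then show ?thesis using False by (simp add: emeasure_distr vimage_def)
  qed
  have R: "emeasure ?R {..r} = ennreal (if r > 0 then ?V * r ^ card A else 0)" for r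
  proof (cases "r > 0")
    case True
    have "emeasure ?R {..r} = (\<integral>\<^sup>+\<rho>. ennreal (?V * card A * \<rho> ^ (card A - 1)) * indicator {0..r} \<rho> \<partial>lborel)"
      by (subst emeasure_density) (auto intro!: nn_integral_cong simp: indicator_def)
    also have "\<dots> = ?V * r ^ card A - ?V * 0 ^ card A"
      using True c by (intro nn_integral_FTC_Icc) (auto intro!: derivative_eq_intros)
    finally show ?thesis using True c by simp
  next
    case False
    have "emeasure ?R {..r} = (\<integral>\<^sup>+\<rho>. 0 \<partial>(lborel :: real measure))"
      by (subst emeasure_density, simp, simp, rule nn_integral_cong_AE, rule AE_I[of _ _ "{0}"])
         (use False in \<open>auto simp: indicator_def split: if_splits\<close>)
    then show ?thesis using False by simp
  qed
  \<comment> \<open>The ball volume is available for positive radius; the value at zero is squeezed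
    by the volumes of small balls.\<close>
  have L0: "emeasure ?L {..0} = 0"
  proof -
    have "emeasure ?L {..0} \<le> ennreal (?V * e ^ card A)" if "e > 0" for e
    proof -
      have "emeasure ?L {..0} \<le> emeasure ?L {..e}" using that by (intro emeasure_mono) auto
      then show ?thesis using L[of e] that by simp
    qed
    moreover have "((\<lambda>e. ennreal (?V * e ^ card A)) \<longlongrightarrow> ennreal (?V * 0 ^ card A)) (at_right 0)"
      by (intro tendsto_intros)
    moreover have "\<forall>\<^sub>F e in at_right 0. 0 < (e::real)" by (rule eventually_at_right_less)
    ultimately have "emeasure ?L {..0} \<le> ennreal (?V * 0 ^ card A)"
      by (intro tendsto_lowerbound[of _ _ "at_right 0"]) (auto elim: eventually_mono)
    moreover have "0 ^ card A = (0::real)" using c by (simp add: zero_power)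
    ultimately show ?thesis by simp
  qed
  show ?thesis
  proof (rule measure_eqI_generator_eq[where E = "range atMost" and \<Omega> = UNIV and A = "\<lambda>n. {..real n}"])
    show "Int_stable (range (atMost :: real \<Rightarrow> _))" by (auto simp: Int_stable_def)
    show "emeasure ?L X = emeasure ?R X" if X: "X \<in> range atMost" for X
    proof -
      obtain r where "X = {..r}" using X by (elim imageE)
      then show ?thesis using L[of r] R[of r] L0 by (cases "r = 0") simp_all
    qed
    have "sets (borel :: real measure) = sigma_sets UNIV (range atMost)"
      unfolding borel_eq_atMost by (subst sets_measure_of) auto
    then show "sets ?L = sigma_sets UNIV (range atMost)" "sets ?R = sigma_sets UNIV (range atMost)"
      by simp_all
    show "emeasure ?L {..real n} \<noteq> \<infinity>" for n
      using L[of n] L0 by (cases "n = 0") auto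
    show "(\<Union>n. {..real n}) = UNIV" using real_arch_simple by auto
  qed auto
qed

section \<open>Radial moments and mean norms\<close>

definition gauss_moment :: "nat \<Rightarrow> real" where
  "gauss_moment k = (\<integral>\<rho>. indicator {0..} \<rho> * (\<rho> ^ k * exp (- \<rho>\<^sup>2 / 2)) \<partial>lborel)"

lemma nn_integral_PiM_std_normal_radial:
  assumes A: "finite A" "A \<noteq> {}" and [measurable]: "h \<in> borel_measurable borel"
  shows "(\<integral>\<^sup>+x. h (sqrt (\<Sum>i\<in>A. (x i)\<^sup>2)) \<partial>PiM A (\<lambda>_. std_normal))
    = (1 / sqrt (2 * pi)) ^ card A * unit_ball_vol (card A) * card A *
       (\<integral>\<^sup>+\<rho>. h \<rho> * ennreal (indicator {0..} \<rho> * (\<rho> ^ (card A - 1) * exp (- \<rho>\<^sup>2 / 2))) \<partial>lborel)"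
proof -
  let ?c = "(1 / sqrt (2 * pi)) ^ card A" and ?V = "unit_ball_vol (real (card A))"
  let ?s = "\<lambda>x. sqrt (\<Sum>i\<in>A. (x i)\<^sup>2)"
  have "(\<integral>\<^sup>+x. h (?s x) \<partial>PiM A (\<lambda>_. std_normal))
    = (\<integral>\<^sup>+x. ennreal (?c * exp (- (?s x)\<^sup>2 / 2)) * h (?s x) \<partial>PiM A (\<lambda>_. lborel))"
    unfolding PiM_std_normal[OF A(1)] by (rule nn_integral_density) measurable
  also have "\<dots> = (\<integral>\<^sup>+\<rho>. ennreal (?c * exp (- \<rho>\<^sup>2 / 2)) * h \<rho> \<partial>distr (PiM A (\<lambda>_. lborel)) borel ?s)"
    by (rule nn_integral_distr[symmetric]) measurable
  also have "\<dots> = (\<integral>\<^sup>+\<rho>. (ennreal (?V * card A * \<rho> ^ (card A - 1)) * indicator {0..} \<rho>) *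
      (ennreal (?c * exp (- \<rho>\<^sup>2 / 2)) * h \<rho>) \<partial>lborel)"
    unfolding distr_norm_PiM_lborel[OF A] by (rule nn_integral_density) measurable
  also have "\<dots> = (\<integral>\<^sup>+\<rho>. ennreal (?c * ?V * card A) *
      (h \<rho> * ennreal (indicator {0..} \<rho> * (\<rho> ^ (card A - 1) * exp (- \<rho>\<^sup>2 / 2)))) \<partial>lborel)"
    by (intro nn_integral_cong) (auto simp: indicator_def ennreal_mult mult_ac)
  also have "\<dots> = ennreal (?c * ?V * card A) *
      (\<integral>\<^sup>+\<rho>. h \<rho> * ennreal (indicator {0..} \<rho> * (\<rho> ^ (card A - 1) * exp (- \<rho>\<^sup>2 / 2))) \<partial>lborel)"
    by (rule nn_integral_cmult) measurable
  finally show ?thesis .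
qed

lemma has_gauss_moment:
  "has_bochner_integral lborel (\<lambda>\<rho>. indicator {0..} \<rho> * (\<rho> ^ (2 * k) * exp (- \<rho>\<^sup>2 / 2)))
     (sqrt 2 * 2 ^ k * ((sqrt pi / 2) * (fact (2 * k) / (2 ^ (2 * k) * fact k))))" (is ?even)
  "has_bochner_integral lborel (\<lambda>\<rho>. indicator {0..} \<rho> * (\<rho> ^ (2 * k + 1) * exp (- \<rho>\<^sup>2 / 2)))
     (sqrt 2 * (sqrt 2 * 2 ^ k) * (fact k / 2))" (is ?odd)
proof -
  have *: "has_bochner_integral lborel (\<lambda>\<rho>. indicator {0..} \<rho> * (\<rho> ^ m * exp (- \<rho>\<^sup>2 / 2))) (sqrt 2 * (sqrt 2 ^ m * I))"
    if "has_bochner_integral lborel (\<lambda>x::real. indicator {0..} x *\<^sub>R (exp (- x\<^sup>2) * x ^ m)) I" for m I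
  proof -
    have "has_bochner_integral lborel (\<lambda>x. indicator {0..} (0 + sqrt 2 * x) * ((0 + sqrt 2 * x) ^ m * exp (- (0 + sqrt 2 * x)\<^sup>2 / 2)))
      (sqrt 2 ^ m * I)"
      using has_bochner_integral_mult_right[OF that, of "sqrt 2 ^ m"]
      by (rule has_bochner_integral_cong[THEN iffD1, rotated -1])
         (auto simp: indicator_def power_mult_distrib zero_le_mult_iff)
    then show ?thesis
      using lborel_has_bochner_integral_real_affine_iff[of "sqrt 2"
        "\<lambda>\<rho>. indicator {0..} \<rho> * (\<rho> ^ m * exp (- \<rho>\<^sup>2 / 2))" "sqrt 2 * (sqrt 2 ^ m * I)" 0]
      by (simp only: inverse_eq_divide) simp
  qed
  have "sqrt 2 ^ (2 * k) = 2 ^ k" "sqrt 2 ^ (2 * k + 1) = sqrt 2 * 2 ^ k" by (simp_all add: power_mult)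
  then show ?even ?odd using *[OF gaussian_moment_even_pos[of k]] *[OF gaussian_moment_odd_pos[of k]]
    by (simp_all only: mult.assoc)
qed

lemma gauss_moment_even: "gauss_moment (2 * k) = sqrt 2 * 2 ^ k * ((sqrt pi / 2) * (fact (2 * k) / (2 ^ (2 * k) * fact k)))"
  and gauss_moment_odd: "gauss_moment (2 * k + 1) = sqrt 2 * (sqrt 2 * 2 ^ k) * (fact k / 2)"
  unfolding gauss_moment_def using has_gauss_moment[of k] by (auto dest: has_bochner_integral_integral_eq)

lemma gauss_moment_pos: "gauss_moment k > 0"
proof (cases "even k")
  case True
  then obtain b where k: "k = 2 * b" by (elim evenE)
  show ?thesis unfolding k gauss_moment_even by simp
next
  case False
  then obtain b where k: "k = 2 * b + 1" by (elim oddE)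
  show ?thesis unfolding k gauss_moment_odd by simp
qed

lemma integrable_gauss_moment:
  "integrable lborel (\<lambda>\<rho>::real. indicator {0..} \<rho> * (\<rho> ^ k * exp (- \<rho>\<^sup>2 / 2)) :: real)"
proof (cases "even k")
  case True
  then obtain b where k: "k = 2 * b" by (elim evenE)
  show ?thesis unfolding k using has_gauss_moment(1) by (rule integrable.intros)
next
  case False
  then obtain b where k: "k = 2 * b + 1" by (elim oddE)
  show ?thesis unfolding k using has_gauss_moment(2) by (rule integrable.intros)
qed

lemma nn_integral_gauss_moment:
  "(\<integral>\<^sup>+\<rho>. ennreal (indicator {0..} \<rho> * (\<rho> ^ k * exp (- \<rho>\<^sup>2 / 2))) \<partial>lborel) = ennreal (gauss_moment k)"
  unfolding gauss_moment_def
  by (rule nn_integral_eq_integral[OF integrable_gauss_moment]) (auto simp: indicator_def)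

lemma gauss_moment_rec: "gauss_moment (2 * k + 2) = (2 * k + 1) * gauss_moment (2 * k)"
proof -
  have *: "2 * (k' * (m * B)) / ((4 * P) * (k' * A)) = (m / 2) * (B / (P * A))"
    if "k' \<noteq> 0" for k' m A B P :: real
    using that by (simp add: field_simps)
  have 1: "(fact (2 * Suc k) :: real) = 2 * (real (k + 1) * ((2 * real k + 1) * fact (2 * k)))" by (simp add: algebra_simps)
  have 2: "(fact (Suc k) :: real) = real (k + 1) * fact k" "(2::real) ^ (2 * Suc k) = 4 * 2 ^ (2 * k)"
    by (simp_all add: algebra_simps)
  have "fact (2 * Suc k) / (2 ^ (2 * Suc k) * fact (Suc k)) = ((2 * real k + 1) / 2) * (fact (2 * k) / (2 ^ (2 * k) * fact k) :: real)"
    unfolding 1 2 by (rule *) simp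
  then show ?thesis using gauss_moment_even[of "Suc k"] gauss_moment_even[of k] by (simp add: mult_ac del: fact_Suc)
qed

text \<open>For \<open>r\<close> at least 1 this is the mean norm of a standard Gaussian vector in
  \<open>r\<close> dimensions, by \<open>gauss_mean_norm\<close>.\<close>

definition kappa :: "nat \<Rightarrow> real" where
  "kappa r = gauss_moment r / gauss_moment (r - 1)"

lemma kappa_pos: "kappa r > 0"
  by (simp add: kappa_def gauss_moment_pos)

text \<open>The product telescopes to a quotient of two even moments, one step of the moment
  recursion. It makes Gaussian factors taken in pairs contribute odd integers.\<close>

lemma kappa_product: "kappa (2 * k + 2) * kappa (2 * k + 1) = 2 * k + 1"
  using gauss_moment_pos[of "2 * k"] gauss_moment_pos[of "2 * k + 1"]
  by (simp add: kappa_def gauss_moment_rec[simplified])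

text \<open>Integrating the constant 1 identifies the normalization without evaluating the volume of
  the unit ball.\<close>

lemma radial_constant:
  assumes A: "finite A" "A \<noteq> {}"
  shows "(1 / sqrt (2 * pi)) ^ card A * unit_ball_vol (card A) * card A = 1 / gauss_moment (card A - 1)"
proof -
  have "prob_space (PiM A (\<lambda>_. std_normal))"
    by (intro prob_space_PiM prob_space_normal_density) simp
  then have "1 = (\<integral>\<^sup>+x. 1 \<partial>PiM A (\<lambda>_. std_normal))" by (simp add: prob_space.emeasure_space_1)
  also have "\<dots> = ennreal ((1 / sqrt (2 * pi)) ^ card A * unit_ball_vol (card A) * card A) * ennreal (gauss_moment (card A - 1))"
    using nn_integral_PiM_std_normal_radial[OF A, of "\<lambda>_. 1"] by (simp add: nn_integral_gauss_moment[simplified])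
  also have "\<dots> = ennreal ((1 / sqrt (2 * pi)) ^ card A * unit_ball_vol (card A) * card A * gauss_moment (card A - 1))"
    by (rule ennreal_mult[symmetric]) (simp_all add: less_imp_le[OF gauss_moment_pos])
  finally have "(1 / sqrt (2 * pi)) ^ card A * unit_ball_vol (card A) * card A * gauss_moment (card A - 1) = 1"
    by (metis ennreal_eq_1)
  then show ?thesis using less_imp_neq[OF gauss_moment_pos[of "card A - 1"]] by (subst nonzero_eq_divide_eq) auto
qed

lemma gauss_mean_norm:
  fixes B :: "'w::euclidean_space set"
  assumes B: "pairwise orthogonal B" "\<And>b. b \<in> B \<Longrightarrow> norm b = 1" "B \<noteq> {}"
  shows "has_bochner_integral gauss_space (\<lambda>\<omega>. sqrt (\<Sum>b\<in>B. (gauss_vec \<omega> \<bullet> b)\<^sup>2)) (kappa (card B))"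
proof (rule has_bochner_integral_nn_integral)
  have fin: "finite B" using B by (intro distr_gauss_orthonormal(1))
  have [measurable]: "(\<lambda>x. sqrt (\<Sum>b\<in>B. (x b)\<^sup>2)) \<in> borel_measurable (PiM B (\<lambda>_. borel))" by measurable
  have "(\<integral>\<^sup>+\<omega>. ennreal (sqrt (\<Sum>b\<in>B. (gauss_vec \<omega> \<bullet> b)\<^sup>2)) \<partial>gauss_space)
    = (\<integral>\<^sup>+x. ennreal (sqrt (\<Sum>b\<in>B. (x b)\<^sup>2)) \<partial>PiM B (\<lambda>_. std_normal))"
    using nn_integral_gauss_orthonormal[OF B(1,2), of "\<lambda>x. ennreal (sqrt (\<Sum>b\<in>B. (x b)\<^sup>2))"] by simp
  also have "\<dots> = ennreal (1 / gauss_moment (card B - 1)) *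
       (\<integral>\<^sup>+\<rho>. ennreal \<rho> * ennreal (indicator {0..} \<rho> * (\<rho> ^ (card B - 1) * exp (- \<rho>\<^sup>2 / 2))) \<partial>lborel)"
    using nn_integral_PiM_std_normal_radial[OF fin B(3), of ennreal] by (simp only: radial_constant[OF fin B(3)]) simp
  also have "(\<integral>\<^sup>+\<rho>. ennreal \<rho> * ennreal (indicator {0..} \<rho> * (\<rho> ^ (card B - 1) * exp (- \<rho>\<^sup>2 / 2))) \<partial>lborel)
    = (\<integral>\<^sup>+\<rho>. ennreal (indicator {0..} \<rho> * (\<rho> ^ card B * exp (- \<rho>\<^sup>2 / 2))) \<partial>lborel)"
  proof (rule nn_integral_cong)
    fix \<rho> :: real
    have "\<rho> ^ card B = \<rho> * \<rho> ^ (card B - 1)" using fin B(3) by (simp add: power_eq_if)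
    then show "ennreal \<rho> * ennreal (indicator {0..} \<rho> * (\<rho> ^ (card B - 1) * exp (- \<rho>\<^sup>2 / 2)))
      = ennreal (indicator {0..} \<rho> * (\<rho> ^ card B * exp (- \<rho>\<^sup>2 / 2)))"
      by (auto simp: indicator_def simp flip: ennreal_mult)
  qed
  finally show "(\<integral>\<^sup>+\<omega>. ennreal (sqrt (\<Sum>b\<in>B. (gauss_vec \<omega> \<bullet> b)\<^sup>2)) \<partial>gauss_space) = ennreal (kappa (card B))"
    by (simp add: nn_integral_gauss_moment[simplified] kappa_def less_imp_le[OF gauss_moment_pos] flip: ennreal_mult')
qed (auto simp: less_imp_le[OF kappa_pos] sum_nonneg)

section \<open>The mean absolute difference of exponential variables\<close>

lemma nn_integral_exp_abs_affine:
  fixes a \<mu> :: real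
  assumes "a \<ge> 0" "\<mu> > 0"
  shows "(\<integral>\<^sup>+\<tau>. ennreal (\<bar>a - \<mu> * \<tau>\<^sup>2\<bar> * (indicator {0..} \<tau> * (\<tau> * exp (- \<tau>\<^sup>2 / 2)))) \<partial>lborel)
    = ennreal (a - 2 * \<mu> + 4 * \<mu> * exp (- a / (2 * \<mu>)))"
proof -
  \<comment> \<open>The sign under the absolute value changes at \<open>T\<close>; \<open>F\<close>
    is a primitive without the absolute value and is used with opposite signs on the two
    sides.\<close>
  define T where "T = sqrt (a / \<mu>)"
  have T: "T \<ge> 0" "\<mu> * T\<^sup>2 = a" "T\<^sup>2 = a / \<mu>" using assms by (auto simp: T_def)
  define F where "F \<tau> = (\<mu> * \<tau>\<^sup>2 + 2 * \<mu> - a) * exp (- \<tau>\<^sup>2 / 2)" for \<tau> :: real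
  have F: "(F has_real_derivative (a - \<mu> * \<tau>\<^sup>2) * (\<tau> * exp (- \<tau>\<^sup>2 / 2))) (at \<tau> within S)" for \<tau> S
    unfolding F_def by (auto intro!: derivative_eq_intros simp: field_simps power2_eq_square)
  have FT: "F T = 2 * \<mu> * exp (- a / (2 * \<mu>))" "F 0 = 2 * \<mu> - a"
    using T by (simp_all add: F_def field_simps)
  have le: "\<mu> * \<tau>\<^sup>2 \<le> a" if "0 \<le> \<tau>" "\<tau> \<le> T" for \<tau>
    using mult_left_mono[OF power_mono[OF that(2,1), of 2], of \<mu>] T assms by simp
  have ge: "\<mu> * \<tau>\<^sup>2 \<ge> a" if "T \<le> \<tau>" for \<tau>
    using mult_left_mono[OF power_mono[OF that T(1), of 2], of \<mu>] T assms by simp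
  let ?f = "\<lambda>\<tau>. \<bar>a - \<mu> * \<tau>\<^sup>2\<bar> * (\<tau> * exp (- \<tau>\<^sup>2 / 2))"
  have "(\<integral>\<^sup>+\<tau>. ennreal (\<bar>a - \<mu> * \<tau>\<^sup>2\<bar> * (indicator {0..} \<tau> * (\<tau> * exp (- \<tau>\<^sup>2 / 2)))) \<partial>lborel)
    = (\<integral>\<^sup>+\<tau>. ennreal (?f \<tau>) * indicator {0..T} \<tau> + ennreal (?f \<tau>) * indicator {T..} \<tau> \<partial>lborel)"
    by (rule nn_integral_cong_AE, rule AE_I[of _ _ "{T}"]) (use T(1) in \<open>auto simp: indicator_def\<close>)
  also have "\<dots> = (\<integral>\<^sup>+\<tau>. ennreal (?f \<tau>) * indicator {0..T} \<tau> \<partial>lborel) + (\<integral>\<^sup>+\<tau>. ennreal (?f \<tau>) * indicator {T..} \<tau> \<partial>lborel)"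
    by (rule nn_integral_add) auto
  also have "(\<integral>\<^sup>+\<tau>. ennreal (?f \<tau>) * indicator {0..T} \<tau> \<partial>lborel) = ennreal (F T - F 0)"
  proof (rule nn_integral_FTC_Icc)
    show "(F has_real_derivative ?f x) (at x)" if "x \<in> {0..T}" for x
      using F[of x UNIV] le[of x] that by simp
  qed (use T in auto)
  also have "(\<integral>\<^sup>+\<tau>. ennreal (?f \<tau>) * indicator {T..} \<tau> \<partial>lborel) = ennreal (0 - (- F T))"
  proof (rule nn_integral_FTC_atLeast)
    show "((\<lambda>x. - F x) has_real_derivative ?f x) (at x)" if "T \<le> x" for x
      using DERIV_minus[OF F[of x UNIV]] ge[OF that] by (simp add: minus_mult_left)
    show "((\<lambda>x. - F x) \<longlongrightarrow> 0) at_top" unfolding F_def using assms by real_asymp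
  qed (use T in auto)
  \<comment> \<open>The first summand is nonnegative by 1 + x \<le> exp x, so the two extended
    values may be added as real numbers.\<close>
  also have "ennreal (F T - F 0) + ennreal (0 - (- F T)) = ennreal (F T - F 0 + F T)"
  proof -
    have "1 + (- a / (2 * \<mu>)) \<le> exp (- a / (2 * \<mu>))" by (rule exp_ge_add_one_self)
    then have "2 * \<mu> * (1 + (- a / (2 * \<mu>))) \<le> 2 * \<mu> * exp (- a / (2 * \<mu>))"
      using assms by (intro mult_left_mono) auto
    moreover have "2 * \<mu> * (1 + (- a / (2 * \<mu>))) = 2 * \<mu> - a" using assms by (simp add: right_diff_distrib)
    ultimately have "F T \<ge> F 0" by (simp add: FT)
    then show ?thesis using assms by (subst ennreal_plus[symmetric]) (auto simp: FT)
  qed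
  also have "F T - F 0 + F T = a - 2 * \<mu> + 4 * \<mu> * exp (- a / (2 * \<mu>))" by (simp add: FT)
  finally show ?thesis .
qed

text \<open>Half the squared radius of a planar Gaussian is exponentially distributed, so this is 2
  E|l X - \<mu> Y| for independent standard exponential variables, that is, 2 (l^2 + \<mu>^2) / (l +
  \<mu>). The normalization of \<open>l + \<mu>\<close> leaves a polynomial.\<close>

lemma nn_integral_exp_abs_difference:
  fixes l \<mu> :: real
  assumes "l \<ge> 0" "\<mu> \<ge> 0" "l + \<mu> = 1"
  shows "(\<integral>\<^sup>+\<rho>. (\<integral>\<^sup>+\<tau>. ennreal (\<bar>l * \<rho>\<^sup>2 - \<mu> * \<tau>\<^sup>2\<bar> * (indicator {0..} \<tau> * (\<tau> * exp (- \<tau>\<^sup>2 / 2)))) \<partial>lborel) *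
      ennreal (indicator {0..} \<rho> * (\<rho> * exp (- \<rho>\<^sup>2 / 2))) \<partial>lborel) = ennreal (2 * (l\<^sup>2 + \<mu>\<^sup>2))"
proof (cases "\<mu> = 0")
  \<comment> \<open>The primitive used for positive \<mu> divides by \<mu>, so this case is
    separate; it is a single third moment.\<close>
  case True
  then have "l = 1" using assms by simp
  have "(\<integral>\<^sup>+\<tau>. ennreal (\<rho>\<^sup>2 * (indicator {0..} \<tau> * (\<tau> * exp (- \<tau>\<^sup>2 / 2)))) \<partial>lborel) = ennreal (\<rho>\<^sup>2)" for \<rho> :: real
    using nn_integral_gauss_moment[of 1] gauss_moment_odd[of 0]
    by (subst ennreal_mult') (auto simp: nn_integral_cmult simp flip: real_sqrt_mult)
  then have "(\<integral>\<^sup>+\<rho>. (\<integral>\<^sup>+\<tau>. ennreal (\<bar>l * \<rho>\<^sup>2 - \<mu> * \<tau>\<^sup>2\<bar> * (indicator {0..} \<tau> * (\<tau> * exp (- \<tau>\<^sup>2 / 2)))) \<partial>lborel) *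
      ennreal (indicator {0..} \<rho> * (\<rho> * exp (- \<rho>\<^sup>2 / 2))) \<partial>lborel)
     = (\<integral>\<^sup>+\<rho>. ennreal (indicator {0..} \<rho> * (\<rho> ^ 3 * exp (- \<rho>\<^sup>2 / 2))) \<partial>lborel)"
    using True \<open>l = 1\<close> by (auto intro!: nn_integral_cong simp: indicator_def power2_eq_square power3_eq_cube mult_ac simp flip: ennreal_mult')
  then show ?thesis using nn_integral_gauss_moment[of 3] gauss_moment_odd[of 1] True \<open>l = 1\<close>
    by (simp add: numeral_3_eq_3 flip: real_sqrt_mult)
next
  case False
  then have m: "\<mu> > 0" using assms by simp
  \<comment> \<open>Two exponentials occur because the inner integral contributes exp (- l \<rho>^2
    / (2 \<mu>)), which combines with the Gaussian weight to exp (- \<rho>^2 / (2 \<mu>)), as l +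
    \<mu> = 1.\<close>
  define F where "F \<rho> = - (l * \<rho>\<^sup>2 + 2 * l - 2 * \<mu>) * exp (- \<rho>\<^sup>2 / 2) - 4 * \<mu>\<^sup>2 * exp (- \<rho>\<^sup>2 / (2 * \<mu>))" for \<rho>
  define f where "f \<rho> = (l * \<rho>\<^sup>2 - 2 * \<mu> + 4 * \<mu> * exp (- (l * \<rho>\<^sup>2) / (2 * \<mu>))) * (\<rho> * exp (- \<rho>\<^sup>2 / 2))" for \<rho>
  have pos: "l * \<rho>\<^sup>2 - 2 * \<mu> + 4 * \<mu> * exp (- (l * \<rho>\<^sup>2) / (2 * \<mu>)) \<ge> 0" for \<rho>
  proof -
    have "1 + (- (l * \<rho>\<^sup>2) / (2 * \<mu>)) \<le> exp (- (l * \<rho>\<^sup>2) / (2 * \<mu>))" by (rule exp_ge_add_one_self)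
    then have "2 * \<mu> * (1 + (- (l * \<rho>\<^sup>2) / (2 * \<mu>))) \<le> 2 * \<mu> * exp (- (l * \<rho>\<^sup>2) / (2 * \<mu>))"
      using m by (intro mult_left_mono) auto
    moreover have "2 * \<mu> * (1 + (- (l * \<rho>\<^sup>2) / (2 * \<mu>))) = 2 * \<mu> - l * \<rho>\<^sup>2"
      using m by (simp add: right_diff_distrib)
    ultimately have "2 * \<mu> - l * \<rho>\<^sup>2 \<le> 2 * \<mu> * exp (- (l * \<rho>\<^sup>2) / (2 * \<mu>))" by simp
    moreover have "0 \<le> \<mu> * exp (- (l * \<rho>\<^sup>2) / (2 * \<mu>))" using m by simp
    ultimately show ?thesis by linarith
  qed
  have "(\<integral>\<^sup>+\<rho>. (\<integral>\<^sup>+\<tau>. ennreal (\<bar>l * \<rho>\<^sup>2 - \<mu> * \<tau>\<^sup>2\<bar> * (indicator {0..} \<tau> * (\<tau> * exp (- \<tau>\<^sup>2 / 2)))) \<partial>lborel) *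
      ennreal (indicator {0..} \<rho> * (\<rho> * exp (- \<rho>\<^sup>2 / 2))) \<partial>lborel) = (\<integral>\<^sup>+\<rho>. ennreal (f \<rho>) * indicator {0..} \<rho> \<partial>lborel)"
  proof (rule nn_integral_cong)
    fix \<rho> :: real
    have "l * \<rho>\<^sup>2 \<ge> 0" using assms by simp
    note inner = nn_integral_exp_abs_affine[OF this m]
    show "(\<integral>\<^sup>+\<tau>. ennreal (\<bar>l * \<rho>\<^sup>2 - \<mu> * \<tau>\<^sup>2\<bar> * (indicator {0..} \<tau> * (\<tau> * exp (- \<tau>\<^sup>2 / 2)))) \<partial>lborel) *
      ennreal (indicator {0..} \<rho> * (\<rho> * exp (- \<rho>\<^sup>2 / 2))) = ennreal (f \<rho>) * indicator {0..} \<rho>"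
    proof (cases "\<rho> \<ge> 0")
      case True
      then have "ennreal (f \<rho>) = ennreal (l * \<rho>\<^sup>2 - 2 * \<mu> + 4 * \<mu> * exp (- (l * \<rho>\<^sup>2) / (2 * \<mu>))) * ennreal (\<rho> * exp (- \<rho>\<^sup>2 / 2))"
        unfolding f_def by (intro ennreal_mult'') simp
      then show ?thesis unfolding inner using True by simp
    qed simp
  qed
  also have "\<dots> = ennreal (0 - F 0)"
  proof (rule nn_integral_FTC_atLeast)
    show "(F has_real_derivative f x) (at x)" for x
    proof -
      have "exp (- (l * x\<^sup>2) / (2 * \<mu>)) * exp (- x\<^sup>2 / 2) = exp (- x\<^sup>2 / (2 * \<mu>))"
      proof -
        have "- (l * x\<^sup>2) / (2 * \<mu>) + - x\<^sup>2 / 2 = - ((l + \<mu>) * x\<^sup>2) / (2 * \<mu>)"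
          using m by (simp add: field_simps)
        then show ?thesis using assms(3) by (simp flip: exp_add)
      qed
      then have "f x = (l * x\<^sup>2 - 2 * \<mu>) * (x * exp (- x\<^sup>2 / 2)) + 4 * \<mu> * x * exp (- x\<^sup>2 / (2 * \<mu>))"
        unfolding f_def by (simp add: algebra_simps)
      then show ?thesis
        unfolding F_def using m by (auto intro!: derivative_eq_intros simp: field_simps power2_eq_square)
    qed
    show "0 \<le> f x" if "0 \<le> x" for x using pos[of x] that by (simp add: f_def)
    have "((\<lambda>\<rho>::real. \<rho>\<^sup>2 * exp (- \<rho>\<^sup>2 / 2)) \<longlongrightarrow> 0) at_top" "((\<lambda>\<rho>::real. exp (- \<rho>\<^sup>2 / 2)) \<longlongrightarrow> 0) at_top"
      "((\<lambda>\<rho>::real. exp (- \<rho>\<^sup>2 / (2 * \<mu>))) \<longlongrightarrow> 0) at_top"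
      using m by real_asymp+
    then have "((\<lambda>\<rho>. - (l * (\<rho>\<^sup>2 * exp (- \<rho>\<^sup>2 / 2)) + (2 * l - 2 * \<mu>) * exp (- \<rho>\<^sup>2 / 2))
        - 4 * \<mu>\<^sup>2 * exp (- \<rho>\<^sup>2 / (2 * \<mu>))) \<longlongrightarrow> - (l * 0 + (2 * l - 2 * \<mu>) * 0) - 4 * \<mu>\<^sup>2 * 0) at_top"
      by (intro tendsto_intros)
    then show "(F \<longlongrightarrow> 0) at_top" unfolding F_def by (simp add: algebra_simps)
  qed (simp add: f_def)
  also have "0 - F 0 = 2 * (l\<^sup>2 + \<mu>\<^sup>2)"
  proof -
    have l: "l = 1 - \<mu>" using assms by simp
    show ?thesis unfolding F_def l by (simp add: power2_eq_square algebra_simps)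
  qed
  finally show ?thesis .
qed

text \<open>Each eigenvalue has multiplicity two, so the quadratic form depends on two independent
  planar radii, and Fubini with radial integration reduces it to the exponential
  computation.\<close>

lemma gauss_mean_abs_difference:
  fixes A B :: "'w::euclidean_space set"
  assumes AB: "pairwise orthogonal (A \<union> B)" "\<And>b. b \<in> A \<union> B \<Longrightarrow> norm b = 1" "card A = 2" "card B = 2" "A \<inter> B = {}"
    and l: "l \<ge> 0" "\<mu> \<ge> 0" "l + \<mu> = 1"
  shows "has_bochner_integral gauss_space
    (\<lambda>\<omega>. \<bar>l * (\<Sum>b\<in>A. (gauss_vec \<omega> \<bullet> b)\<^sup>2) - \<mu> * (\<Sum>b\<in>B. (gauss_vec \<omega> \<bullet> b)\<^sup>2)\<bar>) (2 * (l\<^sup>2 + \<mu>\<^sup>2))"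
proof (rule has_bochner_integral_nn_integral)
  interpret S: prob_space std_normal by (rule prob_space_normal_density) simp
  interpret N: product_sigma_finite "\<lambda>_::'w. std_normal" by standard
  have fin: "finite A" "finite B" "A \<noteq> {}" "B \<noteq> {}" using AB by (auto intro: card_ge_0_finite)
  let ?h = "\<lambda>x. ennreal \<bar>l * (\<Sum>b\<in>A. (x b)\<^sup>2) - \<mu> * (\<Sum>b\<in>B. (x b)\<^sup>2)\<bar>"
  have sets: "sets (PiM I (\<lambda>_. std_normal)) = sets (PiM I (\<lambda>_. borel))" for I :: "'w set" by (rule sets_PiM_cong) auto
  have h: "?h \<in> borel_measurable (PiM (A \<union> B) (\<lambda>_. borel))" by measurable
  \<comment> \<open>In two dimensions the radial density \<rho> exp (- \<rho>^2 / 2) is already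
    normalized.\<close>
  have c: "1 / gauss_moment 1 = 1" using gauss_moment_odd[of 0] by (simp flip: real_sqrt_mult)
  have rad: "(\<integral>\<^sup>+x. h (sqrt (\<Sum>i\<in>I. (x i)\<^sup>2)) \<partial>PiM I (\<lambda>_. std_normal))
    = (\<integral>\<^sup>+\<rho>. h \<rho> * ennreal (indicator {0..} \<rho> * (\<rho> * exp (- \<rho>\<^sup>2 / 2))) \<partial>lborel)"
    if "finite I" "card I = 2" "h \<in> borel_measurable borel" for I :: "'w set" and h
  proof -
    have "I \<noteq> {}" using that by auto
    then show ?thesis
      using nn_integral_PiM_std_normal_radial[OF that(1) _ that(3)] radial_constant[OF that(1)] that(2) c by simp
  qed
  have sq: "(\<Sum>b\<in>I. (x b)\<^sup>2) = (sqrt (\<Sum>b\<in>I. (x b)\<^sup>2))\<^sup>2" for I and x :: "'w \<Rightarrow> real" by (simp add: sum_nonneg)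
  have "(\<integral>\<^sup>+\<omega>. ennreal \<bar>l * (\<Sum>b\<in>A. (gauss_vec \<omega> \<bullet> b)\<^sup>2) - \<mu> * (\<Sum>b\<in>B. (gauss_vec \<omega> \<bullet> b)\<^sup>2)\<bar> \<partial>gauss_space)
    = (\<integral>\<^sup>+x. ?h x \<partial>PiM (A \<union> B) (\<lambda>_. std_normal))"
    using nn_integral_gauss_orthonormal[OF AB(1,2) h] by simp
  also have "\<dots> = (\<integral>\<^sup>+x. \<integral>\<^sup>+y. ?h (merge A B (x, y)) \<partial>PiM B (\<lambda>_. std_normal) \<partial>PiM A (\<lambda>_. std_normal))"
    using h fin AB(5) by (intro N.product_nn_integral_fold) (auto simp: sets cong: measurable_cong_sets)
  also have "\<dots> = (\<integral>\<^sup>+x. \<integral>\<^sup>+y. ennreal \<bar>l * (sqrt (\<Sum>b\<in>A. (x b)\<^sup>2))\<^sup>2 - \<mu> * (sqrt (\<Sum>b\<in>B. (y b)\<^sup>2))\<^sup>2\<bar>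
       \<partial>PiM B (\<lambda>_. std_normal) \<partial>PiM A (\<lambda>_. std_normal))"
  proof -
    have "(\<Sum>b\<in>A. (merge A B (x, y) b)\<^sup>2) = (\<Sum>b\<in>A. (x b)\<^sup>2)" "(\<Sum>b\<in>B. (merge A B (x, y) b)\<^sup>2) = (\<Sum>b\<in>B. (y b)\<^sup>2)"
      for x y :: "'w \<Rightarrow> real" using AB(5) by (auto intro!: sum.cong simp: merge_def)
    then show ?thesis by (simp only: flip: sq)
  qed
  also have "\<dots> = (\<integral>\<^sup>+x. (\<integral>\<^sup>+\<tau>. ennreal \<bar>l * (sqrt (\<Sum>b\<in>A. (x b)\<^sup>2))\<^sup>2 - \<mu> * \<tau>\<^sup>2\<bar> *
       ennreal (indicator {0..} \<tau> * (\<tau> * exp (- \<tau>\<^sup>2 / 2))) \<partial>lborel) \<partial>PiM A (\<lambda>_. std_normal))"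
    by (intro nn_integral_cong rad) (use fin AB in auto)
  also have "\<dots> = (\<integral>\<^sup>+\<rho>. (\<integral>\<^sup>+\<tau>. ennreal \<bar>l * \<rho>\<^sup>2 - \<mu> * \<tau>\<^sup>2\<bar> * ennreal (indicator {0..} \<tau> * (\<tau> * exp (- \<tau>\<^sup>2 / 2))) \<partial>lborel) *
      ennreal (indicator {0..} \<rho> * (\<rho> * exp (- \<rho>\<^sup>2 / 2))) \<partial>lborel)"
    by (rule rad) (use fin AB in \<open>simp_all\<close>)
  also have "\<dots> = ennreal (2 * (l\<^sup>2 + \<mu>\<^sup>2))"
    using nn_integral_exp_abs_difference[OF l] by (simp add: ennreal_mult')
  finally show "(\<integral>\<^sup>+\<omega>. ennreal \<bar>l * (\<Sum>b\<in>A. (gauss_vec \<omega> \<bullet> b)\<^sup>2) - \<mu> * (\<Sum>b\<in>B. (gauss_vec \<omega> \<bullet> b)\<^sup>2)\<bar> \<partial>gauss_space)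
    = ennreal (2 * (l\<^sup>2 + \<mu>\<^sup>2))" .
qed auto

section \<open>Haar measure on the unitary group\<close>

text \<open>A matrix is treated as the family \<open>G\<close> of its columns \<open>G $ j\<close>, so that left multiplication acts
  on each member of the family. The Gram-Schmidt steps commute with left multiplication by a
  unitary matrix, hence transport a left invariant measure on invertible matrices to the group.\<close>

definition cinner :: "complex ^ 'n \<Rightarrow> complex ^ 'n::finite \<Rightarrow> complex" where
  "cinner x y = (\<Sum>i\<in>UNIV. cnj (x $ i) * y $ i)"

lemma cinner_diff: "cinner x (y - z) = cinner x y - cinner x z"
  and cinner_scale: "cinner x (c *s y) = c * cinner x y"
  and cinner_scale_left: "cinner (c *s x) y = cnj c * cinner x y"
  by (simp_all add: cinner_def algebra_simps sum.distrib sum_subtractf sum_distrib_left)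

lemma cinner_commute: "cinner y x = cnj (cinner x y)"
  by (simp add: cinner_def mult.commute)

lemma cinner_self: "cinner x x = complex_of_real ((norm x)\<^sup>2)"
proof -
  have "cinner x x = complex_of_real (\<Sum>i\<in>UNIV. (norm (x $ i))\<^sup>2)"
    unfolding cinner_def of_real_sum by (intro sum.cong refl) (metis complex_norm_square mult.commute)
  also have "(\<Sum>i\<in>UNIV. (norm (x $ i))\<^sup>2) = (norm x)\<^sup>2"
    by (simp add: norm_vec_def L2_set_def sum_nonneg)
  finally show ?thesis .
qed

definition cadjoint :: "complex ^ 'n ^ 'n \<Rightarrow> complex ^ 'n::finite ^ 'n" where
  "cadjoint A = (\<chi> i j. cnj (A $ j $ i))"

lemma unitary_group_iff: "A \<in> unitary_group \<longleftrightarrow> cadjoint A ** A = mat 1"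
  by (simp add: unitary_group_def cadjoint_def)

lemma cinner_mult: "cinner x (A *v y) = cinner (cadjoint A *v x) y"
proof -
  have "cinner x (A *v y) = (\<Sum>i\<in>UNIV. \<Sum>j\<in>UNIV. cnj (x $ i) * A $ i $ j * y $ j)"
    by (simp add: cinner_def matrix_vector_mult_def sum_distrib_left mult.assoc)
  also have "\<dots> = (\<Sum>j\<in>UNIV. \<Sum>i\<in>UNIV. cnj (x $ i) * A $ i $ j * y $ j)" by (rule sum.swap)
  also have "\<dots> = cinner (cadjoint A *v x) y"
    by (simp add: cinner_def matrix_vector_mult_def cadjoint_def sum_distrib_right sum_distrib_left mult_ac)
  finally show ?thesis .
qed

lemma unitary_cinner:
  assumes "A \<in> unitary_group"
  shows "cinner (A *v x) (A *v y) = cinner x y"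
proof -
  have "cadjoint A *v (A *v x) = x"
    using assms by (simp add: unitary_group_iff matrix_vector_mul_assoc)
  then show ?thesis by (simp add: cinner_mult)
qed

lemma unitary_norm: "A \<in> unitary_group \<Longrightarrow> norm (A *v x) = norm x"
  using unitary_cinner[of A x x] by (simp add: cinner_self flip: of_real_power)

definition family_act :: "complex ^ 'n ^ 'n \<Rightarrow> complex ^ 'n ^ 'n \<Rightarrow> complex ^ 'n::finite ^ 'n" where
  "family_act B G = (\<chi> j. B *v (G $ j))"

text \<open>A member indexed by \<open>S\<close> has to be orthogonal to every other member, also to
  those outside \<open>S\<close>. This stronger property is the invariant of the Gram-Schmidt
  steps.\<close>

definition orthonormal_family :: "complex ^ 'n ^ 'n \<Rightarrow> 'n::finite set \<Rightarrow> bool" where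
  "orthonormal_family G S \<longleftrightarrow> (\<forall>i\<in>S. \<forall>j. cinner (G $ i) (G $ j) = (if i = j then 1 else 0))"

definition independent_family :: "complex ^ 'n ^ 'n::finite \<Rightarrow> bool" where
  "independent_family G \<longleftrightarrow> (\<forall>c. (\<Sum>j\<in>UNIV. c j *s G $ j) = 0 \<longrightarrow> (\<forall>j. c j = 0))"

text \<open>All other members are cleared of their component along the chosen one at once, so that a
  finished member is left unchanged by later steps.\<close>

definition gs_step :: "'n \<Rightarrow> complex ^ 'n ^ 'n \<Rightarrow> complex ^ 'n::finite ^ 'n" where
  "gs_step i G = (\<chi> j. if j = i then complex_of_real (1 / norm (G $ i)) *s G $ i
     else G $ j - (cinner (G $ i) (G $ j) / complex_of_real ((norm (G $ i))\<^sup>2)) *s G $ i)"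

lemma gs_step_act:
  assumes "B \<in> unitary_group"
  shows "gs_step i (family_act B G) = family_act B (gs_step i G)"
proof (rule vec_eq_iff[THEN iffD2], rule allI)
  fix j
  show "gs_step i (family_act B G) $ j = family_act B (gs_step i G) $ j"
    using assms
    by (simp add: gs_step_def family_act_def unitary_norm unitary_cinner matrix_vector_mult_diff_distrib vector_scalar_commute)
qed

lemma gs_step_independent:
  assumes "independent_family G"
  shows "G $ i \<noteq> 0" "independent_family (gs_step i G)"
proof -
  show nz: "G $ i \<noteq> 0"
  proof
    assume "G $ i = 0"
    then have "(\<Sum>j\<in>UNIV. (if j = i then 1 else 0) *s G $ j) = 0"
      by (intro sum.neutral) auto
    from assms[unfolded independent_family_def, rule_format, OF this, of i] show False by simp
  qed
  define a where "a j = cinner (G $ i) (G $ j) / complex_of_real ((norm (G $ i))\<^sup>2)" for j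
  show "independent_family (gs_step i G)"
    unfolding independent_family_def
  proof (intro allI impI)
    fix c j assume c: "(\<Sum>j\<in>UNIV. c j *s gs_step i G $ j) = 0"
    \<comment> \<open>The coefficient of \<open>G $ i\<close> once the relation among the new
      members is rewritten in the old ones; after the other coefficients it forces
      \<open>c i\<close> to vanish.\<close>
    define e where "e = c i * complex_of_real (1 / norm (G $ i)) - (\<Sum>j\<in>UNIV - {i}. c j * a j)"
    have "(\<Sum>j\<in>UNIV. c j *s gs_step i G $ j)
      = c i *s gs_step i G $ i + (\<Sum>j\<in>UNIV - {i}. c j *s gs_step i G $ j)"
      by (rule sum.remove) auto
    also have "\<dots> = (c i * complex_of_real (1 / norm (G $ i))) *s G $ i + (\<Sum>j\<in>UNIV - {i}. c j *s G $ j - (c j * a j) *s G $ i)"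
      by (intro arg_cong2[where f = "(+)"] sum.cong) (auto simp: gs_step_def a_def vector_ssub_ldistrib)
    also have "\<dots> = e *s G $ i + (\<Sum>j\<in>UNIV - {i}. c j *s G $ j)"
      by (simp add: e_def sum_subtractf vec.scale_sum_left vec.scale_left_diff_distrib)
    also have "\<dots> = (\<Sum>j\<in>UNIV. (if j = i then e else c j) *s G $ j)"
      by (subst sum.remove[of UNIV i]) auto
    finally have "(\<Sum>j\<in>UNIV. (if j = i then e else c j) *s G $ j) = 0" using c by simp
    from assms[unfolded independent_family_def, rule_format, OF this]
    have 0: "(if j = i then e else c j) = 0" for j .
    have 1: "c j = 0" if "j \<noteq> i" for j using that 0[of j] by simp
    have "e = 0" using 0[of i] by simp
    moreover have "e = c i * complex_of_real (1 / norm (G $ i))" using 1 by (simp add: e_def)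
    ultimately have "c i = 0" using nz by simp
    with 1 show "c j = 0" by metis
  qed
qed

lemma gs_step_orthonormal:
  assumes "orthonormal_family G S" "G $ i \<noteq> 0" "i \<notin> S"
  shows "orthonormal_family (gs_step i G) (insert i S)"
proof -
  have n: "complex_of_real (norm (G $ i)) \<noteq> 0" using assms(2) by simp
  have 1: "cinner (G $ k) (G $ j) = (if k = j then 1 else 0)" if "k \<in> S" for k j
    using assms(1) that by (auto simp: orthonormal_family_def)
  have 2: "gs_step i G $ k = G $ k" if "k \<in> S" for k
  proof -
    have "cinner (G $ i) (G $ k) = 0" using 1[OF that, of i] assms(3) that cinner_commute[of "G $ i" "G $ k"] by auto
    then show ?thesis using that assms(3) by (auto simp: gs_step_def)
  qed
  have "cinner (gs_step i G $ i) (gs_step i G $ j) = (if i = j then 1 else 0)" for j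
    using n by (auto simp: gs_step_def cinner_diff cinner_scale cinner_scale_left cinner_self power2_eq_square)
  moreover have "cinner (gs_step i G $ k) (gs_step i G $ j) = (if k = j then 1 else 0)" if "k \<in> S" for k j
    using that assms(3) 1[OF that] by (auto simp: 2[OF that]) (auto simp: gs_step_def cinner_diff cinner_scale)
  ultimately show ?thesis by (auto simp: orthonormal_family_def)
qed

definition gram_schmidt_list :: "'n list \<Rightarrow> complex ^ 'n ^ 'n \<Rightarrow> complex ^ 'n::finite ^ 'n" where
  "gram_schmidt_list = fold gs_step"

lemma gram_schmidt_list_orthonormal:
  "orthonormal_family G S \<Longrightarrow> independent_family G \<Longrightarrow> distinct is \<Longrightarrow> S \<inter> set is = {} \<Longrightarrow>
     orthonormal_family (gram_schmidt_list is G) (S \<union> set is)"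
proof (induction "is" arbitrary: G S)
  case (Cons i "is")
  have "orthonormal_family (gram_schmidt_list is (gs_step i G)) (insert i S \<union> set is)"
    using Cons.prems gs_step_independent[of G i] by (intro Cons.IH gs_step_orthonormal) auto
  then show ?case by (simp add: gram_schmidt_list_def)
qed (simp add: gram_schmidt_list_def)

lemma gram_schmidt_list_act:
  "B \<in> unitary_group \<Longrightarrow> gram_schmidt_list is (family_act B G) = family_act B (gram_schmidt_list is G)"
  by (induction "is" arbitrary: G) (simp_all add: gram_schmidt_list_def gs_step_act)

lemma measurable_vec_nth [measurable (raw)]:
  "f \<in> borel_measurable M \<Longrightarrow> (\<lambda>x. f x $ i :: 'b::euclidean_space) \<in> borel_measurable M"
  by (rule measurable_compose[OF _ borel_measurable_continuous_onI]) (auto intro: continuous_intros)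

lemma borel_measurable_vec_lambda:
  fixes f :: "'a \<Rightarrow> 'n::finite \<Rightarrow> 'b::euclidean_space"
  assumes "\<And>j. (\<lambda>x. f x j) \<in> borel_measurable M"
  shows "(\<lambda>x. \<chi> j. f x j) \<in> borel_measurable M"
proof (subst borel_measurable_euclidean_space, intro ballI)
  fix b :: "'b ^ 'n" assume "b \<in> Basis"
  then obtain j u where "b = axis j u" by (auto simp: Basis_vec_def)
  then show "(\<lambda>x. (\<chi> j. f x j) \<bullet> b) \<in> borel_measurable M"
    using assms[of j] by (simp add: inner_axis)
qed

lemma measurable_gs_step [measurable]: "gs_step i \<in> borel_measurable borel"
  unfolding gs_step_def cinner_def vector_scalar_mult_def
  by (intro borel_measurable_vec_lambda measurable_If borel_measurable_diff) 
     (auto intro!: borel_measurable_vec_lambda borel_measurable_times borel_measurable_divide borel_measurable_sum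
       measurable_vec_nth borel_measurable_continuous_onI[of cnj, THEN measurable_compose[rotated]] continuous_intros)

lemma measurable_gram_schmidt_list [measurable]: "gram_schmidt_list is \<in> borel_measurable borel"
proof (induction "is")
  case (Cons i "is")
  have "gram_schmidt_list (i # is) = gram_schmidt_list is \<circ> gs_step i" by (simp add: gram_schmidt_list_def fun_eq_iff)
  then show ?case using Cons by (simp add: measurable_comp[OF measurable_gs_step])
qed (simp add: gram_schmidt_list_def id_def)

lemma independent_family_iff_det: "independent_family G \<longleftrightarrow> det G \<noteq> 0"
proof -
  have "row i G = G $ i" for i by (simp add: row_def vec_eq_iff)
  then show ?thesis
    using matrix_right_invertible_independent_rows[of G] invertible_det_nz[of G] invertible_right_inverse[of G]
    by (auto simp: independent_family_def)
qed

lemma open_independent_family: "open {G :: complex ^ 'n ^ 'n::finite. independent_family G}"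
proof -
  have "continuous_on UNIV (det :: complex ^ 'n ^ 'n \<Rightarrow> complex)"
    unfolding det_def[abs_def] by (intro continuous_intros)
  then have "open (det -` (- {0}) :: (complex ^ 'n ^ 'n) set)" by (intro open_vimage) auto
  then show ?thesis by (simp add: independent_family_iff_det vimage_def Compl_eq)
qed

text \<open>This set is open, nonempty, bounded and stable under unitary left multiplication, so
  normalized Lebesgue measure on it is an invariant probability measure to which Gram-Schmidt can be
  applied.\<close>

definition haar_seed :: "(complex ^ 'n ^ 'n::finite) set" where
  "haar_seed = {G. norm G < 1 \<and> independent_family G}"

lemma open_haar_seed: "open haar_seed"
proof -
  have "haar_seed = ball 0 1 \<inter> {G. independent_family G}" by (auto simp: haar_seed_def)
  then show ?thesis using open_independent_family by (metis open_Int open_ball)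
qed

lemma haar_seed_measurable [measurable]: "haar_seed \<in> sets borel"
  by (rule borel_open[OF open_haar_seed])

lemma emeasure_haar_seed: "emeasure lborel (haar_seed :: (complex ^ 'n ^ 'n::finite) set) \<noteq> 0"
  "emeasure lborel (haar_seed :: (complex ^ 'n ^ 'n) set) \<noteq> \<infinity>"
proof -
  define I :: "complex ^ 'n ^ 'n" where "I = mat 1"
  have "I \<noteq> 0" by (auto simp: I_def mat_def vec_eq_iff)
  then have I: "det I = 1" "norm I \<noteq> 0" by (simp_all add: I_def)
  define c where "c = 1 / (2 * norm I)"
  have "det (c *\<^sub>R I) \<noteq> 0"
  proof -
    have "c *\<^sub>R I = (\<chi> i. complex_of_real c *s I $ i)" by (simp add: vec_eq_iff) (simp add: scaleR_conv_of_real)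
    then have "det (c *\<^sub>R I) = (\<Prod>i\<in>(UNIV :: 'n set). complex_of_real c) * det (\<chi> i. I $ i)" by (simp only: det_rows_mul)
    then show ?thesis using I by (simp add: c_def)
  qed
  then have "c *\<^sub>R I \<in> haar_seed" using I by (simp add: haar_seed_def independent_family_iff_det c_def)
  then obtain e where e: "e > 0" "ball (c *\<^sub>R I) e \<subseteq> haar_seed" using open_haar_seed open_contains_ball by metis
  have "emeasure lborel (ball (c *\<^sub>R I) e) \<noteq> 0"
    using e(1) unit_ball_vol_pos[of "real DIM(complex ^ 'n ^ 'n)", THEN less_imp_neq] by (simp add: emeasure_ball)
  moreover have "emeasure lborel (ball (c *\<^sub>R I) e) \<le> emeasure lborel (haar_seed :: (complex ^ 'n ^ 'n) set)"
    using e(2) by (intro emeasure_mono) auto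
  ultimately show "emeasure lborel (haar_seed :: (complex ^ 'n ^ 'n) set) \<noteq> 0" by auto
  have "emeasure lborel (haar_seed :: (complex ^ 'n ^ 'n) set) \<le> emeasure lborel (ball (0 :: complex ^ 'n ^ 'n) 1)"
    by (intro emeasure_mono) (auto simp: haar_seed_def)
  also have "\<dots> < \<infinity>" by (simp add: emeasure_ball)
  finally show "emeasure lborel (haar_seed :: (complex ^ 'n ^ 'n) set) \<noteq> \<infinity>" by auto
qed

lemma orthogonal_family_act:
  assumes "B \<in> unitary_group"
  shows "orthogonal_transformation (family_act B)"
  unfolding orthogonal_transformation
proof (intro conjI allI)
  have "(c *\<^sub>R x) = complex_of_real c *s x" for c and x :: "complex ^ 'a"
    by (simp add: vec_eq_iff) (simp add: scaleR_conv_of_real)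
  then show "linear (family_act B)"
    by (intro linearI vec_eq_iff[THEN iffD2] allI)
       (simp_all add: family_act_def matrix_vector_right_distrib vector_scalar_commute)
  show "norm (family_act B G) = norm G" for G
    using assms by (simp add: norm_vec_def[of "family_act B G"] norm_vec_def[of G]) (simp add: family_act_def unitary_norm)
qed

lemma family_act_seed:
  assumes "B \<in> unitary_group"
  shows "family_act B G \<in> haar_seed \<longleftrightarrow> G \<in> haar_seed"
proof -
  have "(\<Sum>j\<in>UNIV. c j *s family_act B G $ j) = B *v (\<Sum>j\<in>UNIV. c j *s G $ j)" for c
  proof -
    have "B *v (\<Sum>j\<in>S. f j) = (\<Sum>j\<in>S. B *v f j)" if "finite S" for S and f :: "'a \<Rightarrow> complex ^ 'a"
      using that by (induction S) (simp_all add: matrix_vector_right_distrib)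
    then show ?thesis by (simp add: family_act_def vector_scalar_commute)
  qed
  moreover have "B *v x = 0 \<longleftrightarrow> x = 0" for x
    using unitary_norm[OF assms, of x] by (metis norm_eq_zero)
  ultimately show ?thesis
    using orthogonal_transformation_norm[OF orthogonal_family_act[OF assms]]
    by (simp add: haar_seed_def independent_family_def)
qed

lemma closed_unitary_group: "closed (unitary_group :: (complex ^ 'n ^ 'n::finite) set)"
  unfolding unitary_group_def vec_eq_iff matrix_matrix_mult_def
  by (intro closed_Collect_all closed_Collect_eq) (simp_all, intro continuous_intros)

lemma haar_unitary_exists:
  "\<exists>M :: (complex ^ 'n ^ 'n::finite) measure. prob_space M \<and> sets M = sets borel \<and> (AE A in M. A \<in> unitary_group) \<and>
     (\<forall>B\<in>unitary_group. distr M borel (\<lambda>A. B ** A) = M)"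
proof -
  obtain js where js: "set js = (UNIV :: 'n set)" "distinct js" using finite_distinct_list[of "UNIV :: 'n set"] by auto
  define M0 :: "(complex ^ 'n ^ 'n) measure" where "M0 = uniform_measure lborel haar_seed"
  \<comment> \<open>The members of the orthonormalized family are its rows; transposition makes them
    the columns of a matrix, on which left multiplication acts.\<close>
  define \<Phi> :: "complex ^ 'n ^ 'n \<Rightarrow> complex ^ 'n ^ 'n" where "\<Phi> G = transpose (gram_schmidt_list js G)" for G
  interpret prob_space M0
    unfolding M0_def by (rule prob_space_uniform_measure) (use emeasure_haar_seed in auto)
  have [measurable_cong]: "sets M0 = sets borel" by (simp add: M0_def)
  have [measurable]: "(transpose :: complex ^ 'n ^ 'n \<Rightarrow> _) \<in> borel_measurable borel"
    unfolding transpose_def by (intro borel_measurable_vec_lambda measurable_vec_nth) auto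
  have \<Phi>: "\<Phi> \<in> measurable M0 borel" unfolding \<Phi>_def by measurable
  have [measurable]: "(\<lambda>A. B ** A) \<in> borel_measurable borel" for B :: "complex ^ 'n ^ 'n"
    unfolding matrix_matrix_mult_def
    by (intro borel_measurable_continuous_onI continuous_intros)
  define M where "M = distr M0 borel \<Phi>"
  have "AE G in M0. G \<in> haar_seed"
    unfolding M0_def using emeasure_haar_seed by (intro AE_uniform_measureI) auto
  then have AE: "AE G in M0. \<Phi> G \<in> unitary_group"
  proof eventually_elim
    case (elim G)
    then have "orthonormal_family (gram_schmidt_list js G) ({} \<union> set js)"
      using js by (intro gram_schmidt_list_orthonormal) (auto simp: orthonormal_family_def haar_seed_def)
    then have "cinner (gram_schmidt_list js G $ i) (gram_schmidt_list js G $ j) = (if i = j then 1 else 0)" for i j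
      using js by (simp add: orthonormal_family_def)
    then show ?case
      by (simp add: unitary_group_def \<Phi>_def vec_eq_iff matrix_matrix_mult_def transpose_def cinner_def mat_def)
  qed
  have inv0: "distr M0 borel (family_act B) = M0" if B: "B \<in> unitary_group" for B
  proof -
    note orth = orthogonal_family_act[OF B]
    have [measurable]: "family_act B \<in> borel_measurable borel"
      using orthogonal_transformation_linear[OF orth]
      by (intro borel_measurable_continuous_onI linear_continuous_on) (simp add: linear_conv_bounded_linear)
    let ?h = "\<lambda>G. indicator haar_seed G / emeasure lborel (haar_seed :: (complex ^ 'n ^ 'n) set)"
    \<comment> \<open>The density is constant along the action, so it can be written in terms of the
      moved family and then pulled through the image measure.\<close>
    have "M0 = density lborel (\<lambda>G. ?h (family_act B G))"
      unfolding M0_def uniform_measure_def by (simp add: indicator_def family_act_seed[OF B])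
    then have "distr M0 borel (family_act B) = distr (density lborel (\<lambda>G. ?h (family_act B G))) borel (family_act B)"
      by simp
    also have "\<dots> = density (distr lborel borel (family_act B)) ?h"
      by (rule density_distr[symmetric]) measurable
    finally show ?thesis by (simp add: lborel_orthogonal[OF orth] M0_def uniform_measure_def)
  qed
  have "distr M borel (\<lambda>A. B ** A) = M" if B: "B \<in> unitary_group" for B
  proof -
    have [measurable]: "family_act B \<in> borel_measurable borel"
      using orthogonal_transformation_linear[OF orthogonal_family_act[OF B]]
      by (intro borel_measurable_continuous_onI linear_continuous_on) (simp add: linear_conv_bounded_linear)
    have "B ** transpose Q = transpose (family_act B Q)" for Q
      by (simp add: vec_eq_iff transpose_def family_act_def matrix_matrix_mult_def matrix_vector_mult_def)
    then have eq: "B ** \<Phi> G = \<Phi> (family_act B G)" for G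
      unfolding \<Phi>_def gram_schmidt_list_act[OF B] .
    have "distr M borel (\<lambda>A. B ** A) = distr M0 borel (\<lambda>G. \<Phi> (family_act B G))"
      unfolding M_def using \<Phi> by (subst distr_distr) (auto simp: o_def eq)
    also have "\<dots> = distr (distr M0 borel (family_act B)) borel \<Phi>"
      using \<Phi> by (subst distr_distr) (auto simp: o_def)
    finally show ?thesis by (simp add: inv0[OF B] M_def)
  qed
  moreover have "AE A in M. A \<in> unitary_group"
    unfolding M_def using AE by (subst AE_distr_iff[OF \<Phi>]) (auto intro!: borel_closed closed_unitary_group)
  moreover have "prob_space M" unfolding M_def using \<Phi> by (rule prob_space_distr)
  ultimately show ?thesis by (intro exI[of _ M]) (simp add: M_def)
qed

lemma
  shows prob_space_haar: "prob_space (haar_unitary :: (complex ^ 'n ^ 'n::finite) measure)"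
    and sets_haar: "sets (haar_unitary :: (complex ^ 'n ^ 'n) measure) = sets borel"
    and AE_haar: "AE A in (haar_unitary :: (complex ^ 'n ^ 'n) measure). A \<in> unitary_group"
    and haar_invariant: "B \<in> unitary_group \<Longrightarrow> distr haar_unitary borel (\<lambda>A. B ** A) = (haar_unitary :: (complex ^ 'n ^ 'n) measure)"
  using someI_ex[OF haar_unitary_exists[where 'n = 'n], folded haar_unitary_def] by auto

section \<open>Virtual zonoids and the quotient ring\<close>

lemma integrable_law_distr:
  fixes X :: "'a \<Rightarrow> 'w::euclidean_space"
  assumes "prob_space M" "integrable M X"
  shows "integrable_law (distr M borel X)"
  using assms borel_measurable_integrable[OF assms(2)]
  by (auto simp: integrable_law_def integrable_distr_eq intro: prob_space.prob_space_distr)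

lemma K_class_distr:
  fixes X :: "'a \<Rightarrow> 'w::euclidean_space"
  assumes "prob_space M" "integrable M X"
  shows "K_class M X = K_class (distr M borel X) (\<lambda>x. x)"
proof -
  note l = integrable_lawD[OF integrable_law_distr[OF assms]]
  show ?thesis
    unfolding vz_support_inject vz_support_K_class[OF assms] vz_support_K_class[OF l(1,3)]
    using borel_measurable_integrable[OF assms(2)] by (auto simp: integral_distr)
qed

lemma integrable_law_return: "integrable_law (return borel (v :: 'w::euclidean_space))"
proof -
  interpret prob_space "return borel v" by (rule prob_space_return) simp
  have "integrable (return borel v) (\<lambda>x. x)"
    by (rule integrable_const_bound[where B = "norm v"]) (auto simp: AE_return)
  then show ?thesis by (auto simp: integrable_law_def intro: prob_space_return)
qed

lemma vz_support_law: "integrable_law M \<Longrightarrow> vz_support (K_class M (\<lambda>x. x)) u = (\<integral>x. \<bar>u \<bullet> x\<bar> \<partial>M) / 2"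
  by (rule vz_support_K_class) (auto dest: integrable_lawD)

definition law_classes :: "'w::euclidean_space vzonoid set" where
  "law_classes = {K_class M (\<lambda>x. x) | M. integrable_law M}"

lemma linear_vz_support: "linear (\<lambda>x. vz_support x u)"
  by (rule linearI) (simp_all add: vz_support_add vz_support_scale)

text \<open>The integrand \<open>\<bar>u \<bullet> x\<bar>\<close> is even and homogeneous in
  \<open>u\<close>, and both properties pass to linear combinations.\<close>

lemma vz_support_homogeneous:
  assumes "x \<in> span law_classes"
  shows "vz_support x (c *\<^sub>R u) = \<bar>c\<bar> * vz_support x u"
  by (rule linear_eq_on_span[OF linear_vz_support linear_compose[OF linear_vz_support linear_times, unfolded o_def] _ assms])
     (auto simp: law_classes_def vz_support_law abs_mult)

text \<open>Pairing with a law averages the support function over it. Testing against Dirac laws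
  therefore recovers point values, which is how null classes are recognized.\<close>

lemma vz_pairing_law:
  assumes N: "integrable_law N" and x: "x \<in> span law_classes"
  shows "vz_pairing x (K_class N (\<lambda>x. x)) = 2 * (\<integral>y. vz_support x y \<partial>N)"
proof (rule linear_eq_on_span[OF _ _ _ x])
  show "linear (\<lambda>x. vz_pairing x (K_class N (\<lambda>x. x)))" using bilinear_vz_pairing by (auto simp: bilinear_def)
  show "linear (\<lambda>x. 2 * (\<integral>y. vz_support x y \<partial>N))"
    using linear_compose[OF linear_integral_vz_support[OF integrable_lawD(3)[OF N]] linear_times] by (simp add: o_def)
  have b: "bilinear ((\<bullet>) :: 'a \<Rightarrow> 'a \<Rightarrow> real)"
    by (simp add: bilinear_conv_bounded_bilinear bounded_bilinear_inner)
  have a: "adjoint (\<lambda>x. x \<bullet> y) 1 = y" for y :: 'a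
    by (rule adjoint_unique[THEN fun_cong, of _ "\<lambda>c. c *\<^sub>R y", THEN trans]) (auto simp: inner_commute)
  fix z :: "'a vzonoid" assume "z \<in> law_classes"
  then obtain M where M: "integrable_law M" "z = K_class M (\<lambda>x. x)" by (auto simp: law_classes_def)
  show "vz_pairing z (K_class N (\<lambda>x. x)) = 2 * (\<integral>y. vz_support z y \<partial>N)"
    using slice_functionals(1)[OF b M(1) N, of 1] by (simp add: M vz_pairing_K_class N a)
qed

lemma vz_wedge_law:
  assumes "integrable_law M" "integrable_law N"
  shows "integrable_law (distr (M \<Otimes>\<^sub>M N) borel (\<lambda>(x, y). wedge x y))"
    and "vz_wedge (K_class M (\<lambda>x. x)) (K_class N (\<lambda>x. x)) = K_class (distr (M \<Otimes>\<^sub>M N) borel (\<lambda>(x, y). wedge x y)) (\<lambda>x. x)"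
proof -
  interpret M: prob_space M using assms by (auto dest: integrable_lawD)
  interpret N: prob_space N using assms by (auto dest: integrable_lawD)
  interpret pair_prob_space M N ..
  note i = prob_space_axioms integrable_pair_bilinear[OF assms bilinear_wedge]
  show "integrable_law (distr (M \<Otimes>\<^sub>M N) borel (\<lambda>(x, y). wedge x y))" by (rule integrable_law_distr[OF i])
  show "vz_wedge (K_class M (\<lambda>x. x)) (K_class N (\<lambda>x. x)) = K_class (distr (M \<Otimes>\<^sub>M N) borel (\<lambda>(x, y). wedge x y)) (\<lambda>x. x)"
    unfolding vz_wedge_K_class[OF assms] by (rule K_class_distr[OF i])
qed

text \<open>One factor is kept as a law and moved to the argument by an adjoint; the other may be
  any linear combination of classes. The algebraic properties of the product are derived from this
  formula.\<close>

lemma vz_support_wedge: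
  assumes M: "integrable_law M" and x: "x \<in> span law_classes"
  shows "vz_support (vz_wedge (K_class M (\<lambda>x. x)) x) u = (\<integral>\<eta>. vz_support x (adjoint (wedge \<eta>) u) \<partial>M)"
proof (rule linear_eq_on_span[OF _ _ _ x])
  show "linear (\<lambda>x. vz_support (vz_wedge (K_class M (\<lambda>x. x)) x) u)"
    by (rule linearI) (simp_all add: bilinear_radd[OF bilinear_vz_wedge] bilinear_rmul[OF bilinear_vz_wedge] vz_support_add vz_support_scale)
  show "linear (\<lambda>x. \<integral>\<eta>. vz_support x (adjoint (wedge \<eta>) u) \<partial>M)"
    by (rule linear_integral_vz_support[OF integrable_adjoint_slice(2)[OF bilinear_wedge M]])
  fix z :: "'a ext vzonoid" assume "z \<in> law_classes"
  then obtain N where N: "integrable_law N" "z = K_class N (\<lambda>x. x)" by (auto simp: law_classes_def)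
  interpret M: prob_space M using M by (auto dest: integrable_lawD)
  interpret N: prob_space N using N by (auto dest: integrable_lawD)
  interpret pair_prob_space M N ..
  show "vz_support (vz_wedge (K_class M (\<lambda>x. x)) z) u = (\<integral>\<eta>. vz_support z (adjoint (wedge \<eta>) u) \<partial>M)"
    unfolding N(2) vz_wedge_K_class[OF M N(1)]
      vz_support_K_class[OF prob_space_axioms integrable_pair_bilinear[OF M N(1) bilinear_wedge]]
    using slice_functionals(2)[OF bilinear_wedge M N(1), of u] by (simp add: split_def)
qed

lemma adjoint_wedge_inner: "adjoint (wedge \<eta>) u \<bullet> y = u \<bullet> wedge \<eta> y"
  using adjoint_works[OF linear_wedge_right] by (metis inner_commute)

lemma vz_support_wedge_law:
  assumes M: "integrable_law M" and N: "integrable_law N"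
  shows "vz_support (vz_wedge (K_class M (\<lambda>x. x)) (K_class N (\<lambda>x. x))) u = (\<integral>x. \<integral>y. \<bar>u \<bullet> wedge x y\<bar> \<partial>N \<partial>M) / 2"
proof -
  have "K_class N (\<lambda>x. x) \<in> span law_classes" using N by (auto simp: law_classes_def intro: span_base)
  then show ?thesis by (simp add: vz_support_wedge[OF M] vz_support_law[OF N] adjoint_wedge_inner)
qed

section \<open>Grassmann classes and null classes\<close>

definition grass_classes :: "nat \<Rightarrow> 'm::finite ext vzonoid set" where
  "grass_classes d = {K_class M (\<lambda>x. x) | M. integrable_law M \<and> (AE x in M. x \<in> simple_ext d)}"

lemma grass_span: "grass d = span (grass_classes d)"
  by (simp add: grass_def grass_classes_def)

lemma subspace_grass: "subspace (grass d)" and subspace_grass_total: "subspace grass_total"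
  by (simp_all add: grass_def grass_total_def)

lemma grass_total_span: "grass_total = span (\<Union>d. grass_classes d)"
proof -
  have "grass d \<subseteq> span (\<Union>d. grass_classes d)" for d :: nat
    unfolding grass_span by (rule span_mono) auto
  moreover have "(\<Union>d. grass_classes d) \<subseteq> span (\<Union>d. grass d)"
    by (auto simp: grass_span intro!: span_base)
  ultimately show ?thesis
    unfolding grass_total_def by (intro span_eq[THEN iffD2]) auto
qed

lemma grass_subset_total: "grass d \<subseteq> grass_total"
  unfolding grass_total_def by (auto intro: span_base)

lemma grass_total_subset: "grass_total \<subseteq> span law_classes"
  unfolding grass_total_span by (rule span_mono) (auto simp: grass_classes_def law_classes_def)

lemma grass_subset: "grass d \<subseteq> span law_classes"
  using grass_subset_total grass_total_subset by blast

lemma simple_ext_0: "simple_ext 0 = {axis {} 1}"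
  by (auto simp: simple_ext_def)

lemma simple_ext_Suc: "simple_ext (Suc d) = (\<lambda>(v, y). wedge (ext_vec v) y) ` (UNIV \<times> simple_ext d)"
proof (intro equalityI subsetI)
  fix x assume "x \<in> simple_ext (Suc d)"
  then obtain v vs where "length vs = d" "x = wedge (ext_vec v) (ext_product vs)"
    by (auto simp: simple_ext_def length_Suc_conv)
  then show "x \<in> (\<lambda>(v, y). wedge (ext_vec v) y) ` (UNIV \<times> simple_ext d)" by (auto simp: simple_ext_def)
next
  fix x assume "x \<in> (\<lambda>(v, y). wedge (ext_vec v) y) ` (UNIV \<times> simple_ext d)"
  then obtain v vs where "length vs = d" "x = ext_product (v # vs)" by (auto simp: simple_ext_def)
  then show "x \<in> simple_ext (Suc d)" by (auto simp: simple_ext_def intro!: exI[of _ "v # vs"])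
qed

text \<open>Continuous images of Borel sets can fail to be Borel, but countable unions of compact
  sets have images of the same kind. This gives measurability of sets of products of vectors by
  induction on the number of factors.\<close>

lemma sigma_compact_image:
  fixes f :: "'a::euclidean_space \<times> 'b::euclidean_space \<Rightarrow> 'c::euclidean_space"
  assumes C: "\<And>k. compact (C k)" "S = (\<Union>k::nat. C k)" and f: "continuous_on UNIV f"
  shows "\<exists>D :: nat \<Rightarrow> 'c set. (\<forall>k. compact (D k)) \<and> f ` (UNIV \<times> S) = (\<Union>k. D k)"
proof -
  define D where "D k = f ` (cball 0 (real (fst (prod_decode k))) \<times> C (snd (prod_decode k)))" for k
  have "compact (D k)" for k
    unfolding D_def using C(1) f
    by (intro compact_continuous_image compact_Times) (auto intro: continuous_on_subset)
  moreover have "f ` (UNIV \<times> S) = (\<Union>k. D k)"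
  proof (intro equalityI subsetI)
    fix x assume "x \<in> f ` (UNIV \<times> S)"
    then obtain v y k where "x = f (v, y)" "y \<in> C k" by (auto simp: C(2))
    moreover obtain m where "norm v \<le> real m" using real_arch_simple by blast
    ultimately have "x \<in> D (prod_encode (m, k))" by (auto simp: D_def)
    then show "x \<in> (\<Union>k. D k)" by blast
  next
    fix x assume "x \<in> (\<Union>k. D k)"
    then show "x \<in> f ` (UNIV \<times> S)" by (auto simp: D_def C(2))
  qed
  ultimately show ?thesis by blast
qed

lemma simple_ext_measurable [measurable]: "(simple_ext d :: 'm::finite ext set) \<in> sets borel"
proof -
  have "\<exists>C :: nat \<Rightarrow> 'm ext set. (\<forall>k. compact (C k)) \<and> simple_ext d = (\<Union>k. C k)"
  proof (induction d)
    case 0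
    then show ?case by (intro exI[of _ "\<lambda>_. {axis {} 1}"]) (simp add: simple_ext_0)
  next
    case (Suc d)
    then obtain C :: "nat \<Rightarrow> 'm ext set" where C: "\<And>k. compact (C k)" "simple_ext d = (\<Union>k. C k)" by blast
    have "continuous_on UNIV (\<lambda>p. wedge (ext_vec (fst p)) (snd p) :: 'm ext)"
      using linear_ext_vec
      by (intro bounded_bilinear.continuous_on[OF bilinear_wedge[unfolded bilinear_conv_bounded_bilinear]]
          continuous_on_compose2[OF linear_continuous_on[of ext_vec UNIV]] continuous_intros)
         (auto simp: linear_conv_bounded_linear)
    then show ?case
      unfolding simple_ext_Suc by (intro sigma_compact_image[OF C]) (simp add: split_def)
  qed
  then obtain C :: "nat \<Rightarrow> 'm ext set" where C: "\<And>k. compact (C k)" "simple_ext d = (\<Union>k. C k)" by blast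
  have "C k \<in> sets borel" for k using C(1) by (intro borel_closed compact_imp_closed)
  then show ?thesis unfolding C(2) by (intro sets.countable_UN) auto
qed

text \<open>A simple vector of degree \<open>d\<close> meets only the degree \<open>d\<close> part
  of \<open>u\<close>; this is what keeps the degrees apart.\<close>

lemma vz_support_degree:
  fixes x :: "'m::finite ext vzonoid"
  assumes "x \<in> grass d"
  shows "vz_support x u = vz_support x (ext_degree d u)"
proof (rule linear_eq_on_span[OF linear_vz_support linear_vz_support _ assms[unfolded grass_span]])
  fix z :: "'m ext vzonoid" assume "z \<in> grass_classes d"
  then obtain M where M: "integrable_law M" "AE x in M. x \<in> simple_ext d" "z = K_class M (\<lambda>x. x)"
    by (auto simp: grass_classes_def)
  have [measurable]: "ext_degree d \<in> borel_measurable (borel :: 'm ext measure)"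
    using linear_ext_degree by (intro borel_measurable_continuous_onI linear_continuous_on) (simp add: linear_conv_bounded_linear)
  have [measurable_cong]: "sets M = sets borel" using M(1) by (auto dest: integrable_lawD)
  have "(\<integral>x. \<bar>u \<bullet> x\<bar> \<partial>M) = (\<integral>x. \<bar>ext_degree d u \<bullet> x\<bar> \<partial>M)"
    using M(2) by (intro integral_cong_AE) (auto simp: ext_degree_inner ext_degree_simple)
  then show "vz_support z u = vz_support z (ext_degree d u)" by (simp add: M vz_support_law)
qed

lemma grass_above:
  fixes x :: "'m::finite ext vzonoid"
  assumes "x \<in> grass d" "d > CARD('m)"
  shows "x = 0"
proof -
  have "ext_degree d u = 0" for u :: "'m ext"
  proof -
    have "card I \<noteq> d" for I :: "'m set" using card_mono[of UNIV I] assms(2) by auto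
    then show ?thesis by (simp add: ext_degree_def vec_eq_iff)
  qed
  then show ?thesis using vz_support_degree[OF assms(1)] by (auto simp: vz_support_inject vz_support_0 vz_support_at_0)
qed

text \<open>Dirac laws at simple vectors are among the test classes, which gives point values;
  conversely the pairing with a law of simple vectors is an average of such values.\<close>

lemma grass_null_iff:
  fixes x :: "'m::finite ext vzonoid"
  shows "x \<in> grass_null d \<longleftrightarrow> x \<in> grass d \<and> (\<forall>v\<in>simple_ext d. vz_support x v = 0)"
proof (intro iffI conjI ballI; (elim conjE)?)
  show "x \<in> grass d" if "x \<in> grass_null d" using that by (simp add: grass_null_def)
  show "vz_support x v = 0" if x: "x \<in> grass_null d" and v: "v \<in> simple_ext d" for v
  proof -
    have "K_class (return borel v) (\<lambda>x. x) \<in> grass d"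
      using v integrable_law_return[of v] unfolding grass_def
      by (intro span_base CollectI exI[of _ "return borel v"]) (simp add: AE_return)
    then have "vz_pairing x (K_class (return borel v) (\<lambda>x. x)) = 0" using x by (auto simp: grass_null_def)
    moreover have "x \<in> span law_classes" using x grass_subset by (auto simp: grass_null_def)
    moreover have "(\<integral>y. vz_support x y \<partial>return borel v) = vz_support x v" by (rule integral_return) auto
    ultimately show ?thesis using vz_pairing_law[OF integrable_law_return, of x v] by simp
  qed
  show "x \<in> grass_null d" if x: "x \<in> grass d" and v: "\<forall>v\<in>simple_ext d. vz_support x v = 0"
  proof -
    have "vz_pairing x y = 0" if y: "y \<in> grass d" for y
    proof (rule linear_eq_0_on_span[OF _ _ y[unfolded grass_span]])
      show "linear (vz_pairing x)" using bilinear_vz_pairing by (auto simp: bilinear_def)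
      fix z :: "'m ext vzonoid" assume "z \<in> grass_classes d"
      then obtain M where M: "integrable_law M" "AE x in M. x \<in> simple_ext d" "z = K_class M (\<lambda>x. x)"
        by (auto simp: grass_classes_def)
      have "(\<integral>y. vz_support x y \<partial>M) = 0"
        using M(2) v by (intro integral_eq_zero_AE) auto
      then show "vz_pairing x z = 0" using vz_pairing_law[OF M(1), of x] x grass_subset by (auto simp: M(3))
    qed
    then show ?thesis using x by (simp add: grass_null_def)
  qed
qed

text \<open>Components above the dimension vanish, so one finite range of degrees serves for all
  classes.\<close>

lemma grass_total_decompose:
  fixes x :: "'m::finite ext vzonoid"
  assumes "x \<in> grass_total"
  shows "\<exists>f. (\<forall>d. f d \<in> grass d) \<and> x = (\<Sum>d\<le>CARD('m). f d)"
  using assms unfolding grass_total_def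
proof (induction rule: span_induct_alt)
  case base
  then show ?case by (intro exI[of _ "\<lambda>_. 0"]) (simp add: subspace_0[OF subspace_grass])
next
  case (step c y z)
  then obtain d where d: "y \<in> grass d" by auto
  from step obtain f where f: "\<forall>d. f d \<in> grass d" "z = (\<Sum>d\<le>CARD('m). f d)" by blast
  define g where "g e = (if e = d then c *\<^sub>R y else 0) + f e" for e
  have "c *\<^sub>R y = 0" if "d > CARD('m)" using grass_above[OF d that] by simp
  then have "(\<Sum>e\<le>CARD('m). if e = d then c *\<^sub>R y else 0) = c *\<^sub>R y" by (auto simp: not_le)
  then have "c *\<^sub>R y + z = (\<Sum>e\<le>CARD('m). g e)" by (simp add: g_def f(2) sum.distrib)
  moreover have "g e \<in> grass e" for e
    using f(1) d by (auto simp: g_def intro!: subspace_add[OF subspace_grass] subspace_scale[OF subspace_grass])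
  ultimately show ?case by blast
qed

text \<open>At a simple vector of one degree only the component of that degree contributes, so the
  condition splits over the degrees.\<close>

lemma grass_null_total_iff:
  fixes z :: "'m::finite ext vzonoid"
  shows "z \<in> grass_null_total \<longleftrightarrow> z \<in> grass_total \<and> (\<forall>d. \<forall>v\<in>simple_ext d. vz_support z v = 0)"
proof (intro iffI conjI allI ballI; (elim conjE)?)
  assume z: "z \<in> grass_null_total"
  have "grass_null d \<subseteq> (grass_total :: 'm ext vzonoid set)" for d by (auto simp: grass_null_iff dest: subsetD[OF grass_subset_total])
  then have "grass_null_total \<subseteq> (grass_total :: 'm ext vzonoid set)"
    unfolding grass_null_total_def by (intro span_minimal subspace_grass_total) auto
  then show "z \<in> grass_total" using z by blast
  fix d and v :: "'m ext" assume v: "v \<in> simple_ext d"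
  show "vz_support z v = 0"
  proof (rule linear_eq_0_on_span[OF linear_vz_support _ z[unfolded grass_null_total_def]])
    fix y :: "'m ext vzonoid" assume "y \<in> (\<Union>d. grass_null d)"
    then obtain e where e: "y \<in> grass_null e" by auto
    then have g: "y \<in> grass e" "\<forall>v\<in>simple_ext e. vz_support y v = 0" by (simp_all add: grass_null_iff)
    show "vz_support y v = 0"
    proof (cases "e = d")
      case False
      then show ?thesis by (subst vz_support_degree[OF g(1)]) (simp add: ext_degree_simple[OF v] vz_support_at_0)
    qed (use g v in simp)
  qed
next
  assume z: "z \<in> grass_total" "\<forall>d. \<forall>v\<in>simple_ext d. vz_support z v = 0"
  then obtain f where f: "\<And>d. f d \<in> grass d" "z = (\<Sum>d\<le>CARD('m). f d)" using grass_total_decompose by blast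
  have "f e \<in> grass_null e" if e: "e \<le> CARD('m)" for e
  proof -
    have "vz_support (f e) v = 0" if v: "v \<in> simple_ext e" for v
    proof -
      have "vz_support z v = (\<Sum>d\<le>CARD('m). vz_support (f d) v)"
        unfolding f(2) by (rule linear_sum[OF linear_vz_support])
      also have "\<dots> = (\<Sum>d\<le>CARD('m). if d = e then vz_support (f e) v else 0)"
      proof (rule sum.cong[OF refl])
        fix d
        show "vz_support (f d) v = (if d = e then vz_support (f e) v else 0)"
          using vz_support_degree[OF f(1), of d v] v by (simp add: ext_degree_simple vz_support_at_0)
      qed
      finally show ?thesis using z(2) v e by simp
    qed
    then show ?thesis using f(1) by (simp add: grass_null_iff)
  qed
  then show "z \<in> grass_null_total" unfolding f(2) grass_null_total_def
    by (intro span_sum span_base) auto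
qed

section \<open>Support functions on the quotient\<close>

lemma q_rel_iff: "q_rel x y \<longleftrightarrow> x \<in> grass_total \<and> y \<in> grass_total \<and> (\<forall>d. \<forall>v\<in>simple_ext d. vz_support x v = vz_support y v)"
proof -
  have "vz_support (x - y) v = vz_support x v - vz_support y v" for v
    by (rule linear_diff[OF linear_vz_support])
  then show ?thesis
    by (auto simp: q_rel_def grass_null_total_iff subspace_diff[OF subspace_grass_total])
qed

text \<open>At simple vectors the value is independent of the chosen representative, by
  \<open>q_rel_iff\<close>; hence the restriction to them in the rules below.\<close>

definition q_support :: "'m::finite qring \<Rightarrow> 'm ext \<Rightarrow> real" where
  "q_support q v = vz_support (rep_qring q) v"

lemma rep_qring_grass: "rep_qring q \<in> grass_total"
  using Quotient3_rep_reflp[OF Quotient3_qring, of q] by (simp add: q_rel_iff_refl)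

lemma abs_rep_qring: "abs_qring (rep_qring q) = q"
  by (rule Quotient3_abs_rep[OF Quotient3_qring])

lemma abs_qring_eq_iff:
  "x \<in> grass_total \<Longrightarrow> y \<in> grass_total \<Longrightarrow> abs_qring x = abs_qring y \<longleftrightarrow> q_rel x y"
  using Quotient3_rel[OF Quotient3_qring, of x y] by (simp add: q_rel_iff_refl)

lemma q_support_abs: "x \<in> grass_total \<Longrightarrow> v \<in> simple_ext d \<Longrightarrow> q_support (abs_qring x) v = vz_support x v"
  using abs_qring_eq_iff[OF rep_qring_grass[of "abs_qring x"], of x] abs_rep_qring[of "abs_qring x"]
  by (auto simp: q_rel_iff q_support_def)

lemma qring_eqI:
  assumes "\<And>d v. v \<in> simple_ext d \<Longrightarrow> q_support p v = q_support q v"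
  shows "p = q"
proof -
  have "q_rel (rep_qring p) (rep_qring q)"
    using assms by (auto simp: q_rel_iff rep_qring_grass q_support_def)
  then have "abs_qring (rep_qring p) = abs_qring (rep_qring q)"
    by (simp add: abs_qring_eq_iff rep_qring_grass)
  then show ?thesis by (simp add: abs_rep_qring)
qed

lemma abs_qring_0: "abs_qring 0 = 0"
  by (simp add: zero_qring_def)

lemma abs_qring_add: "x \<in> grass_total \<Longrightarrow> y \<in> grass_total \<Longrightarrow> abs_qring (x + y) = abs_qring x + abs_qring y"
  by (simp add: plus_qring.abs_eq q_rel_iff_refl)

lemma abs_qring_scale: "x \<in> grass_total \<Longrightarrow> abs_qring (c *\<^sub>R x) = c *\<^sub>R abs_qring x"
  by (simp add: scaleR_qring.abs_eq q_rel_iff_refl)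

lemma q_support_add: "v \<in> simple_ext d \<Longrightarrow> q_support (p + q) v = q_support p v + q_support q v"
  using q_support_abs[of "rep_qring p + rep_qring q" v d]
  by (simp add: abs_qring_add rep_qring_grass abs_rep_qring subspace_add[OF subspace_grass_total] vz_support_add q_support_def)

lemma q_support_scale: "v \<in> simple_ext d \<Longrightarrow> q_support (c *\<^sub>R p) v = c * q_support p v"
  using q_support_abs[of "c *\<^sub>R rep_qring p" v d]
  by (simp add: abs_qring_scale rep_qring_grass abs_rep_qring subspace_scale[OF subspace_grass_total] vz_support_scale q_support_def)

lemma q_support_homogeneous: "q_support p (c *\<^sub>R v) = \<bar>c\<bar> * q_support p v"
  unfolding q_support_def using rep_qring_grass grass_total_subset by (intro vz_support_homogeneous) blast

lemma q_support_0_right: "q_support p 0 = 0"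
  using q_support_homogeneous[of p 0 0] by simp

lemma q_support_minus: "q_support p (- v) = q_support p v"
  using q_support_homogeneous[of p "- 1" v] by simp

subsection \<open>The product\<close>

lemma wedge_simple: "x \<in> simple_ext d \<Longrightarrow> y \<in> simple_ext e \<Longrightarrow> wedge x y \<in> simple_ext (d + e)"
  unfolding simple_ext_def by clarsimp (metis ext_product_append length_append)

lemma AE_pair_fst_snd:
  assumes "prob_space M" "prob_space N" "AE x in M. P x" "AE y in N. Q y"
  shows "AE p in M \<Otimes>\<^sub>M N. P (fst p) \<and> Q (snd p)"
proof -
  interpret M: prob_space M by fact
  interpret N: prob_space N by fact
  interpret pair_prob_space M N ..
  obtain A where A: "A \<in> null_sets M" "{x \<in> space M. \<not> P x} \<subseteq> A" using assms(3) by (auto elim: AE_E simp: null_sets_def)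
  obtain B where B: "B \<in> null_sets N" "{x \<in> space N. \<not> Q x} \<subseteq> B" using assms(4) by (auto elim: AE_E simp: null_sets_def)
  have "A \<times> space N \<in> null_sets (M \<Otimes>\<^sub>M N)" "space M \<times> B \<in> null_sets (M \<Otimes>\<^sub>M N)"
    using A(1) B(1) by (auto simp: null_sets_def N.emeasure_pair_measure_Times)
  then have "A \<times> space N \<union> space M \<times> B \<in> null_sets (M \<Otimes>\<^sub>M N)" by auto
  then show ?thesis
    by (rule AE_I') (use A(2) B(2) in \<open>auto simp: space_pair_measure\<close>)
qed

lemma vz_wedge_grass_classes:
  assumes "x \<in> grass_classes d" "y \<in> grass_classes e"
  shows "vz_wedge x y \<in> grass_classes (d + e)"
proof -
  obtain M where M: "integrable_law M" "AE x in M. x \<in> simple_ext d" "x = K_class M (\<lambda>x. x)"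
    using assms by (auto simp: grass_classes_def)
  obtain N where N: "integrable_law N" "AE x in N. x \<in> simple_ext e" "y = K_class N (\<lambda>x. x)"
    using assms by (auto simp: grass_classes_def)
  note w = vz_wedge_law[OF M(1) N(1)]
  have m: "(\<lambda>(x, y). wedge x y) \<in> borel_measurable (M \<Otimes>\<^sub>M N)"
    using integrable_pair_bilinear[OF M(1) N(1) bilinear_wedge] by (rule borel_measurable_integrable)
  have "AE p in M \<Otimes>\<^sub>M N. fst p \<in> simple_ext d \<and> snd p \<in> simple_ext e"
    using M N by (intro AE_pair_fst_snd) (auto dest: integrable_lawD)
  then have "AE p in M \<Otimes>\<^sub>M N. (\<lambda>(x, y). wedge x y) p \<in> simple_ext (d + e)"
    by eventually_elim (auto simp: wedge_simple split_beta)
  then have "AE z in distr (M \<Otimes>\<^sub>M N) borel (\<lambda>(x, y). wedge x y). z \<in> simple_ext (d + e)"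
    by (subst AE_distr_iff[OF m]) auto
  then show ?thesis using w by (auto simp: grass_classes_def M(3) N(3))
qed

lemma contract_list_above: "x \<in> simple_ext d \<Longrightarrow> d < length ws \<Longrightarrow> contract_list ws x = 0"
proof (induction ws arbitrary: x d)
  case (Cons w ws)
  have zero: "contract_list ws 0 = 0" for ws :: "(real ^ 'a) list"
    by (induction ws) (simp_all add: contract_list_def contract_simps)
  have scale: "contract_list ws (c *\<^sub>R y) = c *\<^sub>R contract_list ws y" for c y
    by (induction ws arbitrary: c y) (simp_all add: contract_list_def contract_simps)
  show ?case
  proof (cases d)
    case 0
    then show ?thesis using Cons.prems zero[of ws] by (simp add: simple_ext_0 contract_list_def)
  next
    case (Suc e)
    obtain c y where "y \<in> simple_ext e" "contract w x = c *\<^sub>R y"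
      using contract_simple Cons.prems(1) Suc by metis
    then show ?thesis using Cons.IH[of y e] Cons.prems(2) Suc scale by (simp add: contract_list_def)
  qed
qed simp

text \<open>The adjoint of wedging with a product of vectors is an iterated contraction. This
  closure property is the reason that null classes form an ideal.\<close>

lemma adjoint_wedge_simple:
  assumes "\<eta> \<in> simple_ext e" "v \<in> simple_ext f"
  shows "\<exists>c d. \<exists>y\<in>simple_ext d. adjoint (wedge \<eta>) v = c *\<^sub>R y"
proof -
  obtain ws where ws: "\<eta> = ext_product ws" "length ws = e" using assms by (auto simp: simple_ext_def)
  show ?thesis
  proof (cases "e \<le> f")
    case True
    then show ?thesis
      using contract_list_simple[of v ws "f - e"] assms(2) ws by (auto simp: adjoint_wedge_ext_product)
  next
    \<comment> \<open>Contracting by more factors than the degree allows gives zero, which is zero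
      times any simple vector.\<close>
    case False
    then show ?thesis
      using contract_list_above[OF assms(2), of ws] assms(2) ws
      by (intro exI[of _ 0] exI[of _ f] bexI[of _ v]) (auto simp: adjoint_wedge_ext_product)
  qed
qed

lemma grass_classesE:
  assumes "x \<in> grass_classes d"
  obtains M where "integrable_law M" "AE x in M. x \<in> simple_ext d" "x = K_class M (\<lambda>x. x)"
  using assms by (auto simp: grass_classes_def)

lemma vz_wedge_grass:
  assumes "x \<in> grass d" "y \<in> grass e"
  shows "vz_wedge x y \<in> grass (d + e)"
proof -
  have 1: "vz_wedge x y \<in> grass (d + e)" if x: "x \<in> grass_classes d" for x
    using assms(2) unfolding grass_span[of e]
  proof (induction rule: span_induct_alt)
    case (step c z y)
    then show ?case
      using vz_wedge_grass_classes[OF x, of z e]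
      by (auto simp: bilinear_radd[OF bilinear_vz_wedge] bilinear_rmul[OF bilinear_vz_wedge] grass_span
          intro!: span_add span_scale intro: span_base)
  qed (simp add: bilinear_rzero[OF bilinear_vz_wedge] grass_span span_zero)
  show ?thesis using assms(1) unfolding grass_span[of d]
  proof (induction rule: span_induct_alt)
    case (step c z x)
    then show ?case
      using 1[of z] by (auto simp: bilinear_ladd[OF bilinear_vz_wedge] bilinear_lmul[OF bilinear_vz_wedge] 
          intro!: subspace_add[OF subspace_grass] subspace_scale[OF subspace_grass])
  qed (simp add: bilinear_lzero[OF bilinear_vz_wedge] subspace_0[OF subspace_grass])
qed

lemma vz_wedge_total_step:
  assumes "x \<in> grass_classes d" "y \<in> grass_total"
  shows "vz_wedge x y \<in> grass_total"
  using assms(2) unfolding grass_total_span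
proof (induction rule: span_induct_alt)
  case (step c z y)
  then obtain e where "z \<in> grass_classes e" by auto
  with assms(1) have "vz_wedge x z \<in> grass_classes (d + e)" by (rule vz_wedge_grass_classes)
  then have "vz_wedge x z \<in> (\<Union>d. grass_classes d)" by blast
  then show ?case using step
    by (auto simp: bilinear_radd[OF bilinear_vz_wedge] bilinear_rmul[OF bilinear_vz_wedge]
        intro!: span_add span_scale intro: span_base)
qed (simp add: bilinear_rzero[OF bilinear_vz_wedge] span_zero)

lemma vz_wedge_total:
  assumes "x \<in> grass_total" "y \<in> grass_total"
  shows "vz_wedge x y \<in> grass_total"
  using assms(1) unfolding grass_total_span[of]
proof (induction rule: span_induct_alt)
  case (step c z x)
  then obtain d where "z \<in> grass_classes d" by auto
  then have "vz_wedge z y \<in> grass_total" using assms(2) by (rule vz_wedge_total_step)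
  then show ?case using step unfolding grass_total_span
    by (auto simp: bilinear_ladd[OF bilinear_vz_wedge] bilinear_lmul[OF bilinear_vz_wedge]
        intro!: span_add span_scale)
qed (simp add: bilinear_lzero[OF bilinear_vz_wedge] span_zero)

lemma bilinear_eq_grass_total:
  assumes "bilinear f" "bilinear g" "x \<in> grass_total" "y \<in> grass_total"
    and "\<And>d e x y. x \<in> grass_classes d \<Longrightarrow> y \<in> grass_classes e \<Longrightarrow> f x y = g x y"
  shows "f x y = g x y"
  using assms(3,4) unfolding grass_total_span
  by (rule bilinear_eq[OF assms(1,2) order_refl order_refl]) (use assms(5) in auto)

lemma wedge_simple_commute:
  assumes "x \<in> simple_ext d" "y \<in> simple_ext e"
  shows "\<bar>u \<bullet> wedge x y\<bar> = \<bar>u \<bullet> wedge y x\<bar>"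
proof -
  obtain vs ws where vw: "x = ext_product vs" "y = ext_product ws" using assms by (auto simp: simple_ext_def)
  have "(\<lambda>z. \<bar>u \<bullet> z\<bar>) (ext_product (vs @ ws)) = (\<lambda>z. \<bar>u \<bullet> z\<bar>) (ext_product (ws @ vs))"
    by (rule ext_product_perm_eq) auto
  then show ?thesis by (simp add: vw ext_product_append)
qed

text \<open>The sign by which two simple vectors fail to commute disappears under the absolute
  value, so the algebra is commutative without signs.\<close>

lemma vz_wedge_commute:
  assumes "x \<in> grass_total" "y \<in> grass_total"
  shows "vz_wedge x y = vz_wedge y x"
proof (rule bilinear_eq_grass_total[OF bilinear_vz_wedge _ assms])
  show "bilinear (\<lambda>x y. vz_wedge y x)" using bilinear_vz_wedge by (auto simp: bilinear_def)
  fix d e and x y :: "'a ext vzonoid" assume x: "x \<in> grass_classes d" and y: "y \<in> grass_classes e"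
  obtain M where M: "integrable_law M" "AE x in M. x \<in> simple_ext d" "x = K_class M (\<lambda>x. x)"
    using x by (rule grass_classesE)
  obtain N where N: "integrable_law N" "AE x in N. x \<in> simple_ext e" "y = K_class N (\<lambda>x. x)"
    using y by (rule grass_classesE)
  interpret M: prob_space M using M by (auto dest: integrable_lawD)
  interpret N: prob_space N using N by (auto dest: integrable_lawD)
  interpret P: pair_sigma_finite M N ..
  show "vz_wedge x y = vz_wedge y x"
    unfolding vz_support_inject
  proof
    fix u
    have i: "integrable (M \<Otimes>\<^sub>M N) (\<lambda>(x, y). \<bar>u \<bullet> wedge x y\<bar>)" if "integrable_law M" "integrable_law N" for M N :: "'a ext measure"
      using integrable_abs[OF integrable_inner_right[OF integrable_pair_bilinear[OF that bilinear_wedge], of u]]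
      by (simp add: split_def)
    have b: "bilinear (\<lambda>x y. wedge y x :: 'a ext)" using bilinear_wedge by (auto simp: bilinear_def)
    have i': "integrable (M \<Otimes>\<^sub>M N) (\<lambda>(x, y). \<bar>u \<bullet> wedge y x\<bar>)"
      using integrable_abs[OF integrable_inner_right[OF integrable_pair_bilinear[OF M(1) N(1) b], of u]]
      by (simp add: split_def)
    have "(\<integral>x. \<integral>y. \<bar>u \<bullet> wedge x y\<bar> \<partial>N \<partial>M) = (\<integral>p. (case p of (x, y) \<Rightarrow> \<bar>u \<bullet> wedge x y\<bar>) \<partial>(M \<Otimes>\<^sub>M N))"
      using P.integral_fst[OF i[OF M(1) N(1)]] by simp
    also have "\<dots> = (\<integral>p. (case p of (x, y) \<Rightarrow> \<bar>u \<bullet> wedge y x\<bar>) \<partial>(M \<Otimes>\<^sub>M N))"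
    proof (rule integral_cong_AE)
      show "AE p in M \<Otimes>\<^sub>M N. (case p of (x, y) \<Rightarrow> \<bar>u \<bullet> wedge x y\<bar>) = (case p of (x, y) \<Rightarrow> \<bar>u \<bullet> wedge y x\<bar>)"
        using AE_pair_fst_snd[OF M.prob_space_axioms N.prob_space_axioms M(2) N(2)]
        by eventually_elim (auto intro: wedge_simple_commute)
    qed (use i[OF M(1) N(1)] i' in \<open>auto dest: borel_measurable_integrable\<close>)
    also have "\<dots> = (\<integral>y. \<integral>x. \<bar>u \<bullet> wedge y x\<bar> \<partial>M \<partial>N)"
      using P.integral_snd[OF i'] by simp
    finally show "vz_support (vz_wedge x y) u = vz_support (vz_wedge y x) u"
      by (simp add: M(3) N(3) vz_support_wedge_law[OF M(1) N(1)] vz_support_wedge_law[OF N(1) M(1)])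
  qed
qed

text \<open>The adjoint of wedging with a product of two vectors is the composition of the two
  adjoints. The third factor is kept general, so that bilinear extension remains only for the first
  two.\<close>

lemma vz_wedge_assoc_law:
  assumes M: "integrable_law M" and N: "integrable_law N" and z: "z \<in> grass_total"
  shows "vz_wedge (vz_wedge (K_class M (\<lambda>x. x)) (K_class N (\<lambda>x. x))) z
    = vz_wedge (K_class M (\<lambda>x. x)) (vz_wedge (K_class N (\<lambda>x. x)) z)"
  unfolding vz_support_inject
proof
  fix u :: "'a ext"
  interpret M: prob_space M using M by (auto dest: integrable_lawD)
  interpret N: prob_space N using N by (auto dest: integrable_lawD)
  interpret P: pair_sigma_finite M N ..
  have zl: "z \<in> span law_classes" using z grass_total_subset by blast
  have Nz: "vz_wedge (K_class N (\<lambda>x. x)) z \<in> span law_classes"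
    using zl
  proof (induction rule: span_induct_alt)
    case (step c x y)
    then obtain L where L: "integrable_law L" "x = K_class L (\<lambda>x. x)" by (auto simp: law_classes_def)
    have "vz_wedge (K_class N (\<lambda>x. x)) x \<in> law_classes"
      using vz_wedge_law[OF N L(1)] by (auto simp: law_classes_def L(2))
    then show ?case using step
      by (auto simp: bilinear_radd[OF bilinear_vz_wedge] bilinear_rmul[OF bilinear_vz_wedge]
          intro!: span_add span_scale intro: span_base)
  qed (simp add: bilinear_rzero[OF bilinear_vz_wedge] span_zero)
  have adj: "adjoint (wedge (wedge x y)) u = adjoint (wedge y) (adjoint (wedge x) u)" for x y
    by (rule vector_eq_rdot[THEN iffD1]) (simp add: adjoint_wedge_inner wedge_assoc)
  let ?D = "distr (M \<Otimes>\<^sub>M N) borel (\<lambda>(x, y). wedge x y)"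
  note w = vz_wedge_law[OF M N]
  have m: "(\<lambda>(x, y). wedge x y) \<in> borel_measurable (M \<Otimes>\<^sub>M N)"
    using integrable_pair_bilinear[OF M N bilinear_wedge] by (rule borel_measurable_integrable)
  have iD: "integrable ?D (\<lambda>\<eta>. vz_support z (adjoint (wedge \<eta>) u))"
    by (rule integrable_vz_support[OF integrable_adjoint_slice(2)[OF bilinear_wedge w(1)]])
  have meas: "(\<lambda>\<eta>. vz_support z (adjoint (wedge \<eta>) u)) \<in> borel_measurable borel"
    using borel_measurable_integrable[OF iD] by (simp cong: measurable_cong_sets)
  have "integrable (M \<Otimes>\<^sub>M N) (\<lambda>p. vz_support z (adjoint (wedge (case p of (x, y) \<Rightarrow> wedge x y)) u))"
    using iD integrable_distr_eq[OF m meas] by simp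
  then have i: "integrable (M \<Otimes>\<^sub>M N) (\<lambda>(x, y). vz_support z (adjoint (wedge (wedge x y)) u))"
    by (simp add: split_def)
  have "vz_support (vz_wedge (vz_wedge (K_class M (\<lambda>x. x)) (K_class N (\<lambda>x. x))) z) u
    = (\<integral>\<eta>. vz_support z (adjoint (wedge \<eta>) u) \<partial>?D)"
    unfolding w(2) by (rule vz_support_wedge[OF w(1) zl])
  also have "\<dots> = (\<integral>p. vz_support z (adjoint (wedge (case p of (x, y) \<Rightarrow> wedge x y)) u) \<partial>(M \<Otimes>\<^sub>M N))"
    by (rule integral_distr[OF m meas])
  also have "\<dots> = (\<integral>p. (case p of (x, y) \<Rightarrow> vz_support z (adjoint (wedge (wedge x y)) u)) \<partial>(M \<Otimes>\<^sub>M N))"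
    by (simp add: split_def)
  also have "\<dots> = (\<integral>x. \<integral>y. vz_support z (adjoint (wedge (wedge x y)) u) \<partial>N \<partial>M)"
    using P.integral_fst[OF i] by simp
  also have "\<dots> = vz_support (vz_wedge (K_class M (\<lambda>x. x)) (vz_wedge (K_class N (\<lambda>x. x)) z)) u"
    by (simp add: vz_support_wedge[OF M Nz] vz_support_wedge[OF N zl] adj)
  finally show "vz_support (vz_wedge (vz_wedge (K_class M (\<lambda>x. x)) (K_class N (\<lambda>x. x))) z) u
    = vz_support (vz_wedge (K_class M (\<lambda>x. x)) (vz_wedge (K_class N (\<lambda>x. x)) z)) u" .
qed

lemma vz_wedge_assoc:
  assumes "x \<in> grass_total" "y \<in> grass_total" "z \<in> grass_total"
  shows "vz_wedge (vz_wedge x y) z = vz_wedge x (vz_wedge y z)"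
proof (rule bilinear_eq_grass_total[of "\<lambda>x y. vz_wedge (vz_wedge x y) z" "\<lambda>x y. vz_wedge x (vz_wedge y z)", OF _ _ assms(1,2)])
  note b = bilinear_ladd[OF bilinear_vz_wedge] bilinear_radd[OF bilinear_vz_wedge]
    bilinear_lmul[OF bilinear_vz_wedge] bilinear_rmul[OF bilinear_vz_wedge]
  show "bilinear (\<lambda>x y. vz_wedge (vz_wedge x y) z)" "bilinear (\<lambda>x y. vz_wedge x (vz_wedge y z))"
    by (auto simp: bilinear_def b intro!: linearI)
  show "vz_wedge (vz_wedge x y) z = vz_wedge x (vz_wedge y z)"
    if "x \<in> grass_classes d" "y \<in> grass_classes e" for d e x y
    using that assms(3) by (auto simp: grass_classes_def vz_wedge_assoc_law)
qed

lemma unit_class_grass: "K_class (return borel (axis {} 1)) (\<lambda>x. x) \<in> grass_classes 0"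
  using integrable_law_return[of "axis {} 1"]
  by (auto simp: grass_classes_def AE_return simple_ext_0 intro!: exI[of _ "return borel (axis {} 1)"])

lemma vz_wedge_one:
  assumes "x \<in> grass_total"
  shows "vz_wedge (K_class (return borel (axis {} 1)) (\<lambda>x. x)) x = x"
  unfolding vz_support_inject
proof
  fix u :: "'a ext"
  have x: "x \<in> span law_classes" using assms grass_total_subset by blast
  have "adjoint (wedge (axis {} 1)) u = u"
    by (rule vector_eq_rdot[THEN iffD1]) (simp add: adjoint_wedge_inner)
  moreover have "(\<lambda>\<eta>. vz_support x (adjoint (wedge \<eta>) u)) \<in> borel_measurable borel"
    using borel_measurable_integrable[OF integrable_vz_support[OF integrable_adjoint_slice(2)[OF bilinear_wedge integrable_law_return]]]
    by (simp cong: measurable_cong_sets)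
  ultimately show "vz_support (vz_wedge (K_class (return borel (axis {} 1)) (\<lambda>x. x)) x) u = vz_support x u"
    by (simp add: vz_support_wedge[OF integrable_law_return x] integral_return)
qed

text \<open>At a simple vector the support function of the product averages that of \<open>x\<close>
  over contractions of this vector, which are again multiples of simple vectors.\<close>

lemma vz_wedge_null_left:
  assumes y: "y \<in> grass_total" and x: "x \<in> grass_null_total"
  shows "vz_wedge y x \<in> grass_null_total"
proof -
  have xt: "x \<in> grass_total" "\<And>d v. v \<in> simple_ext d \<Longrightarrow> vz_support x v = 0"
    using x by (auto simp: grass_null_total_iff)
  have xl: "x \<in> span law_classes" using xt grass_total_subset by blast
  have "vz_support (vz_wedge y x) v = 0" if v: "v \<in> simple_ext d" for d v
  proof -
    have "linear (\<lambda>y. vz_support (vz_wedge y x) v)"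
      by (rule linearI) (simp_all add: bilinear_ladd[OF bilinear_vz_wedge] bilinear_lmul[OF bilinear_vz_wedge] vz_support_add vz_support_scale)
    then show ?thesis
    proof (rule linear_eq_0_on_span[OF _ _ y[unfolded grass_total_span]])
      fix z :: "'a ext vzonoid" assume "z \<in> (\<Union>d. grass_classes d)"
      then obtain e where "z \<in> grass_classes e" by auto
      then obtain M where M: "integrable_law M" "AE x in M. x \<in> simple_ext e" "z = K_class M (\<lambda>x. x)"
        by (rule grass_classesE)
      have "(\<integral>\<eta>. vz_support x (adjoint (wedge \<eta>) v) \<partial>M) = 0"
      proof (rule integral_eq_zero_AE, use M(2) in eventually_elim)
        case (elim \<eta>)
        obtain c d y where "y \<in> simple_ext d" "adjoint (wedge \<eta>) v = c *\<^sub>R y"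
          using adjoint_wedge_simple[OF elim v] by blast
        then show ?case using xt(2) by (simp add: vz_support_homogeneous[OF xl])
      qed
      then show "vz_support (vz_wedge z x) v = 0" by (simp add: M(3) vz_support_wedge[OF M(1) xl])
    qed
  qed
  then show ?thesis using vz_wedge_total[OF y xt(1)] by (auto simp: grass_null_total_iff)
qed

lemma abs_qring_wedge:
  assumes "x \<in> grass_total" "y \<in> grass_total"
  shows "abs_qring (vz_wedge x y) = abs_qring x * abs_qring y"
proof -
  let ?x = "rep_qring (abs_qring x)" and ?y = "rep_qring (abs_qring y)"
  have r: "?x \<in> grass_total" "?y \<in> grass_total" by (rule rep_qring_grass)+
  have "q_rel ?x x" "q_rel ?y y"
    using assms r abs_rep_qring[of "abs_qring x"] abs_rep_qring[of "abs_qring y"] by (simp_all flip: abs_qring_eq_iff)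
  then have n: "?x - x \<in> grass_null_total" "?y - y \<in> grass_null_total" by (simp_all add: q_rel_def)
  \<comment> \<open>Changing one representative at a time leaves products with a null class;
    commutativity puts the null factor on the right in both.\<close>
  have "vz_wedge ?x ?y - vz_wedge x y = vz_wedge ?x (?y - y) + vz_wedge y (?x - x)"
    using vz_wedge_commute[OF r(1) assms(2)] vz_wedge_commute[OF assms]
    by (simp add: bilinear_rsub[OF bilinear_vz_wedge])
  also have "\<dots> \<in> grass_null_total"
    using vz_wedge_null_left[OF r(1) n(2)] vz_wedge_null_left[OF assms(2) n(1)]
    unfolding grass_null_total_def by (rule span_add)
  finally have "q_rel (vz_wedge ?x ?y) (vz_wedge x y)"
    using r assms by (simp add: q_rel_def vz_wedge_total)
  then show ?thesis
    using r assms by (simp add: times_qring_def abs_qring_eq_iff[symmetric] vz_wedge_total)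
qed

lemma qring_cases: obtains x where "x \<in> grass_total" "q = abs_qring x"
  using rep_qring_grass abs_rep_qring by metis

lemma unit_class_total: "K_class (return borel (axis {} 1)) (\<lambda>x. x) \<in> grass_total"
  using unit_class_grass grass_span[of 0] grass_subset_total[of 0] by (auto intro: span_base)

instance qring :: (finite) comm_ring_1
proof
  fix a b c :: "'a qring"
  obtain x where x: "x \<in> grass_total" "a = abs_qring x" by (rule qring_cases)
  obtain y where y: "y \<in> grass_total" "b = abs_qring y" by (rule qring_cases)
  obtain z where z: "z \<in> grass_total" "c = abs_qring z" by (rule qring_cases)
  show "a * b * c = a * (b * c)"
    unfolding x y z using x y z by (simp add: abs_qring_wedge[symmetric] vz_wedge_total vz_wedge_assoc)
  show "a * b = b * a"
    unfolding x y using x y by (simp add: abs_qring_wedge[symmetric] vz_wedge_commute[of x y])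
  show "1 * a = a"
    unfolding x one_qring_def using x by (simp add: abs_qring_wedge[symmetric] unit_class_total vz_wedge_one)
  show "(a + b) * c = a * c + b * c"
    unfolding x y z using x y z
    by (simp add: abs_qring_wedge[symmetric] abs_qring_add[symmetric] vz_wedge_total subspace_add[OF subspace_grass_total]
        bilinear_ladd[OF bilinear_vz_wedge])
  \<comment> \<open>Zero and one are separated by their values at the empty product.\<close>
  have "q_support (1 :: 'a qring) (axis {} 1) = 1 / 2"
    using q_support_abs[OF unit_class_total, of "axis {} 1" 0]
    by (simp add: one_qring_def simple_ext_0 vz_support_law[OF integrable_law_return] integral_return inner_axis_axis)
  moreover have "q_support (0 :: 'a qring) (axis {} 1) = 0"
    using q_support_scale[of "axis {} 1" 0 0 0] by (simp add: simple_ext_0)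
  ultimately show "(0 :: 'a qring) \<noteq> 1" by force
qed

instance qring :: (finite) real_algebra_1
proof
  fix a :: real and x y :: "'a qring"
  obtain u where u: "u \<in> grass_total" "x = abs_qring u" by (rule qring_cases)
  obtain v where v: "v \<in> grass_total" "y = abs_qring v" by (rule qring_cases)
  show "a *\<^sub>R x * y = a *\<^sub>R (x * y)" "x * a *\<^sub>R y = a *\<^sub>R (x * y)"
    unfolding u v using u v
    by (simp_all add: abs_qring_wedge[symmetric] abs_qring_scale[symmetric] vz_wedge_total subspace_scale[OF subspace_grass_total]
        bilinear_lmul[OF bilinear_vz_wedge] bilinear_rmul[OF bilinear_vz_wedge])
qed

lemma subspace_q_deg: "subspace (q_deg d)"
proof (rule subspaceI)
  show "0 \<in> q_deg d" using subspace_0[OF subspace_grass] by (auto simp: q_deg_def intro!: image_eqI[of _ _ 0] simp: abs_qring_0)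
  fix p q :: "'a qring" and c assume "p \<in> q_deg d" "q \<in> q_deg d"
  then obtain x y where xy: "x \<in> grass d" "y \<in> grass d" "p = abs_qring x" "q = abs_qring y" by (auto simp: q_deg_def)
  have t: "x \<in> grass_total" "y \<in> grass_total" using xy grass_subset_total by auto
  show "p + q \<in> q_deg d" using xy t subspace_add[OF subspace_grass xy(1,2)]
    by (auto simp: q_deg_def simp flip: abs_qring_add)
  show "c *\<^sub>R p \<in> q_deg d" using xy t subspace_scale[OF subspace_grass xy(1)]
    by (auto simp: q_deg_def simp flip: abs_qring_scale)
qed

lemma q_deg_mult: "p \<in> q_deg d \<Longrightarrow> q \<in> q_deg e \<Longrightarrow> p * q \<in> q_deg (d + e)"
proof -
  assume "p \<in> q_deg d" "q \<in> q_deg e"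
  then obtain x y where xy: "x \<in> grass d" "y \<in> grass e" "p = abs_qring x" "q = abs_qring y" by (auto simp: q_deg_def)
  then have "x \<in> grass_total" "y \<in> grass_total" using grass_subset_total by blast+
  then have "p * q = abs_qring (vz_wedge x y)" by (simp add: xy abs_qring_wedge)
  then show ?thesis using vz_wedge_grass[OF xy(1,2)] by (simp add: q_deg_def)
qed

lemma q_deg_one: "1 \<in> q_deg 0"
  unfolding q_deg_def one_qring_def using unit_class_grass grass_span[of 0] by (auto intro: span_base)

lemma q_deg_power: "p \<in> q_deg d \<Longrightarrow> p ^ k \<in> q_deg (k * d)"
  by (induction k) (auto simp: q_deg_one q_deg_mult)

lemma q_support_degree:
  assumes "q \<in> q_deg d" "v \<in> simple_ext e" "d \<noteq> e"
  shows "q_support q v = 0"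
proof -
  obtain x where x: "x \<in> grass d" "q = abs_qring x" using assms(1) by (auto simp: q_deg_def)
  have "q_support q v = vz_support x v"
    unfolding x(2) using x(1) assms(2) grass_subset_total by (intro q_support_abs) auto
  also have "\<dots> = vz_support x (ext_degree d v)" by (rule vz_support_degree[OF x(1)])
  finally show ?thesis using assms by (simp add: ext_degree_simple vz_support_at_0)
qed

subsection \<open>Orthogonal maps\<close>

lemma ext_map_wedge:
  assumes f: "linear f"
  shows "ext_map f (wedge x y) = wedge (ext_map f x) (ext_map f y)"
proof -
  note s = linear_add[OF linear_ext_map] linear_scale[OF linear_ext_map]
  have 1: "ext_map f (wedge (ext_product vs) y) = wedge (ext_map f (ext_product vs)) (ext_map f y)" for vs y
    by (induction vs) (simp_all add: wedge_assoc ext_map_wedge_vec[OF f] ext_map_axis)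
  show ?thesis
    by (rule fun_cong[of _ _ x], rule ext_linear_eqI') (auto intro!: linearI simp: 1 s wedge_bilinear_simps)
qed

lemma ext_map_simple: "linear f \<Longrightarrow> x \<in> simple_ext d \<Longrightarrow> ext_map f x \<in> simple_ext d"
  by (auto simp: simple_ext_def ext_map_ext_product)

lemma adjoint_ext_map:
  assumes f: "orthogonal_transformation f"
  shows "adjoint (ext_map f) = ext_map (inv f)"
proof (rule adjoint_unique, intro allI)
  fix x y
  note f' = orthogonal_transformation_linear[OF f]
  have i: "linear (inv f)" by (rule orthogonal_transformation_linear[OF orthogonal_transformation_inv[OF f]])
  have "f (inv f z) = z" for z using orthogonal_transformation_surj[OF f] by (rule surj_f_inv_f)
  then have "ext_map f (ext_map (inv f) y) = y" by (simp add: ext_map_compose[OF f' i] ext_map_ident)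
  then show "ext_map f x \<bullet> y = x \<bullet> ext_map (inv f) y" by (metis ext_map_inner[OF f])
qed

lemma linear_vz_map: "linear f \<Longrightarrow> linear (vz_map f)"
  by (rule linearI) (simp_all add: vz_support_inject vz_support_map vz_support_add vz_support_scale)

lemma vz_map_law:
  fixes f :: "'v::euclidean_space \<Rightarrow> 'w::euclidean_space"
  assumes f: "linear f" and M: "integrable_law M"
  shows "integrable_law (distr M borel f)" "vz_map f (K_class M (\<lambda>x. x)) = K_class (distr M borel f) (\<lambda>x. x)"
proof -
  note l = integrable_lawD[OF M]
  have b: "bounded_linear f" using f by (simp add: linear_conv_bounded_linear)
  have i: "integrable M f" by (rule integrable_bounded_linear[OF b l(3)])
  show D: "integrable_law (distr M borel f)" by (rule integrable_law_distr[OF l(1) i])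
  show "vz_map f (K_class M (\<lambda>x. x)) = K_class (distr M borel f) (\<lambda>x. x)"
    unfolding vz_support_inject vz_support_map[OF f] vz_support_law[OF M] vz_support_law[OF D]
    using borel_measurable_integrable[OF i] adjoint_works[OF f]
    by (auto simp: integral_distr inner_commute)
qed

lemma vz_map_grass_classes:
  assumes f: "linear f" and x: "x \<in> grass_classes d"
  shows "vz_map (ext_map f) x \<in> grass_classes d"
proof -
  obtain M where M: "integrable_law M" "AE x in M. x \<in> simple_ext d" "x = K_class M (\<lambda>x. x)"
    using x by (rule grass_classesE)
  have m: "ext_map f \<in> borel_measurable M"
    using linear_ext_map integrable_lawD(2)[OF M(1)]
    by (simp cong: measurable_cong_sets) (intro borel_measurable_continuous_onI linear_continuous_on, simp add: linear_conv_bounded_linear)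
  have "AE x in M. ext_map f x \<in> simple_ext d" using M(2) by eventually_elim (rule ext_map_simple[OF f])
  then have "AE x in distr M borel (ext_map f). x \<in> simple_ext d" by (subst AE_distr_iff[OF m]) auto
  then show ?thesis using vz_map_law[OF linear_ext_map M(1), of f] by (auto simp: grass_classes_def M(3))
qed

lemma vz_map_total:
  assumes f: "linear f" and x: "x \<in> grass_total"
  shows "vz_map (ext_map f) x \<in> grass_total"
  using x unfolding grass_total_span
proof (induction rule: span_induct_alt)
  case (step c y z)
  then obtain d where "y \<in> grass_classes d" by auto
  then have "vz_map (ext_map f) y \<in> (\<Union>d. grass_classes d)" using vz_map_grass_classes[OF f] by blast
  then show ?case using step(2) linear_vz_map[OF linear_ext_map, of f]
    by (auto simp: linear_add linear_scale intro!: span_add span_scale intro: span_base)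
qed (simp add: linear_0[OF linear_vz_map[OF linear_ext_map]] span_zero)

lemma vz_map_wedge:
  fixes x y :: "'m::finite ext vzonoid"
  assumes f: "linear f" and "x \<in> grass_total" "y \<in> grass_total"
  shows "vz_map (ext_map f) (vz_wedge x y) = vz_wedge (vz_map (ext_map f) x) (vz_map (ext_map f) y)"
proof (rule bilinear_eq_grass_total[of "\<lambda>x y. vz_map (ext_map f) (vz_wedge x y)"
    "\<lambda>x y. vz_wedge (vz_map (ext_map f) x) (vz_map (ext_map f) y)", OF _ _ assms(2,3)])
  note b = bilinear_ladd[OF bilinear_vz_wedge] bilinear_radd[OF bilinear_vz_wedge]
    bilinear_lmul[OF bilinear_vz_wedge] bilinear_rmul[OF bilinear_vz_wedge]
    linear_add[OF linear_vz_map[OF linear_ext_map]] linear_scale[OF linear_vz_map[OF linear_ext_map]]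
  show "bilinear (\<lambda>x y. vz_map (ext_map f) (vz_wedge x y))"
    "bilinear (\<lambda>x y. vz_wedge (vz_map (ext_map f) x) (vz_map (ext_map f) y))"
    by (auto simp: bilinear_def b intro!: linearI)
  fix d e and x y :: "'m ext vzonoid" assume x: "x \<in> grass_classes d" and y: "y \<in> grass_classes e"
  obtain M where M: "integrable_law M" "x = K_class M (\<lambda>x. x)"
    using x by (rule grass_classesE)
  obtain N where N: "integrable_law N" "y = K_class N (\<lambda>x. x)"
    using y by (rule grass_classesE)
  note MD = vz_map_law[OF linear_ext_map M(1), of f] and ND = vz_map_law[OF linear_ext_map N(1), of f]
  have [measurable]: "ext_map f \<in> borel_measurable borel"
    using linear_ext_map by (intro borel_measurable_continuous_onI linear_continuous_on) (simp add: linear_conv_bounded_linear)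
  have [measurable_cong]: "sets M = sets borel" "sets N = sets borel" using M N by (auto dest: integrable_lawD)
  interpret N: prob_space "distr N borel (ext_map f)" using integrable_lawD[OF ND(1)] by simp
  show "vz_map (ext_map f) (vz_wedge x y) = vz_wedge (vz_map (ext_map f) x) (vz_map (ext_map f) y)"
    unfolding vz_support_inject
  proof
    fix u :: "'m ext"
    have m [measurable]: "(\<lambda>y. \<bar>u \<bullet> wedge x y\<bar>) \<in> borel_measurable borel" for x
      using linear_wedge_right[of x]
      by (intro borel_measurable_abs borel_measurable_inner borel_measurable_const borel_measurable_continuous_onI linear_continuous_on)
         (simp add: linear_conv_bounded_linear)
    have m2: "(\<lambda>x. \<integral>y. \<bar>u \<bullet> wedge x y\<bar> \<partial>distr N borel (ext_map f)) \<in> borel_measurable borel"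
    proof (rule N.borel_measurable_lebesgue_integral)
      have "(\<lambda>p. wedge (fst p) (snd p) :: 'm ext) \<in> borel_measurable (borel \<Otimes>\<^sub>M borel)"
        unfolding borel_prod
        by (intro borel_measurable_continuous_onI bounded_bilinear.continuous_on[OF bilinear_wedge[unfolded bilinear_conv_bounded_bilinear]]
        continuous_intros)
      then show "(\<lambda>(x, y). \<bar>u \<bullet> wedge x y\<bar>) \<in> borel_measurable (borel \<Otimes>\<^sub>M distr N borel (ext_map f))"
        by (simp add: split_def cong: measurable_cong_sets sets_pair_measure_cong)
    qed
    have "vz_support (vz_map (ext_map f) (vz_wedge x y)) u = (\<integral>x. \<integral>y. \<bar>u \<bullet> wedge (ext_map f x) (ext_map f y)\<bar> \<partial>N \<partial>M) / 2"
      using adjoint_works[OF linear_ext_map, of _ f]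
      by (simp add: vz_support_map[OF linear_ext_map] M(2) N(2) vz_support_wedge_law[OF M(1) N(1)] ext_map_wedge[OF f, symmetric] inner_commute)
    also have "\<dots> = (\<integral>x. \<integral>y. \<bar>u \<bullet> wedge x y\<bar> \<partial>distr N borel (ext_map f) \<partial>distr M borel (ext_map f)) / 2"
      using m2 by (simp add: integral_distr)
    also have "\<dots> = vz_support (vz_wedge (vz_map (ext_map f) x) (vz_map (ext_map f) y)) u"
      by (simp add: M(2) N(2) MD ND vz_support_wedge_law)
    finally show "vz_support (vz_map (ext_map f) (vz_wedge x y)) u = vz_support (vz_wedge (vz_map (ext_map f) x) (vz_map (ext_map f) y)) u" .
  qed
qed

lemma q_support_map:
  assumes f: "orthogonal_transformation f" and v: "v \<in> simple_ext d"
  shows "q_support (q_map f q) v = q_support q (ext_map (inv f) v)"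
proof -
  note f' = orthogonal_transformation_linear[OF f]
  have "q_support (q_map f q) v = vz_support (vz_map (ext_map f) (rep_qring q)) v"
    unfolding q_map_def by (rule q_support_abs[OF vz_map_total[OF f' rep_qring_grass] v])
  then show ?thesis by (simp add: vz_support_map[OF linear_ext_map] adjoint_ext_map[OF f] q_support_def)
qed

lemma q_map_abs:
  assumes f: "orthogonal_transformation f" and x: "x \<in> grass_total"
  shows "q_map f (abs_qring x) = abs_qring (vz_map (ext_map f) x)"
proof (rule qring_eqI)
  fix d and v :: "'a ext" assume v: "v \<in> simple_ext d"
  note f' = orthogonal_transformation_linear[OF f]
  have "ext_map (inv f) v \<in> simple_ext d"
    using v orthogonal_transformation_linear[OF orthogonal_transformation_inv[OF f]] by (intro ext_map_simple)
  then show "q_support (q_map f (abs_qring x)) v = q_support (abs_qring (vz_map (ext_map f) x)) v"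
    using q_support_abs[OF vz_map_total[OF f' x] v] q_support_abs[OF x]
    by (simp add: q_support_map[OF f v] vz_support_map[OF linear_ext_map] adjoint_ext_map[OF f])
qed

lemma q_map_mult:
  assumes f: "orthogonal_transformation f"
  shows "q_map f (p * q) = q_map f p * q_map f q"
proof -
  note f' = orthogonal_transformation_linear[OF f]
  obtain x where x: "x \<in> grass_total" "p = abs_qring x" by (rule qring_cases)
  obtain y where y: "y \<in> grass_total" "q = abs_qring y" by (rule qring_cases)
  show ?thesis unfolding x y using x y
    by (simp add: abs_qring_wedge[symmetric] q_map_abs[OF f] vz_wedge_total vz_map_total[OF f'] vz_map_wedge[OF f'])
qed

lemma linear_q_map:
  assumes f: "orthogonal_transformation f"
  shows "linear (q_map f)"
proof -
  have s: "ext_map (inv f) v \<in> simple_ext d" if "v \<in> simple_ext d" for d v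
    using that orthogonal_transformation_linear[OF orthogonal_transformation_inv[OF f]] by (intro ext_map_simple)
  show ?thesis
  proof (intro linearI qring_eqI)
    fix p q :: "'a qring" and c d and v :: "'a ext" assume v: "v \<in> simple_ext d"
    show "q_support (q_map f (p + q)) v = q_support (q_map f p + q_map f q) v"
      "q_support (q_map f (c *\<^sub>R p)) v = q_support (c *\<^sub>R q_map f p) v"
      by (simp_all add: q_support_map[OF f v] q_support_add[OF v] q_support_add[OF s[OF v]]
          q_support_scale[OF v] q_support_scale[OF s[OF v]])
  qed
qed

lemma q_map_one:
  assumes f: "orthogonal_transformation f"
  shows "q_map f 1 = 1"
proof (rule qring_eqI)
  fix d and v :: "'a ext" assume v: "v \<in> simple_ext d"
  have v': "ext_map (inv f) v \<in> simple_ext d"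
    using v orthogonal_transformation_linear[OF orthogonal_transformation_inv[OF f]] by (intro ext_map_simple)
  show "q_support (q_map f 1) v = q_support 1 v"
  proof (cases "d = 0")
    case True
    then show ?thesis using v v' q_support_map[OF f v, of 1] by (simp add: simple_ext_0)
  next
    case False
    then show ?thesis
      using q_support_degree[OF q_deg_one v] q_support_degree[OF q_deg_one v'] q_support_map[OF f v, of 1] by simp
  qed
qed

subsection \<open>The length\<close>

text \<open>Here \<open>C\<close> is a basis of the subspace and \<open>B\<close> one of its
  orthogonal complement; the size of \<open>B\<close> is the number of coordinates that survive a
  wedge with a basis of the subspace.\<close>

lemma orthonormal_split:
  fixes W :: "'w::euclidean_space set"
  assumes "subspace W"
  obtains C B where "pairwise orthogonal (C \<union> B)" "\<And>b. b \<in> C \<union> B \<Longrightarrow> norm b = 1" "C \<inter> B = {}"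
    "finite C" "finite B" "span C = W" "card C = dim W" "card B = DIM('w) - dim W"
    "\<And>x. (\<Sum>b\<in>C. (x \<bullet> b) *\<^sub>R b) + (\<Sum>b\<in>B. (x \<bullet> b) *\<^sub>R b) = x"
proof -
  obtain C where C: "C \<subseteq> W" "pairwise orthogonal C" "\<And>x. x \<in> C \<Longrightarrow> norm x = 1" "independent C" "card C = dim W" "span C = W"
    using orthonormal_basis_subspace[OF assms] by metis
  obtain B' where B': "C \<subseteq> B'" "pairwise orthogonal B'" "\<And>b. b \<in> B' \<Longrightarrow> norm b = 1"
    "finite B'" "card B' = DIM('w)" "span B' = UNIV" using orthonormal_extend[OF C(2,3)] by metis
  have CB: "C \<union> (B' - C) = B'" using B'(1) by auto
  have fC: "finite C" using B'(1,4) finite_subset by blast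
  have "(\<Sum>b\<in>B'. (x \<bullet> b) *\<^sub>R b) = x" for x
    using orthonormal_basis_expand[OF B'(2,3) _ B'(4), of x] B'(6) by (simp add: inner_commute)
  moreover have "(\<Sum>b\<in>B'. (x \<bullet> b) *\<^sub>R b) = (\<Sum>b\<in>C. (x \<bullet> b) *\<^sub>R b) + (\<Sum>b\<in>B' - C. (x \<bullet> b) *\<^sub>R b)" for x
    using sum.subset_diff[OF B'(1,4), of "\<lambda>b. (x \<bullet> b) *\<^sub>R b"] by (simp add: add.commute)
  ultimately have e: "(\<Sum>b\<in>C. (x \<bullet> b) *\<^sub>R b) + (\<Sum>b\<in>B' - C. (x \<bullet> b) *\<^sub>R b) = x" for x by metis
  show ?thesis
  proof (rule that[of C "B' - C"])
    show "norm b = 1" if "b \<in> C \<union> (B' - C)" for b using that B'(1,3) by auto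
  qed (use B'(2,4,5) C(5,6) fC e CB card_Diff_subset[OF fC B'(1)] in auto)
qed

lemma contract_span_orthogonal:
  assumes "\<And>c. c \<in> C \<Longrightarrow> p \<bullet> c = 0" "set vs \<subseteq> span C"
  shows "contract p (ext_product vs) = 0"
proof (rule contract_ext_product_orthogonal)
  fix v assume "v \<in> set vs"
  then have "v \<in> span C" using assms(2) by auto
  then show "p \<bullet> v = 0" by (induction rule: span_induct_alt) (auto simp: inner_add_right assms(1))
qed

text \<open>The part of \<open>x\<close> in the span of the factors is killed by the wedge, so only
  the orthogonal projection \<pi> matters, and for it wedging multiplies norms.\<close>

lemma wedge_vec_reduce:
  assumes CB: "pairwise orthogonal (C \<union> B)" "\<And>b. b \<in> C \<union> B \<Longrightarrow> norm b = 1" "C \<inter> B = {}" "finite C" "finite B"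
      "span C = span (set vs)" "\<And>x. (\<Sum>b\<in>C. (x \<bullet> b) *\<^sub>R b) + (\<Sum>b\<in>B. (x \<bullet> b) *\<^sub>R b) = x"
  defines "\<pi> \<equiv> \<lambda>x. \<Sum>b\<in>B. (x \<bullet> b) *\<^sub>R b"
  shows "wedge (ext_vec x) (ext_product vs) = wedge (ext_vec (\<pi> x)) (ext_product vs)"
    and "contract (\<pi> x) (ext_product vs) = 0"
    and "norm (\<pi> x) = sqrt (\<Sum>b\<in>B. (x \<bullet> b)\<^sup>2)"
    and "norm (wedge (ext_vec x) (ext_product vs)) = sqrt (\<Sum>b\<in>B. (x \<bullet> b)\<^sup>2) * norm (ext_product vs)"
proof -
  have o: "b \<bullet> c = (if b = c then 1 else 0)" if "b \<in> C \<union> B" "c \<in> C \<union> B" for b c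
    using CB(1) CB(2)[OF that(1)] that by (auto simp: pairwise_def orthogonal_def dot_square_norm)
  have "(\<Sum>b\<in>C. (x \<bullet> b) *\<^sub>R b) \<in> span (set vs)"
    unfolding CB(6)[symmetric] by (intro span_sum span_scale span_base)
  then have "wedge (ext_vec (\<Sum>b\<in>C. (x \<bullet> b) *\<^sub>R b)) (ext_product vs) = 0" by (rule wedge_ext_product_span)
  moreover have "x = (\<Sum>b\<in>C. (x \<bullet> b) *\<^sub>R b) + \<pi> x" using CB(7)[of x] by (simp add: \<pi>_def)
  ultimately show 1: "wedge (ext_vec x) (ext_product vs) = wedge (ext_vec (\<pi> x)) (ext_product vs)"
    by (metis (no_types, lifting) add.left_neutral ext_vec_simps(1) wedge_bilinear_simps(1))
  have "\<pi> x \<bullet> c = 0" if "c \<in> C" for c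
    unfolding \<pi>_def inner_sum_left using that CB(3) by (intro sum.neutral) (auto simp: o)
  then show 2: "contract (\<pi> x) (ext_product vs) = 0"
    using span_superset[of "set vs"] by (intro contract_span_orthogonal[of C]) (auto simp: CB(6))
  have "\<pi> x \<bullet> \<pi> x = (\<Sum>b\<in>B. (x \<bullet> b) * (\<pi> x \<bullet> b))"
    by (subst (2) \<pi>_def) (simp add: inner_sum_right)
  also have "\<dots> = (\<Sum>b\<in>B. (x \<bullet> b)\<^sup>2)"
  proof (rule sum.cong[OF refl])
    fix b assume b: "b \<in> B"
    have "\<pi> x \<bullet> b = (\<Sum>c\<in>B. if c = b then x \<bullet> b else 0)"
      unfolding \<pi>_def inner_sum_left using b by (intro sum.cong) (auto simp: o)
    then show "(x \<bullet> b) * (\<pi> x \<bullet> b) = (x \<bullet> b)\<^sup>2" using b CB(5) by (simp add: power2_eq_square)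
  qed
  finally show 3: "norm (\<pi> x) = sqrt (\<Sum>b\<in>B. (x \<bullet> b)\<^sup>2)" by (simp add: norm_eq_sqrt_inner)
  show "norm (wedge (ext_vec x) (ext_product vs)) = sqrt (\<Sum>b\<in>B. (x \<bullet> b)\<^sup>2) * norm (ext_product vs)"
    unfolding 1 norm_wedge_orthogonal[OF 2] 3 ..
qed

text \<open>A Gaussian vector represents the class of the ball up to a scalar, see
  \<open>cp_beta_eq\<close>; its rotation invariance makes lengths of products computable.\<close>

definition gauss_law :: "'m::finite ext measure" where
  "gauss_law = distr gauss_space borel (\<lambda>\<omega>. ext_vec (gauss_vec \<omega>))"

lemma integrable_ext_gauss: "integrable gauss_space (\<lambda>\<omega>. ext_vec (gauss_vec \<omega> :: real ^ 'm::finite))"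
  using linear_ext_vec by (intro integrable_bounded_linear[OF _ integrable_gauss_vec]) (simp add: linear_conv_bounded_linear)

lemma integrable_gauss_law: "integrable_law gauss_law"
  unfolding gauss_law_def by (rule integrable_law_distr[OF prob_space_gauss_space integrable_ext_gauss])

lemma gauss_class_grass: "K_class gauss_law (\<lambda>x. x) \<in> grass_classes 1"
proof -
  have "ext_vec v \<in> simple_ext 1" for v :: "real ^ 'a"
    by (auto simp: simple_ext_def intro!: exI[of _ "[v]"])
  then have "AE x in gauss_law. x \<in> (simple_ext 1 :: 'a ext set)"
    unfolding gauss_law_def using borel_measurable_integrable[OF integrable_ext_gauss]
    by (subst AE_distr_iff) auto
  then show ?thesis using integrable_gauss_law by (auto simp: grass_classes_def)
qed

text \<open>The wedge sees only the projection of the Gaussian vector to the orthogonal complement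
  of the factors, a standard Gaussian vector in \<open>CARD('m) - e\<close> dimensions.\<close>

lemma gauss_wedge_norm:
  fixes y :: "'m::finite ext"
  assumes "y \<in> simple_ext e" "e < CARD('m)"
  shows "(\<integral>x. norm (wedge x y) \<partial>gauss_law) = kappa (CARD('m) - e) * norm y"
proof -
  obtain vs where vs: "y = ext_product vs" "length vs = e" using assms by (auto simp: simple_ext_def)
  have [measurable]: "(\<lambda>x. wedge x y) \<in> borel_measurable borel"
    using linear_wedge_left by (intro borel_measurable_continuous_onI linear_continuous_on) (simp add: linear_conv_bounded_linear)
  have "(\<integral>x. norm (wedge x y) \<partial>gauss_law) = (\<integral>\<omega>. norm (wedge (ext_vec (gauss_vec \<omega>)) y) \<partial>gauss_space)"
    unfolding gauss_law_def using borel_measurable_integrable[OF integrable_ext_gauss]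
    by (subst integral_distr) auto
  also have "\<dots> = kappa (CARD('m) - e) * norm y"
  proof (cases "y = 0")
    case False
    \<comment> \<open>A nonzero product has independent factors.\<close>
    have d: "dim (span (set vs)) = e"
    proof -
      have "dim (set vs) \<ge> e" using ext_product_dependent[of vs] False vs by (meson not_le)
      moreover have "dim (set vs) \<le> e" using dim_le_card'[of "set vs"] card_length[of vs] vs by simp
      ultimately show ?thesis by simp
    qed
    obtain C B where CB: "pairwise orthogonal (C \<union> B)" "\<And>b. b \<in> C \<union> B \<Longrightarrow> norm b = 1" "C \<inter> B = {}"
      "finite C" "finite B" "span C = span (set vs)" "card B = DIM(real ^ 'm) - dim (span (set vs))"
      "\<And>x. (\<Sum>b\<in>C. (x \<bullet> b) *\<^sub>R b) + (\<Sum>b\<in>B. (x \<bullet> b) *\<^sub>R b) = x"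
      by (rule orthonormal_split[OF subspace_span]) blast
    have card: "card B = CARD('m) - e" using CB(7) d by simp
    then have "B \<noteq> {}" using assms(2) by auto
    moreover have "pairwise orthogonal B" using CB(1) by (rule pairwise_mono) auto
    ultimately have "has_bochner_integral gauss_space (\<lambda>\<omega>. sqrt (\<Sum>b\<in>B. (gauss_vec \<omega> \<bullet> b)\<^sup>2)) (kappa (CARD('m) - e))"
      using gauss_mean_norm[of B] CB(2) card by simp
    note mean = has_bochner_integral_integral_eq[OF has_bochner_integral_mult_left[OF this, of "norm y"]]
    have "norm (wedge (ext_vec x) (ext_product vs)) = sqrt (\<Sum>b\<in>B. (x \<bullet> b)\<^sup>2) * norm (ext_product vs)" for x
      by (rule wedge_vec_reduce(4)[OF CB(1-6,8)])
    then show ?thesis using mean by (simp add: vs(1))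
  qed (simp add: wedge_bilinear_simps)
  finally show ?thesis .
qed

lemma vz_length_wedge_law:
  assumes M: "integrable_law M" and N: "integrable_law N"
  shows "vz_length (vz_wedge (K_class M (\<lambda>x. x)) (K_class N (\<lambda>x. x))) = (\<integral>y. \<integral>x. norm (wedge x y) \<partial>M \<partial>N)"
proof -
  interpret M: prob_space M using M by (auto dest: integrable_lawD)
  interpret N: prob_space N using N by (auto dest: integrable_lawD)
  interpret P: pair_sigma_finite M N ..
  note w = vz_wedge_law[OF M N]
  have i: "integrable (M \<Otimes>\<^sub>M N) (\<lambda>(x, y). wedge x y)" by (rule integrable_pair_bilinear[OF M N bilinear_wedge])
  have "vz_length (vz_wedge (K_class M (\<lambda>x. x)) (K_class N (\<lambda>x. x))) = (\<integral>p. norm (case p of (x, y) \<Rightarrow> wedge x y) \<partial>(M \<Otimes>\<^sub>M N))"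
    unfolding w(2) vz_length_K_class[OF w(1)] by (rule integral_distr[OF borel_measurable_integrable[OF i]]) simp
  also have "\<dots> = (\<integral>p. (case p of (x, y) \<Rightarrow> norm (wedge x y)) \<partial>(M \<Otimes>\<^sub>M N))" by (simp add: split_def)
  also have "\<dots> = (\<integral>y. \<integral>x. norm (wedge x y) \<partial>M \<partial>N)"
    using P.integral_snd[of "\<lambda>x y. norm (wedge x y)"] integrable_norm[OF i] by (simp add: split_def)
  finally show ?thesis .
qed

text \<open>The constant is the same for all simple vectors of degree \<open>e\<close>, so it can be
  taken out of the integral over any law of such vectors. A length is thereby determined by one in
  the next higher degree.\<close>

lemma vz_length_gauss_wedge:
  fixes x :: "'m::finite ext vzonoid"
  assumes x: "x \<in> grass e" and e: "e < CARD('m)"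
  shows "vz_length (vz_wedge (K_class gauss_law (\<lambda>x. x)) x) = kappa (CARD('m) - e) * vz_length x"
proof (rule linear_eq_on_span[OF _ _ _ x[unfolded grass_span]])
  note l = linear_add[OF linear_vz_length] linear_scale[OF linear_vz_length]
  show "linear (\<lambda>x. vz_length (vz_wedge (K_class gauss_law (\<lambda>x. x)) x))" "linear (\<lambda>x. kappa (CARD('m) - e) * vz_length x)"
    by (auto intro!: linearI simp: bilinear_radd[OF bilinear_vz_wedge] bilinear_rmul[OF bilinear_vz_wedge] l algebra_simps)
  fix z :: "'m ext vzonoid" assume "z \<in> grass_classes e"
  then obtain M where M: "integrable_law M" "AE x in M. x \<in> simple_ext e" "z = K_class M (\<lambda>x. x)"
    by (rule grass_classesE)
  have [measurable_cong]: "sets M = sets borel" using M by (auto dest: integrable_lawD)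
  have "(\<integral>y. \<integral>x. norm (wedge x y) \<partial>gauss_law \<partial>M) = (\<integral>y. kappa (CARD('m) - e) * norm y \<partial>M)"
  proof (rule integral_cong_AE)
    interpret G: prob_space gauss_law using integrable_gauss_law by (auto dest: integrable_lawD)
    have "(\<lambda>p. wedge (snd p) (fst p) :: 'm ext) \<in> borel_measurable (borel \<Otimes>\<^sub>M borel)"
      unfolding borel_prod
      by (intro borel_measurable_continuous_onI bounded_bilinear.continuous_on[OF bilinear_wedge[unfolded bilinear_conv_bounded_bilinear]]
        continuous_intros)
    then have "(\<lambda>(y, x). norm (wedge x y :: 'm ext)) \<in> borel_measurable (M \<Otimes>\<^sub>M gauss_law)"
      by (simp add: split_def gauss_law_def cong: measurable_cong_sets sets_pair_measure_cong)
    then show "(\<lambda>y. \<integral>x. norm (wedge x y) \<partial>gauss_law) \<in> borel_measurable M"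
      by (rule G.borel_measurable_lebesgue_integral)
    show "AE y in M. (\<integral>x. norm (wedge x y) \<partial>gauss_law) = kappa (CARD('m) - e) * norm y"
      using M(2) by eventually_elim (rule gauss_wedge_norm[OF _ e])
  qed measurable
  then show "vz_length (vz_wedge (K_class gauss_law (\<lambda>x. x)) z) = kappa (CARD('m) - e) * vz_length z"
    by (simp add: M(3) vz_length_wedge_law[OF integrable_gauss_law M(1)] vz_length_K_class[OF M(1)])
qed

text \<open>The top degree is one-dimensional, so there the norm is the absolute inner product with
  the volume form.\<close>

lemma vz_length_top:
  fixes x :: "'m::finite ext vzonoid"
  assumes x: "x \<in> grass CARD('m)"
  shows "vz_length x = 2 * vz_support x (axis UNIV 1)"
proof (rule linear_eq_on_span[OF linear_vz_length _ _ x[unfolded grass_span]])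
  show "linear (\<lambda>x. 2 * vz_support x (axis UNIV 1 :: 'm ext))"
    by (rule linearI) (simp_all add: vz_support_add vz_support_scale)
  fix z :: "'m ext vzonoid" assume "z \<in> grass_classes CARD('m)"
  then obtain M where M: "integrable_law M" "AE x in M. x \<in> simple_ext CARD('m)" "z = K_class M (\<lambda>x. x)"
    by (rule grass_classesE)
  have [measurable_cong]: "sets M = sets borel" using M by (auto dest: integrable_lawD)
  have "norm x = \<bar>axis UNIV 1 \<bullet> x\<bar>" if "x \<in> simple_ext CARD('m)" for x :: "'m ext"
  proof -
    have "x = ext_degree CARD('m) x" using that by (simp add: ext_degree_simple)
    also have "\<dots> = (axis UNIV 1 \<bullet> x) *\<^sub>R axis UNIV 1"
    proof -
      have "axis UNIV 1 \<bullet> x = x $ UNIV" by (subst inner_commute) (simp add: inner_axis)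
      moreover have "card I = CARD('m) \<longleftrightarrow> I = UNIV" for I :: "'m set"
        using card_eq_UNIV_imp_eq_UNIV[of I] by auto
      ultimately show ?thesis by (simp add: ext_degree_def vec_eq_iff axis_def)
    qed
    finally have "norm x = norm ((axis UNIV 1 \<bullet> x) *\<^sub>R (axis UNIV 1 :: 'm ext))" by simp
    then show ?thesis by simp
  qed
  then have "(\<integral>x. norm x \<partial>M) = (\<integral>x. \<bar>axis UNIV 1 \<bullet> x\<bar> \<partial>M)"
    using M(2) by (intro integral_cong_AE) auto
  then show "vz_length z = 2 * vz_support z (axis UNIV 1)"
    by (simp add: M(3) vz_length_K_class[OF M(1)] vz_support_law[OF M(1)])
qed

text \<open>In top degree the length is a value of the support function at a multiple of a simple
  vector. From a lower degree one climbs by wedging with a Gaussian vector, which preserves null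
  classes and multiplies the length by a positive constant; the induction descends from the
  top.\<close>

lemma vz_length_null:
  fixes x :: "'m::finite ext vzonoid"
  assumes "x \<in> grass_null e"
  shows "vz_length x = 0"
proof (cases "e \<le> CARD('m)")
  case True
  then show ?thesis using assms
  proof (induction arbitrary: x rule: inc_induct)
    case base
    obtain c vs where "length vs = CARD('m)" "axis UNIV 1 = (c *\<^sub>R ext_product vs :: 'm ext)"
      using axis_ext_product[of "UNIV :: 'm set"] by blast
    then have "vz_support x (axis UNIV 1) = 0"
      using base vz_support_homogeneous[of x c "ext_product vs"] subsetD[OF grass_subset, of x]
      by (auto simp: grass_null_iff simple_ext_def)
    then show ?case using base vz_length_top[of x] by (simp add: grass_null_iff)
  next
    case (step e)
    let ?g = "K_class gauss_law (\<lambda>x. x) :: 'm ext vzonoid"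
    have g: "?g \<in> grass 1" using gauss_class_grass grass_span by (metis span_base)
    have "x \<in> (\<Union>d. grass_null d)" using step.prems by blast
    then have x: "x \<in> grass e" "x \<in> grass_null_total"
      using step.prems unfolding grass_null_total_def by (auto simp: grass_null_iff intro!: span_base)
    have "vz_wedge ?g x \<in> grass (Suc e)" using vz_wedge_grass[OF g x(1)] by simp
    moreover have "vz_wedge ?g x \<in> grass_null_total"
      using g grass_subset_total x(2) by (intro vz_wedge_null_left) auto
    ultimately have "vz_wedge ?g x \<in> grass_null (Suc e)" by (simp add: grass_null_iff grass_null_total_iff)
    then have "vz_length (vz_wedge ?g x) = 0" by (rule step.IH)
    then show ?case using vz_length_gauss_wedge[OF x(1) step.hyps(2)] kappa_pos[of "CARD('m) - e"] by simp
  qed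
next
  case False
  then show ?thesis using grass_above[of x e] assms by (simp add: grass_null_iff linear_0[OF linear_vz_length])
qed

lemma vz_length_null_total: "x \<in> grass_null_total \<Longrightarrow> vz_length x = 0"
  unfolding grass_null_total_def
  by (rule linear_eq_0_on_span[OF linear_vz_length]) (auto intro: vz_length_null)

lemma q_length_abs: "x \<in> grass_total \<Longrightarrow> q_length (abs_qring x) = vz_length x"
proof -
  assume x: "x \<in> grass_total"
  then have "q_rel (rep_qring (abs_qring x)) x"
    using rep_qring_grass[of "abs_qring x"] abs_rep_qring[of "abs_qring x"] by (simp flip: abs_qring_eq_iff)
  then have "vz_length (rep_qring (abs_qring x) - x) = 0" by (auto simp: q_rel_def vz_length_null_total)
  then show ?thesis by (simp add: q_length_def linear_diff[OF linear_vz_length])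
qed

lemma linear_q_length: "linear q_length"
proof (rule linearI)
  fix p q :: "'a qring" and c
  obtain x where x: "x \<in> grass_total" "p = abs_qring x" by (rule qring_cases)
  obtain y where y: "y \<in> grass_total" "q = abs_qring y" by (rule qring_cases)
  show "q_length (p + q) = q_length p + q_length q"
    using x y by (simp add: abs_qring_add[symmetric] q_length_abs subspace_add[OF subspace_grass_total] linear_add[OF linear_vz_length])
  show "q_length (c *\<^sub>R p) = c *\<^sub>R q_length p"
    using x by (simp add: abs_qring_scale[symmetric] q_length_abs subspace_scale[OF subspace_grass_total] linear_scale[OF linear_vz_length])
qed

definition q_gauss :: "'m::finite qring" where
  "q_gauss = abs_qring (K_class gauss_law (\<lambda>x. x))"

lemma gauss_class_grass': "K_class gauss_law (\<lambda>x. x) \<in> grass 1"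
  using gauss_class_grass grass_span by (metis span_base)

lemma q_gauss_deg: "q_gauss \<in> q_deg 1"
  unfolding q_gauss_def q_deg_def using gauss_class_grass' by blast

lemma q_length_gauss:
  fixes q :: "'m::finite qring"
  assumes "q \<in> q_deg e" "e < CARD('m)"
  shows "q_length (q_gauss * q) = kappa (CARD('m) - e) * q_length q"
proof -
  obtain x where x: "x \<in> grass e" "q = abs_qring x" using assms by (auto simp: q_deg_def)
  have "(K_class gauss_law (\<lambda>x. x) :: 'm ext vzonoid) \<in> grass_total" "x \<in> grass_total"
    using x(1) gauss_class_grass' grass_subset_total by blast+
  then show ?thesis
    using x vz_length_gauss_wedge[OF x(1) assms(2)]
    by (simp add: q_gauss_def abs_qring_wedge[symmetric] q_length_abs vz_wedge_total)
qed

section \<open>The Hermitian structure\<close>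

definition imul :: "real ^ ('n::finite \<times> bool) \<Rightarrow> real ^ ('n \<times> bool)" where
  "imul x = (\<chi> p. if snd p then x $ (fst p, False) else - x $ (fst p, True))"

lemma sum_prod_bool: "(\<Sum>p\<in>UNIV. f p) = (\<Sum>i\<in>(UNIV :: 'n::finite set). f (i, False) + f (i, True))"
proof -
  have "(\<Sum>p\<in>UNIV. f p) = (\<Sum>i\<in>(UNIV :: 'n set). \<Sum>b\<in>(UNIV :: bool set). f (i, b))"
    by (simp add: sum.cartesian_product flip: UNIV_Times_UNIV)
  then show ?thesis by (simp add: UNIV_bool add.commute)
qed

lemma linear_imul: "linear imul"
  by (rule linearI) (auto simp: imul_def vec_eq_iff)

lemmas imul_simps = linear_add[OF linear_imul] linear_scale[OF linear_imul] linear_0[OF linear_imul]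
  linear_neg[OF linear_imul] linear_diff[OF linear_imul]

lemma imul_imul [simp]: "imul (imul x) = - x"
  by (auto simp: imul_def vec_eq_iff)

lemma imul_inner_left: "imul x \<bullet> y = - (x \<bullet> imul y)"
  by (simp add: inner_vec_def sum_prod_bool imul_def sum_negf[symmetric] algebra_simps)

lemma imul_inner [simp]: "imul x \<bullet> imul y = x \<bullet> y"
  by (simp add: imul_inner_left)

lemma inner_imul_self [simp]: "x \<bullet> imul x = 0" "imul x \<bullet> x = 0"
  using imul_inner_left[of x x] by (simp_all add: inner_commute)

lemma norm_imul [simp]: "norm (imul x) = norm x"
  by (simp add: norm_eq_sqrt_inner)

text \<open>The unitary group in real form; invariance can then be tested without matrices.\<close>

definition hermitian_map :: "(real ^ ('n::finite \<times> bool) \<Rightarrow> real ^ ('n \<times> bool)) \<Rightarrow> bool" where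
  "hermitian_map f \<longleftrightarrow> orthogonal_transformation f \<and> (\<forall>x. f (imul x) = imul (f x))"

lemma complexify_realify [simp]: "complexify (realify v) = v"
  by (simp add: complexify_def realify_def vec_eq_iff)

lemma realify_complexify [simp]: "realify (complexify x) = x"
  by (auto simp: complexify_def realify_def vec_eq_iff)

lemma linear_realify: "linear realify"
  by (rule linearI) (simp_all add: realify_def vec_eq_iff)

lemma linear_complexify: "linear complexify"
  by (rule linearI; rule vec_eq_iff[THEN iffD2]; rule allI; rule complex_eqI; simp add: complexify_def)

lemma realify_imul: "realify (\<i> *s v) = imul (realify v)"
  by (auto simp: realify_def imul_def vec_eq_iff)

lemma complexify_imul: "complexify (imul x) = \<i> *s complexify x"
  by (auto simp: complexify_def imul_def vec_eq_iff complex_eq_iff)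

lemma cinner_Re: "Re (cinner x y) = realify x \<bullet> realify y"
  by (simp add: cinner_def realify_def inner_vec_def sum_prod_bool)

lemma cinner_eq: "cinner x y = Complex (realify x \<bullet> realify y) (- (realify x \<bullet> imul (realify y)))"
proof -
  have "Im (cinner x y) = - Re (cinner x (\<i> *s y))" by (simp add: cinner_scale)
  then show ?thesis by (simp add: complex_eq_iff cinner_Re realify_imul)
qed

lemma linear_real_action: "linear (real_action A)"
proof (rule linearI)
  have s: "c *\<^sub>R v = complex_of_real c *s v" for c and v :: "complex ^ 'a"
    by (simp add: vec_eq_iff) (simp add: scaleR_conv_of_real)
  show "real_action A (x + y) = real_action A x + real_action A y" for x y
    by (simp add: real_action_def linear_add[OF linear_complexify] linear_add[OF linear_realify] matrix_vector_right_distrib)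
  show "real_action A (c *\<^sub>R x) = c *\<^sub>R real_action A x" for c x
    by (simp add: real_action_def linear_scale[OF linear_complexify] s vector_scalar_commute)
       (simp add: linear_scale[OF linear_realify] flip: s)
qed

lemma real_action_imul: "real_action A (imul x) = imul (real_action A x)"
  by (simp add: real_action_def complexify_imul vector_scalar_commute realify_imul)

lemma real_action_hermitian:
  assumes "A \<in> unitary_group"
  shows "hermitian_map (real_action A)"
proof -
  have n: "norm (realify v) = norm v" for v :: "complex ^ 'a"
  proof -
    have "complex_of_real ((norm v)\<^sup>2) = complex_of_real (Re (cinner v v))" by (simp add: cinner_self)
    then have "(norm v)\<^sup>2 = realify v \<bullet> realify v" by (simp only: of_real_eq_iff cinner_Re)
    then have "(norm (realify v))\<^sup>2 = (norm v)\<^sup>2" by (simp only: power2_norm_eq_inner)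
    then show ?thesis by (rule power2_eq_imp_eq) simp_all
  qed
  have "norm (real_action A x) = norm x" for x
    using n[of "A *v complexify x"] n[of "complexify x"] unitary_norm[OF assms] by (simp add: real_action_def)
  then show ?thesis
    by (simp add: hermitian_map_def orthogonal_transformation linear_real_action real_action_imul)
qed

lemma hermitian_map_real_action:
  assumes f: "hermitian_map f"
  obtains A where "A \<in> unitary_group" "real_action A = f"
proof -
  note fo = f[unfolded hermitian_map_def, THEN conjunct1] and fJ = f[unfolded hermitian_map_def, THEN conjunct2, rule_format]
  define g where "g v = complexify (f (realify v))" for v
  have g_lin: "linear g"
    unfolding g_def
    using linear_compose[OF linear_compose[OF linear_realify orthogonal_transformation_linear[OF fo]] linear_complexify]
    by (simp add: o_def)
  have gi: "g (\<i> *s v) = \<i> *s g v" for v by (simp add: g_def realify_imul fJ complexify_imul)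
  have gs: "g (c *s v) = c *s g v" for c v
  proof -
    \<comment> \<open>Splitting the scalar into real and imaginary part reduces complex linearity to
      real linearity and commutation with the imaginary unit.\<close>
    have e: "c *s v = Re c *\<^sub>R v + Im c *\<^sub>R (\<i> *s v)" for v :: "complex ^ 'a"
      by (simp add: vec_eq_iff) (simp add: scaleR_conv_of_real complex_eq_iff)
    show ?thesis unfolding e[of v] e[of "g v"] by (simp add: linear_add[OF g_lin] linear_scale[OF g_lin] gi)
  qed
  have cg: "cinner (g x) (g y) = cinner x y" for x y
    using fo by (simp add: cinner_eq g_def fJ[symmetric] orthogonal_transformation_def)
  define A where "A = (\<chi> i j. g (axis j 1) $ i)"
  have A: "A *v v = g v" for v
  proof -
    have "g v = g (\<Sum>j\<in>UNIV. v $ j *s axis j 1)"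
      by (rule arg_cong[where f = g]) (simp add: vec_eq_iff axis_def if_distrib[of "(*) _"] cong: if_cong)
    also have "\<dots> = (\<Sum>j\<in>UNIV. v $ j *s g (axis j 1))" by (simp add: linear_sum[OF g_lin] gs)
    also have "\<dots> = A *v v" by (simp add: vec_eq_iff A_def matrix_vector_mult_def mult.commute)
    finally show ?thesis by simp
  qed
  have "(cadjoint A ** A) $ i $ j = mat 1 $ i $ j" for i j
  proof -
    have "(cadjoint A ** A) $ i $ j = cinner (g (axis i 1)) (g (axis j 1))"
      by (simp add: matrix_matrix_mult_def cadjoint_def cinner_def A_def)
    also have "\<dots> = cinner (axis i 1) (axis j 1)" by (rule cg)
    also have "\<dots> = (\<Sum>k\<in>UNIV. if k = i then (if i = j then 1 else 0) else 0)"
      unfolding cinner_def by (intro sum.cong) (auto simp: axis_def)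
    finally show ?thesis by (simp add: mat_def)
  qed
  then have "A \<in> unitary_group" by (simp add: unitary_group_iff vec_eq_iff)
  moreover have "real_action A = f" by (rule ext) (simp add: real_action_def A g_def)
  ultimately show ?thesis by (rule that)
qed

lemma hermitian_map_inv:
  assumes f: "hermitian_map f"
  shows "hermitian_map (inv f)" "inv (inv f) = f"
proof -
  note fo = f[unfolded hermitian_map_def, THEN conjunct1] and fJ = f[unfolded hermitian_map_def, THEN conjunct2, rule_format]
  have "inv f (imul x) = imul (inv f x)" for x
    using orthogonal_transformation_inj[OF fo] surj_f_inv_f[OF orthogonal_transformation_surj[OF fo], of x]
    by (metis fJ inv_f_f)
  then show "hermitian_map (inv f)" using orthogonal_transformation_inv[OF fo] by (simp add: hermitian_map_def)
  show "inv (inv f) = f" using orthogonal_transformation_bij[OF fo] by (rule inv_inv_eq)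
qed

lemma hermitian_map_compose: "hermitian_map f \<Longrightarrow> hermitian_map g \<Longrightarrow> hermitian_map (\<lambda>x. f (g x))"
  using orthogonal_transformation_compose[of f g] by (simp add: hermitian_map_def o_def)

lemma cp_ring_iff: "q \<in> cp_ring \<longleftrightarrow> (\<forall>f. hermitian_map f \<longrightarrow> q_map f q = q)"
proof -
  have "q_map f q = q" if "\<forall>A\<in>unitary_group. q_map (real_action A) q = q" "hermitian_map f" for f
    using hermitian_map_real_action[OF that(2)] that(1) by metis
  then show ?thesis using real_action_hermitian by (auto simp: cp_ring_def)
qed

lemma cp_ring_support_iff:
  fixes q :: "('n::finite \<times> bool) qring"
  shows "q \<in> cp_ring \<longleftrightarrow> (\<forall>f d. \<forall>v\<in>simple_ext d. hermitian_map f \<longrightarrow> q_support q (ext_map f v) = q_support q v)"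
proof -
  have *: "q_map f q = q \<longleftrightarrow> (\<forall>d. \<forall>v\<in>simple_ext d. q_support q (ext_map (inv f) v) = q_support q v)" if "hermitian_map f" for f
  proof -
    have s: "q_support (q_map f q) v = q_support q (ext_map (inv f) v)" if "v \<in> simple_ext d" for d v
      using q_support_map[OF _ that] \<open>hermitian_map f\<close> by (simp add: hermitian_map_def)
    show ?thesis
    proof
      assume "q_map f q = q"
      then show "\<forall>d. \<forall>v\<in>simple_ext d. q_support q (ext_map (inv f) v) = q_support q v" using s by auto
    next
      assume "\<forall>d. \<forall>v\<in>simple_ext d. q_support q (ext_map (inv f) v) = q_support q v"
      then show "q_map f q = q" using s by (intro qring_eqI) auto
    qed
  qed
  show ?thesis
    unfolding cp_ring_iff
  proof (intro iffI allI ballI impI)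
    fix f :: "real ^ ('n \<times> bool) \<Rightarrow> real ^ ('n \<times> bool)" and d and v :: "('n \<times> bool) ext" assume "\<forall>f. hermitian_map f \<longrightarrow> q_map f q = q" and v: "v \<in> simple_ext d" and f: "hermitian_map f"
    then have "q_map (inv f) q = q" using hermitian_map_inv(1)[OF f] by blast
    then show "q_support q (ext_map f v) = q_support q v"
      using *[OF hermitian_map_inv(1)[OF f]] v hermitian_map_inv(2)[OF f] by auto
  next
    fix f :: "real ^ ('n \<times> bool) \<Rightarrow> real ^ ('n \<times> bool)" assume "\<forall>f d. \<forall>v\<in>simple_ext d. hermitian_map f \<longrightarrow> q_support q (ext_map f v) = q_support q v" "hermitian_map f"
    then show "q_map f q = q" using *[of f] hermitian_map_inv(1)[of f] by blast
  qed
qed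

lemma cp_ring_mult: "p \<in> cp_ring \<Longrightarrow> q \<in> cp_ring \<Longrightarrow> p * q \<in> cp_ring"
  and cp_ring_one: "1 \<in> cp_ring"
  by (auto simp: cp_ring_iff hermitian_map_def q_map_mult q_map_one)

lemma subspace_cp_ring: "subspace cp_ring"
  by (rule subspaceI)
     (auto simp: cp_ring_iff hermitian_map_def linear_0[OF linear_q_map] linear_add[OF linear_q_map] linear_scale[OF linear_q_map])

lemma subspace_cp_deg: "subspace (cp_deg d)"
  unfolding cp_deg_def by (intro subspace_inter subspace_cp_ring subspace_q_deg)

lemma cp_deg_mult: "p \<in> cp_deg d \<Longrightarrow> q \<in> cp_deg e \<Longrightarrow> p * q \<in> cp_deg (d + e)"
  by (simp add: cp_deg_def cp_ring_mult q_deg_mult)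

lemma cp_deg_power: "p \<in> cp_deg d \<Longrightarrow> p ^ k \<in> cp_deg (k * d)"
  by (induction k) (auto simp: cp_deg_def cp_ring_one q_deg_one cp_ring_mult q_deg_mult)

definition horth :: "real ^ ('n::finite \<times> bool) \<Rightarrow> real ^ ('n \<times> bool) \<Rightarrow> bool" where
  "horth x y \<longleftrightarrow> x \<bullet> y = 0 \<and> x \<bullet> imul y = 0"

lemma horth_sym: "horth x y \<Longrightarrow> horth y x"
  using imul_inner_left[of y x] by (simp add: horth_def inner_commute)

lemma horth_imul: "horth x y \<Longrightarrow> horth x (imul y)" "horth x y \<Longrightarrow> horth (imul x) y"
  by (simp_all add: horth_def imul_inner_left)

lemma horth_add: "horth x y \<Longrightarrow> horth x z \<Longrightarrow> horth x (y + z)"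
  and horth_scale: "horth x y \<Longrightarrow> horth x (c *\<^sub>R y)"
  and horth_diff: "horth x y \<Longrightarrow> horth x z \<Longrightarrow> horth x (y - z)"
  by (simp_all add: horth_def imul_simps inner_add_right inner_diff_right)

lemma horth_hermitian_map: "hermitian_map f \<Longrightarrow> horth (f x) (f y) \<longleftrightarrow> horth x y"
  unfolding horth_def hermitian_map_def orthogonal_transformation_def by metis

subsection \<open>A complex plane\<close>

locale complex_frame =
  fixes u w :: "real ^ ('n::finite \<times> bool)"
  assumes norm_u: "norm u = 1" and norm_w: "norm w = 1" and horth_uw: "horth u w"
begin

definition proj :: "real ^ ('n \<times> bool) \<Rightarrow> real ^ ('n \<times> bool)" where
  "proj x = (x \<bullet> u) *\<^sub>R u + (x \<bullet> imul u) *\<^sub>R imul u + (x \<bullet> w) *\<^sub>R w + (x \<bullet> imul w) *\<^sub>R imul w"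

text \<open>The quaternionic structure of the plane, antilinear with respect to \<open>imul\<close>.\<close>

definition quat :: "real ^ ('n \<times> bool) \<Rightarrow> real ^ ('n \<times> bool)" where
  "quat x = (x \<bullet> u) *\<^sub>R w - (x \<bullet> imul u) *\<^sub>R imul w - (x \<bullet> w) *\<^sub>R u + (x \<bullet> imul w) *\<^sub>R imul u"

lemma frame_inner:
  "u \<bullet> u = 1" "w \<bullet> w = 1" "u \<bullet> w = 0" "w \<bullet> u = 0" "u \<bullet> imul w = 0" "imul w \<bullet> u = 0" "imul u \<bullet> w = 0" "w \<bullet> imul u = 0"
  using norm_u norm_w horth_uw imul_inner_left[of u w] by (simp_all add: norm_eq_1 horth_def inner_commute)

lemmas inner_simps' = inner_add_left inner_add_right inner_diff_left inner_diff_right frame_inner imul_simps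

lemma linear_proj: "linear proj" and linear_quat: "linear quat"
  by (auto intro!: linearI simp: proj_def quat_def inner_add_left algebra_simps)

lemma proj_inner: "proj x \<bullet> y = (x \<bullet> u) * (y \<bullet> u) + (x \<bullet> imul u) * (y \<bullet> imul u) + (x \<bullet> w) * (y \<bullet> w) + (x \<bullet> imul w) * (y \<bullet> imul w)"
  by (simp add: proj_def inner_simps' inner_commute)

lemma proj_sym: "proj x \<bullet> y = x \<bullet> proj y"
  using proj_inner[of x y] proj_inner[of y x] by (simp add: inner_commute mult.commute)

lemma proj_proj [simp]: "proj (proj x) = proj x"
  by (simp add: proj_def[of "proj x"] proj_inner inner_simps') (simp add: proj_def)

lemma proj_imul: "proj (imul x) = imul (proj x)"
  by (simp add: proj_def inner_simps' imul_inner_left)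

lemma proj_quat [simp]: "proj (quat x) = quat x"
  by (simp add: proj_def quat_def inner_simps')

lemma quat_imul: "quat (imul x) = - imul (quat x)"
  by (simp add: quat_def inner_simps' imul_inner_left)

lemma quat_skew: "quat x \<bullet> y = - (x \<bullet> quat y)"
  by (simp add: quat_def inner_simps' inner_commute)

lemma quat_quat: "quat (quat x) = - proj x"
  by (simp add: quat_def proj_def inner_simps')

lemma quat_norm: "proj x = x \<Longrightarrow> quat x \<bullet> quat x = x \<bullet> x"
  by (simp add: quat_skew quat_quat)

lemma quat_horth: "horth (quat x) x"
proof -
  have "quat x \<bullet> x = 0" using quat_skew[of x x] by (simp add: inner_commute)
  moreover have "quat x \<bullet> imul x = 0"
    using quat_skew[of x "imul x"] imul_inner_left[of x "quat x"]
    by (simp add: quat_imul inner_commute)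
  ultimately show ?thesis by (simp add: horth_def)
qed

text \<open>The component in the plane is re-expanded along the new frame and the rest is left
  alone; both operations commute with \<open>imul\<close>.\<close>

lemma frame_map:
  assumes p: "norm p = 1" "proj p = p" and q: "norm q = 1" "proj q = q" and pq: "horth p q"
  obtains f where "hermitian_map f" "f u = p" "f w = q" "\<And>x. horth x u \<Longrightarrow> horth x w \<Longrightarrow> f x = x"
proof -
  define S where "S x = (x \<bullet> u) *\<^sub>R p + (x \<bullet> imul u) *\<^sub>R imul p + (x \<bullet> w) *\<^sub>R q + (x \<bullet> imul w) *\<^sub>R imul q" for x
  define f where "f x = x - proj x + S x" for x
  interpret P: complex_frame p q using p q pq by unfold_locales
  have lS: "linear S" by (auto intro!: linearI simp: S_def inner_add_left algebra_simps)
  have lin: "linear f"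
    by (rule linearI) (simp_all add: f_def linear_add[OF lS] linear_add[OF linear_proj] linear_scale[OF lS] linear_scale[OF linear_proj] algebra_simps)
  have SJ: "S (imul x) = imul (S x)" for x by (simp add: S_def imul_simps imul_inner_left)
  have "f x \<bullet> f x = x \<bullet> x" for x
  proof -
    have SS: "S x \<bullet> S x = proj x \<bullet> x"
      by (simp add: S_def P.inner_simps' proj_inner)
    have "(x - proj x) \<bullet> y = 0" if "proj y = y" for y using that proj_sym[of x y] by (simp add: inner_diff_left)
    then have "(x - proj x) \<bullet> S x = 0"
      unfolding S_def using p q by (simp add: inner_add_right proj_imul)
    moreover have "(x - proj x) \<bullet> (x - proj x) = x \<bullet> x - proj x \<bullet> x"
      using proj_sym[of x "proj x"] by (simp add: inner_diff_left inner_diff_right inner_commute)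
    ultimately show ?thesis using SS by (simp add: f_def inner_add_left inner_add_right inner_commute)
  qed
  then have "norm (f x) = norm x" for x by (simp add: norm_eq_sqrt_inner)
  then have "hermitian_map f" using lin
    by (simp add: hermitian_map_def orthogonal_transformation) (simp add: f_def proj_imul SJ imul_simps)
  moreover have "f u = p" "f w = q" by (simp_all add: f_def S_def proj_def inner_simps')
  moreover have "f x = x" if "horth x u" "horth x w" for x
    using that by (simp add: f_def S_def proj_def horth_def)
  ultimately show ?thesis by (rule that)
qed

end

text \<open>The motion takes place in the complex span of the two vectors and fixes everything
  Hermitian orthogonal to both, which allows frames to be matched one vector at a time.\<close>

lemma hermitian_map_unit:
  assumes x: "norm x = 1" and y: "norm y = 1"
  obtains f where "hermitian_map f" "f x = y" "\<And>z. horth z x \<Longrightarrow> horth z y \<Longrightarrow> f z = z"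
proof -
  \<comment> \<open>The component of \<open>y\<close> Hermitian orthogonal to \<open>x\<close>; if
    it vanishes, both vectors lie in one complex line.\<close>
  define c where "c = y - (y \<bullet> x) *\<^sub>R x - (y \<bullet> imul x) *\<^sub>R imul x"
  have xx: "x \<bullet> x = 1" "y \<bullet> y = 1" using x y by (simp_all add: norm_eq_1)
  have hc: "horth x c"
    using xx imul_inner_left[of x y] unfolding horth_def c_def
    by (simp add: inner_diff_right inner_add_right imul_simps inner_commute)
  have yc: "y = (y \<bullet> x) *\<^sub>R x + (y \<bullet> imul x) *\<^sub>R imul x + c" by (simp add: c_def)
  show ?thesis
  proof (cases "c = 0")
    case True
    then have y': "y = (y \<bullet> x) *\<^sub>R x + (y \<bullet> imul x) *\<^sub>R imul x" using yc by simp
    define f where "f z = z - (z \<bullet> x) *\<^sub>R x - (z \<bullet> imul x) *\<^sub>R imul x + (z \<bullet> x) *\<^sub>R y + (z \<bullet> imul x) *\<^sub>R imul y" for z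
    have lin: "linear f" by (auto intro!: linearI simp: f_def inner_add_left algebra_simps)
    have fJ: "f (imul z) = imul (f z)" for z by (simp add: f_def imul_simps imul_inner_left)
    have "f z \<bullet> f z = z \<bullet> z" for z
    proof -
      define z' where "z' = z - (z \<bullet> x) *\<^sub>R x - (z \<bullet> imul x) *\<^sub>R imul x"
      have zx: "z' \<bullet> x = 0" "z' \<bullet> imul x = 0" using xx by (simp_all add: z'_def inner_diff_left)
      have "z' \<bullet> y = 0" by (subst y') (simp add: inner_add_right zx)
      moreover have "z' \<bullet> imul y = 0" by (subst y') (simp add: inner_add_right inner_diff_right zx imul_simps)
      moreover have "f z = z' + (z \<bullet> x) *\<^sub>R y + (z \<bullet> imul x) *\<^sub>R imul y" by (simp add: f_def z'_def)
      moreover have "z \<bullet> z = z' \<bullet> z' + (z \<bullet> x)\<^sup>2 + (z \<bullet> imul x)\<^sup>2"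
      proof -
        have "(z' + \<alpha> *\<^sub>R x + \<beta> *\<^sub>R imul x) \<bullet> (z' + \<alpha> *\<^sub>R x + \<beta> *\<^sub>R imul x) = z' \<bullet> z' + \<alpha>\<^sup>2 + \<beta>\<^sup>2" for \<alpha> \<beta>
          using zx xx by (simp add: inner_add_left inner_add_right power2_eq_square inner_commute)
        moreover have "z' + (z \<bullet> x) *\<^sub>R x + (z \<bullet> imul x) *\<^sub>R imul x = z" by (simp add: z'_def)
        ultimately show ?thesis by metis
      qed
      ultimately show ?thesis using xx
        by (simp add: inner_add_left inner_add_right power2_eq_square inner_commute)
    qed
    then have "norm (f z) = norm z" for z by (simp add: norm_eq_sqrt_inner)
    then have "hermitian_map f" using lin fJ by (simp add: hermitian_map_def orthogonal_transformation)
    moreover have "f x = y" using xx by (simp add: f_def)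
    moreover have "f z = z" if "horth z x" "horth z y" for z using that by (simp add: f_def horth_def)
    ultimately show ?thesis by (rule that)
  next
    case False
    define w where "w = c /\<^sub>R norm c"
    have w: "norm w = 1" "horth x w" using False hc by (simp_all add: w_def horth_scale)
    interpret complex_frame x w using x w by unfold_locales
    have cw: "c = norm c *\<^sub>R w" using False by (simp add: w_def)
    have py: "proj y = y"
    proof -
      have "y \<bullet> w = norm c" by (subst yc, subst cw) (simp add: inner_simps')
      moreover have "y \<bullet> imul w = 0" by (subst yc, subst cw) (simp add: inner_simps')
      ultimately show ?thesis unfolding proj_def using yc cw by simp
    qed
    \<comment> \<open>The quaternionic structure supplies a unit vector that completes
      \<open>y\<close> to a frame of the same plane.\<close>
    have "norm (quat y) = 1" using quat_norm[OF py] xx by (simp add: norm_eq_sqrt_inner)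
    from frame_map[OF y py this proj_quat horth_sym[OF quat_horth]]
    obtain f where f: "hermitian_map f" "f x = y" "\<And>z. horth z x \<Longrightarrow> horth z w \<Longrightarrow> f z = z" by metis
    have "horth z w" if "horth z x" "horth z y" for z
    proof -
      have "horth z c" unfolding c_def using that by (intro horth_diff horth_scale horth_imul)
      then show ?thesis unfolding w_def by (rule horth_scale)
    qed
    then show ?thesis using f that[of f] by blast
  qed
qed

definition hermitian_orthonormal :: "(real ^ ('n::finite \<times> bool)) list \<Rightarrow> bool" where
  "hermitian_orthonormal xs \<longleftrightarrow> (\<forall>x\<in>set xs. norm x = 1) \<and> sorted_wrt horth xs"

text \<open>Once the tails are matched, the heads are matched by a map that fixes the tail, since
  the tail is Hermitian orthogonal to both heads.\<close>

lemma hermitian_orthonormal_transitive: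
  "hermitian_orthonormal xs \<Longrightarrow> hermitian_orthonormal ys \<Longrightarrow> length xs = length ys \<Longrightarrow>
     \<exists>f. hermitian_map f \<and> map f xs = ys"
proof (induction xs arbitrary: ys)
  case Nil
  then show ?case
    by (intro exI[of _ "\<lambda>x. x"]) (auto simp: hermitian_map_def orthogonal_transformation_id)
next
  case (Cons x xs)
  then obtain y ys' where ys: "ys = y # ys'" by (cases ys) auto
  then obtain f where f: "hermitian_map f" "map f xs = ys'"
    using Cons by (force simp: hermitian_orthonormal_def)
  have "norm (f x) = 1" "norm y = 1"
    using f(1) Cons.prems ys by (auto simp: hermitian_map_def orthogonal_transformation hermitian_orthonormal_def)
  then obtain g where g: "hermitian_map g" "g (f x) = y" "\<And>z. horth z (f x) \<Longrightarrow> horth z y \<Longrightarrow> g z = z"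
    using hermitian_map_unit by metis
  have "g z = z" if z: "z \<in> set ys'" for z
  proof (rule g(3))
    show "horth z y" using z Cons.prems(2) ys by (auto simp: hermitian_orthonormal_def intro: horth_sym)
    obtain z' where "z' \<in> set xs" "z = f z'" using z f(2) by auto
    then show "horth z (f x)"
      using Cons.prems(1) by (auto simp: horth_hermitian_map[OF f(1)] hermitian_orthonormal_def intro: horth_sym)
  qed
  then have "map g (map f xs) = ys'" unfolding f(2) by (rule map_idI)
  then have "map (\<lambda>x. g (f x)) (x # xs) = ys" using g(2) ys by (simp add: o_def)
  then show ?case using hermitian_map_compose[OF g(1) f(1)] by blast
qed

subsection \<open>Averaging over a complex plane\<close>

lemma gauss_second_moment:
  fixes x :: "'w::euclidean_space"
  assumes "norm x = 1"
  shows "has_bochner_integral gauss_space (\<lambda>\<omega>. (gauss_vec \<omega> \<bullet> x)\<^sup>2) 1"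
proof (rule has_bochner_integral_nn_integral)
  have "(\<integral>\<^sup>+\<omega>. ennreal ((gauss_vec \<omega> \<bullet> x)\<^sup>2) \<partial>gauss_space) = (\<integral>\<^sup>+y. ennreal ((y x)\<^sup>2) \<partial>PiM {x} (\<lambda>_. std_normal))"
    using nn_integral_gauss_orthonormal[of "{x}" "\<lambda>y. ennreal ((y x)\<^sup>2)"] assms by simp
  also have "\<dots> = (\<integral>\<^sup>+y. ennreal ((sqrt (\<Sum>i\<in>{x}. (y i)\<^sup>2))\<^sup>2) \<partial>PiM {x} (\<lambda>_. std_normal))" by simp
  also have "\<dots> = ennreal (1 / gauss_moment 0) *
      (\<integral>\<^sup>+\<rho>. ennreal (\<rho>\<^sup>2) * ennreal (indicator {0..} \<rho> * (\<rho> ^ 0 * exp (- \<rho>\<^sup>2 / 2))) \<partial>lborel)"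
    using nn_integral_PiM_std_normal_radial[of "{x}" "\<lambda>\<rho>. ennreal (\<rho>\<^sup>2)"] radial_constant[of "{x}"] by simp
  also have "(\<integral>\<^sup>+\<rho>. ennreal (\<rho>\<^sup>2) * ennreal (indicator {0..} \<rho> * (\<rho> ^ 0 * exp (- \<rho>\<^sup>2 / 2))) \<partial>lborel)
     = (\<integral>\<^sup>+\<rho>. ennreal (indicator {0..} \<rho> * (\<rho> ^ 2 * exp (- \<rho>\<^sup>2 / 2))) \<partial>lborel)"
    by (intro nn_integral_cong) (auto simp: indicator_def simp flip: ennreal_mult)
  also have "\<dots> = ennreal (gauss_moment 2)" by (rule nn_integral_gauss_moment)
  also have "ennreal (1 / gauss_moment 0) * ennreal (gauss_moment 2) = 1"
    using gauss_moment_rec[of 0] gauss_moment_pos[of 0] by (simp add: numeral_2_eq_2 flip: ennreal_mult')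
  finally show "(\<integral>\<^sup>+\<omega>. ennreal ((gauss_vec \<omega> \<bullet> x)\<^sup>2) \<partial>gauss_space) = ennreal 1" by simp
qed auto

text \<open>The quadratic form has eigenvalues \<open>(1 + t)/2\<close> and \<open>-(1 - t)/2\<close>, each of multiplicity two; \<open>z0\<close>, \<open>z1\<close>,
  \<open>z2\<close>, \<open>z3\<close> are eigenvectors.\<close>

lemma gauss_mean_plane_unit:
  fixes x y :: "'w::euclidean_space" and a :: "'w \<Rightarrow> 'w"
  assumes a: "linear a" and T: "x \<in> T" "y \<in> T" "subspace T"
    and a_T: "\<And>p. p \<in> T \<Longrightarrow> a p \<in> T" "\<And>p q. p \<in> T \<Longrightarrow> q \<in> T \<Longrightarrow> a p \<bullet> q = - (p \<bullet> a q)" "\<And>p. p \<in> T \<Longrightarrow> a (a p) = - p"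
    and xy: "norm x = 1" "norm y = 1" "x \<bullet> y = 0"
  shows "has_bochner_integral gauss_space
    (\<lambda>\<omega>. \<bar>(gauss_vec \<omega> \<bullet> a x) * (gauss_vec \<omega> \<bullet> y) - (gauss_vec \<omega> \<bullet> x) * (gauss_vec \<omega> \<bullet> a y)\<bar>) (1 + (a x \<bullet> y)\<^sup>2)"
proof -
  define t where "t = a x \<bullet> y"
  define r where "r = norm (y - t *\<^sub>R a x)"
  note a' = linear_add[OF a] linear_diff[OF a] linear_scale[OF a]
  have iso: "a p \<bullet> a q = p \<bullet> q" if "p \<in> T" "q \<in> T" for p q
    unfolding a_T(2)[OF that(1) a_T(1)[OF that(2)]] a_T(3)[OF that(2)] by simp
  have skew: "a p \<bullet> p = 0" if "p \<in> T" for p using a_T(2)[OF that that] by (simp add: inner_commute)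
  have xx: "x \<bullet> x = 1" "y \<bullet> y = 1" using xy by (simp_all add: norm_eq_1)
  have ax: "a x \<in> T" "a x \<bullet> a x = 1" "a x \<bullet> x = 0" "x \<bullet> a x = 0"
    using a_T(1)[OF T(1)] iso[OF T(1) T(1)] skew[OF T(1)] xx by (simp_all add: inner_commute)
  have r2: "r\<^sup>2 = 1 - t\<^sup>2"
  proof -
    have "r\<^sup>2 = y \<bullet> y - t * (a x \<bullet> y) - t * (a x \<bullet> y) + t * t * (a x \<bullet> a x)"
      unfolding r_def power2_norm_eq_inner
      by (simp add: inner_diff_left inner_diff_right inner_commute[of y "a x"] algebra_simps)
    then show ?thesis using ax xx by (simp add: t_def power2_eq_square)
  qed
  show ?thesis
  proof (cases "r = 0")
    \<comment> \<open>Here \<open>y\<close> is \<open>a x\<close> up to sign and the form is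
      semidefinite; the mean of its absolute value is 2.\<close>
    case True
    then have y: "y = t *\<^sub>R a x" by (simp add: r_def)
    have t2: "t\<^sup>2 = 1" using r2 True by simp
    then have "\<bar>t\<bar> = 1" by (auto simp: power2_eq_1_iff abs_if)
    have ay: "a y = - t *\<^sub>R x" using a_T(3)[OF T(1)] by (subst y) (simp add: a')
    have "(g \<bullet> a x) * (g \<bullet> y) - (g \<bullet> x) * (g \<bullet> a y) = t * ((g \<bullet> a x)\<^sup>2 + (g \<bullet> x)\<^sup>2)" for g
      unfolding ay by (subst y) (simp add: power2_eq_square algebra_simps)
    then have "\<bar>(g \<bullet> a x) * (g \<bullet> y) - (g \<bullet> x) * (g \<bullet> a y)\<bar> = (g \<bullet> a x)\<^sup>2 + (g \<bullet> x)\<^sup>2" for g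
      using \<open>\<bar>t\<bar> = 1\<close> by (simp add: abs_mult)
    moreover have "has_bochner_integral gauss_space (\<lambda>\<omega>. (gauss_vec \<omega> \<bullet> a x)\<^sup>2 + (gauss_vec \<omega> \<bullet> x)\<^sup>2) (1 + 1)"
      by (intro has_bochner_integral_add gauss_second_moment) (use xy ax in \<open>simp_all add: norm_eq_1\<close>)
    ultimately show ?thesis using t2 by (simp add: t_def[symmetric])
  next
    case False
    then have "r > 0" by (simp add: r_def)
    then have "t\<^sup>2 < 1" using r2 by (metis diff_gt_0_iff_gt zero_less_power)
    then have t: "- 1 < t" "t < 1" by (simp_all add: power2_less_1_iff abs_square_less_1 abs_less_iff)
    define b where "b = (1 / r) *\<^sub>R (y - t *\<^sub>R a x)"
    have y: "y = t *\<^sub>R a x + r *\<^sub>R b" using False by (simp add: b_def)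
    have bT: "b \<in> T" unfolding b_def using T ax by (intro subspace_scale subspace_diff)
    have b1: "b \<bullet> b = 1" unfolding b_def using False r_def
      by (simp add: dot_square_norm power2_eq_square)
    have b2: "b \<bullet> x = 0" "b \<bullet> a x = 0"
      using ax xy by (simp_all add: b_def inner_diff_left inner_diff_right inner_commute t_def)
    note ab = a_T(1)[OF bT]
    have ip: "a b \<bullet> a b = 1" "a b \<bullet> b = 0" "a b \<bullet> x = 0" "a b \<bullet> a x = 0"
      using iso[OF bT bT] skew[OF bT] a_T(2)[OF bT T(1)] iso[OF bT T(1)] b1 b2 by simp_all
    note ips = xx ax b1 b2 ip ip(2-4)[unfolded inner_commute[of "a b"]] b2[unfolded inner_commute[of b]]
    have ay: "a y = - t *\<^sub>R x + r *\<^sub>R a b" using a_T(3)[OF T(1)] by (subst y) (simp add: a')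
    \<comment> \<open>Half-angle values: with \<open>t\<close> the cosine of an angle,
      \<open>C\<close> and \<open>S\<close> are cosine and sine of its half, so that C^2 - S^2 = t
      and 2 C S = r.\<close>
    define C S where "C = sqrt ((1 + t) / 2)" and "S = sqrt ((1 - t) / 2)"
    have CS: "C\<^sup>2 = (1 + t) / 2" "S\<^sup>2 = (1 - t) / 2" "C \<ge> 0" "S \<ge> 0" using t by (simp_all add: C_def S_def)
    have CS1: "C * C + S * S = 1" "C * C - S * S = t" using CS by (simp_all add: power2_eq_square)
    have r_CS: "r = 2 * (C * S)"
    proof (rule power2_eq_imp_eq)
      show "r\<^sup>2 = (2 * (C * S))\<^sup>2" by (simp add: r2 power_mult_distrib CS(1,2)) (simp add: field_simps power2_eq_square)
    qed (use \<open>r > 0\<close> CS in auto)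
    define z0 z1 z2 z3 where "z0 = C *\<^sub>R a x + S *\<^sub>R b" and "z1 = C *\<^sub>R x - S *\<^sub>R a b"
      and "z2 = S *\<^sub>R a x - C *\<^sub>R b" and "z3 = S *\<^sub>R x + C *\<^sub>R a b"
    note zd = z0_def z1_def z2_def z3_def
    note expand = inner_add_left inner_add_right inner_diff_left inner_diff_right ips
    have z: "z0 \<bullet> z0 = 1" "z1 \<bullet> z1 = 1" "z2 \<bullet> z2 = 1" "z3 \<bullet> z3 = 1"
      using CS1(1) by (simp_all add: zd expand mult.commute add.commute)
    have zo: "z0 \<bullet> z1 = 0" "z0 \<bullet> z2 = 0" "z0 \<bullet> z3 = 0" "z1 \<bullet> z2 = 0" "z1 \<bullet> z3 = 0" "z2 \<bullet> z3 = 0"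
      by (simp_all add: zd expand mult.commute)
    have ne: "z0 \<noteq> z1" "z0 \<noteq> z2" "z0 \<noteq> z3" "z1 \<noteq> z2" "z1 \<noteq> z3" "z2 \<noteq> z3" using z zo by auto
    have form: "(g \<bullet> a x) * (g \<bullet> y) - (g \<bullet> x) * (g \<bullet> a y)
      = (1 + t) / 2 * (\<Sum>b\<in>{z0, z1}. (g \<bullet> b)\<^sup>2) - (1 - t) / 2 * (\<Sum>b\<in>{z2, z3}. (g \<bullet> b)\<^sup>2)" for g
    proof -
      define g0 g1 g2 g3 where "g0 = g \<bullet> x" and "g1 = g \<bullet> a x" and "g2 = g \<bullet> b" and "g3 = g \<bullet> a b"
      have "(g \<bullet> a x) * (g \<bullet> y) - (g \<bullet> x) * (g \<bullet> a y) = t * (g0\<^sup>2 + g1\<^sup>2) + r * (g1 * g2 - g0 * g3)"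
        unfolding ay by (subst y) (simp add: inner_add_right g0_def g1_def g2_def g3_def power2_eq_square algebra_simps)
      moreover have "(\<Sum>b\<in>{z0, z1}. (g \<bullet> b)\<^sup>2) = (C * g1 + S * g2)\<^sup>2 + (C * g0 - S * g3)\<^sup>2"
        "(\<Sum>b\<in>{z2, z3}. (g \<bullet> b)\<^sup>2) = (S * g1 - C * g2)\<^sup>2 + (S * g0 + C * g3)\<^sup>2"
        using ne by (simp_all add: zd inner_add_right inner_diff_right g0_def g1_def g2_def g3_def)
      moreover have "t * (g0\<^sup>2 + g1\<^sup>2) + r * (g1 * g2 - g0 * g3)
        = C\<^sup>2 * ((C * g1 + S * g2)\<^sup>2 + (C * g0 - S * g3)\<^sup>2) - S\<^sup>2 * ((S * g1 - C * g2)\<^sup>2 + (S * g0 + C * g3)\<^sup>2)"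
      proof -
        have "C\<^sup>2 * ((C * g1 + S * g2)\<^sup>2 + (C * g0 - S * g3)\<^sup>2) - S\<^sup>2 * ((S * g1 - C * g2)\<^sup>2 + (S * g0 + C * g3)\<^sup>2)
          = (C * C + S * S) * ((C * C - S * S) * (g0\<^sup>2 + g1\<^sup>2) + (2 * (C * S)) * (g1 * g2 - g0 * g3))"
          by (simp add: power2_eq_square algebra_simps)
        then show ?thesis by (simp only: CS1 r_CS mult_1)
      qed
      ultimately show ?thesis by (simp only: CS(1,2))
    qed
    have "has_bochner_integral gauss_space (\<lambda>\<omega>. \<bar>(1 + t) / 2 * (\<Sum>b\<in>{z0, z1}. (gauss_vec \<omega> \<bullet> b)\<^sup>2)
        - (1 - t) / 2 * (\<Sum>b\<in>{z2, z3}. (gauss_vec \<omega> \<bullet> b)\<^sup>2)\<bar>) (2 * (((1 + t) / 2)\<^sup>2 + ((1 - t) / 2)\<^sup>2))"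
    proof (rule gauss_mean_abs_difference)
      show "pairwise orthogonal ({z0, z1} \<union> {z2, z3})"
        using zo by (auto simp: pairwise_def orthogonal_def inner_commute)
      show "norm b = 1" if "b \<in> {z0, z1} \<union> {z2, z3}" for b using that z by (auto simp: norm_eq_1)
    qed (use ne t in \<open>auto simp: field_simps\<close>)
    moreover have "2 * (((1 + t) / 2)\<^sup>2 + ((1 - t) / 2)\<^sup>2) = 1 + t\<^sup>2" by (simp add: power2_eq_square field_simps)
    ultimately show ?thesis by (simp only: form t_def)
  qed
qed

text \<open>Both the form and \<open>a x \<bullet> y\<close> are unchanged when a multiple of
  \<open>x\<close> is added to \<open>y\<close>, the latter since \<open>a\<close> is skew. Hence
  \<open>y\<close> may be made orthogonal to \<open>x\<close>, and the area \<open>D\<close> of the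
  parallelogram factors out.\<close>

lemma gauss_mean_plane:
  fixes x y :: "'w::euclidean_space" and a :: "'w \<Rightarrow> 'w"
  defines "D \<equiv> sqrt ((x \<bullet> x) * (y \<bullet> y) - (x \<bullet> y)\<^sup>2)"
  assumes a: "linear a" and T: "x \<in> T" "y \<in> T" "subspace T"
    and a_T: "\<And>p. p \<in> T \<Longrightarrow> a p \<in> T" "\<And>p q. p \<in> T \<Longrightarrow> q \<in> T \<Longrightarrow> a p \<bullet> q = - (p \<bullet> a q)" "\<And>p. p \<in> T \<Longrightarrow> a (a p) = - p"
  shows "has_bochner_integral gauss_space
    (\<lambda>\<omega>. \<bar>(gauss_vec \<omega> \<bullet> a x) * (gauss_vec \<omega> \<bullet> y) - (gauss_vec \<omega> \<bullet> x) * (gauss_vec \<omega> \<bullet> a y)\<bar>) (D + (a x \<bullet> y)\<^sup>2 / D)"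
proof (cases "x = 0")
  case True
  then show ?thesis by (simp add: D_def linear_0[OF a] has_bochner_integral_zero)
next
  case False
  note a' = linear_add[OF a] linear_diff[OF a] linear_scale[OF a]
  define x0 where "x0 = (1 / norm x) *\<^sub>R x"
  have x0: "norm x0 = 1" "x = norm x *\<^sub>R x0" "x0 \<in> T" using False T by (auto simp: x0_def subspace_scale)
  define z where "z = y - (x0 \<bullet> y) *\<^sub>R x0"
  have zT: "z \<in> T" unfolding z_def using T x0 by (intro subspace_diff subspace_scale)
  have zx: "x0 \<bullet> z = 0" using x0(1) by (simp add: z_def inner_diff_right dot_square_norm)
  have y: "y = (x0 \<bullet> y) *\<^sub>R x0 + z" by (simp add: z_def)
  have skew: "a x0 \<bullet> x0 = 0" using a_T(2)[OF x0(3) x0(3)] by (simp add: inner_commute)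
  have D: "D = norm x * norm z"
  proof -
    have "x \<bullet> y = norm x * (x0 \<bullet> y)" by (subst x0(2)) simp
    moreover have "y \<bullet> y = (x0 \<bullet> y)\<^sup>2 + (norm z)\<^sup>2"
    proof -
      have "(s *\<^sub>R x0 + z) \<bullet> (s *\<^sub>R x0 + z) = s\<^sup>2 + z \<bullet> z" for s
        using x0(1) zx zx[unfolded inner_commute[of x0]]
        by (simp add: norm_eq_1 inner_add_left inner_add_right power2_eq_square)
      moreover have "y \<bullet> y = ((x0 \<bullet> y) *\<^sub>R x0 + z) \<bullet> ((x0 \<bullet> y) *\<^sub>R x0 + z)"
        by (rule arg_cong2[where f = inner, OF y y])
      ultimately show ?thesis by (simp only: dot_square_norm)
    qed
    ultimately have "(x \<bullet> x) * (y \<bullet> y) - (x \<bullet> y)\<^sup>2 = (norm x * norm z)\<^sup>2"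
      by (simp add: dot_square_norm power2_eq_square algebra_simps)
    then show ?thesis by (simp add: D_def)
  qed
  have form: "(g \<bullet> a x) * (g \<bullet> y) - (g \<bullet> x) * (g \<bullet> a y) = norm x * ((g \<bullet> a x0) * (g \<bullet> z) - (g \<bullet> x0) * (g \<bullet> a z))" for g
  proof -
    have "a x = norm x *\<^sub>R a x0" by (subst x0(2)) (simp add: a')
    moreover have "a y = (x0 \<bullet> y) *\<^sub>R a x0 + a z" by (subst y) (simp add: a')
    moreover have "g \<bullet> y = (x0 \<bullet> y) * (g \<bullet> x0) + g \<bullet> z" by (subst y) (simp add: inner_add_right)
    moreover have "g \<bullet> x = norm x * (g \<bullet> x0)" by (subst x0(2)) simp
    ultimately show ?thesis by (simp add: inner_add_right algebra_simps)
  qed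
  show ?thesis
  proof (cases "z = 0")
    \<comment> \<open>Here \<open>D\<close> is 0 and division by zero yields 0, in agreement with
      the vanishing form.\<close>
    case True
    then show ?thesis by (simp add: form D linear_0[OF a] has_bochner_integral_zero)
  next
    case False
    define y0 where "y0 = (1 / norm z) *\<^sub>R z"
    have y0: "norm y0 = 1" "z = norm z *\<^sub>R y0" "y0 \<in> T" "x0 \<bullet> y0 = 0" using False T zT zx by (auto simp: y0_def subspace_scale)
    have form': "(g \<bullet> a x) * (g \<bullet> y) - (g \<bullet> x) * (g \<bullet> a y) = D * ((g \<bullet> a x0) * (g \<bullet> y0) - (g \<bullet> x0) * (g \<bullet> a y0))" for g
      unfolding form by (subst (1 2) y0(2)) (simp add: a' D algebra_simps)
    have "a x \<bullet> y = D * (a x0 \<bullet> y0)"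
    proof -
      have "a x \<bullet> y = norm x * (a x0 \<bullet> z)" by (subst x0(2), subst y) (simp add: a' inner_add_right skew)
      also have "\<dots> = D * (a x0 \<bullet> y0)" by (subst y0(2)) (simp add: D)
      finally show ?thesis .
    qed
    moreover have "D > 0" using False \<open>x \<noteq> 0\<close> by (simp add: D)
    ultimately have "D * (1 + (a x0 \<bullet> y0)\<^sup>2) = D + (a x \<bullet> y)\<^sup>2 / D"
      by (simp add: power_mult_distrib power2_eq_square field_simps)
    moreover have "has_bochner_integral gauss_space (\<lambda>\<omega>. D * \<bar>(gauss_vec \<omega> \<bullet> a x0) * (gauss_vec \<omega> \<bullet> y0) - (gauss_vec \<omega> \<bullet> x0) * (gauss_vec \<omega> \<bullet> a y0)\<bar>)
      (D * (1 + (a x0 \<bullet> y0)\<^sup>2))"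
      by (intro has_bochner_integral_mult_right gauss_mean_plane_unit[OF a x0(3) y0(3) T(3) a_T x0(1) y0(1) y0(4)])
    ultimately show ?thesis using \<open>D > 0\<close> by (simp add: form' abs_mult)
  qed
qed

text \<open>Exchanging the two laws lets an average of a support function over twisted vectors be
  computed first for a fixed vector of the law that represents the class.\<close>

lemma law_symmetric:
  assumes M: "integrable_law M" and L: "integrable_law L"
  shows "(\<integral>y. vz_support (K_class M (\<lambda>x. x)) y \<partial>L) = (\<integral>x. vz_support (K_class L (\<lambda>x. x)) x \<partial>M)"
proof -
  have b: "bilinear ((\<bullet>) :: 'a \<Rightarrow> 'a \<Rightarrow> real)"
    by (simp add: bilinear_conv_bounded_bilinear bounded_bilinear_inner)
  have a: "adjoint (\<lambda>x. x \<bullet> y) 1 = y" "adjoint ((\<bullet>) y) 1 = y" for y :: 'a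
    by (rule adjoint_unique[THEN fun_cong, of _ "\<lambda>c. c *\<^sub>R y", THEN trans]; auto simp: inner_commute)+
  show ?thesis
    using slice_functionals(1)[OF b M L, of 1] slice_functionals(2)[OF b M L, of 1] by (simp add: a)
qed

lemma ext_product_pair_inner:
  "ext_product [a, b] \<bullet> ext_product [c, d] = (a \<bullet> c) * (b \<bullet> d) - (a \<bullet> d) * (b \<bullet> c)"
proof -
  have "ext_product [a, b] \<bullet> ext_product [c, d] = contract b (contract a (ext_product [c, d])) \<bullet> axis {} 1"
    using contract_inner[of b "contract a (ext_product [c, d])" "axis {} 1"] contract_inner[of a "ext_product [c, d]" "wedge (ext_vec b) (axis {} 1)"]
    by (simp add: inner_commute)
  also have "contract a (ext_product [c, d]) = (a \<bullet> c) *\<^sub>R ext_vec d - (a \<bullet> d) *\<^sub>R ext_vec c"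
    using contract_wedge[of a d "axis {} 1"] by (simp add: contract_wedge wedge_bilinear_simps)
  also have "contract b \<dots> = ((a \<bullet> c) * (b \<bullet> d) - (a \<bullet> d) * (b \<bullet> c)) *\<^sub>R axis {} 1"
    using contract_wedge[of b d "axis {} 1"] contract_wedge[of b c "axis {} 1"]
    by (simp add: contract_simps wedge_bilinear_simps scaleR_diff_left)
  finally show ?thesis by (simp add: inner_axis_axis)
qed

lemma integrable_norm_gauss_sq: "integrable gauss_space (\<lambda>\<omega>. (norm (gauss_vec \<omega> :: 'w::euclidean_space))\<^sup>2)"
proof -
  have "(norm (gauss_vec \<omega> :: 'w))\<^sup>2 = (\<Sum>b\<in>Basis. (gauss_vec \<omega> \<bullet> b)\<^sup>2)" for \<omega>
    unfolding power2_norm_eq_inner by (subst euclidean_inner) (simp add: power2_eq_square)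
  moreover have "integrable gauss_space (\<lambda>\<omega>. \<Sum>b\<in>Basis. (gauss_vec \<omega> \<bullet> (b :: 'w))\<^sup>2)"
    by (intro Bochner_Integration.integrable_sum integrable.intros[OF gauss_second_moment]) simp
  ultimately show ?thesis by simp
qed

section \<open>Twisted planes and the Kaehler angle\<close>

context complex_frame
begin

text \<open>For a unit triple these are complex structures of the plane, a sphere of them from the
  quaternionic structure. For every nonzero \<open>z\<close> of the plane, \<open>z\<close> and its
  twist span a real plane with Kaehler angle of cosine |\<alpha>|, which is why a Gaussian
  \<open>z\<close> can be used.\<close>

definition twist :: "real \<Rightarrow> real \<Rightarrow> real \<Rightarrow> real ^ ('n \<times> bool) \<Rightarrow> real ^ ('n \<times> bool)" where
  "twist \<alpha> \<beta> \<gamma> x = \<alpha> *\<^sub>R imul x + \<beta> *\<^sub>R quat x + \<gamma> *\<^sub>R imul (quat x)"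

lemma linear_twist: "linear (twist \<alpha> \<beta> \<gamma>)"
  by (rule linearI) (simp_all add: twist_def imul_simps linear_add[OF linear_quat] linear_scale[OF linear_quat] algebra_simps)

lemma proj_twist: "proj x = x \<Longrightarrow> proj (twist \<alpha> \<beta> \<gamma> x) = twist \<alpha> \<beta> \<gamma> x"
  by (simp add: twist_def linear_add[OF linear_proj] linear_scale[OF linear_proj] proj_imul)

lemma twist_skew: "twist \<alpha> \<beta> \<gamma> x \<bullet> y = - (x \<bullet> twist \<alpha> \<beta> \<gamma> y)"
proof -
  have "imul (quat x) \<bullet> y = - (x \<bullet> imul (quat y))"
    by (simp add: imul_inner_left[of "quat x"] quat_skew quat_imul)
  then show ?thesis
    by (simp add: twist_def inner_add_left inner_add_right imul_inner_left[of x] quat_skew algebra_simps)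
qed

lemma twist_twist:
  assumes "proj x = x" "\<alpha>\<^sup>2 + \<beta>\<^sup>2 + \<gamma>\<^sup>2 = 1"
  shows "twist \<alpha> \<beta> \<gamma> (twist \<alpha> \<beta> \<gamma> x) = - x"
proof -
  have q2: "quat (quat x) = - x" using assms by (simp add: quat_quat)
  have "twist \<alpha> \<beta> \<gamma> (twist \<alpha> \<beta> \<gamma> x) = - ((\<alpha>\<^sup>2 + \<beta>\<^sup>2 + \<gamma>\<^sup>2) *\<^sub>R x)"
    by (simp add: twist_def imul_simps linear_add[OF linear_quat] linear_scale[OF linear_quat] quat_imul q2
        power2_eq_square algebra_simps)
  then show ?thesis using assms by simp
qed

lemma subspace_plane: "subspace {x. proj x = x}"
  by (rule subspaceI) (simp_all add: linear_0[OF linear_proj] linear_add[OF linear_proj] linear_scale[OF linear_proj])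

text \<open>Unitary maps of the plane, up to scaling, carry \<open>(u, \<kappa> iu + \<sigma> w)\<close> to \<open>(z, twist z)\<close>.\<close>

lemma q_support_twist:
  assumes q: "q \<in> cp_ring" and ks: "\<beta>\<^sup>2 + \<gamma>\<^sup>2 = \<sigma>\<^sup>2"
    and z: "proj z = z" and Q: "\<And>x. x \<in> set Q \<Longrightarrow> horth x u \<and> horth x w"
  shows "q_support q (ext_product (Q @ [z, twist \<kappa> \<beta> \<gamma> z])) =
    (norm z)\<^sup>2 * q_support q (ext_product (Q @ [u, \<kappa> *\<^sub>R imul u + \<sigma> *\<^sub>R w]))"
proof (cases "z = 0")
  case True
  then show ?thesis by (simp add: ext_product_append ext_vec_simps wedge_bilinear_simps q_support_0_right)
next
  case False
  define p where "p = (1 / norm z) *\<^sub>R z"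
  have p: "norm p = 1" "proj p = p" "z = norm z *\<^sub>R p" using False z by (simp_all add: p_def linear_scale[OF linear_proj])
  \<comment> \<open>If \<sigma> vanishes, so do \<beta> and \<gamma>, and any unit vector of the
    plane Hermitian orthogonal to \<open>p\<close> completes the frame.\<close>
  define r where "r = (if \<sigma> = 0 then quat p else (\<beta> / \<sigma>) *\<^sub>R quat p + (\<gamma> / \<sigma>) *\<^sub>R imul (quat p))"
  have qq: "quat p \<bullet> quat p = 1" using quat_norm[OF p(2)] p(1) by (simp add: norm_eq_1)
  have r_s: "\<sigma> *\<^sub>R r = \<beta> *\<^sub>R quat p + \<gamma> *\<^sub>R imul (quat p)"
    using ks by (cases "\<sigma> = 0") (simp_all add: r_def scaleR_add_right sum_power2_eq_zero_iff)
  have "r \<bullet> r = 1"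
  proof (cases "\<sigma> = 0")
    case False
    have "r \<bullet> r = (\<beta>\<^sup>2 + \<gamma>\<^sup>2) / \<sigma>\<^sup>2"
      using False qq by (simp add: r_def inner_add_left inner_add_right power2_eq_square add_divide_distrib)
    then show ?thesis using False ks by simp
  qed (simp add: r_def qq)
  then have r1: "norm r = 1" by (simp add: norm_eq_1)
  have r2: "proj r = r"
    by (simp add: r_def linear_add[OF linear_proj] linear_scale[OF linear_proj] proj_imul)
  have r3: "horth p r"
    unfolding r_def using horth_sym[OF quat_horth[of p]] by (auto intro!: horth_add horth_scale horth_imul)
  obtain f where f: "hermitian_map f" "f u = p" "f w = r" "\<And>x. horth x u \<Longrightarrow> horth x w \<Longrightarrow> f x = x"
    using frame_map[OF p(1,2) r1 r2 r3] by metis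
  have lf: "linear f" using f(1) by (simp add: hermitian_map_def orthogonal_transformation_linear)
  have "map f Q = Q" using Q f(4) by (intro map_idI) auto
  moreover have "f (\<kappa> *\<^sub>R imul u + \<sigma> *\<^sub>R w) = twist \<kappa> \<beta> \<gamma> p"
    using f by (simp add: hermitian_map_def linear_add[OF lf] linear_scale[OF lf] r_s twist_def)
  ultimately have "ext_map f (ext_product (Q @ [u, \<kappa> *\<^sub>R imul u + \<sigma> *\<^sub>R w])) = ext_product (Q @ [p, twist \<kappa> \<beta> \<gamma> p])"
    using f(2) by (simp add: ext_map_ext_product[OF lf])
  moreover have "ext_product (Q @ [u, \<kappa> *\<^sub>R imul u + \<sigma> *\<^sub>R w]) \<in> simple_ext (length Q + 2)"
    unfolding simple_ext_def by (intro CollectI exI[of _ "Q @ [u, \<kappa> *\<^sub>R imul u + \<sigma> *\<^sub>R w]"]) simp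
  ultimately have "q_support q (ext_product (Q @ [p, twist \<kappa> \<beta> \<gamma> p])) = q_support q (ext_product (Q @ [u, \<kappa> *\<^sub>R imul u + \<sigma> *\<^sub>R w]))"
    using q f(1) unfolding cp_ring_support_iff by metis
  moreover have "ext_product (Q @ [z, twist \<kappa> \<beta> \<gamma> z]) = (norm z)\<^sup>2 *\<^sub>R ext_product (Q @ [p, twist \<kappa> \<beta> \<gamma> p])"
  proof -
    have "twist \<kappa> \<beta> \<gamma> z = norm z *\<^sub>R twist \<kappa> \<beta> \<gamma> p" by (subst p(3)) (rule linear_scale[OF linear_twist])
    then show ?thesis
      by (subst (1) p(3)) (simp add: ext_product_append ext_vec_simps wedge_bilinear_simps power2_eq_square)
  qed
  ultimately show ?thesis by (simp add: q_support_homogeneous)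
qed

definition twist_vec :: "(real ^ ('n \<times> bool)) list \<Rightarrow> real \<Rightarrow> real \<Rightarrow> real \<Rightarrow> (real ^ ('n \<times> bool) \<Rightarrow> real) \<Rightarrow> ('n \<times> bool) ext" where
  "twist_vec Q \<alpha> \<beta> \<gamma> \<omega> = ext_product (Q @ [proj (gauss_vec \<omega>), twist \<alpha> \<beta> \<gamma> (proj (gauss_vec \<omega>))])"

lemma twist_vec_simple: "twist_vec Q \<alpha> \<beta> \<gamma> \<omega> \<in> simple_ext (length Q + 2)"
  unfolding twist_vec_def simple_ext_def
  by (intro CollectI exI[of _ "Q @ [proj (gauss_vec \<omega>), twist \<alpha> \<beta> \<gamma> (proj (gauss_vec \<omega>))]"]) simp

lemma integrable_twist_vec: "integrable gauss_space (twist_vec Q \<alpha> \<beta> \<gamma>)"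
proof -
  let ?b = "\<lambda>x y. ext_product (Q @ [x, y])"
  have b: "bilinear ?b"
    by (auto simp: bilinear_def ext_product_append ext_vec_simps wedge_bilinear_simps intro!: linearI)
  obtain B where B: "B > 0" "\<And>x y. norm (?b x y) \<le> B * norm x * norm y" using bilinear_bounded_pos[OF b] by metis
  obtain P where P: "P > 0" "\<And>x. norm (proj x) \<le> P * norm x" using linear_bounded_pos[OF linear_proj] by metis
  obtain W where W: "W > 0" "\<And>x. norm (twist \<alpha> \<beta> \<gamma> x) \<le> W * norm x" using linear_bounded_pos[OF linear_twist] by metis
  have "continuous_on UNIV (\<lambda>x. ?b (proj x) (twist \<alpha> \<beta> \<gamma> (proj x)))"
    using linear_proj linear_compose[OF linear_proj linear_twist, unfolded o_def]
    by (intro bounded_bilinear.continuous_on[OF b[unfolded bilinear_conv_bounded_bilinear]] linear_continuous_on)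
       (simp_all add: linear_conv_bounded_linear)
  then have "(\<lambda>x. ?b (proj x) (twist \<alpha> \<beta> \<gamma> (proj x))) \<in> borel_measurable borel" by (rule borel_measurable_continuous_onI)
  then have m: "twist_vec Q \<alpha> \<beta> \<gamma> \<in> borel_measurable gauss_space"
    unfolding twist_vec_def[abs_def] by (rule measurable_compose[OF measurable_gauss_vec])
  show ?thesis
  proof (rule Bochner_Integration.integrable_bound)
    show "integrable gauss_space (\<lambda>\<omega>. (B * P * W * P) * (norm (gauss_vec \<omega> :: real ^ ('n \<times> bool)))\<^sup>2)"
      by (intro integrable_mult_right integrable_norm_gauss_sq)
    have "norm (twist_vec Q \<alpha> \<beta> \<gamma> \<omega>) \<le> (B * P * W * P) * (norm (gauss_vec \<omega> :: real ^ ('n \<times> bool)))\<^sup>2" for \<omega>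
    proof -
      let ?g = "gauss_vec \<omega> :: real ^ ('n \<times> bool)"
      have "norm (twist_vec Q \<alpha> \<beta> \<gamma> \<omega>) \<le> B * norm (proj ?g) * norm (twist \<alpha> \<beta> \<gamma> (proj ?g))"
        unfolding twist_vec_def by (rule B(2))
      also have "\<dots> \<le> B * (P * norm ?g) * (W * (P * norm ?g))"
        using B(1) P W by (intro mult_mono order_trans[OF W(2)] mult_left_mono P(2)) auto
      finally show ?thesis by (simp add: power2_eq_square mult_ac)
    qed
    then show "AE \<omega> in gauss_space. norm (twist_vec Q \<alpha> \<beta> \<gamma> \<omega>) \<le> norm ((B * P * W * P) * (norm (gauss_vec \<omega> :: real ^ ('n \<times> bool)))\<^sup>2)"
      using B(1) P(1) W(1) by (auto simp: abs_mult)
  qed (rule m)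
qed

text \<open>Contracting \<xi> by \<open>Q\<close> leaves a multiple of a product of two vectors, of
  which only the projections \<open>x\<close> and \<open>y\<close> to the plane matter. The mean
  involves the triple only through the square of
  \<open>twist \<alpha> \<beta> \<gamma> x \<bullet> y\<close>, and this inner product is linear in
  the triple.\<close>

lemma mean_twist_vec:
  assumes \<xi>: "\<xi> \<in> simple_ext (length Q + 2)"
  shows "\<exists>A E tJ tK tL. \<forall>\<alpha> \<beta> \<gamma>. \<alpha>\<^sup>2 + \<beta>\<^sup>2 + \<gamma>\<^sup>2 = 1 \<longrightarrow>
     (\<integral>\<omega>. \<bar>\<xi> \<bullet> twist_vec Q \<alpha> \<beta> \<gamma> \<omega>\<bar> \<partial>gauss_space) = A + E * (\<alpha> * tJ + \<beta> * tK + \<gamma> * tL)\<^sup>2"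
proof -
  obtain c \<tau> where "\<tau> \<in> simple_ext 2" "contract_list Q \<xi> = c *\<^sub>R \<tau>" using contract_list_simple[OF \<xi>] by blast
  moreover from this(1) obtain vs where vs: "\<tau> = ext_product vs" "length vs = 2" by (auto simp: simple_ext_def)
  moreover from vs(2) obtain x' y' where "vs = [x', y']" by (auto simp: length_Suc_conv numeral_2_eq_2)
  ultimately have \<tau>: "contract_list Q \<xi> = c *\<^sub>R ext_product [x', y']" by simp
  define x y where "x = proj x'" and "y = proj y'"
  define D where "D = sqrt ((x \<bullet> x) * (y \<bullet> y) - (x \<bullet> y)\<^sup>2)"
  have "(\<integral>\<omega>. \<bar>\<xi> \<bullet> twist_vec Q \<alpha> \<beta> \<gamma> \<omega>\<bar> \<partial>gauss_space)
     = \<bar>c\<bar> * D + (\<bar>c\<bar> / D) * (\<alpha> * (imul x \<bullet> y) + \<beta> * (quat x \<bullet> y) + \<gamma> * (imul (quat x) \<bullet> y))\<^sup>2"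
    if unit: "\<alpha>\<^sup>2 + \<beta>\<^sup>2 + \<gamma>\<^sup>2 = 1" for \<alpha> \<beta> \<gamma>
  proof -
    let ?a = "twist \<alpha> \<beta> \<gamma>"
    have "\<xi> \<bullet> twist_vec Q \<alpha> \<beta> \<gamma> \<omega> = c * ((gauss_vec \<omega> \<bullet> ?a x) * (gauss_vec \<omega> \<bullet> y) - (gauss_vec \<omega> \<bullet> x) * (gauss_vec \<omega> \<bullet> ?a y))" for \<omega>
    proof -
      let ?g = "gauss_vec \<omega> :: real ^ ('n \<times> bool)"
      have px: "v \<bullet> proj ?g = ?g \<bullet> proj v" for v using proj_sym[of v ?g] by (simp add: inner_commute)
      have pa: "v \<bullet> ?a (proj ?g) = - (?g \<bullet> ?a (proj v))" for v
      proof -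
        have "v \<bullet> ?a (proj ?g) = proj v \<bullet> ?a (proj ?g)" using proj_sym[of v] proj_twist[of "proj ?g"] by (metis proj_proj)
        also have "\<dots> = - (?a (proj v) \<bullet> proj ?g)" by (simp add: twist_skew)
        also have "?a (proj v) \<bullet> proj ?g = ?g \<bullet> ?a (proj v)" using px[of "?a (proj v)"] by (simp add: proj_twist)
        finally show ?thesis .
      qed
      have "\<xi> \<bullet> twist_vec Q \<alpha> \<beta> \<gamma> \<omega> = contract_list Q \<xi> \<bullet> ext_product [proj ?g, ?a (proj ?g)]"
        unfolding twist_vec_def ext_product_append contract_list_inner ..
      also have "\<dots> = c * ((x' \<bullet> proj ?g) * (y' \<bullet> ?a (proj ?g)) - (x' \<bullet> ?a (proj ?g)) * (y' \<bullet> proj ?g))"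
        unfolding \<tau> inner_scaleR_left ext_product_pair_inner ..
      finally show ?thesis unfolding px pa by (simp add: x_def y_def algebra_simps)
    qed
    moreover have "has_bochner_integral gauss_space
        (\<lambda>\<omega>. \<bar>(gauss_vec \<omega> \<bullet> ?a x) * (gauss_vec \<omega> \<bullet> y) - (gauss_vec \<omega> \<bullet> x) * (gauss_vec \<omega> \<bullet> ?a y)\<bar>) (D + (?a x \<bullet> y)\<^sup>2 / D)"
      unfolding D_def
      by (rule gauss_mean_plane[OF linear_twist, where T = "{x. proj x = x}"])
         (auto simp: x_def y_def subspace_plane proj_twist twist_skew twist_twist unit)
    ultimately have "(\<integral>\<omega>. \<bar>\<xi> \<bullet> twist_vec Q \<alpha> \<beta> \<gamma> \<omega>\<bar> \<partial>gauss_space) = \<bar>c\<bar> * (D + (?a x \<bullet> y)\<^sup>2 / D)"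
      by (simp add: abs_mult has_bochner_integral_integral_eq)
    then show ?thesis by (simp add: twist_def inner_add_left distrib_left)
  qed
  then show ?thesis by metis
qed

text \<open>In the square of the linear form the mixed terms of \<kappa> and \<sigma> change sign
  with \<sigma> and cancel in the sum; the constant term is distributed by means of \<kappa>^2 +
  \<sigma>^2 = 1. The identity holds at simple vectors, is integrated over a law of such vectors and
  extends linearly to all classes.\<close>

lemma mean_twist_linear:
  fixes x :: "('n \<times> bool) ext vzonoid"
  assumes x: "x \<in> grass (length Q + 2)" and ks: "\<kappa>\<^sup>2 + \<sigma>\<^sup>2 = 1"
  defines "I \<equiv> \<lambda>\<alpha> \<beta> \<gamma> x. \<integral>\<omega>. vz_support x (twist_vec Q \<alpha> \<beta> \<gamma> \<omega>) \<partial>gauss_space"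
  shows "I \<kappa> \<sigma> 0 x + I \<kappa> (- \<sigma>) 0 x + I \<kappa> 0 \<sigma> x + I \<kappa> 0 (- \<sigma>) x
     = \<kappa>\<^sup>2 * (4 * I 1 0 0 x) + \<sigma>\<^sup>2 * (2 * (I 0 1 0 x + I 0 0 1 x))"
proof (rule linear_eq_on_span[OF _ _ _ x[unfolded grass_span]])
  have lin: "linear (I \<alpha> \<beta> \<gamma>)" for \<alpha> \<beta> \<gamma>
    unfolding I_def by (rule linear_integral_vz_support[OF integrable_twist_vec])
  show "linear (\<lambda>x. I \<kappa> \<sigma> 0 x + I \<kappa> (- \<sigma>) 0 x + I \<kappa> 0 \<sigma> x + I \<kappa> 0 (- \<sigma>) x)"
    "linear (\<lambda>x. \<kappa>\<^sup>2 * (4 * I 1 0 0 x) + \<sigma>\<^sup>2 * (2 * (I 0 1 0 x + I 0 0 1 x)))"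
    by (rule linearI; simp add: linear_add[OF lin] linear_scale[OF lin] algebra_simps)+
  fix z :: "('n \<times> bool) ext vzonoid" assume "z \<in> grass_classes (length Q + 2)"
  then obtain M where M: "integrable_law M" "AE x in M. x \<in> simple_ext (length Q + 2)" "z = K_class M (\<lambda>x. x)"
    by (rule grass_classesE)
  have [measurable_cong]: "sets M = sets borel" using M by (auto dest: integrable_lawD)
  define L where "L \<alpha> \<beta> \<gamma> = distr gauss_space borel (twist_vec Q \<alpha> \<beta> \<gamma>)" for \<alpha> \<beta> \<gamma>
  define h where "h \<alpha> \<beta> \<gamma> \<xi> = (\<integral>\<omega>. \<bar>\<xi> \<bullet> twist_vec Q \<alpha> \<beta> \<gamma> \<omega>\<bar> \<partial>gauss_space) / 2" for \<alpha> \<beta> \<gamma> \<xi>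
  note tm = borel_measurable_integrable[OF integrable_twist_vec]
  have Ll: "integrable_law (L \<alpha> \<beta> \<gamma>)" for \<alpha> \<beta> \<gamma>
    unfolding L_def by (rule integrable_law_distr[OF prob_space_gauss_space integrable_twist_vec])
  have hL: "h \<alpha> \<beta> \<gamma> \<xi> = vz_support (K_class (L \<alpha> \<beta> \<gamma>) (\<lambda>x. x)) \<xi>" for \<alpha> \<beta> \<gamma> \<xi>
  proof -
    have "(\<integral>x. \<bar>\<xi> \<bullet> x\<bar> \<partial>L \<alpha> \<beta> \<gamma>) = (\<integral>\<omega>. \<bar>\<xi> \<bullet> twist_vec Q \<alpha> \<beta> \<gamma> \<omega>\<bar> \<partial>gauss_space)"
      unfolding L_def by (rule integral_distr[OF tm]) simp
    then show ?thesis by (simp add: h_def vz_support_law[OF Ll])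
  qed
  have hi: "integrable M (h \<alpha> \<beta> \<gamma>)" for \<alpha> \<beta> \<gamma>
    unfolding hL[abs_def] by (rule integrable_vz_support[OF integrable_lawD(3)[OF M(1)]])
  have I: "I \<alpha> \<beta> \<gamma> z = (\<integral>\<xi>. h \<alpha> \<beta> \<gamma> \<xi> \<partial>M)" for \<alpha> \<beta> \<gamma>
  proof -
    have "I \<alpha> \<beta> \<gamma> z = (\<integral>y. vz_support (K_class M (\<lambda>x. x)) y \<partial>L \<alpha> \<beta> \<gamma>)"
      unfolding I_def L_def M(3) by (rule integral_distr[OF tm, symmetric]) simp
    then show ?thesis unfolding law_symmetric[OF M(1) Ll] hL .
  qed
  have "I \<kappa> \<sigma> 0 z + I \<kappa> (- \<sigma>) 0 z + I \<kappa> 0 \<sigma> z + I \<kappa> 0 (- \<sigma>) z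
    = (\<integral>\<xi>. h \<kappa> \<sigma> 0 \<xi> + h \<kappa> (- \<sigma>) 0 \<xi> + h \<kappa> 0 \<sigma> \<xi> + h \<kappa> 0 (- \<sigma>) \<xi> \<partial>M)"
    unfolding I by (simp add: hi)
  also have "\<dots> = (\<integral>\<xi>. \<kappa>\<^sup>2 * (4 * h 1 0 0 \<xi>) + \<sigma>\<^sup>2 * (2 * (h 0 1 0 \<xi> + h 0 0 1 \<xi>)) \<partial>M)"
  proof (rule integral_cong_AE)
    show "AE \<xi> in M. h \<kappa> \<sigma> 0 \<xi> + h \<kappa> (- \<sigma>) 0 \<xi> + h \<kappa> 0 \<sigma> \<xi> + h \<kappa> 0 (- \<sigma>) \<xi>
      = \<kappa>\<^sup>2 * (4 * h 1 0 0 \<xi>) + \<sigma>\<^sup>2 * (2 * (h 0 1 0 \<xi> + h 0 0 1 \<xi>))"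
      using M(2)
    proof eventually_elim
      case (elim \<xi>)
      obtain A E tJ tK tL where *: "\<And>\<alpha> \<beta> \<gamma>. \<alpha>\<^sup>2 + \<beta>\<^sup>2 + \<gamma>\<^sup>2 = 1 \<Longrightarrow> 2 * h \<alpha> \<beta> \<gamma> \<xi> = A + E * (\<alpha> * tJ + \<beta> * tK + \<gamma> * tL)\<^sup>2"
        using mean_twist_vec[OF elim] unfolding h_def by auto
      have eqs: "2 * h \<kappa> \<sigma> 0 \<xi> = A + E * (\<kappa> * tJ + \<sigma> * tK)\<^sup>2" "2 * h \<kappa> (- \<sigma>) 0 \<xi> = A + E * (\<kappa> * tJ - \<sigma> * tK)\<^sup>2"
        "2 * h \<kappa> 0 \<sigma> \<xi> = A + E * (\<kappa> * tJ + \<sigma> * tL)\<^sup>2" "2 * h \<kappa> 0 (- \<sigma>) \<xi> = A + E * (\<kappa> * tJ - \<sigma> * tL)\<^sup>2"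
        "2 * h 1 0 0 \<xi> = A + E * tJ\<^sup>2" "2 * h 0 1 0 \<xi> = A + E * tK\<^sup>2" "2 * h 0 0 1 \<xi> = A + E * tL\<^sup>2"
        using *[of \<kappa> \<sigma> 0] *[of \<kappa> "- \<sigma>" 0] *[of \<kappa> 0 \<sigma>] *[of \<kappa> 0 "- \<sigma>"] *[of 1 0 0] *[of 0 1 0] *[of 0 0 1] ks
        by simp_all
      have "(A + E * (\<kappa> * tJ + \<sigma> * tK)\<^sup>2) + (A + E * (\<kappa> * tJ - \<sigma> * tK)\<^sup>2) + (A + E * (\<kappa> * tJ + \<sigma> * tL)\<^sup>2) + (A + E * (\<kappa> * tJ - \<sigma> * tL)\<^sup>2)
        = 4 * A + 4 * E * \<kappa>\<^sup>2 * tJ\<^sup>2 + 2 * E * \<sigma>\<^sup>2 * tK\<^sup>2 + 2 * E * \<sigma>\<^sup>2 * tL\<^sup>2"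
        by (simp add: power2_eq_square algebra_simps)
      also have "\<dots> = 4 * A * (\<kappa>\<^sup>2 + \<sigma>\<^sup>2) + 4 * E * \<kappa>\<^sup>2 * tJ\<^sup>2 + 2 * E * \<sigma>\<^sup>2 * tK\<^sup>2 + 2 * E * \<sigma>\<^sup>2 * tL\<^sup>2"
        by (simp add: ks)
      also have "\<dots> = \<kappa>\<^sup>2 * (4 * (A + E * tJ\<^sup>2)) + \<sigma>\<^sup>2 * (2 * ((A + E * tK\<^sup>2) + (A + E * tL\<^sup>2)))"
        by (simp add: algebra_simps)
      finally show ?case unfolding eqs[symmetric] by (simp add: algebra_simps)
    qed
  qed (use hi[THEN borel_measurable_integrable] in measurable)
  also have "\<dots> = \<kappa>\<^sup>2 * (4 * I 1 0 0 z) + \<sigma>\<^sup>2 * (2 * (I 0 1 0 z + I 0 0 1 z))"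
    unfolding I by (simp add: hi)
  finally show "I \<kappa> \<sigma> 0 z + I \<kappa> (- \<sigma>) 0 z + I \<kappa> 0 \<sigma> z + I \<kappa> 0 (- \<sigma>) z = \<kappa>\<^sup>2 * (4 * I 1 0 0 z) + \<sigma>\<^sup>2 * (2 * (I 0 1 0 z + I 0 0 1 z))" .
qed

lemma mean_norm_proj: "has_bochner_integral gauss_space (\<lambda>\<omega>. (norm (proj (gauss_vec \<omega>)))\<^sup>2) 4"
proof -
  have "(norm (proj x))\<^sup>2 = (x \<bullet> u)\<^sup>2 + (x \<bullet> imul u)\<^sup>2 + (x \<bullet> w)\<^sup>2 + (x \<bullet> imul w)\<^sup>2" for x
    unfolding power2_norm_eq_inner using proj_sym[of x "proj x"] proj_inner[of x x]
    by (simp add: inner_commute power2_eq_square)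
  moreover have "has_bochner_integral gauss_space (\<lambda>\<omega>. (gauss_vec \<omega> \<bullet> u)\<^sup>2 + (gauss_vec \<omega> \<bullet> imul u)\<^sup>2
      + (gauss_vec \<omega> \<bullet> w)\<^sup>2 + (gauss_vec \<omega> \<bullet> imul w)\<^sup>2) (1 + 1 + 1 + 1)"
    by (intro has_bochner_integral_add gauss_second_moment) (simp_all add: norm_u norm_w)
  ultimately show ?thesis by simp
qed

text \<open>Here \<open>\<kappa>\<close> is the cosine of the Kaehler angle of the plane spanned by \<open>u\<close> and \<open>\<kappa> iu + \<sigma> w\<close>.\<close>

lemma q_support_kaehler_angle:
  assumes q: "q \<in> cp_deg (length Q + 2)" and ks: "\<kappa>\<^sup>2 + \<sigma>\<^sup>2 = 1"
    and Q: "\<And>x. x \<in> set Q \<Longrightarrow> horth x u \<and> horth x w"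
  shows "q_support q (ext_product (Q @ [u, \<kappa> *\<^sub>R imul u + \<sigma> *\<^sub>R w])) =
    \<kappa>\<^sup>2 * q_support q (ext_product (Q @ [u, imul u])) + \<sigma>\<^sup>2 * q_support q (ext_product (Q @ [u, w]))"
proof -
  obtain x where x: "x \<in> grass (length Q + 2)" "q = abs_qring x" and qr: "q \<in> cp_ring"
    using q by (auto simp: cp_deg_def q_deg_def)
  define I where "I \<alpha> \<beta> \<gamma> = (\<integral>\<omega>. vz_support x (twist_vec Q \<alpha> \<beta> \<gamma> \<omega>) \<partial>gauss_space)" for \<alpha> \<beta> \<gamma>
  \<comment> \<open>The factor 4 is the mean squared norm of a Gaussian vector in the plane, whose
    real dimension is 4. The value depends on \<open>b\<close> and \<open>c\<close> only through the
    sum of their squares.\<close>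
  have I: "I k b c = 4 * q_support q (ext_product (Q @ [u, k *\<^sub>R imul u + s *\<^sub>R w]))" if "b\<^sup>2 + c\<^sup>2 = s\<^sup>2" for k b c s
  proof -
    have "vz_support x (twist_vec Q k b c \<omega>)
      = (norm (proj (gauss_vec \<omega>)))\<^sup>2 * q_support q (ext_product (Q @ [u, k *\<^sub>R imul u + s *\<^sub>R w]))" for \<omega>
    proof -
      have "vz_support x (twist_vec Q k b c \<omega>) = q_support q (twist_vec Q k b c \<omega>)"
        unfolding x(2) using x(1) grass_subset_total twist_vec_simple by (intro q_support_abs[symmetric]) auto
      then show ?thesis unfolding twist_vec_def using q_support_twist[OF qr that _ Q] by simp
    qed
    then show ?thesis
      using has_bochner_integral_integral_eq[OF has_bochner_integral_mult_left[OF mean_norm_proj]] by (simp add: I_def)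
  qed
  have "I \<kappa> \<sigma> 0 + I \<kappa> (- \<sigma>) 0 + I \<kappa> 0 \<sigma> + I \<kappa> 0 (- \<sigma>) = \<kappa>\<^sup>2 * (4 * I 1 0 0) + \<sigma>\<^sup>2 * (2 * (I 0 1 0 + I 0 0 1))"
    unfolding I_def by (rule mean_twist_linear[OF x(1) ks])
  then show ?thesis
    using I[of \<sigma> 0 \<sigma> \<kappa>] I[of "- \<sigma>" 0 \<sigma> \<kappa>] I[of 0 \<sigma> \<sigma> \<kappa>] I[of 0 "- \<sigma>" \<sigma> \<kappa>] I[of 0 0 0 1] I[of 1 0 1 0] I[of 0 1 1 0]
    by simp
qed

end

section \<open>The upper bound for the dimension\<close>

text \<open>First-order condition at a maximum: for small \<open>t\<close> the gain is linear while
  the right side grows only quadratically.\<close>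

lemma perturbation_zero:
  fixes \<kappa> b c :: real
  assumes "\<kappa> \<ge> 0" "c \<ge> 0" "\<And>t. \<kappa> + t * b \<le> \<kappa> * sqrt (1 + t\<^sup>2 * c)"
  shows "b = 0"
proof (rule ccontr)
  assume b: "b \<noteq> 0"
  \<comment> \<open>Adding 1 keeps the denominator positive. For \<open>t = b / m\<close> the gain
    is b^2 / m, while the quadratic growth is at most half of it.\<close>
  define m where "m = \<kappa> * c + 1"
  have m: "m \<ge> 1" using assms by (simp add: m_def)
  define t where "t = b / m"
  have "sqrt (1 + t\<^sup>2 * c) \<le> 1 + t\<^sup>2 * c / 2"
  proof (rule real_le_lsqrt)
    have "(1 + t\<^sup>2 * c / 2)\<^sup>2 = 1 + t\<^sup>2 * c + (t\<^sup>2 * c / 2)\<^sup>2" by (simp add: power2_sum)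
    then show "1 + t\<^sup>2 * c \<le> (1 + t\<^sup>2 * c / 2)\<^sup>2" by simp
  qed (use assms(2) in auto)
  then have "\<kappa> * sqrt (1 + t\<^sup>2 * c) \<le> \<kappa> * (1 + t\<^sup>2 * c / 2)" using assms(1) by (rule mult_left_mono)
  then have "t * b \<le> t\<^sup>2 * (\<kappa> * c) / 2" using assms(3)[of t] by (simp add: algebra_simps)
  also have "\<dots> \<le> t\<^sup>2 * m / 2" by (simp add: m_def mult_left_mono)
  also have "t\<^sup>2 * m = t * b" using m by (simp add: t_def power2_eq_square)
  finally have "t * b \<le> 0" by linarith
  moreover have "t * b = b\<^sup>2 / m" by (simp add: t_def power2_eq_square)
  moreover have "b\<^sup>2 / m > 0" using b m by simp
  ultimately show False by simp
qed

text \<open>A pair maximizing \<open>imul u \<bullet> v\<close> splits off hermitian orthogonally.\<close>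

lemma maximal_pair:
  fixes E :: "(real ^ ('n::finite \<times> bool)) set"
  assumes E: "subspace E" "dim E \<ge> 2"
  obtains u v where "u \<in> E" "v \<in> E" "norm u = 1" "norm v = 1" "u \<bullet> v = 0" "0 \<le> imul u \<bullet> v"
    "\<And>x. x \<in> E \<Longrightarrow> x \<bullet> u = 0 \<Longrightarrow> x \<bullet> v = 0 \<Longrightarrow> horth x u \<and> horth x v"
proof -
  define S where "S = {p \<in> E \<times> E. norm (fst p) = 1 \<and> norm (snd p) = 1 \<and> fst p \<bullet> snd p = 0}"
  have clE: "closed E" using E(1) by (rule closed_subspace)
  have "S = (E \<times> E) \<inter> {p. norm (fst p) = 1} \<inter> {p. norm (snd p) = 1} \<inter> {p. fst p \<bullet> snd p = 0}"
    by (auto simp: S_def)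
  moreover have "closed \<dots>"
    by (intro closed_Int closed_Times clE closed_Collect_eq continuous_intros)
  ultimately have "closed S" by simp
  moreover have "bounded S"
    by (rule bounded_subset[of "cball 0 1 \<times> cball 0 1"]) (auto simp: S_def bounded_Times)
  ultimately have cS: "compact S" by (simp add: compact_eq_bounded_closed)
  obtain B where B: "B \<subseteq> E" "pairwise orthogonal B" "\<And>x. x \<in> B \<Longrightarrow> norm x = 1" "independent B" "card B = dim E" "span B = E"
    using orthonormal_basis_subspace[OF E(1)] by metis
  obtain b c where bc: "b \<in> B" "c \<in> B" "b \<noteq> c"
  proof -
    have "\<not> card B \<le> Suc 0" using B(5) E(2) by simp
    then show ?thesis using that card_le_Suc0_iff_eq[OF independent_imp_finite[OF B(4)]] by blast
  qed
  then have "(b, c) \<in> S" using B(1,2,3) by (auto simp: S_def pairwise_def orthogonal_def)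
  then have "S \<noteq> {}" by auto
  have "continuous_on S (\<lambda>p. imul (fst p) \<bullet> snd p)"
    using linear_imul by (intro continuous_on_inner continuous_on_compose2[OF linear_continuous_on[of imul UNIV]] continuous_intros)
      (auto simp: linear_conv_bounded_linear)
  then obtain p where p: "p \<in> S" "\<And>q. q \<in> S \<Longrightarrow> imul (fst q) \<bullet> snd q \<le> imul (fst p) \<bullet> snd p"
    using continuous_attains_sup[OF cS \<open>S \<noteq> {}\<close>] by blast
  define u v \<kappa> where "u = fst p" and "v = snd p" and "\<kappa> = imul u \<bullet> v"
  have uv: "u \<in> E" "v \<in> E" "norm u = 1" "norm v = 1" "u \<bullet> v = 0" using p(1) by (auto simp: S_def u_def v_def)
  have max: "imul x \<bullet> y \<le> \<kappa>" if "x \<in> E" "y \<in> E" "norm x = 1" "norm y = 1" "x \<bullet> y = 0" for x y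
    using p(2)[of "(x, y)"] that by (simp add: S_def \<kappa>_def u_def v_def)
  \<comment> \<open>Replacing \<open>v\<close> by its negative changes the sign of the maximized
    value.\<close>
  have \<kappa>: "\<kappa> \<ge> 0"
    using max[of u "- v"] uv E(1) subspace_neg[OF E(1), of v] by (simp add: \<kappa>_def)
  have max': "imul x \<bullet> y \<le> \<kappa> * (norm x * norm y)" if xy: "x \<in> E" "y \<in> E" "x \<noteq> 0" "y \<noteq> 0" "x \<bullet> y = 0" for x y
  proof -
    have "imul ((1 / norm x) *\<^sub>R x) \<bullet> ((1 / norm y) *\<^sub>R y) \<le> \<kappa>"
      using xy by (intro max subspace_scale[OF E(1)]) auto
    then show ?thesis using xy by (simp add: imul_simps field_simps)
  qed
  have key: "imul u \<bullet> x = 0 \<and> imul x \<bullet> v = 0" if x: "x \<in> E" "x \<bullet> u = 0" "x \<bullet> v = 0" for x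
  proof
    have n: "norm (v + t *\<^sub>R x) = sqrt (1 + t\<^sup>2 * (x \<bullet> x))" "norm (u + t *\<^sub>R x) = sqrt (1 + t\<^sup>2 * (x \<bullet> x))" for t
      using uv x by (simp_all add: norm_eq_sqrt_inner[of "_ + _"] inner_add_left inner_add_right inner_commute[of u x] inner_commute[of v x]
          power2_eq_square norm_eq_1)
    have pos: "1 + t\<^sup>2 * (x \<bullet> x) > 0" for t :: real by (simp add: add_pos_nonneg)
    have nz: "v + t *\<^sub>R x \<noteq> 0" "u + t *\<^sub>R x \<noteq> 0" for t
      using n[of t] pos[of t] by (metis less_irrefl norm_zero real_sqrt_gt_0_iff)+
    have uv0: "u \<noteq> 0" "v \<noteq> 0" using uv by auto
    \<comment> \<open>Perturbing \<open>v\<close> by a multiple of \<open>x\<close> keeps the pair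
      orthogonal, so maximality gives the inequality for \<open>t\<close> of either sign.\<close>
    show "imul u \<bullet> x = 0"
    proof (rule perturbation_zero[OF \<kappa>])
      show "\<kappa> + t * (imul u \<bullet> x) \<le> \<kappa> * sqrt (1 + t\<^sup>2 * (x \<bullet> x))" for t
      proof -
        have "u \<bullet> (v + t *\<^sub>R x) = 0" using uv x by (simp add: inner_add_right inner_commute)
        then have "imul u \<bullet> (v + t *\<^sub>R x) \<le> \<kappa> * (norm u * norm (v + t *\<^sub>R x))"
          using uv x nz uv0 by (intro max' subspace_add[OF E(1)] subspace_scale[OF E(1)]) auto
        then show ?thesis using uv by (simp add: n inner_add_right \<kappa>_def)
      qed
    qed simp
    show "imul x \<bullet> v = 0"
    proof (rule perturbation_zero[OF \<kappa>])
      show "\<kappa> + t * (imul x \<bullet> v) \<le> \<kappa> * sqrt (1 + t\<^sup>2 * (x \<bullet> x))" for t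
      proof -
        have "(u + t *\<^sub>R x) \<bullet> v = 0" using uv x by (simp add: inner_add_left)
        then have "imul (u + t *\<^sub>R x) \<bullet> v \<le> \<kappa> * (norm (u + t *\<^sub>R x) * norm v)"
          using uv x nz uv0 by (intro max' subspace_add[OF E(1)] subspace_scale[OF E(1)]) auto
        then show ?thesis using uv by (simp add: n imul_simps inner_add_left \<kappa>_def)
      qed
    qed simp
  qed
  have "horth x u \<and> horth x v" if "x \<in> E" "x \<bullet> u = 0" "x \<bullet> v = 0" for x
    using key[OF that] that imul_inner_left[of x v] by (simp add: horth_def inner_commute)
  then show ?thesis using that[of u v] uv \<kappa> by (simp add: \<kappa>_def)
qed

definition complex_list :: "(real ^ ('n::finite \<times> bool)) list \<Rightarrow> (real ^ ('n \<times> bool)) list" where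
  "complex_list us = concat (map (\<lambda>u. [u, imul u]) us)"

lemma complex_list_simps [simp]: "complex_list [] = []" "complex_list (u # us) = u # imul u # complex_list us"
    "complex_list (us @ ws) = complex_list us @ complex_list ws" "length (complex_list us) = 2 * length us"
  by (induction us) (simp_all add: complex_list_def)

lemma complex_list_horth: "(\<And>u. u \<in> set us \<Longrightarrow> horth x u) \<Longrightarrow> v \<in> set (complex_list us) \<Longrightarrow> horth x v"
  by (induction us) (auto intro: horth_imul)

lemma map_complex_list: "hermitian_map f \<Longrightarrow> map f (complex_list us) = complex_list (map f us)"
  by (induction us) (simp_all add: hermitian_map_def)

lemma horth_span: "v \<in> span S \<Longrightarrow> (\<And>s. s \<in> S \<Longrightarrow> horth x s) \<Longrightarrow> horth x v"
proof (induction rule: span_induct_alt)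
  case base
  then show ?case by (simp add: horth_def imul_simps)
next
  case (step c y z)
  then show ?case by (intro horth_add horth_scale) auto
qed

lemma hermitian_orthonormal_insert:
  assumes "hermitian_orthonormal (us @ ws)" "norm x = 1" "\<And>y. y \<in> set (us @ ws) \<Longrightarrow> horth x y"
  shows "hermitian_orthonormal ((us @ [x]) @ ws)" "hermitian_orthonormal (us @ ws @ [x])"
  using assms by (auto simp: hermitian_orthonormal_def sorted_wrt_append intro: horth_sym)

text \<open>Here \<open>us\<close> collects complex lines, \<open>ws\<close> single unit vectors,
  and \<open>vs\<close> the factors not yet treated, Hermitian orthogonal to all the former. An
  extremal pair in the span of \<open>vs\<close> splits off Hermitian orthogonally; the Kaehler
  angle formula replaces it by a new line or by two new members of \<open>ws\<close>, and
  \<open>vs\<close> gets shorter by two.\<close>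

lemma cp_vanish_step:
  fixes q :: "('n::finite \<times> bool) qring"
  assumes q: "q \<in> cp_deg d"
    and std: "\<And>us ws. hermitian_orthonormal (us @ ws) \<Longrightarrow> 2 * length us + length ws = d \<Longrightarrow>
       q_support q (ext_product (complex_list us @ ws)) = 0"
  shows "hermitian_orthonormal (us @ ws) \<Longrightarrow> (\<And>v x. v \<in> set vs \<Longrightarrow> x \<in> set (us @ ws) \<Longrightarrow> horth v x) \<Longrightarrow>
     2 * length us + length ws + length vs = d \<Longrightarrow> q_support q (ext_product (complex_list us @ ws @ vs)) = 0"
proof (induction "length vs" arbitrary: us ws vs rule: less_induct)
  case less
  let ?F = "\<lambda>vs. q_support q (ext_product vs)"
  have perm: "?F vs = ?F vs'" if "mset vs = mset vs'" for vs vs'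
    using that by (rule ext_product_perm_eq) (rule q_support_minus)
  show ?case
  proof (cases "dim (set vs) < length vs")
    case True
    then have "ext_product vs = 0" by (rule ext_product_dependent)
    then show ?thesis by (simp add: ext_product_append wedge_bilinear_simps q_support_0_right)
  next
    case False
    consider "vs = []" | v where "vs = [v]" | "length vs \<ge> 2"
      by (cases vs; cases "tl vs") auto
    then show ?thesis
    proof cases
      case 1
      then show ?thesis using std less.prems by simp
    next
      \<comment> \<open>A single leftover vector has no partner and is only normalized.\<close>
      case (2 v)
      show ?thesis
      proof (cases "v = 0")
        case True
        then show ?thesis using 2 by (simp add: ext_product_append wedge_bilinear_simps ext_vec_simps q_support_0_right)
      next
        case False
        define v' where "v' = (1 / norm v) *\<^sub>R v"
        have v': "norm v' = 1" "v = norm v *\<^sub>R v'" using False by (simp_all add: v'_def)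
        have "horth v' x" if "x \<in> set (us @ ws)" for x
          using less.prems(2)[of v x] 2 that unfolding v'_def by (intro horth_sym[OF horth_scale] horth_sym[of v x]) auto
        then have "?F (complex_list us @ (ws @ [v'])) = 0"
          using less.prems 2 v'(1) by (intro std hermitian_orthonormal_insert(2)) auto
        moreover have "ext_product (complex_list us @ ws @ vs) = norm v *\<^sub>R ext_product (complex_list us @ (ws @ [v']))"
          unfolding 2 by (subst v'(2)) (simp add: ext_product_append wedge_bilinear_simps ext_vec_simps)
        ultimately show ?thesis by (simp add: q_support_homogeneous)
      qed
    next
      case 3
      let ?E = "span (set vs)"
      have hE: "horth x y" if "x \<in> ?E" "y \<in> set (us @ ws)" for x y
        by (rule horth_sym, rule horth_span[OF that(1)], rule horth_sym, rule less.prems(2)) (use that in auto)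
      obtain u v where uv: "u \<in> ?E" "v \<in> ?E" "norm u = 1" "norm v = 1" "u \<bullet> v = 0" "0 \<le> imul u \<bullet> v"
        and split: "\<And>x. x \<in> ?E \<Longrightarrow> x \<bullet> u = 0 \<Longrightarrow> x \<bullet> v = 0 \<Longrightarrow> horth x u \<and> horth x v"
      proof (rule maximal_pair[OF subspace_span])
        show "2 \<le> dim ?E" using False 3 by (simp add: dim_span)
      qed (rule that)
      obtain vs1 c1 where vs1: "length vs = Suc (length vs1)" "ext_product vs = c1 *\<^sub>R ext_product (u # vs1)"
        "\<forall>x\<in>set vs1. u \<bullet> x = 0" "span (insert u (set vs1)) = ?E"
        using ext_product_split_unit[OF uv(1,3)] by blast
      have u1: "u \<bullet> x = 0" if "x \<in> span (set vs1)" for x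
        using that vs1(3) by (induction rule: span_induct_alt) (auto simp: inner_add_right)
      \<comment> \<open>As \<open>v\<close> and the remaining factors are orthogonal to
        \<open>u\<close>, the component of \<open>v\<close> along \<open>u\<close> is zero.\<close>
      have "v \<in> span (set vs1)"
      proof -
        obtain a where a: "v - a *\<^sub>R u \<in> span (set vs1)" using uv(2) vs1(4) by (auto simp: span_insert)
        have "u \<bullet> (v - a *\<^sub>R u) = - a" using uv by (simp add: inner_diff_right dot_square_norm)
        then have "a = 0" using u1[OF a] by simp
        then show ?thesis using a by simp
      qed
      then obtain vs2 c2 where vs2: "length vs1 = Suc (length vs2)" "ext_product vs1 = c2 *\<^sub>R ext_product (v # vs2)"
        "\<forall>x\<in>set vs2. v \<bullet> x = 0" "span (insert v (set vs2)) = span (set vs1)"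
        using ext_product_split_unit[OF _ uv(4)] by blast
      have x2: "x \<in> ?E" "horth x u" "horth x v" if x: "x \<in> set vs2" for x
      proof -
        have x1: "x \<in> span (set vs1)" unfolding vs2(4)[symmetric] using x by (auto intro: span_base)
        then show xE: "x \<in> ?E" unfolding vs1(4)[symmetric] using span_mono[of "set vs1" "insert u (set vs1)"] by auto
        show "horth x u" "horth x v"
          using split[OF xE] u1[OF x1] vs2(3) x by (auto simp: inner_commute)
      qed
      have eq: "ext_product (complex_list us @ ws @ vs) = (c1 * c2) *\<^sub>R ext_product (complex_list us @ ws @ u # v # vs2)"
        by (simp add: ext_product_append vs1(2) vs2(2) wedge_bilinear_simps)
      let ?Q = "complex_list us @ ws @ vs2"
      have Q: "horth x u" "horth x v" if "x \<in> set ?Q" for x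
      proof -
        have "horth y x" if "y \<in> {u, v}" "x \<in> set (complex_list us @ ws)" for y
          using that uv(1,2) hE[of y] by (auto intro: complex_list_horth)
        then show "horth x u" "horth x v" using that x2 by (auto intro: horth_sym)
      qed
      have ih: "?F (complex_list us' @ ws' @ vs2) = 0"
        if "hermitian_orthonormal (us' @ ws')" "\<And>v x. v \<in> set vs2 \<Longrightarrow> x \<in> set (us' @ ws') \<Longrightarrow> horth v x"
          "2 * length us' + length ws' = 2 * length us + length ws + 2" for us' ws'
        using that less.prems(3) vs1(1) vs2(1) by (intro less.hyps) auto
      have hu: "hermitian_orthonormal ((us @ [u]) @ ws)" "hermitian_orthonormal (us @ ws @ [u])"
        using hermitian_orthonormal_insert[OF less.prems(1) uv(3)] hE[OF uv(1)] by auto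
      have F1: "?F (?Q @ [u, imul u]) = 0"
      proof -
        have "?F (?Q @ [u, imul u]) = ?F (complex_list (us @ [u]) @ ws @ vs2)" by (rule perm) simp
        also have "\<dots> = 0" by (rule ih[OF hu(1)]) (use x2 hE in auto)
        finally show ?thesis .
      qed
      define \<kappa> where "\<kappa> = imul u \<bullet> v"
      have \<kappa>: "0 \<le> \<kappa>" "\<kappa> \<le> 1" using uv Cauchy_Schwarz_ineq2[of "imul u" v] by (auto simp: \<kappa>_def)
      have "?F (?Q @ [u, v]) = 0"
      proof (cases "\<kappa> = 1")
        \<comment> \<open>Equality in the Cauchy-Schwarz inequality: the pair is itself a complex
          line, and there is no second direction to normalize.\<close>
        case True
        have "(v - imul u) \<bullet> (v - imul u) = 2 - 2 * \<kappa>"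
          using uv by (simp add: inner_diff_left inner_diff_right norm_eq_1 \<kappa>_def inner_commute[of v "imul u"])
        then have "v = imul u" using True by simp
        then show ?thesis using F1 by simp
      next
        case False
        define \<sigma> where "\<sigma> = sqrt (1 - \<kappa>\<^sup>2)"
        have "\<kappa>\<^sup>2 < 1" using \<kappa> False by (simp add: power2_less_1_iff abs_square_less_1)
        then have \<sigma>: "\<sigma> > 0" "\<kappa>\<^sup>2 + \<sigma>\<^sup>2 = 1" by (simp_all add: \<sigma>_def)
        \<comment> \<open>The unit vector Hermitian orthogonal to \<open>u\<close> for which
          \<open>v\<close> takes the form required by the Kaehler angle formula.\<close>
        define w where "w = (1 / \<sigma>) *\<^sub>R (v - \<kappa> *\<^sub>R imul u)"
        have v: "v = \<kappa> *\<^sub>R imul u + \<sigma> *\<^sub>R w" using \<sigma> by (simp add: w_def)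
        have uu: "u \<bullet> u = 1" "v \<bullet> v = 1" using uv by (simp_all add: dot_square_norm)
        have "(v - \<kappa> *\<^sub>R imul u) \<bullet> (v - \<kappa> *\<^sub>R imul u) = \<sigma>\<^sup>2"
          using uu \<sigma>(2) by (simp add: inner_diff_left inner_diff_right \<kappa>_def[symmetric] inner_commute[of v "imul u"] power2_eq_square algebra_simps)
        then have w1: "norm w = 1" using \<sigma> by (simp add: w_def norm_eq_sqrt_inner power2_eq_square)
        have uw: "horth u w"
          unfolding w_def using uu uv(5) imul_inner_left[of u v]
          by (intro horth_scale) (simp add: horth_def inner_diff_right inner_add_right imul_simps \<kappa>_def)
        interpret complex_frame u w using uv(3) w1 uw by unfold_locales
        have hw: "horth x w" if "horth x u" "horth x v" for x
          unfolding w_def using that by (intro horth_scale horth_diff horth_imul)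
        have q': "q \<in> cp_deg (length ?Q + 2)" using q less.prems(3) vs1(1) vs2(1) by (simp add: algebra_simps)
        have "?F (?Q @ [u, v]) = \<kappa>\<^sup>2 * ?F (?Q @ [u, imul u]) + \<sigma>\<^sup>2 * ?F (?Q @ [u, w])"
          by (subst v, rule q_support_kaehler_angle[OF q' \<sigma>(2)]) (use Q hw in blast)
        moreover have "?F (?Q @ [u, w]) = 0"
        proof -
          have "?F (?Q @ [u, w]) = ?F (complex_list us @ ((ws @ [u]) @ [w]) @ vs2)" by (rule perm) simp
          also have "\<dots> = 0"
          proof (rule ih)
            have "horth w y" if "y \<in> set (us @ ws @ [u])" for y
            proof (cases "y = u")
              case True
              then show ?thesis using uw by (simp add: horth_sym)
            next
              case False
              then have "y \<in> set (us @ ws)" using that by auto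
              then show ?thesis using hE[of u y] hE[of v y] uv(1,2) by (intro horth_sym[OF hw]) (auto intro: horth_sym)
            qed
            then show "hermitian_orthonormal (us @ (ws @ [u]) @ [w])"
              using hermitian_orthonormal_insert(2)[OF hu(2) w1] by simp
            show "horth z x" if "z \<in> set vs2" "x \<in> set (us @ (ws @ [u]) @ [w])" for z x
              using that x2[of z] hE[of z x] hw[of z] by auto
          qed auto
          finally show ?thesis .
        qed
        ultimately show ?thesis using F1 by simp
      qed
      moreover have "?F (complex_list us @ ws @ u # v # vs2) = ?F (?Q @ [u, v])" by (rule perm) simp
      ultimately show ?thesis unfolding eq q_support_homogeneous by simp
    qed
  qed
qed

lemma cp_zeroI:
  fixes q :: "('n::finite \<times> bool) qring"
  assumes q: "q \<in> cp_deg d"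
    and std: "\<And>us ws. hermitian_orthonormal (us @ ws) \<Longrightarrow> 2 * length us + length ws = d \<Longrightarrow>
       q_support q (ext_product (complex_list us @ ws)) = 0"
  shows "q = 0"
proof (rule qring_eqI)
  fix e and v :: "('n \<times> bool) ext" assume v: "v \<in> simple_ext e"
  have "q_support q v = 0"
  proof (cases "e = d")
    case True
    then obtain vs where "v = ext_product vs" "length vs = d" using v by (auto simp: simple_ext_def)
    then show ?thesis
      using cp_vanish_step[OF q std, of "[]" "[]" vs] by (simp add: hermitian_orthonormal_def)
  next
    case False
    then show ?thesis using q v by (intro q_support_degree[of q d v e]) (auto simp: cp_deg_def)
  qed
  then show "q_support q v = q_support 0 v" using q_support_scale[OF v, of 0 0] by simp
qed

text \<open>The vectors together with their images under \<open>imul\<close> are orthonormal over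
  the reals.\<close>

lemma hermitian_orthonormal_length:
  fixes xs :: "(real ^ ('n::finite \<times> bool)) list"
  assumes "hermitian_orthonormal xs"
  shows "length xs \<le> CARD('n)"
proof -
  have unit: "x \<bullet> x = 1" if "x \<in> set xs" for x using assms that by (simp add: hermitian_orthonormal_def norm_eq_1)
  have h: "horth (xs ! i) (xs ! j)" if "i < length xs" "j < length xs" "i \<noteq> j" for i j
    using assms that unfolding hermitian_orthonormal_def sorted_wrt_iff_nth_less
    by (metis horth_sym linorder_neqE_nat)
  have dist: "distinct xs"
    unfolding distinct_conv_nth using h unit by (metis horth_def nth_mem zero_neq_one)
  have hs: "horth x y" if "x \<in> set xs" "y \<in> set xs" "x \<noteq> y" for x y using that h by (metis in_set_conv_nth)
  have inj: "inj_on imul (set xs)" by (rule inj_onI) (metis imul_imul neg_equal_iff_equal)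
  have disj: "set xs \<inter> imul ` set xs = {}"
  proof (rule ccontr)
    assume "set xs \<inter> imul ` set xs \<noteq> {}"
    then obtain x y where xy: "x \<in> set xs" "y \<in> set xs" "x = imul y" by auto
    then have "x \<bullet> imul y = 1" using unit by metis
    moreover have "x \<bullet> imul y = 0" using hs[OF xy(1,2)] by (cases "x = y") (auto simp: horth_def)
    ultimately show False by simp
  qed
  have "pairwise orthogonal (set xs \<union> imul ` set xs)"
  proof (rule pairwiseI)
    fix x y assume "x \<in> set xs \<union> imul ` set xs" "y \<in> set xs \<union> imul ` set xs" "x \<noteq> y"
    then obtain a b where "a \<in> set xs" "b \<in> set xs" "x = a \<or> x = imul a" "y = b \<or> y = imul b" "x \<noteq> y" by auto
    then show "orthogonal x y"
      using hs[of a b] by (cases "a = b") (auto simp: orthogonal_def horth_def imul_inner_left)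
  qed
  moreover have "0 \<notin> set xs \<union> imul ` set xs"
  proof
    assume "0 \<in> set xs \<union> imul ` set xs"
    then obtain x where "x \<in> set xs" "x = 0 \<or> imul x = 0" by auto
    moreover from this have "x = 0" by (metis norm_imul norm_eq_zero)
    ultimately show False using unit[of x] by simp
  qed
  ultimately have "independent (set xs \<union> imul ` set xs)" by (rule pairwise_orthogonal_independent)
  then have "card (set xs \<union> imul ` set xs) \<le> DIM(real ^ ('n \<times> bool))" by (rule independent_card_le)
  moreover have "card (set xs \<union> imul ` set xs) = 2 * length xs"
    using disj dist inj by (simp add: card_Un_disjoint card_image distinct_card)
  ultimately show ?thesis by (simp add: card_UNIV_bool)
qed

text \<open>The functionals jointly embed the subspace in a space of dimension
  \<open>card K\<close>, so an independent set of at least that size already spans. The injection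
  \<iota> serves to make the functionals coordinates of one vector.\<close>

lemma span_of_functionals:
  fixes \<phi> :: "'i \<Rightarrow> 'a::real_vector \<Rightarrow> real" and \<iota> :: "'i \<Rightarrow> 'm::finite"
  assumes K: "finite K" "inj_on \<iota> K" and \<phi>: "\<And>k. k \<in> K \<Longrightarrow> linear (\<phi> k)"
    and S: "subspace S" "\<And>x. x \<in> S \<Longrightarrow> (\<And>k. k \<in> K \<Longrightarrow> \<phi> k x = 0) \<Longrightarrow> x = 0"
    and C: "C \<subseteq> S" "independent C" "finite C" "card K \<le> card C"
  shows "S \<subseteq> span C"
proof
  define \<Phi> :: "'a \<Rightarrow> real ^ 'm" where "\<Phi> x = (\<Sum>k\<in>K. \<phi> k x *\<^sub>R axis (\<iota> k) 1)" for x
  have lin: "linear \<Phi>"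
    by (rule linearI) (simp_all add: \<Phi>_def linear_add[OF \<phi>] linear_scale[OF \<phi>] scaleR_add_left sum.distrib scaleR_sum_right)
  have inj: "x = 0" if "x \<in> S" "\<Phi> x = 0" for x
  proof (rule S(2)[OF that(1)])
    fix k assume k: "k \<in> K"
    have "\<Phi> x $ \<iota> k = (\<Sum>l\<in>K. if l = k then \<phi> k x else 0)"
      unfolding \<Phi>_def sum_component using K(2) k by (intro sum.cong) (auto simp: axis_def inj_on_def)
    then show "\<phi> k x = 0" using that(2) k K(1) by simp
  qed
  fix x assume x: "x \<in> S"
  show "x \<in> span C"
  proof (rule ccontr)
    assume nx: "x \<notin> span C"
    let ?D = "insert x C"
    have iD: "independent ?D" using nx C(2) by (simp add: independent_insertI)
    have "span ?D \<subseteq> S" using x C(1) S(1) by (intro span_minimal) auto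
    then have "inj_on \<Phi> (span ?D)"
      using inj by (intro linear_inj_on_iff_eq_0[OF lin subspace_span, THEN iffD2]) auto
    then have "independent (\<Phi> ` ?D)" and "inj_on \<Phi> ?D"
      using linear_independent_injective_image[OF lin iD] inj_on_subset[OF _ span_superset] by blast+
    moreover have "\<Phi> ` ?D \<subseteq> span ((\<lambda>k. axis (\<iota> k) 1) ` K)"
      unfolding \<Phi>_def by (intro image_subsetI span_sum span_scale span_base imageI)
    ultimately have "card (\<Phi> ` ?D) \<le> card ((\<lambda>k. axis (\<iota> k) (1::real)) ` K)"
      using K(1) independent_span_bound by blast
    also have "\<dots> \<le> card K" using K(1) by (rule card_image_le)
    also have "\<dots> \<le> card C" by (rule C)
    also have "\<dots> < card ?D" using C(3) nx span_superset[of C] by (subst card_insert_disjoint) auto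
    also have "card ?D = card (\<Phi> ` ?D)" using \<open>inj_on \<Phi> ?D\<close> by (rule card_image[symmetric])
    finally show False by simp
  qed
qed

lemma cp_deg_subset_span:
  fixes C :: "('n::finite \<times> bool) qring set"
  assumes d: "d \<le> 2 * CARD('n)" and C: "C \<subseteq> cp_deg d" "independent C" "finite C"
    and card: "min (d div 2) ((2 * CARD('n) - d) div 2) + 1 \<le> card C"
  shows "cp_deg d \<subseteq> span C"
proof -
  define m where "m = min (d div 2) ((2 * CARD('n) - d) div 2)"
  \<comment> \<open>The numbers \<open>k\<close> of complex lines for which \<open>k\<close> lines
    and d - 2 k further vectors can fit into a Hermitian orthonormal family, whose length is at most
    \<open>CARD('n)\<close>.\<close>
  define K where "K = {k. 2 * k \<le> d \<and> d \<le> CARD('n) + k}"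
  define std where "std k p \<longleftrightarrow> (case p of (us, ws) \<Rightarrow> hermitian_orthonormal (us @ ws) \<and> length us = k \<and> length ws = d - 2 * k)"
    for k and p :: "(real ^ ('n \<times> bool)) list \<times> (real ^ ('n \<times> bool)) list"
  define s where "s k = (SOME p. std k p)" for k
  \<comment> \<open>One value at a chosen frame for each \<open>k\<close>; unitary invariance makes
    all frames of that type equivalent. The value 0 covers the case that no frame exists.\<close>
  define \<phi> where "\<phi> k q = (if Ex (std k) then q_support q (ext_product (complex_list (fst (s k)) @ snd (s k))) else 0)"
    for k and q :: "('n \<times> bool) qring"
  have K: "K = {d - CARD('n)..d div 2}" by (auto simp: K_def)
  \<comment> \<open>The number of admissible \<open>k\<close> agrees with the number of monomials in
    degree \<open>d\<close>.\<close>
  have "card K = Suc (d div 2) - (d - CARD('n))" unfolding K by simp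
  then have cardK: "card K = m + 1" using d by (auto simp: m_def min_def)
  have s: "std k (s k)" if "Ex (std k)" for k unfolding s_def using that by (rule someI_ex)
  have lin: "linear (\<phi> k)" if "k \<in> K" for k
  proof (cases "Ex (std k)")
    case True
    define v where "v = ext_product (complex_list (fst (s k)) @ snd (s k))"
    have v: "v \<in> simple_ext (length (complex_list (fst (s k)) @ snd (s k)))" unfolding simple_ext_def v_def by blast
    have "\<phi> k = (\<lambda>q. q_support q v)" by (rule ext) (simp only: \<phi>_def v_def True if_True)
    then show ?thesis by (auto intro!: linearI simp: q_support_add[OF v] q_support_scale[OF v])
  next
    case False
    then have "\<phi> k = (\<lambda>q. 0)" by (auto simp: \<phi>_def)
    then show ?thesis by (simp add: linear_zero)
  qed
  have zero: "q = 0" if q: "q \<in> cp_deg d" and 0: "\<And>k. k \<in> K \<Longrightarrow> \<phi> k q = 0" for q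
  proof (rule cp_zeroI[OF q])
    fix us ws :: "(real ^ ('n \<times> bool)) list" assume h: "hermitian_orthonormal (us @ ws)" "2 * length us + length ws = d"
    let ?k = "length us"
    have "?k \<in> K" using hermitian_orthonormal_length[OF h(1)] h(2) by (simp add: K_def)
    have ex: "Ex (std ?k)" using h by (intro exI[of _ "(us, ws)"]) (auto simp: std_def)
    obtain us' ws' where s': "s ?k = (us', ws')" by (cases "s ?k")
    then have h': "hermitian_orthonormal (us' @ ws')" "length us' = length us" "length ws' = length ws"
      using s[OF ex] h(2) by (auto simp: std_def)
    obtain f where f: "hermitian_map f" "map f (us' @ ws') = us @ ws"
      using hermitian_orthonormal_transitive[OF h'(1) h(1)] h' by auto
    then have m: "map f us' = us" "map f ws' = ws" using h' by (auto simp: append_eq_append_conv)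
    have lf: "linear f" using f(1) by (simp add: hermitian_map_def orthogonal_transformation_linear)
    have "ext_product (complex_list us @ ws) = ext_map f (ext_product (complex_list us' @ ws'))"
      by (simp add: ext_map_ext_product[OF lf] map_complex_list[OF f(1)] m)
    moreover have "ext_product (complex_list us' @ ws') \<in> simple_ext (length (complex_list us' @ ws'))"
      unfolding simple_ext_def by blast
    moreover have "q \<in> cp_ring" using q by (simp add: cp_deg_def)
    ultimately have "q_support q (ext_product (complex_list us @ ws)) = q_support q (ext_product (complex_list us' @ ws'))"
      using f(1) unfolding cp_ring_support_iff by metis
    also have "\<dots> = \<phi> ?k q" using ex s' by (simp add: \<phi>_def)
    finally show "q_support q (ext_product (complex_list us @ ws)) = 0" using 0[OF \<open>?k \<in> K\<close>] by simp
  qed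
  \<comment> \<open>The functionals need an index type with enough elements; the coordinates of the
    real space provide one.\<close>
  have "card K \<le> CARD('n \<times> bool)"
  proof -
    have "m + 1 \<le> 2 * CARD('n)" 
    proof -
      have "2 * m \<le> d" "2 * m \<le> 2 * CARD('n) - d" by (auto simp: m_def min_def)
      then show ?thesis using d zero_less_card_finite[where 'a = 'n] by linarith
    qed
    then show ?thesis using cardK by simp
  qed
  moreover have finK: "finite K" unfolding K by simp
  ultimately obtain \<iota> :: "nat \<Rightarrow> 'n \<times> bool" where inj: "inj_on \<iota> K" using card_le_inj[of K "UNIV :: ('n \<times> bool) set"] by auto
  show ?thesis
    by (rule span_of_functionals[OF finK inj lin subspace_cp_deg zero C]) (use card cardK in \<open>auto simp: m_def\<close>)
qed

section \<open>A positive definite form\<close>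

definition cos_moment :: "nat \<Rightarrow> real" where
  "cos_moment p = integral {0..pi} (\<lambda>t. cos t ^ (2 * p))"

lemma cos_moment_0: "cos_moment 0 = pi"
  by (simp add: cos_moment_def)

text \<open>The difference of the two sides integrates the derivative of
  \<open>sin t * cos t ^ (2 * p + 1)\<close>, which vanishes at both ends.\<close>

lemma cos_moment_Suc: "real (2 * p + 2) * cos_moment (Suc p) = real (2 * p + 1) * cos_moment p"
proof -
  let ?f = "\<lambda>t::real. real (2 * p + 2) * cos t ^ (2 * Suc p) - real (2 * p + 1) * cos t ^ (2 * p)"
  have "((\<lambda>t. sin t * cos t ^ (2 * p + 1)) has_vector_derivative ?f t) (at t within {0..pi})" for t
  proof -
    have "((\<lambda>t. sin t * cos t ^ (2 * p + 1)) has_real_derivative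
        cos t * cos t ^ (2 * p + 1) + sin t * (real (2 * p + 1) * cos t ^ (2 * p) * - sin t)) (at t within {0..pi})"
      by (rule derivative_eq_intros refl | simp)+
    moreover have "cos t * cos t ^ (2 * p + 1) + sin t * (real (2 * p + 1) * cos t ^ (2 * p) * - sin t)
        = cos t * cos t ^ (2 * p + 1) - real (2 * p + 1) * cos t ^ (2 * p) * (sin t)\<^sup>2"
      by (simp add: power2_eq_square)
    moreover have "\<dots> = ?f t" unfolding sin_squared_eq by (simp add: algebra_simps power2_eq_square)
    ultimately show ?thesis by (simp only: has_real_derivative_iff_has_vector_derivative)
  qed
  then have "(?f has_integral (sin pi * cos pi ^ (2 * p + 1) - sin 0 * cos 0 ^ (2 * p + 1))) {0..pi}"
    by (intro fundamental_theorem_of_calculus) auto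
  then have "integral {0..pi} ?f = 0" by (simp add: integral_unique)
  moreover have "integral {0..pi} ?f = real (2 * p + 2) * cos_moment (Suc p) - real (2 * p + 1) * cos_moment p"
    unfolding cos_moment_def
    by (subst integral_diff) (auto intro!: integrable_continuous_real continuous_intros)
  ultimately show ?thesis by simp
qed

text \<open>The exponent splits as 2 (n - i - j) = (n - 2 i) + (n - 2 j), so the sum is the integral
  of the square of a polynomial in the cosine. The bound 2 P \<le> n keeps its exponents from being
  truncated, hence distinct, and the polynomial is not zero.\<close>

lemma cos_moment_form_pos:
  fixes y :: "nat \<Rightarrow> real"
  assumes P: "2 * P \<le> n" and y: "k \<le> P" "y k \<noteq> 0"
  shows "(\<Sum>i\<le>P. \<Sum>j\<le>P. y i * y j * cos_moment (n - i - j)) > 0"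
proof -
  define f where "f t = (\<Sum>i\<le>P. y i * cos t ^ (n - 2 * i))" for t
  have sq: "(f t)\<^sup>2 = (\<Sum>i\<le>P. \<Sum>j\<le>P. y i * y j * cos t ^ (2 * (n - i - j)))" for t
  proof -
    have "cos t ^ (n - 2 * i) * cos t ^ (n - 2 * j) = cos t ^ (2 * (n - i - j))" if "i \<le> P" "j \<le> P" for i j
    proof -
      have "n - 2 * i + (n - 2 * j) = 2 * (n - i - j)" using that P by linarith
      then show ?thesis by (simp flip: power_add)
    qed
    then show ?thesis
      unfolding power2_eq_square f_def sum_product by (intro sum.cong refl) (simp add: mult_ac)
  qed
  have int: "(\<lambda>t. y i * y j * cos t ^ (2 * (n - i - j))) integrable_on {0..pi}" for i j
    by (intro integrable_continuous_real continuous_intros)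
  have cont: "continuous_on {0..pi} (\<lambda>t. (f t)\<^sup>2)" unfolding f_def by (intro continuous_intros)
  have eq: "(\<Sum>i\<le>P. \<Sum>j\<le>P. y i * y j * cos_moment (n - i - j)) = integral {0..pi} (\<lambda>t. (f t)\<^sup>2)"
  proof -
    have "integral {0..pi} (\<lambda>t. (f t)\<^sup>2) = (\<Sum>i\<le>P. integral {0..pi} (\<lambda>t. \<Sum>j\<le>P. y i * y j * cos t ^ (2 * (n - i - j))))"
      unfolding sq by (intro integral_sum integrable_sum int) auto
    also have "\<dots> = (\<Sum>i\<le>P. \<Sum>j\<le>P. integral {0..pi} (\<lambda>t. y i * y j * cos t ^ (2 * (n - i - j))))"
      by (intro sum.cong refl integral_sum int) auto
    finally show ?thesis unfolding cos_moment_def by simp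
  qed
  have "integral {0..pi} (\<lambda>t. (f t)\<^sup>2) \<noteq> 0"
  proof
    assume 0: "integral {0..pi} (\<lambda>t. (f t)\<^sup>2) = 0"
    then have z: "f t = 0" if "t \<in> {0..pi}" for t
      using integral_eq_0_iff[OF cont pi_gt_zero] that by simp
    define p where "p = (\<Sum>i\<le>P. monom (y i) (n - 2 * i))"
    \<comment> \<open>The cosine takes every value in [-1, 1], so the polynomial would have
      infinitely many roots.\<close>
    have "poly p x = 0" if "x \<in> {-1..1}" for x
    proof -
      have "poly p x = f (arccos x)" using that by (simp add: p_def f_def poly_sum poly_monom)
      then show ?thesis using that z[of "arccos x"] by (simp add: arccos_lbound arccos_ubound)
    qed
    then have "{-1..1} \<subseteq> {x. poly p x = 0}" by auto
    then have "infinite {x. poly p x = 0}" by (rule infinite_super) (simp add: infinite_Icc)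
    then have "p = 0" using poly_roots_finite by blast
    moreover have "coeff p (n - 2 * k) = (\<Sum>i\<le>P. if i = k then y k else 0)"
      unfolding p_def coeff_sum
    proof (intro sum.cong refl)
      fix i assume "i \<in> {..P}"
      then have "n - 2 * i = n - 2 * k \<longleftrightarrow> i = k" using P y(1) by auto
      then show "coeff (monom (y i) (n - 2 * i)) (n - 2 * k) = (if i = k then y k else 0)" by simp
    qed
    ultimately show False using y by simp
  qed
  moreover have "integral {0..pi} (\<lambda>t. (f t)\<^sup>2) \<ge> 0"
    using cont by (intro integral_nonneg integrable_continuous_real) auto
  ultimately show ?thesis unfolding eq by simp
qed

section \<open>The class of the ball\<close>

text \<open>Both support functions are multiples of \<open>norm (adjoint ext_vec u)\<close>, with
  factor 1 for the ball and sqrt (2 / pi) / 2 for the Gaussian zonoid. Their quotient is sqrt (2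
  pi), and the equality already holds for the convex bodies.\<close>

lemma cp_beta_eq: "cp_beta = sqrt (2 * pi) *\<^sub>R (q_gauss :: ('n::finite \<times> bool) qring)"
proof -
  let ?B = "ext_vec ` cball (0 :: real ^ ('n \<times> bool)) 1"
  let ?Z = "zonoid_of gauss_law (\<lambda>x. x) :: ('n \<times> bool) ext set"
  note g = integrable_lawD[OF integrable_gauss_law]
  have Z: "centered_zonoid ?Z" by (rule centered_zonoid_zonoid_of[OF g(1,3)])
  have cB: "compact ?B" "convex ?B" "?B \<noteq> {}"
    using linear_ext_vec
    by (auto intro!: compact_continuous_image linear_continuous_on convex_linear_image simp: linear_conv_bounded_linear)
  have sB: "support_fun ?B u = norm (adjoint ext_vec u)" for u :: "('n \<times> bool) ext"
  proof -
    have i: "u \<bullet> ext_vec x = adjoint ext_vec u \<bullet> x" for x :: "real ^ ('n \<times> bool)"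
      using adjoint_works[OF linear_ext_vec, of x u] by (simp add: inner_commute)
    define a where "a = adjoint ext_vec u"
    show ?thesis unfolding a_def[symmetric]
    proof (rule support_fun_eqI)
      show "ext_vec ((1 / norm a) *\<^sub>R a) \<in> ?B" by (auto intro!: imageI)
      show "u \<bullet> ext_vec ((1 / norm a) *\<^sub>R a) = norm a"
        by (simp add: i a_def[symmetric] power2_norm_eq_inner[symmetric] power2_eq_square)
      fix x assume "x \<in> ?B"
      then obtain z where z: "x = ext_vec z" "norm z \<le> 1" by auto
      have "a \<bullet> z \<le> norm a * norm z" by (rule norm_cauchy_schwarz)
      also have "\<dots> \<le> norm a" using z(2) by (intro mult_left_le) auto
      finally show "u \<bullet> x \<le> norm a" by (simp add: z(1) i a_def)
    qed
  qed
  have sZ: "support_fun ?Z u = sqrt (2 / pi) * norm (adjoint ext_vec u) / 2" for u :: "('n \<times> bool) ext"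
  proof -
    have "(\<integral>x. \<bar>u \<bullet> x\<bar> \<partial>gauss_law) = (\<integral>\<omega>. \<bar>u \<bullet> ext_vec (gauss_vec \<omega> :: real ^ ('n \<times> bool))\<bar> \<partial>gauss_space)"
      unfolding gauss_law_def using borel_measurable_integrable[OF integrable_ext_gauss]
      by (subst integral_distr) auto
    also have "\<dots> = (\<integral>\<omega>. \<bar>adjoint ext_vec u \<bullet> (gauss_vec \<omega> :: real ^ ('n \<times> bool))\<bar> \<partial>gauss_space)"
      using adjoint_works[OF linear_ext_vec, of _ u] by (simp add: inner_commute)
    finally show ?thesis
      by (simp add: support_fun_zonoid_of[OF g(1,3)] integral_abs_inner_gauss)
  qed
  have s: "sqrt (2 * pi) * sqrt (2 / pi) = 2" by (simp flip: real_sqrt_mult)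
  have sc: "linear ((*\<^sub>R) (sqrt (2 * pi)) :: ('n \<times> bool) ext \<Rightarrow> _)" by (rule linear_scale_self)
  have cz: "centered_zonoid ((*\<^sub>R) (sqrt (2 * pi)) ` ?Z)" by (rule centered_zonoid_linear_image[OF sc Z])
  note zc = centered_zonoidD[OF Z] centered_zonoidD[OF cz]
  have "?B = (*\<^sub>R) (sqrt (2 * pi)) ` ?Z"
    using zc cB by (intro support_fun_inject) (simp_all add: support_fun_scale sB sZ s)
  then have cB: "centered_zonoid ?B" using cz by simp
  have "vzonoid_of ?B = sqrt (2 * pi) *\<^sub>R K_class gauss_law (\<lambda>x. x)"
    unfolding vz_support_inject vz_support_scale K_class_def vzonoid_of_def
    by (simp add: vz_support_abs Z cB centered_zonoid_0 support_fun_def[of "{0}"] sB sZ s)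
  moreover have "(K_class gauss_law (\<lambda>x. x) :: ('n \<times> bool) ext vzonoid) \<in> grass_total"
    using gauss_class_grass' grass_subset_total by blast
  ultimately show ?thesis by (simp add: cp_beta_def q_gauss_def abs_qring_scale)
qed

lemma q_gauss_cp: "q_gauss \<in> cp_deg 1"
proof -
  have "q_map f q_gauss = q_gauss" if f: "hermitian_map f" for f :: "real ^ ('a \<times> bool) \<Rightarrow> real ^ ('a \<times> bool)"
  proof -
    have fo: "orthogonal_transformation f" using f by (simp add: hermitian_map_def)
    note fl = orthogonal_transformation_linear[OF fo]
    have v: "ext_map f (ext_vec v) = ext_vec (f v)" for v
      using ext_map_ext_product[OF fl, of "[v]"] by simp
    have [measurable]: "ext_map f \<in> borel_measurable borel" "ext_vec \<in> borel_measurable (borel :: (real ^ ('a \<times> bool)) measure)"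
      "f \<in> borel_measurable borel"
      using linear_ext_map[of f] linear_ext_vec fl
      by (auto intro!: borel_measurable_continuous_onI linear_continuous_on simp: linear_conv_bounded_linear)
    have "distr gauss_law borel (ext_map f) = distr gauss_space borel (\<lambda>\<omega>. ext_vec (f (gauss_vec \<omega>)))"
      unfolding gauss_law_def by (subst distr_distr) (auto simp: o_def v)
    also have "\<dots> = distr (distr gauss_space borel (\<lambda>\<omega>. f (gauss_vec \<omega>))) borel ext_vec"
      by (subst distr_distr) (auto simp: o_def)
    also have "\<dots> = gauss_law"
      unfolding distr_gauss_vec_orthogonal[OF fo] gauss_law_def by (subst distr_distr) (auto simp: o_def)
    finally have "distr gauss_law borel (ext_map f) = gauss_law" .
    then show ?thesis
      using q_map_abs[OF fo, of "K_class gauss_law (\<lambda>x. x)"] vz_map_law(2)[OF linear_ext_map integrable_gauss_law, of f]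
        gauss_class_grass' grass_subset_total by (auto simp: q_gauss_def)
  qed
  then show ?thesis using q_gauss_deg by (auto simp: cp_deg_def cp_ring_iff)
qed

section \<open>The class of the hyperplane\<close>

lemma real_action_mult: "real_action (B ** A) x = real_action B (real_action A x)"
  by (simp add: real_action_def matrix_vector_mul_assoc)

lemma linear_real_action_matrix: "linear (\<lambda>A. real_action A x)"
proof -
  have "linear (\<lambda>A. A *v complexify x)"
    by (rule linearI)
       (simp_all add: matrix_vector_mult_def vec_eq_iff sum.distrib distrib_right scaleR_sum_right)
  from linear_compose[OF this linear_realify] show ?thesis by (simp add: o_def real_action_def)
qed

section \<open>Random complex lines\<close>

definition base_vec :: "real ^ ('n::finite \<times> bool)" where
  "base_vec = realify (axis first_index 1)"

lemma imul_base_vec: "imul base_vec = realify (axis first_index \<i>)"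
  unfolding base_vec_def realify_imul[symmetric]
  by (rule arg_cong[where f = realify]) (simp add: vec_eq_iff axis_def)

lemma norm_base_vec [simp]: "norm base_vec = 1"
proof -
  have "base_vec \<bullet> base_vec = (1 :: real)"
    unfolding base_vec_def cinner_Re[symmetric] by (simp add: cinner_self norm_axis_1)
  then show ?thesis by (simp add: norm_eq_1)
qed

definition line_vec :: "complex ^ 'n ^ 'n \<Rightarrow> ('n::finite \<times> bool) ext" where
  "line_vec A = ext_product (complex_list [real_action A base_vec])"

definition line_law :: "('n::finite \<times> bool) ext measure" where
  "line_law = distr haar_unitary borel line_vec"

definition q_line :: "('n::finite \<times> bool) qring" where
  "q_line = abs_qring (K_class line_law (\<lambda>x. x))"

lemma norm_complex_line: "norm (ext_product (complex_list [u])) = (norm u)\<^sup>2"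
proof -
  have "norm (ext_product [u, imul u]) = norm u * norm (ext_product [imul u])"
    using norm_wedge_orthogonal[of u "ext_product [imul u]"] contract_ext_product_orthogonal[of "[imul u]" u] by simp
  also have "norm (ext_product [imul u]) = norm u"
    using norm_wedge_orthogonal[of "imul u" "axis {} 1"] by (simp add: norm_axis_1)
  finally show ?thesis by (simp add: power2_eq_square)
qed

lemma measurable_line_vec [measurable]: "line_vec \<in> borel_measurable haar_unitary"
proof -
  have c: "continuous_on UNIV (\<lambda>A. f (real_action A base_vec))" if "linear f" for f :: "real ^ ('a \<times> bool) \<Rightarrow> ('a \<times> bool) ext"
    using linear_compose[OF linear_real_action_matrix[of base_vec] that]
    by (intro linear_continuous_on) (simp add: o_def linear_conv_bounded_linear)
  have "continuous_on UNIV (\<lambda>A. wedge (ext_vec (real_action A base_vec)) (ext_vec (imul (real_action A base_vec))) :: ('a \<times> bool) ext)"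
    using linear_ext_vec linear_compose[OF linear_imul linear_ext_vec]
    by (intro bounded_bilinear.continuous_on[OF bilinear_wedge[unfolded bilinear_conv_bounded_bilinear]] c) (auto simp: o_def)
  then have "line_vec \<in> borel_measurable (borel :: (complex ^ 'a ^ 'a) measure)"
    by (intro borel_measurable_continuous_onI) (simp add: line_vec_def[abs_def])
  then show ?thesis by (simp add: sets_haar cong: measurable_cong_sets)
qed

lemma integrable_line_vec: "integrable haar_unitary (line_vec :: complex ^ 'n ^ 'n \<Rightarrow> ('n::finite \<times> bool) ext)"
proof -
  interpret prob_space "haar_unitary :: (complex ^ 'n ^ 'n) measure" by (rule prob_space_haar)
  have "AE A in haar_unitary. norm (line_vec A :: ('n \<times> bool) ext) \<le> 1"
    using AE_haar
  proof eventually_elim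
    case (elim A)
    then have "norm (real_action A base_vec) = 1"
      using real_action_hermitian[of A] by (simp add: hermitian_map_def orthogonal_transformation_norm)
    then show ?case by (simp add: line_vec_def norm_complex_line del: complex_list_simps)
  qed
  then show ?thesis by (rule integrable_const_bound) measurable
qed

lemma integrable_line_law: "integrable_law line_law"
  unfolding line_law_def by (rule integrable_law_distr[OF prob_space_haar integrable_line_vec])

lemma cp_gamma_eq: "cp_gamma = (real CARD('n) / pi) *\<^sub>R (q_line :: ('n::finite \<times> bool) qring)"
proof -
  have "ext_map (real_action A) (wedge (ext_vec base_vec) (ext_vec (imul base_vec))) = line_vec A" for A :: "complex ^ 'n ^ 'n"
    using ext_map_ext_product[OF linear_real_action, of A "[base_vec, imul base_vec]"]
    by (simp add: line_vec_def real_action_imul)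
  then show ?thesis
    unfolding cp_gamma_def base_vec_def[symmetric] imul_base_vec[symmetric] q_line_def line_law_def
    by (simp add: K_class_distr[OF prob_space_haar integrable_line_vec, symmetric])
qed

text \<open>Powers of \<open>q_line\<close> are represented by laws of such vectors, and for them
  wedging with a random line multiplies the mean norm by a constant, see
  \<open>line_wedge_norm\<close>.\<close>

definition complex_simple :: "nat \<Rightarrow> ('n::finite \<times> bool) ext set" where
  "complex_simple j = {ext_product (complex_list us) | us. length us = j}"

lemma complex_simple_Suc:
  "complex_simple (Suc j) = (\<lambda>(u, y). wedge (ext_product (complex_list [u])) y) ` (UNIV \<times> complex_simple j)"
proof (intro equalityI subsetI)
  fix x :: "('a \<times> bool) ext" assume "x \<in> complex_simple (Suc j)"
  then obtain u us where "length us = j" "x = wedge (ext_product (complex_list [u])) (ext_product (complex_list us))"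
    by (auto simp: complex_simple_def length_Suc_conv wedge_assoc)
  then show "x \<in> (\<lambda>(u, y). wedge (ext_product (complex_list [u])) y) ` (UNIV \<times> complex_simple j)"
    by (auto simp: complex_simple_def simp del: complex_list_simps)
next
  fix x :: "('a \<times> bool) ext" assume "x \<in> (\<lambda>(u, y). wedge (ext_product (complex_list [u])) y) ` (UNIV \<times> complex_simple j)"
  then obtain u us where "length us = j" "x = ext_product (complex_list (u # us))"
    by (auto simp: complex_simple_def wedge_assoc)
  then show "x \<in> complex_simple (Suc j)" unfolding complex_simple_def by (intro CollectI exI[of _ "u # us"]) auto
qed

lemma complex_simple_subset: "complex_simple j \<subseteq> simple_ext (2 * j)"
  unfolding complex_simple_def simple_ext_def by (force intro: exI[of _ "complex_list us" for us])

lemma complex_simple_measurable [measurable]: "(complex_simple j :: ('n::finite \<times> bool) ext set) \<in> sets borel"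
proof -
  have "\<exists>C :: nat \<Rightarrow> ('n \<times> bool) ext set. (\<forall>k. compact (C k)) \<and> complex_simple j = (\<Union>k. C k)"
  proof (induction j)
    case 0
    then show ?case by (intro exI[of _ "\<lambda>_. {axis {} 1}"]) (auto simp: complex_simple_def)
  next
    case (Suc j)
    then obtain C :: "nat \<Rightarrow> ('n \<times> bool) ext set" where C: "\<And>k. compact (C k)" "complex_simple j = (\<Union>k. C k)" by blast
    note w = bounded_bilinear.continuous_on[OF bilinear_wedge[unfolded bilinear_conv_bounded_bilinear]]
    have l: "continuous_on UNIV (\<lambda>p. f (fst p))" if "linear f" for f :: "real ^ ('n \<times> bool) \<Rightarrow> ('n \<times> bool) ext"
      using that by (intro continuous_on_compose2[OF linear_continuous_on[of f UNIV]] continuous_intros)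
        (auto simp: linear_conv_bounded_linear)
    have "continuous_on UNIV (\<lambda>p. wedge (wedge (ext_vec (fst p)) (ext_vec (imul (fst p)))) (snd p) :: ('n \<times> bool) ext)"
      using linear_ext_vec linear_compose[OF linear_imul linear_ext_vec]
      by (intro w l continuous_intros) (auto simp: o_def)
    then show ?case
      unfolding complex_simple_Suc by (intro sigma_compact_image[OF C]) (simp add: split_def)
  qed
  then obtain C :: "nat \<Rightarrow> ('n \<times> bool) ext set" where C: "\<And>k. compact (C k)" "complex_simple j = (\<Union>k. C k)" by blast
  have "C k \<in> sets borel" for k using C(1) by (intro borel_closed compact_imp_closed)
  then show ?thesis unfolding C(2) by (intro sets.countable_UN) auto
qed

lemma line_law_simple: "AE x in line_law. x \<in> complex_simple 1"
proof -
  have "line_vec A \<in> complex_simple 1" for A :: "complex ^ 'a ^ 'a"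
    unfolding line_vec_def complex_simple_def by (intro CollectI exI[of _ "[real_action A base_vec]"]) simp
  then show ?thesis unfolding line_law_def by (subst AE_distr_iff) auto
qed

lemma line_class_grass: "K_class line_law (\<lambda>x. x) \<in> grass 2"
proof -
  have "AE x in line_law. (x :: ('a \<times> bool) ext) \<in> simple_ext 2"
    using line_law_simple by eventually_elim (use complex_simple_subset[of 1] in auto)
  then show ?thesis
    unfolding grass_span grass_classes_def using integrable_line_law by (blast intro: span_base)
qed

lemma q_line_cp: "q_line \<in> cp_deg 2"
proof -
  note g = line_class_grass[where 'a = 'a]
  have "q_map f q_line = q_line" if f: "hermitian_map f" for f :: "real ^ ('a \<times> bool) \<Rightarrow> real ^ ('a \<times> bool)"
  proof -
    have fo: "orthogonal_transformation f" using f by (simp add: hermitian_map_def)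
    note fl = orthogonal_transformation_linear[OF fo]
    obtain B where B: "B \<in> unitary_group" "real_action B = f" using f by (rule hermitian_map_real_action)
    have v: "ext_map f (line_vec A) = line_vec (B ** A)" for A :: "complex ^ 'a ^ 'a"
      by (simp add: line_vec_def ext_map_ext_product[OF fl] map_complex_list[OF f] real_action_mult B(2) del: complex_list_simps(2))
    have [measurable]: "ext_map f \<in> borel_measurable borel"
      using linear_ext_map[of f]
      by (auto intro!: borel_measurable_continuous_onI linear_continuous_on simp: linear_conv_bounded_linear)
    have m: "(\<lambda>A. B ** A) \<in> measurable haar_unitary haar_unitary"
    proof -
      have "linear (\<lambda>A. B ** A)"
        by (rule linearI) (simp_all add: matrix_matrix_mult_def vec_eq_iff sum.distrib distrib_left scaleR_sum_right)
      then have "(\<lambda>A. B ** A) \<in> borel_measurable borel"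
        by (intro borel_measurable_continuous_onI linear_continuous_on) (simp add: linear_conv_bounded_linear)
      then show ?thesis using sets_haar by (simp cong: measurable_cong_sets add: measurable_cong_sets[OF sets_haar sets_haar])
    qed
    have "distr line_law borel (ext_map f) = distr haar_unitary borel (\<lambda>A. line_vec (B ** A))"
      unfolding line_law_def by (subst distr_distr) (auto simp: o_def v)
    also have "\<dots> = distr (distr haar_unitary haar_unitary (\<lambda>A. B ** A)) borel line_vec"
      by (subst distr_distr[OF measurable_line_vec m]) (simp add: o_def)
    also have "distr haar_unitary haar_unitary (\<lambda>A. B ** A) = distr haar_unitary borel (\<lambda>A. B ** A)"
      by (intro distr_cong) (auto simp: sets_haar)
    also have "\<dots> = haar_unitary" by (rule haar_invariant[OF B(1)])
    finally have "distr line_law borel (ext_map f) = line_law" by (simp add: line_law_def)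
    then show ?thesis
      using q_map_abs[OF fo, of "K_class line_law (\<lambda>x. x)"] vz_map_law(2)[OF linear_ext_map integrable_line_law, of f]
        g grass_subset_total by (auto simp: q_line_def)
  qed
  then show ?thesis using g by (auto simp: cp_deg_def cp_ring_iff q_deg_def q_line_def)
qed

text \<open>Left invariance and transitivity on unit vectors make the mean the same for all
  \<open>b\<close>, and over an orthonormal basis of \<open>2 * CARD('n)\<close> vectors the means
  add up to 1.\<close>

lemma isotropy:
  fixes b :: "real ^ ('n::finite \<times> bool)"
  assumes b: "norm b = 1"
  shows "has_bochner_integral haar_unitary (\<lambda>A. (real_action A base_vec \<bullet> b)\<^sup>2) (1 / (2 * real CARD('n)))"
proof -
  interpret prob_space "haar_unitary :: (complex ^ 'n ^ 'n) measure" by (rule prob_space_haar)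
  define I :: "real ^ ('n \<times> bool) \<Rightarrow> real" where "I c = (\<integral>A. (real_action A base_vec \<bullet> c)\<^sup>2 \<partial>haar_unitary)" for c
  have meas: "(\<lambda>A. real_action A (base_vec :: real ^ ('n \<times> bool))) \<in> borel_measurable borel"
    using linear_real_action_matrix[of base_vec]
    by (intro borel_measurable_continuous_onI linear_continuous_on) (simp add: linear_conv_bounded_linear)
  then have [measurable]: "(\<lambda>A. real_action A (base_vec :: real ^ ('n \<times> bool))) \<in> borel_measurable haar_unitary"
    by (simp add: sets_haar cong: measurable_cong_sets)
  have unit: "AE A in haar_unitary. norm (real_action A (base_vec :: real ^ ('n \<times> bool))) = 1"
    using AE_haar
  proof eventually_elim
    case (elim A)
    then show ?case using real_action_hermitian[of A] by (simp add: hermitian_map_def orthogonal_transformation_norm)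
  qed
  have int: "integrable haar_unitary (\<lambda>A. (real_action A base_vec \<bullet> c)\<^sup>2)" for c :: "real ^ ('n \<times> bool)"
  proof (rule integrable_const_bound)
    show "AE A in haar_unitary. norm ((real_action A base_vec \<bullet> c)\<^sup>2) \<le> (norm c)\<^sup>2"
      using unit
    proof eventually_elim
      case (elim A)
      then have "\<bar>real_action A base_vec \<bullet> c\<bar> \<le> norm c" using Cauchy_Schwarz_ineq2[of "real_action A base_vec" c] by simp
      then show ?case by (simp add: abs_le_square_iff[symmetric])
    qed
  qed measurable
  have const: "I c = I b" if c: "norm c = 1" for c
  proof -
    obtain f where f: "hermitian_map f" "f b = c" using hermitian_map_unit[OF b c] by metis
    obtain B where B: "B \<in> unitary_group" "real_action B = f" using f(1) by (rule hermitian_map_real_action)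
    have "I c = (\<integral>A. (real_action A base_vec \<bullet> c)\<^sup>2 \<partial>distr haar_unitary borel (\<lambda>A. B ** A))"
      unfolding I_def haar_invariant[OF B(1)] ..
    also have "\<dots> = (\<integral>A. (real_action (B ** A) base_vec \<bullet> c)\<^sup>2 \<partial>haar_unitary)"
    proof (rule integral_distr)
      have "linear (\<lambda>A. B ** A)"
        by (rule linearI) (simp_all add: matrix_matrix_mult_def vec_eq_iff sum.distrib distrib_left scaleR_sum_right)
      then have "(\<lambda>A. B ** A) \<in> borel_measurable borel"
        by (intro borel_measurable_continuous_onI linear_continuous_on) (simp add: linear_conv_bounded_linear)
      then show "(\<lambda>A. B ** A) \<in> borel_measurable haar_unitary" by (simp add: sets_haar cong: measurable_cong_sets)
    qed (use meas in measurable)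
    also have "\<dots> = I b"
      using f by (simp add: I_def real_action_mult B(2) hermitian_map_def orthogonal_transformation_def flip: f(2))
    finally show ?thesis .
  qed
  have "(\<Sum>c\<in>Basis. I c) = (\<integral>A. (\<Sum>c\<in>Basis. (real_action A (base_vec :: real ^ ('n \<times> bool)) \<bullet> c)\<^sup>2) \<partial>haar_unitary)"
    unfolding I_def by (rule Bochner_Integration.integral_sum[symmetric]) (rule int)
  also have "\<dots> = (\<integral>A. 1 \<partial>(haar_unitary :: (complex ^ 'n ^ 'n) measure))"
  proof (rule integral_cong_AE)
    show "AE A in haar_unitary. (\<Sum>c\<in>Basis. (real_action A (base_vec :: real ^ ('n \<times> bool)) \<bullet> c)\<^sup>2) = 1"
      using unit
    proof eventually_elim
      case (elim A)
      then have "real_action A base_vec \<bullet> real_action A (base_vec :: real ^ ('n \<times> bool)) = 1" by (simp add: norm_eq_1)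
      then show ?case by (subst (asm) euclidean_inner) (simp add: power2_eq_square)
    qed
  qed measurable
  also have "\<dots> = 1" using prob_space by simp
  also have "(\<Sum>c\<in>Basis. I c) = (\<Sum>c\<in>(Basis :: (real ^ ('n \<times> bool)) set). I b)"
    by (intro sum.cong refl const) simp
  finally have "I b = 1 / (2 * real CARD('n))" by (simp add: field_simps)
  then show ?thesis using int[of b] by (simp add: has_bochner_integral_iff I_def)
qed

text \<open>The span of the factors is a complex subspace, so the projection \<pi> to its complement
  commutes with \<open>imul\<close>. The two vectors of a line therefore project to an orthogonal
  pair of equal norm, and the norm enters squared, free of the square root that a single real vector
  produces.\<close>

lemma complex_line_wedge:
  fixes us :: "(real ^ ('n::finite \<times> bool)) list"
  defines "vs \<equiv> complex_list us"
  assumes CB: "pairwise orthogonal (C \<union> B)" "\<And>b. b \<in> C \<union> B \<Longrightarrow> norm b = 1" "C \<inter> B = {}" "finite C" "finite B"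
      "span C = span (set vs)" "\<And>x. (\<Sum>b\<in>C. (x \<bullet> b) *\<^sub>R b) + (\<Sum>b\<in>B. (x \<bullet> b) *\<^sub>R b) = x"
  shows "norm (wedge (ext_product (complex_list [x])) (ext_product vs)) = (\<Sum>b\<in>B. (x \<bullet> b)\<^sup>2) * norm (ext_product vs)"
proof -
  define \<pi> where "\<pi> x = (\<Sum>b\<in>B. (x \<bullet> b) *\<^sub>R b)" for x
  note reduce = wedge_vec_reduce[OF CB, folded \<pi>_def]
  have o: "b \<bullet> c = 0" if "b \<in> B" "c \<in> C" for b c
    using CB(1,3) that by (metis UnI1 UnI2 disjoint_iff orthogonal_def pairwiseD)
  have orth: "\<pi> x \<bullet> w = 0" if "w \<in> span C" for x w
    using that
  proof (induction rule: span_induct_alt)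
    case (step c y z)
    then show ?case using o by (simp add: inner_add_right \<pi>_def inner_sum_left)
  qed simp
  have diff: "x - \<pi> x \<in> span C" for x
  proof -
    have "x - \<pi> x = (\<Sum>b\<in>C. (x \<bullet> b) *\<^sub>R b)" using CB(7)[of x] by (simp add: \<pi>_def algebra_simps)
    then show ?thesis by (simp add: span_sum span_scale span_base)
  qed
  have J: "imul w \<in> span C" if "w \<in> span C" for w
    using that unfolding CB(6)
  proof (induction rule: span_induct_alt)
    case base
    then show ?case by (simp add: imul_simps span_zero)
  next
    case (step c y z)
    have "imul y \<in> span (set vs)" if "y \<in> set vs" for y
      using that unfolding vs_def
    proof (induction us)
      case (Cons u us)
      have "span (set (complex_list us)) \<subseteq> span (set (complex_list (u # us)))" by (intro span_mono) auto
      moreover have "- u \<in> span (set (complex_list (u # us)))" by (intro span_neg span_base) simp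
      moreover have "y = u \<or> y = imul u \<or> y \<in> set (complex_list us)" using Cons.prems by simp
      ultimately show ?case using Cons.IH by (auto intro: span_base simp del: complex_list_simps(2)) (auto intro: span_base)
    qed simp
    then show ?case using step by (simp add: imul_simps span_add span_scale)
  qed
  have comm: "\<pi> (imul x) = imul (\<pi> x)"
  proof -
    \<comment> \<open>The difference lies in the span, while both of its terms are orthogonal to
      this complex subspace.\<close>
    let ?D = "\<pi> (imul x) - imul (\<pi> x)"
    have "?D = imul (x - \<pi> x) - (imul x - \<pi> (imul x))" by (simp add: imul_simps)
    also have "\<dots> \<in> span C" by (intro span_diff J diff)
    finally have D: "?D \<in> span C" .
    have "?D \<bullet> ?D = \<pi> (imul x) \<bullet> ?D + \<pi> x \<bullet> imul ?D" by (simp add: inner_diff_left imul_inner_left)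
    also have "\<dots> = 0" using orth[OF D] orth[OF J[OF D]] by simp
    finally show ?thesis by simp
  qed
  let ?y = "ext_product vs"
  have "wedge (ext_product (complex_list [x])) ?y = wedge (ext_vec x) (wedge (ext_vec (imul x)) ?y)"
    by (simp add: wedge_assoc)
  \<comment> \<open>Only the factor next to the product can be replaced by its projection, so the
    two vectors take turns in this position.\<close>
  also have "\<dots> = - wedge (ext_vec (imul (\<pi> x))) (wedge (ext_vec x) ?y)"
  proof -
    have "wedge (ext_vec (imul x)) ?y = wedge (ext_vec (imul (\<pi> x))) ?y"
      using reduce(1)[of "imul x"] by (simp only: comm)
    then show ?thesis by (simp only: wedge_vec_swap[of x "imul (\<pi> x)"])
  qed
  also have "\<dots> = wedge (ext_vec (\<pi> x)) (wedge (ext_vec (imul (\<pi> x))) ?y)"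
    using reduce(1)[of x] by (simp only: wedge_vec_swap[of "\<pi> x"])
  finally have "norm (wedge (ext_product (complex_list [x])) ?y) = norm (\<pi> x) * norm (wedge (ext_vec (imul (\<pi> x))) ?y)"
    using reduce(2)[of x] by (simp add: norm_wedge_orthogonal contract_wedge wedge_bilinear_simps del: complex_list_simps)
  also have "norm (wedge (ext_vec (imul (\<pi> x))) ?y) = norm (\<pi> x) * norm ?y"
    using reduce(2)[of "imul x"] by (simp add: comm norm_wedge_orthogonal)
  finally show ?thesis using reduce(3)[of x] by (simp add: sum_nonneg power2_eq_square[symmetric])
qed

text \<open>With n the complex dimension, the complement of a nonzero \<open>y\<close> has real
  dimension 2 (n - j), and each coordinate of a random unit vector has second moment 1 / (2
  n).\<close>

lemma line_wedge_norm:
  fixes y :: "('n::finite \<times> bool) ext"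
  assumes y: "y \<in> complex_simple j"
  shows "(\<integral>x. norm (wedge x y) \<partial>line_law) = (real CARD('n) - j) / CARD('n) * norm y"
proof -
  obtain us where us: "y = ext_product (complex_list us)" "length us = j" using y by (auto simp: complex_simple_def)
  let ?vs = "complex_list us"
  have [measurable]: "(\<lambda>x. wedge x y) \<in> borel_measurable borel"
    using linear_wedge_left by (intro borel_measurable_continuous_onI linear_continuous_on) (simp add: linear_conv_bounded_linear)
  have "(\<integral>x. norm (wedge x y) \<partial>line_law) = (\<integral>A. norm (wedge (line_vec A) y) \<partial>haar_unitary)"
    unfolding line_law_def by (subst integral_distr) auto
  also have "\<dots> = (real CARD('n) - j) / CARD('n) * norm y"
  proof (cases "y = 0")
    case False
    have d: "dim (span (set ?vs)) = 2 * j"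
    proof -
      have "dim (set ?vs) \<ge> 2 * j" using ext_product_dependent[of ?vs] False us by (metis complex_list_simps(4) not_le)
      moreover have "dim (set ?vs) \<le> 2 * j" using dim_le_card'[of "set ?vs"] card_length[of ?vs] us by simp
      ultimately show ?thesis by simp
    qed
    obtain C B where CB: "pairwise orthogonal (C \<union> B)" "\<And>b. b \<in> C \<union> B \<Longrightarrow> norm b = 1" "C \<inter> B = {}"
      "finite C" "finite B" "span C = span (set ?vs)" "card B = DIM(real ^ ('n \<times> bool)) - dim (span (set ?vs))"
      "\<And>x. (\<Sum>b\<in>C. (x \<bullet> b) *\<^sub>R b) + (\<Sum>b\<in>B. (x \<bullet> b) *\<^sub>R b) = x"
      by (rule orthonormal_split[OF subspace_span]) blast
    have "2 * j \<le> 2 * CARD('n)" using d dim_subset_UNIV[of "span (set ?vs)"] by simp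
    then have card: "real (card B) = 2 * (real CARD('n) - j)" using CB(7) d by (simp add: of_nat_diff)
    have "norm (wedge (line_vec A) y) = (\<Sum>b\<in>B. (real_action A base_vec \<bullet> b)\<^sup>2) * norm y" for A :: "complex ^ 'n ^ 'n"
      unfolding line_vec_def us(1) by (rule complex_line_wedge[OF CB(1-6,8)])
    moreover have "has_bochner_integral haar_unitary (\<lambda>A. \<Sum>b\<in>B. (real_action A base_vec \<bullet> b)\<^sup>2) (\<Sum>b\<in>B. 1 / (2 * real CARD('n)))"
      using CB(2) by (intro has_bochner_integral_sum isotropy) auto
    from has_bochner_integral_integral_eq[OF has_bochner_integral_mult_left[OF this, of "norm y"]]
    have "(\<integral>A. (\<Sum>b\<in>B. (real_action A base_vec \<bullet> b)\<^sup>2) * norm y \<partial>haar_unitary) = (\<Sum>b\<in>B. 1 / (2 * real CARD('n))) * norm y"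
      by simp
    ultimately show ?thesis by (simp add: card field_simps)
  qed (simp add: wedge_bilinear_simps)
  finally show ?thesis .
qed

text \<open>The law is carried through the induction because the norm formula applies to vectors
  that are products of complex lines, a property of the law rather than of the class.\<close>

lemma q_line_power:
  "\<exists>M. integrable_law M \<and> (AE x in M. x \<in> complex_simple k) \<and>
    q_line ^ k = abs_qring (K_class M (\<lambda>x. x :: ('n::finite \<times> bool) ext)) \<and> K_class M (\<lambda>x. x) \<in> grass_total \<and>
    (\<integral>x. norm x \<partial>M) = (\<Prod>i<k. (real CARD('n) - real i) / CARD('n))"
proof (induction k)
  case 0
  show ?case
  proof (intro exI conjI)
    show "AE x in return borel (axis {} 1). (x :: ('n \<times> bool) ext) \<in> complex_simple 0"
      by (subst AE_return) (auto simp: complex_simple_def)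
  qed (simp_all add: integrable_law_return one_qring_def unit_class_total integral_return norm_axis_1)
next
  case (Suc k)
  then obtain M :: "('n \<times> bool) ext measure" where M: "integrable_law M" "AE x in M. x \<in> complex_simple k"
    "q_line ^ k = abs_qring (K_class M (\<lambda>x. x))" "K_class M (\<lambda>x. x) \<in> grass_total"
    "(\<integral>x. norm x \<partial>M) = (\<Prod>i<k. (real CARD('n) - real i) / CARD('n))" by blast
  have L: "integrable_law (line_law :: ('n \<times> bool) ext measure)" "AE x in line_law. (x :: ('n \<times> bool) ext) \<in> complex_simple 1"
    by (rule integrable_line_law line_law_simple)+
  let ?W = "distr (line_law \<Otimes>\<^sub>M M) borel (\<lambda>(x, y). wedge x y)"
  have w: "integrable_law ?W" "vz_wedge (K_class line_law (\<lambda>x. x)) (K_class M (\<lambda>x. x)) = K_class ?W (\<lambda>x. x)"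
    by (rule vz_wedge_law[OF L(1) M(1)])+
  have t: "(K_class line_law (\<lambda>x. x) :: ('n \<times> bool) ext vzonoid) \<in> grass_total"
    using line_class_grass grass_subset_total by blast
  show ?case
  proof (intro exI conjI)
    show "integrable_law ?W" by (rule w)
    have m: "(\<lambda>(x, y). wedge x y) \<in> borel_measurable (line_law \<Otimes>\<^sub>M M)"
      using integrable_pair_bilinear[OF L(1) M(1) bilinear_wedge] by (rule borel_measurable_integrable)
    have "AE p in line_law \<Otimes>\<^sub>M M. (fst p :: ('n \<times> bool) ext) \<in> complex_simple 1 \<and> snd p \<in> complex_simple k"
      by (rule AE_pair_fst_snd[OF integrable_lawD(1)[OF L(1)] integrable_lawD(1)[OF M(1)] L(2) M(2)])
    then have "AE p in line_law \<Otimes>\<^sub>M M. (\<lambda>(x, y). wedge x y) p \<in> complex_simple (Suc k)"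
    proof eventually_elim
      case (elim p)
      then obtain u where "fst p = ext_product (complex_list [u])" by (auto simp: complex_simple_def length_Suc_conv)
      then show ?case
        unfolding complex_simple_Suc using elim
        by (intro image_eqI[of _ _ "(u, snd p)"]) (simp_all add: split_def del: complex_list_simps)
    qed
    then show "AE z in ?W. z \<in> complex_simple (Suc k)" by (subst AE_distr_iff[OF m]) auto
    show "q_line ^ Suc k = abs_qring (K_class ?W (\<lambda>x. x))"
      using abs_qring_wedge[OF t M(4)] by (simp only: w(2) power_Suc M(3)) (simp add: q_line_def)
    show "K_class ?W (\<lambda>x. x) \<in> grass_total" using vz_wedge_total[OF t M(4)] by (simp add: w(2))
    have [measurable_cong]: "sets M = sets borel" using M by (auto dest: integrable_lawD)
    have "(\<integral>x. norm x \<partial>?W) = vz_length (K_class ?W (\<lambda>x. x))" using vz_length_K_class[OF w(1)] by simp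
    also have "\<dots> = (\<integral>y. \<integral>x. norm (wedge x y) \<partial>line_law \<partial>M)"
      unfolding w(2)[symmetric] by (rule vz_length_wedge_law[OF L(1) M(1)])
    also have "\<dots> = (\<integral>y. (real CARD('n) - k) / CARD('n) * norm y \<partial>M)"
    proof (rule integral_cong_AE)
      interpret G: prob_space "line_law :: ('n \<times> bool) ext measure" using L by (auto dest: integrable_lawD)
      have "(\<lambda>p. wedge (snd p) (fst p) :: ('n \<times> bool) ext) \<in> borel_measurable (borel \<Otimes>\<^sub>M borel)"
        unfolding borel_prod
        by (intro borel_measurable_continuous_onI bounded_bilinear.continuous_on[OF bilinear_wedge[unfolded bilinear_conv_bounded_bilinear]]
          continuous_intros)
      then have "(\<lambda>(y, x). norm (wedge x y :: ('n \<times> bool) ext)) \<in> borel_measurable (M \<Otimes>\<^sub>M line_law)"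
        by (simp add: split_def line_law_def cong: measurable_cong_sets sets_pair_measure_cong)
      then show "(\<lambda>y. \<integral>x. norm (wedge x y) \<partial>line_law) \<in> borel_measurable M"
        by (rule G.borel_measurable_lebesgue_integral)
      show "AE y in M. (\<integral>x. norm (wedge x y) \<partial>line_law) = (real CARD('n) - k) / CARD('n) * norm y"
        using M(2) by eventually_elim (rule line_wedge_norm)
    qed measurable
    also have "\<dots> = (\<Prod>i<Suc k. (real CARD('n) - real i) / CARD('n))" by (simp add: M(5))
    finally show "(\<integral>x. norm x \<partial>?W) = (\<Prod>i<Suc k. (real CARD('n) - real i) / CARD('n))" .
  qed
qed

lemma q_length_line_power: "q_length ((q_line :: ('n::finite \<times> bool) qring) ^ k) = (\<Prod>i<k. (real CARD('n) - real i) / CARD('n))"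
  using q_line_power[of k, where 'n = 'n] by (auto simp: q_length_abs vz_length_K_class)

section \<open>Bases and positivity\<close>

text \<open>Both sides start at 1 and follow the same recursion. This is where the product of odd
  numbers from Gaussian integration becomes a moment of the cosine.\<close>

lemma prod_odd_cos_moment: "(\<Prod>i=0..<p. real (2 * i + 1)) = fact p * 2 ^ p * cos_moment p / pi"
proof (induction p)
  case (Suc p)
  have "fact (Suc p) * 2 ^ Suc p * cos_moment (Suc p) = fact p * 2 ^ p * (real (2 * p + 2) * cos_moment (Suc p))"
    by (simp add: algebra_simps)
  also have "\<dots> = fact p * 2 ^ p * cos_moment p * real (2 * p + 1)" unfolding cos_moment_Suc by simp
  finally show ?case using Suc.IH by simp
qed (simp add: cos_moment_0)

lemma prod_falling: "k \<le> N \<Longrightarrow> (\<Prod>i<k. (real N - real i) / real N) = fact N / (fact (N - k) * real N ^ k)"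
proof (induction k)
  case (Suc k)
  have "N - k = Suc (N - Suc k)" using Suc.prems by simp
  define a where "a = real N - real k"
  have "fact (N - k) = a * fact (N - Suc k)"
    using \<open>N - k = _\<close> Suc.prems by (simp add: of_nat_diff a_def)
  moreover have "a > 0" using Suc.prems by (simp add: a_def)
  ultimately show ?case using Suc by (simp add: a_def[symmetric])
qed simp

text \<open>Gaussian factors are taken in pairs: with codimension 2 k + 2 left, two of them
  contribute \<open>kappa (2 * k + 2) * kappa (2 * k + 1)\<close>, which is the odd number 2 k +
  1.\<close>

lemma q_length_gauss_power:
  fixes q :: "('m::finite) qring"
  assumes q: "q \<in> q_deg e" "e + 2 * p = CARD('m)"
  shows "m \<le> p \<Longrightarrow> q_length (q_gauss ^ (2 * m) * q) = (\<Prod>i=p-m..<p. real (2 * i + 1)) * q_length q"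
proof (induction m)
  case (Suc m)
  define k where "k = p - Suc m"
  have deg: "q_gauss ^ i * q \<in> q_deg (i + e)" for i
    using q_deg_mult[OF q_deg_power[OF q_gauss_deg, of i] q(1)] by simp
  let ?q = "q_gauss ^ (2 * m) * q"
  have 1: "CARD('m) - (2 * m + e) = 2 * k + 2" "CARD('m) - (2 * m + 1 + e) = 2 * k + 1"
    "2 * m + e < CARD('m)" "2 * m + 1 + e < CARD('m)"
    using Suc.prems q(2) by (simp_all add: k_def)
  have "q_gauss ^ (2 * Suc m) * q = q_gauss * (q_gauss ^ (2 * m + 1) * q)" by (simp add: mult_ac)
  then have "q_length (q_gauss ^ (2 * Suc m) * q) = kappa (2 * k + 1) * q_length (q_gauss ^ (2 * m + 1) * q)"
    using q_length_gauss[OF deg[of "2 * m + 1"] 1(4)] by (simp only: 1)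
  also have "q_length (q_gauss ^ (2 * m + 1) * q) = kappa (2 * k + 2) * q_length ?q"
    using q_length_gauss[OF deg[of "2 * m"] 1(3)] by (simp only: 1) (simp add: mult_ac)
  also have "kappa (2 * k + 1) * (kappa (2 * k + 2) * q_length ?q) = real (2 * k + 1) * q_length ?q"
    using kappa_product[of k] by (simp add: mult.assoc[symmetric] mult.commute[of "kappa (Suc (2 * k))"])
  also have "\<dots> = (\<Prod>i=k..<p. real (2 * i + 1)) * q_length q"
  proof -
    have "p - m = Suc k" "k < p" using Suc.prems by (auto simp: k_def)
    then show ?thesis using Suc by (simp add: prod.atLeast_Suc_lessThan)
  qed
  finally show ?case by (simp add: k_def)
qed simp

text \<open>The factorial of \<open>p\<close> in the Gaussian contribution cancels the one in the
  contribution of the lines, so that only a constant, a power with exponent \<open>p\<close> and the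
  cosine moment remain.\<close>

lemma q_length_gauss_line:
  assumes p: "p \<le> CARD('n)"
  shows "q_length (q_gauss ^ (2 * p) * (q_line :: ('n::finite \<times> bool) qring) ^ (CARD('n) - p))
    = fact CARD('n) / (real CARD('n) ^ CARD('n) * pi) * (2 * real CARD('n)) ^ p * cos_moment p"
proof -
  define N where "N = CARD('n)"
  have N: "N > 0" "p \<le> N" using p by (simp_all add: N_def)
  let ?q = "(q_line :: ('n \<times> bool) qring) ^ (N - p)"
  have "(q_line :: ('n \<times> bool) qring) \<in> q_deg 2" using q_line_cp by (auto simp: cp_deg_def)
  then have "?q \<in> q_deg ((N - p) * 2)" by (rule q_deg_power)
  moreover have "(N - p) * 2 + 2 * p = CARD('n \<times> bool)" using N by (simp add: N_def)
  ultimately have "q_length (q_gauss ^ (2 * p) * ?q) = (\<Prod>i=0..<p. real (2 * i + 1)) * q_length ?q"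
    using q_length_gauss_power[of ?q "(N - p) * 2" p p] by simp
  also have "\<dots> = fact p * 2 ^ p * cos_moment p / pi * (fact N / (fact p * real N ^ (N - p)))"
    unfolding prod_odd_cos_moment q_length_line_power N_def[symmetric] using prod_falling[of "N - p" N] N by simp
  also have "\<dots> = fact N / (real N ^ N * pi) * (2 * real N) ^ p * cos_moment p"
  proof -
    have "real N ^ N = real N ^ (N - p) * real N ^ p" using N by (simp flip: power_add)
    then show ?thesis using N by (simp add: power_mult_distrib mult_ac)
  qed
  finally show ?thesis by (simp add: N_def)
qed

lemma independent_familyI:
  fixes b :: "'i \<Rightarrow> 'a::real_vector"
  assumes J: "finite J" and 0: "\<And>c j. (\<Sum>i\<in>J. c i *\<^sub>R b i) = 0 \<Longrightarrow> j \<in> J \<Longrightarrow> c j = 0"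
  shows "inj_on b J" "independent (b ` J)"
proof -
  show inj: "inj_on b J"
  proof (rule inj_onI, rule ccontr)
    fix i j assume ij: "i \<in> J" "j \<in> J" "b i = b j" "i \<noteq> j"
    let ?c = "\<lambda>k. (if k = i then 1 else 0) - (if k = j then 1 else 0 :: real)"
    have "(\<Sum>k\<in>J. ?c k *\<^sub>R b k) = (\<Sum>k\<in>J. (if k = i then b i else 0)) - (\<Sum>k\<in>J. (if k = j then b j else 0))"
      unfolding sum_subtractf[symmetric] by (intro sum.cong) auto
    then have "(\<Sum>k\<in>J. ?c k *\<^sub>R b k) = 0" using J ij by simp
    from 0[OF this ij(1)] ij(4) show False by simp
  qed
  show "independent (b ` J)"
  proof
    assume "dependent (b ` J)"
    then obtain u where u: "\<exists>v\<in>b ` J. u v \<noteq> 0" "(\<Sum>v\<in>b ` J. u v *\<^sub>R v) = 0"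
      using J by (auto simp: dependent_finite)
    then have "(\<Sum>i\<in>J. u (b i) *\<^sub>R b i) = 0" by (simp add: sum.reindex[OF inj])
    then show False using 0[of "\<lambda>i. u (b i)"] u(1) by blast
  qed
qed

lemma power_scaleR: "(c *\<^sub>R x) ^ n = c ^ n *\<^sub>R (x :: 'a::real_algebra_1) ^ n"
  by (induction n) simp_all

text \<open>Passing to Gaussian and line classes and splitting the power of
  \<open>2 * real N\<close> yields factors that depend on one index each, besides a positive
  constant. They are absorbed in the coefficients \<open>y\<close>, and the matrix of cosine moments
  remains.\<close>

lemma length_form_pos:
  fixes c :: "nat \<Rightarrow> real"
  assumes d: "d \<le> CARD('n::finite)" and k: "k \<le> d div 2" "c k \<noteq> 0"
  defines "x \<equiv> \<Sum>i\<le>d div 2. c i *\<^sub>R (cp_gamma ^ i * cp_beta ^ (d - 2 * i) :: ('n \<times> bool) qring)"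
  shows "q_length (cp_beta ^ (2 * (CARD('n) - d)) * x * x) > 0"
proof -
  define N where "N = CARD('n)"
  have N: "N > 0" by (simp add: N_def)
  define s where "s = sqrt (2 * pi)"
  define g where "g = real N / pi"
  have sg: "s > 0" "g > 0" using N by (simp_all add: s_def g_def)
  let ?G = "q_gauss :: ('n \<times> bool) qring" and ?L = "q_line :: ('n \<times> bool) qring"
  have \<beta>: "cp_beta = s *\<^sub>R ?G" by (simp add: s_def cp_beta_eq)
  have \<gamma>: "cp_gamma = g *\<^sub>R ?L" by (simp add: g_def N_def cp_gamma_eq)
  define P where "P = d div 2"
  have P: "2 * P \<le> d" "2 * P \<le> N" using d by (auto simp: P_def N_def)
  define K where "K = fact N / (real N ^ N * pi) * (2 * real N) ^ N"
  have K: "K > 0" using N by (simp add: K_def)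
  define y where "y i = c i * g ^ i * s ^ (d - 2 * i) / (2 * real N) ^ i" for i
  have x: "x = (\<Sum>i\<le>P. (c i * g ^ i * s ^ (d - 2 * i)) *\<^sub>R (?L ^ i * ?G ^ (d - 2 * i)))"
    unfolding x_def P_def \<beta> \<gamma> by (intro sum.cong refl) (simp add: power_scaleR)
  have entry: "q_length (?G ^ (2 * (N - d)) * (?L ^ i * ?G ^ (d - 2 * i)) * (?L ^ j * ?G ^ (d - 2 * j)))
      = K / (2 * real N) ^ i / (2 * real N) ^ j * cos_moment (N - i - j)" if "i \<le> P" "j \<le> P" for i j
  proof -
    have ij: "i + j \<le> N" using that P by linarith
    \<comment> \<open>Subtraction is truncated; the bounds on \<open>i\<close> and \<open>j\<close>
      ensure that the exponents add up.\<close>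
    have e: "2 * (N - d) + (d - 2 * i) + (d - 2 * j) = 2 * (N - i - j)" "N - (N - i - j) = i + j"
      using that P d by (auto simp: N_def)
    have "?G ^ (2 * (N - d)) * (?L ^ i * ?G ^ (d - 2 * i)) * (?L ^ j * ?G ^ (d - 2 * j))
        = ?G ^ (2 * (N - d) + (d - 2 * i) + (d - 2 * j)) * ?L ^ (i + j)"
      by (simp add: power_add mult_ac)
    also have "\<dots> = ?G ^ (2 * (N - i - j)) * ?L ^ (N - (N - i - j))" by (simp only: e)
    finally have "q_length (?G ^ (2 * (N - d)) * (?L ^ i * ?G ^ (d - 2 * i)) * (?L ^ j * ?G ^ (d - 2 * j)))
        = fact N / (real N ^ N * pi) * (2 * real N) ^ (N - i - j) * cos_moment (N - i - j)"
      using q_length_gauss_line[of "N - i - j", where 'n = 'n] by (simp add: N_def)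
    also have "(2 * real N) ^ (N - i - j) = (2 * real N) ^ N / (2 * real N) ^ i / (2 * real N) ^ j"
    proof -
      have "(2 * real N) ^ N = (2 * real N) ^ (N - i - j) * (2 * real N) ^ i * (2 * real N) ^ j"
        using ij by (simp only: power_add[symmetric]) simp
      then show ?thesis using N by simp
    qed
    finally show ?thesis by (simp add: K_def)
  qed
  have expand: "(\<sigma> *\<^sub>R z) * (\<Sum>i\<le>P. a i *\<^sub>R m i) * (\<Sum>j\<le>P. a j *\<^sub>R m j)
      = (\<Sum>i\<le>P. \<Sum>j\<le>P. (\<sigma> * a i * a j) *\<^sub>R (z * m i * m j))" for \<sigma> a and z :: "('n \<times> bool) qring" and m
  proof -
    have "(\<sigma> *\<^sub>R z) * (\<Sum>i\<le>P. a i *\<^sub>R m i) = (\<Sum>i\<le>P. (\<sigma> * a i) *\<^sub>R (z * m i))"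
      unfolding sum_distrib_left by (simp add: mult.commute)
    then show ?thesis by (simp only: sum_product mult_scaleR_left mult_scaleR_right scaleR_scaleR) (simp add: mult.commute)
  qed
  have "cp_beta ^ (2 * (N - d)) * x * x = (\<Sum>i\<le>P. \<Sum>j\<le>P. (s ^ (2 * (N - d)) * (c i * g ^ i * s ^ (d - 2 * i)) * (c j * g ^ j * s ^ (d - 2 * j))) *\<^sub>R
      (?G ^ (2 * (N - d)) * (?L ^ i * ?G ^ (d - 2 * i)) * (?L ^ j * ?G ^ (d - 2 * j))))"
    unfolding x \<beta> power_scaleR by (rule expand)
  then have "q_length (cp_beta ^ (2 * (N - d)) * x * x) = (\<Sum>i\<le>P. \<Sum>j\<le>P. (s ^ (2 * (N - d)) * (c i * g ^ i * s ^ (d - 2 * i)) * (c j * g ^ j * s ^ (d - 2 * j))) *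
      (K / (2 * real N) ^ i / (2 * real N) ^ j * cos_moment (N - i - j)))"
    by (simp add: linear_sum[OF linear_q_length] linear_scale[OF linear_q_length] entry)
  also have "\<dots> = s ^ (2 * (N - d)) * K * (\<Sum>i\<le>P. \<Sum>j\<le>P. y i * y j * cos_moment (N - i - j))"
    unfolding sum_distrib_left y_def by (intro sum.cong refl) simp
  also have "\<dots> > 0"
    using sg K k N by (intro mult_pos_pos cos_moment_form_pos[OF P(2), of k]) (auto simp: y_def P_def)
  finally show ?thesis by (simp add: N_def)
qed

lemma cp_monomial_deg: "cp_gamma ^ j * cp_beta ^ k \<in> cp_deg (2 * j + k)"
proof -
  have "cp_gamma \<in> cp_deg 2" "cp_beta \<in> cp_deg 1"
    unfolding cp_gamma_eq cp_beta_eq by (intro subspace_scale[OF subspace_cp_deg] q_line_cp q_gauss_cp)+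
  from cp_deg_mult[OF cp_deg_power[OF this(1), of j] cp_deg_power[OF this(2), of k]] show ?thesis by (simp add: mult.commute)
qed

text \<open>The two degrees \<open>e\<close> and \<open>2 n - e\<close> are \<open>e + t\<close> for the two extreme values of \<open>t\<close>.\<close>

lemma cp_basis:
  assumes e: "e \<le> CARD('n::finite)" and t: "t = 0 \<or> t = 2 * (CARD('n) - e)"
  shows "is_basis_of {..e div 2} (\<lambda>j. cp_gamma ^ j * cp_beta ^ (e + t - 2 * j)) (cp_deg (e + t) :: ('n \<times> bool) qring set)"
proof -
  let ?b = "\<lambda>j. cp_gamma ^ j * cp_beta ^ (e + t - 2 * j) :: ('n \<times> bool) qring"
  let ?J = "{..e div 2}"
  have j: "2 * j \<le> e" if "j \<in> ?J" for j using that by auto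
  have zero: "c k = 0" if "(\<Sum>i\<in>?J. c i *\<^sub>R ?b i) = 0" "k \<in> ?J" for c :: "nat \<Rightarrow> real" and k
  proof (rule ccontr)
    assume ck: "c k \<noteq> 0"
    define x where "x = (\<Sum>i\<le>e div 2. c i *\<^sub>R (cp_gamma ^ i * cp_beta ^ (e - 2 * i) :: ('n \<times> bool) qring))"
    have "(\<Sum>i\<in>?J. c i *\<^sub>R ?b i) = cp_beta ^ t * x"
      unfolding x_def sum_distrib_left
    proof (intro sum.cong refl)
      fix i assume "i \<in> ?J"
      then have "e + t - 2 * i = t + (e - 2 * i)" using j[of i] by simp
      then show "c i *\<^sub>R ?b i = cp_beta ^ t * c i *\<^sub>R (cp_gamma ^ i * cp_beta ^ (e - 2 * i))"
        by (simp add: power_add mult_ac)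
    qed
    then have "cp_beta ^ t * x = 0" using that(1) by simp
    \<comment> \<open>A relation in degree \<open>e + t\<close> is multiplied by the missing power
      of \<open>cp_beta\<close>; for either value of \<open>t\<close> this reaches the exponent in
      the positive form.\<close>
    moreover have "cp_beta ^ (2 * (CARD('n) - e)) = cp_beta ^ (2 * (CARD('n) - e) - t) * (cp_beta ^ t :: ('n \<times> bool) qring)"
      using t by (auto simp flip: power_add)
    ultimately have "cp_beta ^ (2 * (CARD('n) - e)) * x = 0" by (simp add: mult.assoc)
    then have "q_length (cp_beta ^ (2 * (CARD('n) - e)) * x * x) = 0" by (simp add: linear_0[OF linear_q_length])
    then show False using length_form_pos[OF e, of k c] that(2) ck by (simp add: x_def)
  qed
  have inj: "inj_on ?b ?J" by (rule independent_familyI(1)) (simp, rule zero)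
  have ind: "independent (?b ` ?J)" by (rule independent_familyI(2)) (simp, rule zero)
  have sub: "?b ` ?J \<subseteq> cp_deg (e + t)"
  proof (rule image_subsetI)
    fix i assume "i \<in> ?J"
    then have "2 * i + (e + t - 2 * i) = e + t" using j[of i] by simp
    then show "?b i \<in> cp_deg (e + t)" using cp_monomial_deg[of i "e + t - 2 * i"] by metis
  qed
  have "cp_deg (e + t) \<subseteq> span (?b ` ?J)"
  proof (rule cp_deg_subset_span[OF _ sub ind])
    show "e + t \<le> 2 * CARD('n)" using e t by auto
    \<comment> \<open>For both values of \<open>t\<close> the minimum is
      \<open>e div 2\<close>.\<close>
    show "min ((e + t) div 2) ((2 * CARD('n) - (e + t)) div 2) + 1 \<le> card (?b ` ?J)"
      unfolding card_image[OF inj] using e t by auto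
  qed simp
  moreover have "span (?b ` ?J) \<subseteq> cp_deg (e + t)" using sub subspace_cp_deg by (rule span_minimal)
  ultimately show ?thesis using inj ind by (simp add: is_basis_of_def)
qed

lemma basis_expansion:
  assumes "is_basis_of J b S" "finite J" "x \<in> S"
  obtains c where "x = (\<Sum>j\<in>J. c j *\<^sub>R b j)"
proof -
  have "x \<in> span (b ` J)" "inj_on b J" using assms by (auto simp: is_basis_of_def)
  then obtain u where "x = (\<Sum>v\<in>b ` J. u v *\<^sub>R v)" using assms(2) by (auto simp: span_finite)
  then show ?thesis using that[of "\<lambda>j. u (b j)"] by (simp add: sum.reindex[OF \<open>inj_on b J\<close>])
qed

lemma length_form_definite:
  assumes "d \<le> CARD('n::finite)" "x \<in> cp_deg d" "x \<noteq> 0"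
  shows "q_length (cp_beta ^ (2 * (CARD('n) - d)) * x * (x :: ('n \<times> bool) qring)) > 0"
proof -
  obtain c where c: "x = (\<Sum>j\<le>d div 2. c j *\<^sub>R (cp_gamma ^ j * cp_beta ^ (d - 2 * j)))"
    using basis_expansion[OF cp_basis[OF assms(1), of 0] _, of x] assms(2) by auto
  then obtain k where "k \<le> d div 2" "c k \<noteq> 0" using assms(3) by (metis (no_types, lifting) atMost_iff scaleR_eq_0_iff sum.neutral)
  then show ?thesis unfolding c by (rule length_form_pos[OF assms(1)])
qed

theorem theorem7p6:
  fixes d :: nat
  assumes "d \<le> 2 * CARD('n::finite)"
  shows
    "is_basis_of {0..min (d div 2) ((2 * CARD('n) - d) div 2)}
        (\<lambda>j. cp_gamma ^ j * cp_beta ^ (d - 2 * j)) (cp_deg d :: ('n \<times> bool) qring set)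
     \<and> (d \<le> CARD('n) \<longrightarrow>
          pos_def_form_on (cp_deg d :: ('n \<times> bool) qring set)
            (\<lambda>x y. q_length (cp_beta ^ (2 * (CARD('n) - d)) * x * y)))
     \<and> (d \<le> CARD('n) \<longrightarrow>
          linear_iso_on (cp_deg d :: ('n \<times> bool) qring set) (cp_deg (2 * CARD('n) - d))
            (\<lambda>x. cp_beta ^ (2 * (CARD('n) - d)) * x))"
proof (intro conjI impI)
  show "is_basis_of {0..min (d div 2) ((2 * CARD('n) - d) div 2)}
        (\<lambda>j. cp_gamma ^ j * cp_beta ^ (d - 2 * j)) (cp_deg d :: ('n \<times> bool) qring set)"
  proof (cases "d \<le> CARD('n)")
    case True
    then have "min (d div 2) ((2 * CARD('n) - d) div 2) = d div 2" by auto
    then show ?thesis using cp_basis[OF True, of 0] by (simp add: atLeast0AtMost)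
  next
    case False
    \<comment> \<open>Above the middle degree the exponents of \<open>cp_gamma\<close> are those of
      the complementary degree \<open>e\<close>, and only the power of \<open>cp_beta\<close> is
      larger.\<close>
    define e where "e = 2 * CARD('n) - d"
    have e: "e \<le> CARD('n)" "e + 2 * (CARD('n) - e) = d" "min (d div 2) ((2 * CARD('n) - d) div 2) = e div 2"
      using False assms by (auto simp: e_def)
    show ?thesis using cp_basis[OF e(1), of "2 * (CARD('n) - e)"] unfolding e(2) e(3) by (simp add: atLeast0AtMost)
  qed
next
  assume d: "d \<le> CARD('n)"
  show "pos_def_form_on (cp_deg d :: ('n \<times> bool) qring set)
            (\<lambda>x y. q_length (cp_beta ^ (2 * (CARD('n) - d)) * x * y))"
    unfolding pos_def_form_on_def
    using length_form_definite[OF d]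
    by (auto simp: subspace_cp_deg mult_ac distrib_left distrib_right linear_add[OF linear_q_length] linear_scale[OF linear_q_length])
  show "linear_iso_on (cp_deg d :: ('n \<times> bool) qring set) (cp_deg (2 * CARD('n) - d))
            (\<lambda>x. cp_beta ^ (2 * (CARD('n) - d)) * x)"
    unfolding linear_iso_on_def
  proof (intro conjI subspace_cp_deg)
    let ?f = "\<lambda>x. cp_beta ^ (2 * (CARD('n) - d)) * x :: ('n \<times> bool) qring"
    have lin: "linear ?f" by (rule linearI) (simp_all add: distrib_left)
    have t: "d + 2 * (CARD('n) - d) = 2 * CARD('n) - d" using d by simp
    let ?b = "\<lambda>j. cp_gamma ^ j * cp_beta ^ (d - 2 * j) :: ('n \<times> bool) qring"
    have "?f ` cp_deg d = ?f ` span (?b ` {..d div 2})"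
      using cp_basis[OF d, of 0] by (simp add: is_basis_of_def)
    also have "\<dots> = span ((\<lambda>j. ?f (?b j)) ` {..d div 2})" 
      by (subst linear_span_image[OF lin, symmetric]) (simp add: image_image)
    also have "(\<lambda>j. ?f (?b j)) ` {..d div 2} = (\<lambda>j. cp_gamma ^ j * cp_beta ^ (d + 2 * (CARD('n) - d) - 2 * j)) ` {..d div 2}"
    proof (intro image_cong refl)
      fix j assume "j \<in> {..d div 2}"
      then have "2 * (CARD('n) - d) + (d - 2 * j) = d + 2 * (CARD('n) - d) - 2 * j" by auto
      moreover have "?f (?b j) = cp_gamma ^ j * cp_beta ^ (2 * (CARD('n) - d) + (d - 2 * j))"
        by (simp add: power_add mult_ac)
      ultimately show "?f (?b j) = cp_gamma ^ j * cp_beta ^ (d + 2 * (CARD('n) - d) - 2 * j)" by (simp only:)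
    qed
    also have "span \<dots> = cp_deg (2 * CARD('n) - d)"
      using cp_basis[OF d, of "2 * (CARD('n) - d)"] by (simp add: is_basis_of_def t)
    finally have "?f ` cp_deg d = cp_deg (2 * CARD('n) - d)" .
    moreover have "inj_on ?f (cp_deg d)"
    proof (rule inj_onI, rule ccontr)
      fix x y assume xy: "x \<in> cp_deg d" "y \<in> cp_deg d" "?f x = ?f y" "x \<noteq> y"
      then have "?f (x - y) = 0" by (simp add: right_diff_distrib)
      moreover have "q_length (?f (x - y) * (x - y)) > 0"
        using xy by (intro length_form_definite[OF d] subspace_diff[OF subspace_cp_deg]) auto
      ultimately show False by (simp add: linear_0[OF linear_q_length])
    qed
    ultimately show "bij_betw ?f (cp_deg d) (cp_deg (2 * CARD('n) - d))" by (simp add: bij_betw_def)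
  qed (simp_all add: distrib_left)
qed

end
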